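(* Let $\mathcal{M}$ be a preadditive monoidal category with equalizers and assume that the tensor functors are additive and preserve equalizers. Assume also that $\mathcal{M}$ has denumerable coproducts and that the tensor functors preserve such coproducts. Then $$\left(\overline{T}_{\mathrm{Br}}:\mathrm{Br}_{\mathcal{M}}\to\mathrm{BrBialg}_{\mathcal{M}},\ P_{\mathrm{Br}}:\mathrm{BrBialg}_{\mathcal{M}}\to\mathrm{Br}_{\mathcal{M}}\right)$$ is an adjunction (with $\overline{T}_{\mathrm{Br}}$ left adjoint to $P_{\mathrm{Br}}$). The unit $\overline{\eta}_{\mathrm{Br}}$ and the counit $\overline{\epsilon}_{\mathrm{Br}}$ are uniquely determined by the following equalities: $$\xi\overline{T}_{\mathrm{Br}}\circ\overline{\eta}_{\mathrm{Br}}=\eta_{\mathrm{Br}},\qquad \epsilon_{\mathrm{Br}}\mho_{\mathrm{Br}}\circ T_{\mathrm{Br}}\xi=\mho_{\mathrm{Br}}\overline{\epsilon}_{\mathrm{Br}},$$ where $\eta_{\mathrm{Br}}$ and $\epsilon_{\mathrm{Br}}$ denote the unit and counit of the adjunction $(T_{\mathrm{Br}},\Omega_{\mathrm{Br}})$ and $\mho_{\mathrm{Br}}:\mathrm{BrBialg}_{\mathcal{M}}\to\mathrm{BrAlg}_{\mathcal{M}}$ denotes the forgetful functor.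
   Context: Associativity constraints of $(\mathcal M,\otimes,\mathbf 1,a,l,r)$ are suppressed; $l_X:\mathbf 1\otimes X\to X$, $r_X:X\otimes\mathbf 1\to X$; an object also denotes its identity morphism. The tensor functors are $M\otimes(-)$ and $(-)\otimes M$ for all objects $M$. $V^{\otimes 0}=\mathbf 1$, $V^{\otimes 1}=V$, $V^{\otimes n}=V^{\otimes(n-1)}\otimes V$ for $n\ge 2$. $\Delta_{\mathbf 1}=l_{\mathbf 1}^{-1}=r_{\mathbf 1}^{-1}$, $m_{\mathbf 1}=l_{\mathbf 1}=r_{\mathbf 1}$. A braided object is a pair $(V,c)$ with $c:V\otimes V\to V\otimes V$ invertible and $(c\otimes V)(V\otimes c)(c\otimes V)=(V\otimes c)(c\otimes V)(V\otimes c)$; a morphism $(V,c_V)\to(W,c_W)$ is $f:V\to W$ with $c_W(f\otimes f)=(f\otimes f)c_V$; category $\mathrm{Br}_{\mathcal M}$. A braided algebra is $(A,m,u,c)$ with $(A,m,u)$ an algebra in $\mathcal M$, $(A,c)$ a braided object, and $c(m\otimes A)=(A\otimes m)(c\otimes A)(A\otimes c)$, $c(A\otimes m)=(m\otimes A)(A\otimes c)(c\otimes A)$, $c(u\otimes A)l_A^{-1}=(A\otimes u)r_A^{-1}$, $c(A\otimes u)r_A^{-1}=(u\otimes A)l_A^{-1}$; morphisms are algebra morphisms that are morphisms of braided objects; category $\mathrm{BrAlg}_{\mathcal M}$. A braided coalgebra is $(C,\Delta,\varepsilon,c)$ with $(C,\Delta,\varepsilon)$ a coalgebra, $(C,c)$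 a braided object, and $(\Delta\otimes C)c=(C\otimes c)(c\otimes C)(C\otimes\Delta)$, $(C\otimes\Delta)c=(c\otimes C)(C\otimes c)(\Delta\otimes C)$, $l_C(\varepsilon\otimes C)c=r_C(C\otimes\varepsilon)$, $r_C(C\otimes\varepsilon)c=l_C(\varepsilon\otimes C)$; morphisms are coalgebra morphisms that are morphisms of braided objects. A braided bialgebra is $(B,m,u,\Delta,\varepsilon,c)$ with $(B,m,u,c)$ a braided algebra, $(B,\Delta,\varepsilon,c)$ a braided coalgebra, and $\Delta m=(m\otimes m)(B\otimes c\otimes B)(\Delta\otimes\Delta)$, $\Delta u=(u\otimes u)\Delta_{\mathbf 1}$, $\varepsilon m=m_{\mathbf 1}(\varepsilon\otimes\varepsilon)$, $\varepsilon u=\mathrm{Id}_{\mathbf 1}$; morphisms are morphisms of both braided algebras and braided coalgebras; category $\mathrm{BrBialg}_{\mathcal M}$. $\Omega_{\mathrm{Br}}:\mathrm{BrAlg}_{\mathcal M}\to\mathrm{Br}_{\mathcal M}$ is the forgetful functor. Tensor algebra: the forgetful functor $\Omega:\mathrm{Alg}_{\mathcal M}\to\mathcal M$ from algebras in $\mathcal M$ has a left adjoint $T$ with $\Omega TV=\oplus_{n\in\mathbb N}V^{\otimes n}$, injections $\alpha_nV:V^{\otimes n}\to\Omega TV$; $\Omega Tf\circ\alpha_nV=\alpha_nW\circ f^{\otimes n}$ for $f:V\to W$; $m_{\Omega TV}\circ(\alpha_mV\otimes\alpha_nV)=\alpha_{m+n}V$, $u_{\Omega TV}=\alpha_0V$.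 Its unit is $\eta V=\alpha_1V$ and its counit $\epsilon$ satisfies $\Omega\epsilon(A,m_A,u_A)\circ\alpha_nA=m_A^{n-1}$ (iterated multiplication; $m_A^{-1}=u_A$, $m_A^0=\mathrm{Id}_A$). Braided tensor algebra: $\Omega_{\mathrm{Br}}$ has the left adjoint $T_{\mathrm{Br}}$ given by $T_{\mathrm{Br}}(V,c)=(TV,c_T)$, where $c_T$ is determined by $c_T\circ(\alpha_mV\otimes\alpha_nV)=(\alpha_nV\otimes\alpha_mV)\circ c_T^{m,n}$, and $T_{\mathrm{Br}}(f)=T(f)$ on morphisms; its unit $\eta_{\mathrm{Br}}$ and counit $\epsilon_{\mathrm{Br}}$ have the same underlying morphisms as $\eta$ and $\epsilon$. Here $c_T^{a,b}:V^{\otimes a}\otimes V^{\otimes b}\to V^{\otimes b}\otimes V^{\otimes a}$ is the unique family such that for all $l,m,n\in\mathbb N$ (identifying $V^{\otimes l}\otimes V^{\otimes m}$ with $V^{\otimes(l+m)}$ via the constraints): $(V^{\otimes n}\otimes c_T^{l,m})(c_T^{l,n}\otimes V^{\otimes m})(V^{\otimes l}\otimes c_T^{m,n})=(c_T^{m,n}\otimes V^{\otimes l})(V^{\otimes m}\otimes c_T^{l,n})(c_T^{l,m}\otimes V^{\otimes n})$; $(c_T^{l,n}\otimes V^{\otimes m})(V^{\otimes l}\otimes c_T^{m,n})=c_T^{l+m,n}$ for $l,m\ne0$; $(V^{\otimes m}\otimes c_T^{l,n})(c_T^{l,m}\otimes V^{\otimes n})=c_T^{l,m+n}$ for $m,n\ne0$;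 $c_T^{0,n}l_{V^{\otimes n}}^{-1}=r_{V^{\otimes n}}^{-1}$; $c_T^{n,0}r_{V^{\otimes n}}^{-1}=l_{V^{\otimes n}}^{-1}$; $c_T^{1,1}=c$. Braided tensor bialgebra: writing $T_{\mathrm{Br}}(V,c)=(A,m_A,u_A,c_A)$, $\overline T_{\mathrm{Br}}(V,c)=(A,m_A,u_A,\Delta_A,\varepsilon_A,c_A)\in\mathrm{BrBialg}_{\mathcal M}$, where $\Delta_A:A\to A\otimes A$ and $\varepsilon_A:A\to\mathbf 1$ are the unique algebra morphisms ($A\otimes A$ being an algebra via $(m_A\otimes m_A)(A\otimes c_A\otimes A)$ and $(u_A\otimes u_A)\Delta_{\mathbf 1}$) with $\Delta_A\circ\alpha_1V=(u_A\otimes\alpha_1V)l_V^{-1}+(\alpha_1V\otimes u_A)r_V^{-1}$ and $\varepsilon_A\circ\alpha_1V=0$; on morphisms $\overline T_{\mathrm{Br}}(f)=T_{\mathrm{Br}}(f)$. Thus $\mho_{\mathrm{Br}}\overline T_{\mathrm{Br}}=T_{\mathrm{Br}}$. Braided primitive functor: for $\mathbb A=(A,m_A,u_A,\Delta_A,\varepsilon_A,c_A)\in\mathrm{BrBialg}_{\mathcal M}$, $\xi\mathbb A:P(\mathbb A)\to A$ is a chosen equalizer of $\Delta_A$ and $(A\otimes u_A)r_A^{-1}+(u_A\otimes A)l_A^{-1}$, and $P_{\mathrm{Br}}(\mathbb A)=(P(\mathbb A),c_{P(\mathbb A)})$, where $c_{P(\mathbb A)}$ is the unique morphism with $(\xi\mathbb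 A\otimes\xi\mathbb A)c_{P(\mathbb A)}=c_A(\xi\mathbb A\otimes\xi\mathbb A)$ (it makes $P(\mathbb A)$ a braided object); $P_{\mathrm{Br}}(f)=P(f)$ is the unique morphism with $\xi\mathbb A'\circ P(f)=f\circ\xi\mathbb A$. This makes $\xi:P_{\mathrm{Br}}\to\Omega_{\mathrm{Br}}\mho_{\mathrm{Br}}$ a natural transformation. *)

theory Defs
  imports "HOL-Algebra.Group"
begin

no_notation monoid.mult (infixl "\<otimes>\<index>" 70)

section \<open>Categories, functors, natural transformations, adjunctions\<close>

record ('o, 'a) category =
  Obj :: "'o set"
  Arr :: "'a set"
  Dom :: "'a \<Rightarrow> 'o"
  Cod :: "'a \<Rightarrow> 'o"
  Comp :: "'a \<Rightarrow> 'a \<Rightarrow> 'a" (infixr "\<cdot>\<index>" 65)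
  Ident :: "'o \<Rightarrow> 'a" ("\<iota>\<index>")

definition Hom :: "('o, 'a, 'm) category_scheme \<Rightarrow> 'o \<Rightarrow> 'o \<Rightarrow> 'a set" where
  "Hom C X Y = {f \<in> Arr C. Dom C f = X \<and> Cod C f = Y}"

locale category =
  fixes C :: "('o, 'a, 'm) category_scheme" (structure)
  assumes Dom_Obj: "f \<in> Arr C \<Longrightarrow> Dom C f \<in> Obj C"
    and Cod_Obj: "f \<in> Arr C \<Longrightarrow> Cod C f \<in> Obj C"
    and Ident_Hom: "X \<in> Obj C \<Longrightarrow> \<iota> X \<in> Hom C X X"
    and Comp_Hom: "\<lbrakk>f \<in> Hom C X Y; g \<in> Hom C Y Z\<rbrakk> \<Longrightarrow> g \<cdot> f \<in> Hom C X Z"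
    and Comp_assoc: "\<lbrakk>f \<in> Hom C W X; g \<in> Hom C X Y; h \<in> Hom C Y Z\<rbrakk> \<Longrightarrow> (h \<cdot> g) \<cdot> f = h \<cdot> (g \<cdot> f)"
    and Comp_Ident_left: "f \<in> Hom C X Y \<Longrightarrow> \<iota> Y \<cdot> f = f"
    and Comp_Ident_right: "f \<in> Hom C X Y \<Longrightarrow> f \<cdot> \<iota> X = f"

definition inverse_arrows :: "('o, 'a, 'm) category_scheme \<Rightarrow> 'a \<Rightarrow> 'a \<Rightarrow> bool" where
  "inverse_arrows C f g \<longleftrightarrow>
     f \<in> Arr C \<and> g \<in> Hom C (Cod C f) (Dom C f) \<and>
     g \<cdot>\<^bsub>C\<^esub> f = \<iota>\<^bsub>C\<^esub> (Dom C f) \<and> f \<cdot>\<^bsub>C\<^esub> g = \<iota>\<^bsub>C\<^esub> (Cod C f)"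

definition is_iso :: "('o, 'a, 'm) category_scheme \<Rightarrow> 'a \<Rightarrow> bool" where
  "is_iso C f \<longleftrightarrow> (\<exists>g. inverse_arrows C f g)"

definition inv_arr :: "('o, 'a, 'm) category_scheme \<Rightarrow> 'a \<Rightarrow> 'a" where
  "inv_arr C f = (THE g. inverse_arrows C f g)"

definition is_equalizer ::
  "('o, 'a, 'm) category_scheme \<Rightarrow> 'o \<Rightarrow> 'o \<Rightarrow> 'a \<Rightarrow> 'a \<Rightarrow> 'o \<Rightarrow> 'a \<Rightarrow> bool" where
  "is_equalizer C X Y f g E e \<longleftrightarrow>
     f \<in> Hom C X Y \<and> g \<in> Hom C X Y \<and> e \<in> Hom C E X \<and> f \<cdot>\<^bsub>C\<^esub> e = g \<cdot>\<^bsub>C\<^esub> e \<and>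
     (\<forall>Z h. h \<in> Hom C Z X \<and> f \<cdot>\<^bsub>C\<^esub> h = g \<cdot>\<^bsub>C\<^esub> h \<longrightarrow> (\<exists>!k. k \<in> Hom C Z E \<and> e \<cdot>\<^bsub>C\<^esub> k = h))"

definition has_equalizers :: "('o, 'a, 'm) category_scheme \<Rightarrow> bool" where
  "has_equalizers C \<longleftrightarrow>
     (\<forall>X Y f g. f \<in> Hom C X Y \<and> g \<in> Hom C X Y \<longrightarrow> (\<exists>E e. is_equalizer C X Y f g E e))"

definition is_coproduct ::
  "('o, 'a, 'm) category_scheme \<Rightarrow> ('i \<Rightarrow> 'o) \<Rightarrow> 'o \<Rightarrow> ('i \<Rightarrow> 'a) \<Rightarrow> bool" where
  "is_coproduct C X S \<kappa> \<longleftrightarrow>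
     S \<in> Obj C \<and> (\<forall>i. \<kappa> i \<in> Hom C (X i) S) \<and>
     (\<forall>Z f. Z \<in> Obj C \<and> (\<forall>i. f i \<in> Hom C (X i) Z) \<longrightarrow>
        (\<exists>!k. k \<in> Hom C S Z \<and> (\<forall>i. k \<cdot>\<^bsub>C\<^esub> \<kappa> i = f i)))"

definition has_denumerable_coproducts :: "('o, 'a, 'm) category_scheme \<Rightarrow> bool" where
  "has_denumerable_coproducts C \<longleftrightarrow>
     (\<forall>X :: nat \<Rightarrow> 'o. (\<forall>n. X n \<in> Obj C) \<longrightarrow> (\<exists>S \<kappa>. is_coproduct C X S \<kappa>))"

record ('x, 'f, 'y, 'g) func =
  map_obj :: "'x \<Rightarrow> 'y"
  map_arr :: "'f \<Rightarrow> 'g"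

definition is_functor ::
  "('x, 'f, 'm) category_scheme \<Rightarrow> ('y, 'g, 'n) category_scheme \<Rightarrow> ('x, 'f, 'y, 'g) func \<Rightarrow> bool" where
  "is_functor C D F \<longleftrightarrow>
     category C \<and> category D \<and>
     (\<forall>X \<in> Obj C. map_obj F X \<in> Obj D) \<and>
     (\<forall>X Y. \<forall>f \<in> Hom C X Y. map_arr F f \<in> Hom D (map_obj F X) (map_obj F Y)) \<and>
     (\<forall>X \<in> Obj C. map_arr F (\<iota>\<^bsub>C\<^esub> X) = \<iota>\<^bsub>D\<^esub> (map_obj F X)) \<and>
     (\<forall>X Y Z. \<forall>f \<in> Hom C X Y. \<forall>g \<in> Hom C Y Z.
        map_arr F (g \<cdot>\<^bsub>C\<^esub> f) = map_arr F g \<cdot>\<^bsub>D\<^esub> map_arr F f)"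

definition id_func :: "('x, 'f, 'x, 'f) func" where
  "id_func = \<lparr>map_obj = (\<lambda>X. X), map_arr = (\<lambda>f. f)\<rparr>"

definition comp_func ::
  "('y, 'g, 'z, 'h) func \<Rightarrow> ('x, 'f, 'y, 'g) func \<Rightarrow> ('x, 'f, 'z, 'h) func" where
  "comp_func G F =
     \<lparr>map_obj = (\<lambda>X. map_obj G (map_obj F X)), map_arr = (\<lambda>f. map_arr G (map_arr F f))\<rparr>"

text \<open>A transformation is its family of components; its values outside \<^term>\<open>Obj C\<close> are irrelevant.\<close>

definition is_nat_trans ::
  "('x, 'f, 'm) category_scheme \<Rightarrow> ('y, 'g, 'n) category_scheme \<Rightarrow>
   ('x, 'f, 'y, 'g) func \<Rightarrow> ('x, 'f, 'y, 'g) func \<Rightarrow> ('x \<Rightarrow> 'g) \<Rightarrow> bool" where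
  "is_nat_trans C D F G \<tau> \<longleftrightarrow>
     is_functor C D F \<and> is_functor C D G \<and>
     (\<forall>X \<in> Obj C. \<tau> X \<in> Hom D (map_obj F X) (map_obj G X)) \<and>
     (\<forall>X Y. \<forall>f \<in> Hom C X Y. \<tau> Y \<cdot>\<^bsub>D\<^esub> map_arr F f = map_arr G f \<cdot>\<^bsub>D\<^esub> \<tau> X)"

text \<open>\<^term>\<open>L :: ('x, 'f, 'y, 'g) func\<close> is left adjoint to \<^term>\<open>R :: ('y, 'g, 'x, 'f) func\<close>
  with unit \<open>\<eta>\<close> and counit \<open>\<epsilon>\<close>.\<close>

definition is_adjunction ::
  "('x, 'f, 'm) category_scheme \<Rightarrow> ('y, 'g, 'n) category_scheme \<Rightarrow>
   ('x, 'f, 'y, 'g) func \<Rightarrow> ('y, 'g, 'x, 'f) func \<Rightarrow> ('x \<Rightarrow> 'f) \<Rightarrow> ('y \<Rightarrow> 'g) \<Rightarrow> bool" where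
  "is_adjunction C D L R \<eta> \<epsilon> \<longleftrightarrow>
     is_functor C D L \<and> is_functor D C R \<and>
     is_nat_trans C C id_func (comp_func R L) \<eta> \<and>
     is_nat_trans D D (comp_func L R) id_func \<epsilon> \<and>
     (\<forall>X \<in> Obj C. \<epsilon> (map_obj L X) \<cdot>\<^bsub>D\<^esub> map_arr L (\<eta> X) = \<iota>\<^bsub>D\<^esub> (map_obj L X)) \<and>
     (\<forall>Y \<in> Obj D. map_arr R (\<epsilon> Y) \<cdot>\<^bsub>C\<^esub> \<eta> (map_obj R Y) = \<iota>\<^bsub>C\<^esub> (map_obj R Y))"

definition preserves_equalizers ::
  "('x, 'f, 'm) category_scheme \<Rightarrow> ('y, 'g, 'n) category_scheme \<Rightarrow> ('x, 'f, 'y, 'g) func \<Rightarrow> bool" where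
  "preserves_equalizers C D F \<longleftrightarrow>
     (\<forall>X Y f g E e. is_equalizer C X Y f g E e \<longrightarrow>
        is_equalizer D (map_obj F X) (map_obj F Y) (map_arr F f) (map_arr F g)
          (map_obj F E) (map_arr F e))"

definition preserves_denumerable_coproducts ::
  "('x, 'f, 'm) category_scheme \<Rightarrow> ('y, 'g, 'n) category_scheme \<Rightarrow> ('x, 'f, 'y, 'g) func \<Rightarrow> bool" where
  "preserves_denumerable_coproducts C D F \<longleftrightarrow>
     (\<forall>(X :: nat \<Rightarrow> 'x) S \<kappa>. is_coproduct C X S \<kappa> \<longrightarrow>
        is_coproduct D (\<lambda>n. map_obj F (X n)) (map_obj F S) (\<lambda>n. map_arr F (\<kappa> n)))"


section \<open>Preadditive monoidal categories\<close>

record ('o, 'a) monoidal_category = "('o, 'a) category" +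
  tensor_obj :: "'o \<Rightarrow> 'o \<Rightarrow> 'o" (infixl "\<boxtimes>\<index>" 70)
  tensor_arr :: "'a \<Rightarrow> 'a \<Rightarrow> 'a" (infixl "\<otimes>\<index>" 70)
  unit_obj :: "'o" ("\<I>\<index>")
  assoc :: "'o \<Rightarrow> 'o \<Rightarrow> 'o \<Rightarrow> 'a" ("\<a>\<index>")
  lunit :: "'o \<Rightarrow> 'a" ("\<l>\<index>")
  runit :: "'o \<Rightarrow> 'a" ("\<r>\<index>")

definition assoc_inv :: "('o, 'a, 'm) monoidal_category_scheme \<Rightarrow> 'o \<Rightarrow> 'o \<Rightarrow> 'o \<Rightarrow> 'a" ("\<a>''\<index>") where
  "\<a>'\<^bsub>M\<^esub> X Y Z = inv_arr M (\<a>\<^bsub>M\<^esub> X Y Z)"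

definition lunit_inv :: "('o, 'a, 'm) monoidal_category_scheme \<Rightarrow> 'o \<Rightarrow> 'a" ("\<l>''\<index>") where
  "\<l>'\<^bsub>M\<^esub> X = inv_arr M (\<l>\<^bsub>M\<^esub> X)"

definition runit_inv :: "('o, 'a, 'm) monoidal_category_scheme \<Rightarrow> 'o \<Rightarrow> 'a" ("\<r>''\<index>") where
  "\<r>'\<^bsub>M\<^esub> X = inv_arr M (\<r>\<^bsub>M\<^esub> X)"

locale monoidal_category = category M
  for M :: "('o, 'a, 'm) monoidal_category_scheme" (structure) +
  assumes unit_Obj: "\<I> \<in> Obj M"
    and tensor_Obj: "\<lbrakk>X \<in> Obj M; Y \<in> Obj M\<rbrakk> \<Longrightarrow> X \<boxtimes> Y \<in> Obj M"
    and tensor_Hom: "\<lbrakk>f \<in> Hom M X Y; f' \<in> Hom M X' Y'\<rbrakk> \<Longrightarrow> f \<otimes> f' \<in> Hom M (X \<boxtimes> X') (Y \<boxtimes> Y')"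
    and tensor_Ident: "\<lbrakk>X \<in> Obj M; Y \<in> Obj M\<rbrakk> \<Longrightarrow> \<iota> X \<otimes> \<iota> Y = \<iota> (X \<boxtimes> Y)"
    and tensor_Comp: "\<lbrakk>f \<in> Hom M X Y; g \<in> Hom M Y Z; f' \<in> Hom M X' Y'; g' \<in> Hom M Y' Z'\<rbrakk>
      \<Longrightarrow> (g \<cdot> f) \<otimes> (g' \<cdot> f') = (g \<otimes> g') \<cdot> (f \<otimes> f')"
    and assoc_Hom: "\<lbrakk>X \<in> Obj M; Y \<in> Obj M; Z \<in> Obj M\<rbrakk>
      \<Longrightarrow> \<a> X Y Z \<in> Hom M ((X \<boxtimes> Y) \<boxtimes> Z) (X \<boxtimes> (Y \<boxtimes> Z))"
    and assoc_iso: "\<lbrakk>X \<in> Obj M; Y \<in> Obj M; Z \<in> Obj M\<rbrakk> \<Longrightarrow> is_iso M (\<a> X Y Z)"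
    and assoc_natural: "\<lbrakk>f \<in> Hom M X X'; g \<in> Hom M Y Y'; h \<in> Hom M Z Z'\<rbrakk>
      \<Longrightarrow> \<a> X' Y' Z' \<cdot> ((f \<otimes> g) \<otimes> h) = (f \<otimes> (g \<otimes> h)) \<cdot> \<a> X Y Z"
    and lunit_Hom: "X \<in> Obj M \<Longrightarrow> \<l> X \<in> Hom M (\<I> \<boxtimes> X) X"
    and lunit_iso: "X \<in> Obj M \<Longrightarrow> is_iso M (\<l> X)"
    and lunit_natural: "f \<in> Hom M X Y \<Longrightarrow> \<l> Y \<cdot> (\<iota> \<I> \<otimes> f) = f \<cdot> \<l> X"
    and runit_Hom: "X \<in> Obj M \<Longrightarrow> \<r> X \<in> Hom M (X \<boxtimes> \<I>) X"
    and runit_iso: "X \<in> Obj M \<Longrightarrow> is_iso M (\<r> X)"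
    and runit_natural: "f \<in> Hom M X Y \<Longrightarrow> \<r> Y \<cdot> (f \<otimes> \<iota> \<I>) = f \<cdot> \<r> X"
    and pentagon: "\<lbrakk>W \<in> Obj M; X \<in> Obj M; Y \<in> Obj M; Z \<in> Obj M\<rbrakk>
      \<Longrightarrow> (\<iota> W \<otimes> \<a> X Y Z) \<cdot> \<a> W (X \<boxtimes> Y) Z \<cdot> (\<a> W X Y \<otimes> \<iota> Z)
        = \<a> W X (Y \<boxtimes> Z) \<cdot> \<a> (W \<boxtimes> X) Y Z"
    and triangle: "\<lbrakk>X \<in> Obj M; Y \<in> Obj M\<rbrakk>
      \<Longrightarrow> (\<iota> X \<otimes> \<l> Y) \<cdot> \<a> X \<I> Y = \<r> X \<otimes> \<iota> Y"

record ('o, 'a) preadditive_monoidal_category = "('o, 'a) monoidal_category" +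
  add_arr :: "'a \<Rightarrow> 'a \<Rightarrow> 'a" (infixl "\<oplus>\<index>" 60)
  zero_arr :: "'o \<Rightarrow> 'o \<Rightarrow> 'a" ("\<zero>\<index>")

locale preadditive_monoidal_category = monoidal_category M
  for M :: "('o, 'a, 'm) preadditive_monoidal_category_scheme" (structure) +
  assumes Hom_comm_group: "\<lbrakk>X \<in> Obj M; Y \<in> Obj M\<rbrakk>
      \<Longrightarrow> comm_group \<lparr>carrier = Hom M X Y, mult = (\<lambda>f g. f \<oplus> g), one = \<zero> X Y\<rparr>"
    and Comp_add_left: "\<lbrakk>f \<in> Hom M X Y; g \<in> Hom M Y Z; g' \<in> Hom M Y Z\<rbrakk>
      \<Longrightarrow> (g \<oplus> g') \<cdot> f = (g \<cdot> f) \<oplus> (g' \<cdot> f)"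
    and Comp_add_right: "\<lbrakk>f \<in> Hom M X Y; f' \<in> Hom M X Y; g \<in> Hom M Y Z\<rbrakk>
      \<Longrightarrow> g \<cdot> (f \<oplus> f') = (g \<cdot> f) \<oplus> (g \<cdot> f')"

definition is_additive ::
  "('x, 'f, 'm) preadditive_monoidal_category_scheme \<Rightarrow>
   ('y, 'g, 'n) preadditive_monoidal_category_scheme \<Rightarrow> ('x, 'f, 'y, 'g) func \<Rightarrow> bool" where
  "is_additive C D F \<longleftrightarrow>
     (\<forall>X Y. \<forall>f \<in> Hom C X Y. \<forall>g \<in> Hom C X Y.
        map_arr F (f \<oplus>\<^bsub>C\<^esub> g) = map_arr F f \<oplus>\<^bsub>D\<^esub> map_arr F g)"

definition tensor_left :: "('o, 'a, 'm) monoidal_category_scheme \<Rightarrow> 'o \<Rightarrow> ('o, 'a, 'o, 'a) func" where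
  "tensor_left M X = \<lparr>map_obj = (\<lambda>Y. X \<boxtimes>\<^bsub>M\<^esub> Y), map_arr = (\<lambda>f. \<iota>\<^bsub>M\<^esub> X \<otimes>\<^bsub>M\<^esub> f)\<rparr>"

definition tensor_right :: "('o, 'a, 'm) monoidal_category_scheme \<Rightarrow> 'o \<Rightarrow> ('o, 'a, 'o, 'a) func" where
  "tensor_right M X = \<lparr>map_obj = (\<lambda>Y. Y \<boxtimes>\<^bsub>M\<^esub> X), map_arr = (\<lambda>f. f \<otimes>\<^bsub>M\<^esub> \<iota>\<^bsub>M\<^esub> X)\<rparr>"


section \<open>Braided objects, algebras, coalgebras and bialgebras\<close>

text \<open>The associativity constraint \<^term>\<open>\<a>\<^bsub>M\<^esub>\<close> and its inverse are inserted wherever the usual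
  notation suppresses them.\<close>

context
  fixes M :: "('o, 'a, 'm) monoidal_category_scheme" (structure)
begin

definition is_algebra :: "'o \<Rightarrow> 'a \<Rightarrow> 'a \<Rightarrow> bool" where
  "is_algebra A m u \<longleftrightarrow>
     A \<in> Obj M \<and> m \<in> Hom M (A \<boxtimes> A) A \<and> u \<in> Hom M \<I> A \<and>
     m \<cdot> (m \<otimes> \<iota> A) = m \<cdot> (\<iota> A \<otimes> m) \<cdot> \<a> A A A \<and>
     m \<cdot> (u \<otimes> \<iota> A) = \<l> A \<and>
     m \<cdot> (\<iota> A \<otimes> u) = \<r> A"

definition is_algebra_mor :: "'o \<Rightarrow> 'a \<Rightarrow> 'a \<Rightarrow> 'a \<Rightarrow> 'o \<Rightarrow> 'a \<Rightarrow> 'a \<Rightarrow> bool" where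
  "is_algebra_mor A m u f A' m' u' \<longleftrightarrow>
     f \<in> Hom M A A' \<and> f \<cdot> m = m' \<cdot> (f \<otimes> f) \<and> f \<cdot> u = u'"

definition is_coalgebra :: "'o \<Rightarrow> 'a \<Rightarrow> 'a \<Rightarrow> bool" where
  "is_coalgebra C \<Delta> \<epsilon> \<longleftrightarrow>
     C \<in> Obj M \<and> \<Delta> \<in> Hom M C (C \<boxtimes> C) \<and> \<epsilon> \<in> Hom M C \<I> \<and>
     \<a> C C C \<cdot> (\<Delta> \<otimes> \<iota> C) \<cdot> \<Delta> = (\<iota> C \<otimes> \<Delta>) \<cdot> \<Delta> \<and>
     \<l> C \<cdot> (\<epsilon> \<otimes> \<iota> C) \<cdot> \<Delta> = \<iota> C \<and>
     \<r> C \<cdot> (\<iota> C \<otimes> \<epsilon>) \<cdot> \<Delta> = \<iota> C"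

definition is_coalgebra_mor :: "'o \<Rightarrow> 'a \<Rightarrow> 'a \<Rightarrow> 'a \<Rightarrow> 'o \<Rightarrow> 'a \<Rightarrow> 'a \<Rightarrow> bool" where
  "is_coalgebra_mor C \<Delta> \<epsilon> f C' \<Delta>' \<epsilon>' \<longleftrightarrow>
     f \<in> Hom M C C' \<and> \<Delta>' \<cdot> f = (f \<otimes> f) \<cdot> \<Delta> \<and> \<epsilon>' \<cdot> f = \<epsilon>"

definition is_braided_object :: "'o \<Rightarrow> 'a \<Rightarrow> bool" where
  "is_braided_object V c \<longleftrightarrow>
     V \<in> Obj M \<and> c \<in> Hom M (V \<boxtimes> V) (V \<boxtimes> V) \<and> is_iso M c \<and>
     (c \<otimes> \<iota> V) \<cdot> \<a>' V V V \<cdot> (\<iota> V \<otimes> c) \<cdot> \<a> V V V \<cdot> (c \<otimes> \<iota> V)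
       = \<a>' V V V \<cdot> (\<iota> V \<otimes> c) \<cdot> \<a> V V V \<cdot> (c \<otimes> \<iota> V) \<cdot> \<a>' V V V \<cdot> (\<iota> V \<otimes> c) \<cdot> \<a> V V V"

definition is_braided_mor :: "'o \<Rightarrow> 'a \<Rightarrow> 'a \<Rightarrow> 'o \<Rightarrow> 'a \<Rightarrow> bool" where
  "is_braided_mor V c f V' c' \<longleftrightarrow> f \<in> Hom M V V' \<and> c' \<cdot> (f \<otimes> f) = (f \<otimes> f) \<cdot> c"

definition is_braided_algebra :: "'o \<Rightarrow> 'a \<Rightarrow> 'a \<Rightarrow> 'a \<Rightarrow> bool" where
  "is_braided_algebra A m u c \<longleftrightarrow>
     is_algebra A m u \<and> is_braided_object A c \<and>
     c \<cdot> (m \<otimes> \<iota> A)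
       = (\<iota> A \<otimes> m) \<cdot> \<a> A A A \<cdot> (c \<otimes> \<iota> A) \<cdot> \<a>' A A A \<cdot> (\<iota> A \<otimes> c) \<cdot> \<a> A A A \<and>
     c \<cdot> (\<iota> A \<otimes> m)
       = (m \<otimes> \<iota> A) \<cdot> \<a>' A A A \<cdot> (\<iota> A \<otimes> c) \<cdot> \<a> A A A \<cdot> (c \<otimes> \<iota> A) \<cdot> \<a>' A A A \<and>
     c \<cdot> (u \<otimes> \<iota> A) \<cdot> \<l>' A = (\<iota> A \<otimes> u) \<cdot> \<r>' A \<and>
     c \<cdot> (\<iota> A \<otimes> u) \<cdot> \<r>' A = (u \<otimes> \<iota> A) \<cdot> \<l>' A"

definition is_braided_coalgebra :: "'o \<Rightarrow> 'a \<Rightarrow> 'a \<Rightarrow> 'a \<Rightarrow> bool" where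
  "is_braided_coalgebra C \<Delta> \<epsilon> c \<longleftrightarrow>
     is_coalgebra C \<Delta> \<epsilon> \<and> is_braided_object C c \<and>
     (\<Delta> \<otimes> \<iota> C) \<cdot> c
       = \<a>' C C C \<cdot> (\<iota> C \<otimes> c) \<cdot> \<a> C C C \<cdot> (c \<otimes> \<iota> C) \<cdot> \<a>' C C C \<cdot> (\<iota> C \<otimes> \<Delta>) \<and>
     (\<iota> C \<otimes> \<Delta>) \<cdot> c
       = \<a> C C C \<cdot> (c \<otimes> \<iota> C) \<cdot> \<a>' C C C \<cdot> (\<iota> C \<otimes> c) \<cdot> \<a> C C C \<cdot> (\<Delta> \<otimes> \<iota> C) \<and>
     \<l> C \<cdot> (\<epsilon> \<otimes> \<iota> C) \<cdot> c = \<r> C \<cdot> (\<iota> C \<otimes> \<epsilon>) \<and>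
     \<r> C \<cdot> (\<iota> C \<otimes> \<epsilon>) \<cdot> c = \<l> C \<cdot> (\<epsilon> \<otimes> \<iota> C)"

text \<open>\<open>B \<otimes> c \<otimes> B\<close> as an endomorphism of \<open>(B \<otimes> B) \<otimes> (B \<otimes> B)\<close>.\<close>

definition middle :: "'o \<Rightarrow> 'a \<Rightarrow> 'a" where
  "middle B c =
     \<a>' B B (B \<boxtimes> B) \<cdot> (\<iota> B \<otimes> (\<a> B B B \<cdot> (c \<otimes> \<iota> B) \<cdot> \<a>' B B B)) \<cdot> \<a> B B (B \<boxtimes> B)"

definition is_braided_bialgebra :: "'o \<Rightarrow> 'a \<Rightarrow> 'a \<Rightarrow> 'a \<Rightarrow> 'a \<Rightarrow> 'a \<Rightarrow> bool" where
  "is_braided_bialgebra B m u \<Delta> \<epsilon> c \<longleftrightarrow>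
     is_braided_algebra B m u c \<and> is_braided_coalgebra B \<Delta> \<epsilon> c \<and>
     \<Delta> \<cdot> m = (m \<otimes> m) \<cdot> middle B c \<cdot> (\<Delta> \<otimes> \<Delta>) \<and>
     \<Delta> \<cdot> u = (u \<otimes> u) \<cdot> \<l>' \<I> \<and>
     \<epsilon> \<cdot> m = \<l> \<I> \<cdot> (\<epsilon> \<otimes> \<epsilon>) \<and>
     \<epsilon> \<cdot> u = \<iota> \<I>"

end

datatype ('o, 'a) br_obj = BrObj (obj_of: 'o) (br_of: 'a)

datatype ('o, 'a) br_alg = BrAlgObj (alg_obj: 'o) (alg_mult: 'a) (alg_unit: 'a) (alg_br: 'a)

datatype ('o, 'a) br_bialg = BrBialgObj (bi_obj: 'o) (bi_mult: 'a) (bi_unit: 'a)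
  (bi_comult: 'a) (bi_counit: 'a) (bi_br: 'a)

text \<open>A morphism of structured objects records its structured source and target, since the same
  underlying morphism may be a morphism between several pairs of structures.\<close>

datatype ('s, 'a) str_arr = StrArr (src: 's) (und: 'a) (trg: 's)

definition structured_category ::
  "('o, 'a, 'm) category_scheme \<Rightarrow> 's set \<Rightarrow> ('s \<Rightarrow> 'o) \<Rightarrow> ('s \<Rightarrow> 'a \<Rightarrow> 's \<Rightarrow> bool) \<Rightarrow>
   ('s, ('s, 'a) str_arr) category" where
  "structured_category C S U mor =
     \<lparr>Obj = S,
      Arr = {StrArr X f Y | X f Y. X \<in> S \<and> Y \<in> S \<and> mor X f Y},
      Dom = src,
      Cod = trg,
      Comp = (\<lambda>g f. StrArr (src f) (und g \<cdot>\<^bsub>C\<^esub> und f) (trg g)),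
      Ident = (\<lambda>X. StrArr X (\<iota>\<^bsub>C\<^esub> (U X)) X)\<rparr>"

context
  fixes M :: "('o, 'a, 'm) monoidal_category_scheme" (structure)
begin

definition Br :: "(('o, 'a) br_obj, (('o, 'a) br_obj, 'a) str_arr) category" where
  "Br = structured_category M
     {X. is_braided_object M (obj_of X) (br_of X)}
     obj_of
     (\<lambda>X f Y. is_braided_mor M (obj_of X) (br_of X) f (obj_of Y) (br_of Y))"

definition BrAlg :: "(('o, 'a) br_alg, (('o, 'a) br_alg, 'a) str_arr) category" where
  "BrAlg = structured_category M
     {X. is_braided_algebra M (alg_obj X) (alg_mult X) (alg_unit X) (alg_br X)}
     alg_obj
     (\<lambda>X f Y.
        is_algebra_mor M (alg_obj X) (alg_mult X) (alg_unit X) f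
          (alg_obj Y) (alg_mult Y) (alg_unit Y) \<and>
        is_braided_mor M (alg_obj X) (alg_br X) f (alg_obj Y) (alg_br Y))"

definition BrBialg :: "(('o, 'a) br_bialg, (('o, 'a) br_bialg, 'a) str_arr) category" where
  "BrBialg = structured_category M
     {X. is_braided_bialgebra M (bi_obj X) (bi_mult X) (bi_unit X)
           (bi_comult X) (bi_counit X) (bi_br X)}
     bi_obj
     (\<lambda>X f Y.
        is_algebra_mor M (bi_obj X) (bi_mult X) (bi_unit X) f
          (bi_obj Y) (bi_mult Y) (bi_unit Y) \<and>
        is_coalgebra_mor M (bi_obj X) (bi_comult X) (bi_counit X) f
          (bi_obj Y) (bi_comult Y) (bi_counit Y) \<and>
        is_braided_mor M (bi_obj X) (bi_br X) f (bi_obj Y) (bi_br Y))"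

end

definition \<Omega>_obj :: "('o, 'a) br_alg \<Rightarrow> ('o, 'a) br_obj" where
  "\<Omega>_obj X = BrObj (alg_obj X) (alg_br X)"

definition \<Omega>_Br ::
  "(('o, 'a) br_alg, (('o, 'a) br_alg, 'a) str_arr, ('o, 'a) br_obj, (('o, 'a) br_obj, 'a) str_arr) func" where
  "\<Omega>_Br = \<lparr>map_obj = \<Omega>_obj,
            map_arr = (\<lambda>f. StrArr (\<Omega>_obj (src f)) (und f) (\<Omega>_obj (trg f)))\<rparr>"

definition mho_obj :: "('o, 'a) br_bialg \<Rightarrow> ('o, 'a) br_alg" where
  "mho_obj X = BrAlgObj (bi_obj X) (bi_mult X) (bi_unit X) (bi_br X)"

definition mho_Br ::
  "(('o, 'a) br_bialg, (('o, 'a) br_bialg, 'a) str_arr, ('o, 'a) br_alg, (('o, 'a) br_alg, 'a) str_arr) func" where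
  "mho_Br = \<lparr>map_obj = mho_obj,
             map_arr = (\<lambda>f. StrArr (mho_obj (src f)) (und f) (mho_obj (trg f)))\<rparr>"


section \<open>The braided tensor algebra\<close>

context
  fixes M :: "('o, 'a, 'm) monoidal_category_scheme" (structure)
begin

fun tpow :: "'o \<Rightarrow> nat \<Rightarrow> 'o" where
  "tpow V 0 = \<I>"
| "tpow V (Suc 0) = V"
| "tpow V (Suc (Suc n)) = tpow V (Suc n) \<boxtimes> V"

fun tpow_arr :: "'a \<Rightarrow> nat \<Rightarrow> 'a" where
  "tpow_arr f 0 = \<iota> \<I>"
| "tpow_arr f (Suc 0) = f"
| "tpow_arr f (Suc (Suc n)) = tpow_arr f (Suc n) \<otimes> f"

text \<open>The canonical isomorphism \<open>V\<^bsup>\<otimes>m\<^esup> \<otimes> V\<^bsup>\<otimes>n\<^esup> \<rightarrow> V\<^bsup>\<otimes>(m+n)\<^esup>\<close> composed of constraints.\<close>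

fun tjoin :: "'o \<Rightarrow> nat \<Rightarrow> nat \<Rightarrow> 'a" where
  "tjoin V m 0 = \<r> (tpow V m)"
| "tjoin V 0 (Suc 0) = \<l> V"
| "tjoin V (Suc m) (Suc 0) = \<iota> (tpow V (Suc m) \<boxtimes> V)"
| "tjoin V m (Suc (Suc n)) = (tjoin V m (Suc n) \<otimes> \<iota> V) \<cdot> \<a>' (tpow V m) (tpow V (Suc n)) V"

text \<open>\<open>m\<^bsup>n-1\<^esup>\<close> in the usual notation, with \<open>m\<^bsup>-1\<^esup> = u\<close>.\<close>

fun iter_mult :: "'o \<Rightarrow> 'a \<Rightarrow> 'a \<Rightarrow> nat \<Rightarrow> 'a" where
  "iter_mult A m u 0 = u"
| "iter_mult A m u (Suc 0) = \<iota> A"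
| "iter_mult A m u (Suc (Suc n)) = m \<cdot> (iter_mult A m u (Suc n) \<otimes> \<iota> A)"

definition is_braiding_family :: "'o \<Rightarrow> 'a \<Rightarrow> (nat \<Rightarrow> nat \<Rightarrow> 'a) \<Rightarrow> bool" where
  "is_braiding_family V c d \<longleftrightarrow> (let W = tpow V in
     (\<forall>m n. d m n \<in> Hom M (W m \<boxtimes> W n) (W n \<boxtimes> W m)) \<and>
     (\<forall>l m n.
        \<a>' (W n) (W m) (W l) \<cdot> (\<iota> (W n) \<otimes> d l m) \<cdot> \<a> (W n) (W l) (W m) \<cdot> (d l n \<otimes> \<iota> (W m)) \<cdot>
          \<a>' (W l) (W n) (W m) \<cdot> (\<iota> (W l) \<otimes> d m n) \<cdot> \<a> (W l) (W m) (W n)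
        = (d m n \<otimes> \<iota> (W l)) \<cdot> \<a>' (W m) (W n) (W l) \<cdot> (\<iota> (W m) \<otimes> d l n) \<cdot> \<a> (W m) (W l) (W n) \<cdot>
          (d l m \<otimes> \<iota> (W n))) \<and>
     (\<forall>l m n. l \<noteq> 0 \<and> m \<noteq> 0 \<longrightarrow>
        (\<iota> (W n) \<otimes> tjoin V l m) \<cdot> \<a> (W n) (W l) (W m) \<cdot> (d l n \<otimes> \<iota> (W m)) \<cdot>
          \<a>' (W l) (W n) (W m) \<cdot> (\<iota> (W l) \<otimes> d m n) \<cdot> \<a> (W l) (W m) (W n)
        = d (l + m) n \<cdot> (tjoin V l m \<otimes> \<iota> (W n))) \<and>
     (\<forall>l m n. m \<noteq> 0 \<and> n \<noteq> 0 \<longrightarrow>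
        (tjoin V m n \<otimes> \<iota> (W l)) \<cdot> \<a>' (W m) (W n) (W l) \<cdot> (\<iota> (W m) \<otimes> d l n) \<cdot>
          \<a> (W m) (W l) (W n) \<cdot> (d l m \<otimes> \<iota> (W n)) \<cdot> \<a>' (W l) (W m) (W n)
        = d l (m + n) \<cdot> (\<iota> (W l) \<otimes> tjoin V m n)) \<and>
     (\<forall>n. d 0 n \<cdot> \<l>' (W n) = \<r>' (W n)) \<and>
     (\<forall>n. d n 0 \<cdot> \<r>' (W n) = \<l>' (W n)) \<and>
     d 1 1 = c)"

definition braiding_family :: "'o \<Rightarrow> 'a \<Rightarrow> nat \<Rightarrow> nat \<Rightarrow> 'a" where
  "braiding_family V c = (THE d. is_braiding_family V c d)"

text \<open>\<open>T V\<close> with injections \<open>\<alpha> V n\<close> is a choice of coproduct of the tensor powers of \<open>V\<close>.\<close>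

context
  fixes T :: "'o \<Rightarrow> 'o" and \<alpha> :: "'o \<Rightarrow> nat \<Rightarrow> 'a"
begin

definition T_mult :: "'o \<Rightarrow> 'a" where
  "T_mult V = (THE h. h \<in> Hom M (T V \<boxtimes> T V) (T V) \<and>
     (\<forall>m n. h \<cdot> (\<alpha> V m \<otimes> \<alpha> V n) = \<alpha> V (m + n) \<cdot> tjoin V m n))"

definition T_unit :: "'o \<Rightarrow> 'a" where
  "T_unit V = \<alpha> V 0"

definition T_arr :: "'o \<Rightarrow> 'a \<Rightarrow> 'o \<Rightarrow> 'a" where
  "T_arr V f W = (THE h. h \<in> Hom M (T V) (T W) \<and> (\<forall>n. h \<cdot> \<alpha> V n = \<alpha> W n \<cdot> tpow_arr f n))"

definition T_braiding :: "'o \<Rightarrow> 'a \<Rightarrow> 'a" where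
  "T_braiding V c = (THE h. h \<in> Hom M (T V \<boxtimes> T V) (T V \<boxtimes> T V) \<and>
     (\<forall>m n. h \<cdot> (\<alpha> V m \<otimes> \<alpha> V n) = (\<alpha> V n \<otimes> \<alpha> V m) \<cdot> braiding_family V c m n))"

definition T_Br_obj :: "('o, 'a) br_obj \<Rightarrow> ('o, 'a) br_alg" where
  "T_Br_obj X = BrAlgObj (T (obj_of X)) (T_mult (obj_of X)) (T_unit (obj_of X))
     (T_braiding (obj_of X) (br_of X))"

definition T_Br ::
  "(('o, 'a) br_obj, (('o, 'a) br_obj, 'a) str_arr, ('o, 'a) br_alg, (('o, 'a) br_alg, 'a) str_arr) func" where
  "T_Br = \<lparr>map_obj = T_Br_obj,
     map_arr = (\<lambda>f. StrArr (T_Br_obj (src f)) (T_arr (obj_of (src f)) (und f) (obj_of (trg f)))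
                  (T_Br_obj (trg f)))\<rparr>"

text \<open>Unit and counit of the adjunction between \<open>T_Br\<close> and \<open>\<Omega>_Br\<close>.\<close>

definition \<eta>_Br :: "('o, 'a) br_obj \<Rightarrow> (('o, 'a) br_obj, 'a) str_arr" where
  "\<eta>_Br X = StrArr X (\<alpha> (obj_of X) 1) (map_obj \<Omega>_Br (map_obj T_Br X))"

definition \<epsilon>_Br :: "('o, 'a) br_alg \<Rightarrow> (('o, 'a) br_alg, 'a) str_arr" where
  "\<epsilon>_Br X = StrArr (map_obj T_Br (map_obj \<Omega>_Br X))
     (THE h. h \<in> Hom M (T (alg_obj X)) (alg_obj X) \<and>
        (\<forall>n. h \<cdot> \<alpha> (alg_obj X) n = iter_mult (alg_obj X) (alg_mult X) (alg_unit X) n))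
     X"

end

end


section \<open>The braided tensor bialgebra and the primitive functor\<close>

context
  fixes M :: "('o, 'a, 'm) preadditive_monoidal_category_scheme" (structure)
begin

context
  fixes T :: "'o \<Rightarrow> 'o" and \<alpha> :: "'o \<Rightarrow> nat \<Rightarrow> 'a"
begin

definition T_comult :: "'o \<Rightarrow> 'a \<Rightarrow> 'a" where
  "T_comult V c = (let A = T V; m = T_mult M T \<alpha> V; u = T_unit \<alpha> V; cA = T_braiding M T \<alpha> V c in
     THE \<Delta>. is_algebra_mor M A m u \<Delta> (A \<boxtimes> A) ((m \<otimes> m) \<cdot> middle M A cA) ((u \<otimes> u) \<cdot> \<l>' \<I>) \<and>
       \<Delta> \<cdot> \<alpha> V 1 = ((u \<otimes> \<alpha> V 1) \<cdot> \<l>' V) \<oplus> ((\<alpha> V 1 \<otimes> u) \<cdot> \<r>' V))"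

definition T_counit :: "'o \<Rightarrow> 'a" where
  "T_counit V =
     (THE \<epsilon>. is_algebra_mor M (T V) (T_mult M T \<alpha> V) (T_unit \<alpha> V) \<epsilon> \<I> (\<l> \<I>) (\<iota> \<I>) \<and>
       \<epsilon> \<cdot> \<alpha> V 1 = \<zero> V \<I>)"

definition Tbar_Br_obj :: "('o, 'a) br_obj \<Rightarrow> ('o, 'a) br_bialg" where
  "Tbar_Br_obj X = BrBialgObj (T (obj_of X)) (T_mult M T \<alpha> (obj_of X)) (T_unit \<alpha> (obj_of X))
     (T_comult (obj_of X) (br_of X)) (T_counit (obj_of X)) (T_braiding M T \<alpha> (obj_of X) (br_of X))"

definition Tbar_Br ::
  "(('o, 'a) br_obj, (('o, 'a) br_obj, 'a) str_arr, ('o, 'a) br_bialg, (('o, 'a) br_bialg, 'a) str_arr) func" where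
  "Tbar_Br = \<lparr>map_obj = Tbar_Br_obj,
     map_arr = (\<lambda>f. StrArr (Tbar_Br_obj (src f))
                  (T_arr M T \<alpha> (obj_of (src f)) (und f) (obj_of (trg f)))
                  (Tbar_Br_obj (trg f)))\<rparr>"

end

text \<open>\<open>P X\<close> with \<open>\<xi> X\<close> is a choice of equalizer of \<open>bi_comult X\<close> and \<^term>\<open>prim_arr X\<close>.\<close>

definition prim_arr :: "('o, 'a) br_bialg \<Rightarrow> 'a" where
  "prim_arr X = ((\<iota> (bi_obj X) \<otimes> bi_unit X) \<cdot> \<r>' (bi_obj X)) \<oplus>
                ((bi_unit X \<otimes> \<iota> (bi_obj X)) \<cdot> \<l>' (bi_obj X))"

context
  fixes P :: "('o, 'a) br_bialg \<Rightarrow> 'o" and \<xi> :: "('o, 'a) br_bialg \<Rightarrow> 'a"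
begin

definition P_Br_obj :: "('o, 'a) br_bialg \<Rightarrow> ('o, 'a) br_obj" where
  "P_Br_obj X = BrObj (P X)
     (THE c. c \<in> Hom M (P X \<boxtimes> P X) (P X \<boxtimes> P X) \<and> (\<xi> X \<otimes> \<xi> X) \<cdot> c = bi_br X \<cdot> (\<xi> X \<otimes> \<xi> X))"

definition P_Br ::
  "(('o, 'a) br_bialg, (('o, 'a) br_bialg, 'a) str_arr, ('o, 'a) br_obj, (('o, 'a) br_obj, 'a) str_arr) func" where
  "P_Br = \<lparr>map_obj = P_Br_obj,
     map_arr = (\<lambda>f. StrArr (P_Br_obj (src f))
                  (THE h. h \<in> Hom M (P (src f)) (P (trg f)) \<and> \<xi> (trg f) \<cdot> h = und f \<cdot> \<xi> (src f))
                  (P_Br_obj (trg f)))\<rparr>"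

definition \<xi>_Br :: "('o, 'a) br_bialg \<Rightarrow> (('o, 'a) br_obj, 'a) str_arr" where
  "\<xi>_Br X = StrArr (map_obj P_Br X) (\<xi> X) (map_obj \<Omega>_Br (map_obj mho_Br X))"

end

end

end

(* Idea. The monoidal category M is replaced by a strict one, whose objects are words of objects of M:
   the word X1 ... Xk acts on M by Z |-> X1 (x) (... (x) (Xk (x) Z)), and arrows are the natural
   transformations compatible with tensoring on the right. Whiskering is then strictly associative, M
   embeds fully and faithfully, all constraints become identities, and the identities of braided algebra
   become word problems which a confluent enough rewriting system solves.

   In the strict setting an algebra map out of the tensor algebra T V is determined by its restriction to
   V, and so is a map F : X (x) T V -> B (x) X that is multiplicative up to a braiding. This yields
   coassociativity, the counit laws and the naturality of the braiding with respect to the comultiplication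
   and counit of T V, and it shows that the extension of a braided map V -> B with primitive values is a
   map of braided bialgebras. The braiding of a bialgebra restricts to its primitive elements P, because
   tensoring preserves equalizers and c (xi (x) B) equalizes B (x) Delta and B (x) (x |-> x (x) 1 + 1 (x) x).
   The unit is the corestriction of V -> T V to primitive elements, the counit the extension of P -> B, and
   naturality and the triangle identities hold because both sides agree on generators or after xi. *)
theory Submission
  imports Defs
begin

section \<open>Strict monoidal categories\<close>

text \<open>In the strict setting the tensor product of two arrows never occurs: a composite is a
  sequence of layers, each applying one generator inside a word. Whiskering is concatenation of
  lists, and the one law without an evident direction is interchange. It is oriented by position or
  by rank, and the other laws are oriented to suit: comultiplications before crossings, crossings
  before multiplications.

  The obstacle on the coalgebra side is that coassociativity compares two algebra maps into a
  threefold braided tensor power, and these are multiplicative only once comultiplication and counit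
  are known to pass through the braiding. So naturality of the braiding has to come first; it
  concerns maps out of \<open>[T, T]\<close>, which explains the twisted uniqueness lemmas.

  Preservation of coproducts and equalizers enters in one form: the universal properties hold inside
  every word.

  On the side of \<open>M\<close> the structure maps of the statement are definite descriptions.
  Each is shown to be represented by an arrow of words; axioms and morphism conditions are then
  transferred as equivalences.\<close>

text \<open>Objects are words of letters. An arrow is used in the form \<open>lay xs f ys\<close>, which is
  \<open>f\<close> tensored with the words \<open>xs\<close> on the left and \<open>ys\<close> on the right. All ill-typed composites
  are identified with one junk value, so that most laws need no typing hypothesis.\<close>

locale strict_monoidal =
  fixes ob :: "'o \<Rightarrow> bool" and ar :: "'b \<Rightarrow> bool"
    and dm :: "'b \<Rightarrow> 'o list" and cd :: "'b \<Rightarrow> 'o list"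
    and comp :: "'b \<Rightarrow> 'b \<Rightarrow> 'b" (infixr "\<bullet>" 55)
    and idn :: "'o list \<Rightarrow> 'b"
    and lay :: "'o list \<Rightarrow> 'b \<Rightarrow> 'o list \<Rightarrow> 'b"
  assumes comp_assoc [simp]: "(h \<bullet> g) \<bullet> f = h \<bullet> (g \<bullet> f)"
    and ar_comp [simp]: "ar (g \<bullet> f) \<longleftrightarrow> ar g \<and> ar f \<and> dm g = cd f"
    and dm_comp [simp]: "ar g \<Longrightarrow> ar f \<Longrightarrow> dm g = cd f \<Longrightarrow> dm (g \<bullet> f) = dm f"
    and cd_comp [simp]: "ar g \<Longrightarrow> ar f \<Longrightarrow> dm g = cd f \<Longrightarrow> cd (g \<bullet> f) = cd g"
    and ar_idn [simp]: "ar (idn xs) \<longleftrightarrow> list_all ob xs"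
    and dm_idn [simp]: "list_all ob xs \<Longrightarrow> dm (idn xs) = xs"
    and cd_idn [simp]: "list_all ob xs \<Longrightarrow> cd (idn xs) = xs"
    and ob_dm: "ar f \<Longrightarrow> list_all ob (dm f)"
    and ob_cd: "ar f \<Longrightarrow> list_all ob (cd f)"
    and ar_lay [simp]: "ar (lay xs f ys) \<longleftrightarrow> list_all ob xs \<and> ar f \<and> list_all ob ys"
    and dm_lay [simp]: "list_all ob xs \<Longrightarrow> ar f \<Longrightarrow> list_all ob ys \<Longrightarrow> dm (lay xs f ys) = xs @ dm f @ ys"
    and cd_lay [simp]: "list_all ob xs \<Longrightarrow> ar f \<Longrightarrow> list_all ob ys \<Longrightarrow> cd (lay xs f ys) = xs @ cd f @ ys"
    and lay_lay [simp]: "lay xs (lay us f vs) ys = lay (xs @ us) f (vs @ ys)"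
    and lay_comp [simp]: "lay xs (g \<bullet> f) ys = lay xs g ys \<bullet> lay xs f ys"
    and lay_nil: "ar f \<Longrightarrow> lay [] f [] = f"
    and lay_idn [simp]: "lay xs (idn ws) ys = idn (xs @ ws @ ys)"
    and lay_comp_idn [simp]: "ar f \<Longrightarrow> ws = xs @ dm f @ ys \<Longrightarrow> lay xs f ys \<bullet> idn ws = lay xs f ys"
    and idn_comp_lay [simp]: "ar f \<Longrightarrow> ws = xs @ cd f @ ys \<Longrightarrow> idn ws \<bullet> lay xs f ys = lay xs f ys"
    and interchange: "ar f \<Longrightarrow> ar g \<Longrightarrow>
      lay xs f (ys @ cd g @ zs) \<bullet> lay (xs @ dm f @ ys) g zs
        = lay (xs @ cd f @ ys) g zs \<bullet> lay xs f (ys @ dm g @ zs)"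
begin

definition hom :: "'b \<Rightarrow> 'o list \<Rightarrow> 'o list \<Rightarrow> bool" where
  "hom f xs ys \<longleftrightarrow> ar f \<and> dm f = xs \<and> cd f = ys"

lemma homD: "hom f xs ys \<Longrightarrow> ar f" "hom f xs ys \<Longrightarrow> dm f = xs" "hom f xs ys \<Longrightarrow> cd f = ys"
  by (simp_all add: hom_def)

lemma hom_ob: "hom f xs ys \<Longrightarrow> list_all ob xs" "hom f xs ys \<Longrightarrow> list_all ob ys"
  using ob_dm ob_cd by (auto simp: hom_def)

lemma idn_comp_lay_comp [simp]:
  "ar f \<Longrightarrow> ws = xs @ cd f @ ys \<Longrightarrow> idn ws \<bullet> lay xs f ys \<bullet> k = lay xs f ys \<bullet> k"
  using idn_comp_lay comp_assoc by metis

lemma lay_comp_idn_comp [simp]: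
  "ar f \<Longrightarrow> ws = xs @ dm f @ ys \<Longrightarrow> lay xs f ys \<bullet> idn ws \<bullet> k = lay xs f ys \<bullet> k"
  using lay_comp_idn comp_assoc by metis

lemma comp_idn [simp]: "ar f \<Longrightarrow> ws = dm f \<Longrightarrow> f \<bullet> idn ws = f"
  using lay_comp_idn[of f ws "[]" "[]"] by (simp add: lay_nil)

lemma idn_comp [simp]: "ar f \<Longrightarrow> ws = cd f \<Longrightarrow> idn ws \<bullet> f = f"
  using idn_comp_lay[of f ws "[]" "[]"] by (simp add: lay_nil)

lemma idn_idn_comp [simp]: "list_all ob ws \<Longrightarrow> idn ws \<bullet> idn ws \<bullet> f = idn ws \<bullet> f"
  by (metis ar_idn cd_idn idn_comp comp_assoc)

text \<open>Composites are nested to the right, so an equation for two adjacent layers matches only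
  at the end of a composite. Its \<open>tail\<close> version carries a remaining factor
  \<open>k\<close> and matches elsewhere; \<open>tail3\<close> does the same for three
  layers.\<close>

lemma tail: "f \<bullet> g = h \<Longrightarrow> f \<bullet> (g \<bullet> k) = h \<bullet> k"
  by (metis comp_assoc)

lemma tail3: "f \<bullet> g \<bullet> g' = h \<Longrightarrow> f \<bullet> (g \<bullet> g' \<bullet> k) = h \<bullet> k"
  by (metis comp_assoc)

lemma swap:
  assumes "ar f" "ar g" "xs = us @ dm f @ ys" "vs = ys @ cd g @ zs" "ws = us @ cd f @ ys" "ts = ys @ dm g @ zs"
  shows "lay us f vs \<bullet> lay xs g zs = lay ws g zs \<bullet> lay us f ts"
  using interchange[of f g us ys zs] assms by simp

text \<open>The word between the two supports is computed by \<open>drop\<close> instead of being a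
  variable of the pattern. On explicit lists the side conditions, which say that the supports are
  disjoint, are then decided by simplification.\<close>

lemma swap_left:
  assumes "ar f" "ar g" "length us + length (dm f) \<le> length xs"
    and "take (length us + length (dm f)) xs = us @ dm f"
    and "vs = drop (length us + length (dm f)) xs @ cd g @ zs"
  shows "lay us f vs \<bullet> lay xs g zs
    = lay (us @ cd f @ drop (length us + length (dm f)) xs) g zs
      \<bullet> lay us f (drop (length us + length (dm f)) xs @ dm g @ zs)"
proof (rule swap[where ys = "drop (length us + length (dm f)) xs"])
  show "xs = us @ dm f @ drop (length us + length (dm f)) xs"
    using assms(4) by (metis append_assoc append_take_drop_id)
qed (use assms in auto)

lemma swap_right:
  assumes "ar f" "ar g" "length xs + length (cd g) \<le> length us"
    and "take (length xs + length (cd g)) us = xs @ cd g"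
    and "zs = drop (length xs + length (cd g)) us @ dm f @ vs"
  shows "lay us f vs \<bullet> lay xs g zs
    = lay xs g (drop (length xs + length (cd g)) us @ cd f @ vs)
      \<bullet> lay (xs @ dm g @ drop (length xs + length (cd g)) us) f vs"
proof (rule swap[where ys = "drop (length xs + length (cd g)) us", symmetric])
  show "us = xs @ cd g @ drop (length xs + length (cd g)) us"
    using assms(4) by (metis append_assoc append_take_drop_id)
qed (use assms in auto)

text \<open>Layers with disjoint supports are sorted so that the left one is executed first. The last
  hypothesis prevents a loop when both supports are empty words at the same place.\<close>

lemma sort:
  "\<lbrakk>ar f; ar g; length us + length (dm f) \<le> length xs; take (length us + length (dm f)) xs = us @ dm f;
    vs = drop (length us + length (dm f)) xs @ cd g @ zs;
    cd f \<noteq> [] \<or> dm g \<noteq> [] \<or> length us + length (dm f) < length xs\<rbrakk> \<Longrightarrow>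
    lay us f vs \<bullet> lay xs g zs = lay (us @ cd f @ drop (length us + length (dm f)) xs) g zs
      \<bullet> lay us f (drop (length us + length (dm f)) xs @ dm g @ zs)"
  by (rule swap_left)

lemmas sort_comp = sort[THEN tail, unfolded comp_assoc]

declare sort [simp] sort_comp [simp]

text \<open>A finer normal form: comultiplications and counits are executed as early as possible,
  multiplications and units as late as possible, and ties are broken from left to right.\<close>

definition rank :: "'b \<Rightarrow> nat" where
  "rank f = (if dm f = [] then 2 else if cd f = [] then 0 else if length (dm f) < length (cd f) then 0
     else if length (cd f) < length (dm f) then 2 else 1)"

lemma rsort_left:
  "\<lbrakk>ar f; ar g; length us + length (dm f) \<le> length xs; take (length us + length (dm f)) xs = us @ dm f;
    vs = drop (length us + length (dm f)) xs @ cd g @ zs; rank f \<le> rank g\<rbrakk> \<Longrightarrow>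
    lay us f vs \<bullet> lay xs g zs = lay (us @ cd f @ drop (length us + length (dm f)) xs) g zs
      \<bullet> lay us f (drop (length us + length (dm f)) xs @ dm g @ zs)"
  by (rule swap_left)

lemma rsort_right:
  "\<lbrakk>ar f; ar g; length xs + length (cd g) \<le> length us; take (length xs + length (cd g)) us = xs @ cd g;
    zs = drop (length xs + length (cd g)) us @ dm f @ vs; rank f < rank g\<rbrakk> \<Longrightarrow>
    lay us f vs \<bullet> lay xs g zs = lay xs g (drop (length xs + length (cd g)) us @ cd f @ vs)
      \<bullet> lay (xs @ dm g @ drop (length xs + length (cd g)) us) f vs"
  by (rule swap_right)

lemmas rsort = rsort_left rsort_right
  rsort_left[THEN tail, unfolded comp_assoc] rsort_right[THEN tail, unfolded comp_assoc]

text \<open>With the opposite tie-breaking the mirror image of a proof by \<open>rsort\<close> goes through.\<close>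

lemma lsort_left:
  "\<lbrakk>ar f; ar g; length us + length (dm f) \<le> length xs; take (length us + length (dm f)) xs = us @ dm f;
    vs = drop (length us + length (dm f)) xs @ cd g @ zs; rank f < rank g\<rbrakk> \<Longrightarrow>
    lay us f vs \<bullet> lay xs g zs = lay (us @ cd f @ drop (length us + length (dm f)) xs) g zs
      \<bullet> lay us f (drop (length us + length (dm f)) xs @ dm g @ zs)"
  by (rule swap_left)

lemma lsort_right:
  "\<lbrakk>ar f; ar g; length xs + length (cd g) \<le> length us; take (length xs + length (cd g)) us = xs @ cd g;
    zs = drop (length xs + length (cd g)) us @ dm f @ vs; rank f \<le> rank g\<rbrakk> \<Longrightarrow>
    lay us f vs \<bullet> lay xs g zs = lay xs g (drop (length xs + length (cd g)) us @ cd f @ vs)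
      \<bullet> lay (xs @ dm g @ drop (length xs + length (cd g)) us) f vs"
  by (rule swap_right)

lemmas lsort = lsort_left lsort_right
  lsort_left[THEN tail, unfolded comp_assoc] lsort_right[THEN tail, unfolded comp_assoc]

text \<open>A bare arrow is invisible to rules about layers. Instantiated at one particular arrow
  this wraps it into a layer; with a variable in its place it would loop, and its converse
  \<open>lay_nil\<close> is kept out of the simplifier.\<close>

lemma layer: "ar f \<Longrightarrow> g \<bullet> f = g \<bullet> lay [] f []" "ar f \<Longrightarrow> f \<bullet> g = lay [] f [] \<bullet> g"
  by (simp_all add: lay_nil)

lemma lay_cong: "f = g \<Longrightarrow> lay xs f ys = lay xs g ys"
  by simp

end

text \<open>In the intended model ill-typed sums are the junk value, so \<open>add_assoc\<close> and
  \<open>add_commute\<close> can be stated without typing. Subtraction enters only as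
  \<open>add_cancel\<close>, whose purpose is that the counit vanishes on primitive arrows.\<close>

locale strict_additive = strict_monoidal +
  fixes add (infixl "\<uplus>" 53) and zero
  assumes ar_add [simp]: "ar (f \<uplus> g) \<longleftrightarrow> ar f \<and> ar g \<and> dm f = dm g \<and> cd f = cd g"
    and dm_add [simp]: "ar f \<Longrightarrow> ar g \<Longrightarrow> dm f = dm g \<Longrightarrow> cd f = cd g \<Longrightarrow> dm (f \<uplus> g) = dm g"
    and cd_add [simp]: "ar f \<Longrightarrow> ar g \<Longrightarrow> dm f = dm g \<Longrightarrow> cd f = cd g \<Longrightarrow> cd (f \<uplus> g) = cd g"
    and comp_add [simp]: "ar f \<Longrightarrow> ar g \<Longrightarrow> dm f = dm g \<Longrightarrow> cd f = cd g \<Longrightarrow> h \<bullet> (f \<uplus> g) = (h \<bullet> f) \<uplus> (h \<bullet> g)"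
    and add_comp [simp]: "ar f \<Longrightarrow> ar g \<Longrightarrow> dm f = dm g \<Longrightarrow> cd f = cd g \<Longrightarrow> (f \<uplus> g) \<bullet> h = (f \<bullet> h) \<uplus> (g \<bullet> h)"
    and lay_add [simp]: "lay xs (f \<uplus> g) ys = lay xs f ys \<uplus> lay xs g ys"
    and add_assoc: "(f \<uplus> g) \<uplus> h = f \<uplus> (g \<uplus> h)"
    and add_commute: "f \<uplus> g = g \<uplus> f"
    and ar_zero [simp]: "ar (zero xs ys) \<longleftrightarrow> list_all ob xs \<and> list_all ob ys"
    and dm_zero [simp]: "list_all ob xs \<Longrightarrow> list_all ob ys \<Longrightarrow> dm (zero xs ys) = xs"
    and cd_zero [simp]: "list_all ob xs \<Longrightarrow> list_all ob ys \<Longrightarrow> cd (zero xs ys) = ys"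
    and add_zero [simp]: "ar f \<Longrightarrow> dm f = xs \<Longrightarrow> cd f = ys \<Longrightarrow> f \<uplus> zero xs ys = f"
    and comp_zero: "ar f \<Longrightarrow> dm f = ys \<Longrightarrow> list_all ob xs \<Longrightarrow> f \<bullet> zero xs ys = zero xs (cd f)"
    and zero_comp: "ar f \<Longrightarrow> cd f = xs \<Longrightarrow> list_all ob ys \<Longrightarrow> zero xs ys \<bullet> f = zero (dm f) ys"
    and lay_zero [simp]: "list_all ob us \<Longrightarrow> list_all ob vs \<Longrightarrow> list_all ob xs \<Longrightarrow> list_all ob ys \<Longrightarrow>
      lay xs (zero us vs) ys = zero (xs @ us @ ys) (xs @ vs @ ys)"
    and add_cancel: "ar f \<Longrightarrow> f \<uplus> g = f \<Longrightarrow> g = zero (dm f) (cd f)"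
begin

lemma zero_add [simp]: "ar f \<Longrightarrow> dm f = xs \<Longrightarrow> cd f = ys \<Longrightarrow> zero xs ys \<uplus> f = f"
  by (subst add_commute) simp

end

section \<open>Braided algebras and coalgebras in a strict monoidal category\<close>

context strict_monoidal begin

text \<open>Carriers are words and not letters because the comultiplication and the counit of the
  tensor algebra take values in algebras on \<open>[T, T]\<close> and on the empty word.\<close>

definition alg :: "'o list \<Rightarrow> 'b \<Rightarrow> 'b \<Rightarrow> bool" where
  "alg W m u \<longleftrightarrow> hom m (W @ W) W \<and> hom u [] W \<and>
     m \<bullet> lay [] m W = m \<bullet> lay W m [] \<and> m \<bullet> lay [] u W = idn W \<and> m \<bullet> lay W u [] = idn W"

end

locale s_alg = strict_monoidal +
  fixes A and m and u
  assumes m_hom: "hom m [A, A] [A]" and u_hom: "hom u [] [A]"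
    and m_assoc: "m \<bullet> lay [A] m [] = m \<bullet> lay [] m [A]"
    and m_unit_left: "m \<bullet> lay [] u [A] = idn [A]"
    and m_unit_right: "m \<bullet> lay [A] u [] = idn [A]"
begin

lemma alg_letter: "alg [A] m u"
  using m_hom u_hom m_assoc m_unit_left m_unit_right by (simp add: alg_def)

lemmas [simp] = m_hom[THEN homD(1)] m_hom[THEN homD(2)] m_hom[THEN homD(3)]
  u_hom[THEN homD(1)] u_hom[THEN homD(2)] u_hom[THEN homD(3)]

lemma ob_A [simp]: "ob A"
  using hom_ob(2)[OF m_hom] by simp

lemma m_assoc_lay [simp]: "xs' = xs @ [A] \<Longrightarrow> lay xs m ys \<bullet> lay xs' m ys = lay xs m ys \<bullet> lay xs m (A # ys)"
  using lay_cong[OF m_assoc, of xs ys] by simp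

lemma m_unit_left_lay [simp]: "lay xs m ys \<bullet> lay xs u (A # ys) = idn (xs @ A # ys)"
  using lay_cong[OF m_unit_left, of xs ys] by simp

lemma m_unit_right_lay [simp]: "xs' = xs @ [A] \<Longrightarrow> lay xs m ys \<bullet> lay xs' u ys = idn (xs @ A # ys)"
  using lay_cong[OF m_unit_right, of xs ys] by simp

lemmas [simp] = m_assoc_lay[THEN tail, unfolded comp_assoc]
  m_unit_left_lay[THEN tail, unfolded comp_assoc] m_unit_right_lay[THEN tail, unfolded comp_assoc]

end

text \<open>The inverse is a parameter and not an existence claim, so that the locale can be
  interpreted a second time with \<open>c\<close> and \<open>c'\<close> exchanged; this yields the
  results on inverse braidings without new proofs.\<close>

locale s_br = strict_monoidal +
  fixes A and c and c'
  assumes c_hom: "hom c [A, A] [A, A]" and c'_hom: "hom c' [A, A] [A, A]"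
    and c_c': "c \<bullet> c' = idn [A, A]" and c'_c: "c' \<bullet> c = idn [A, A]"
    and ybe: "lay [] c [A] \<bullet> lay [A] c [] \<bullet> lay [] c [A] = lay [A] c [] \<bullet> lay [] c [A] \<bullet> lay [A] c []"
begin

lemmas [simp] = c_hom[THEN homD(1)] c_hom[THEN homD(2)] c_hom[THEN homD(3)]
  c'_hom[THEN homD(1)] c'_hom[THEN homD(2)] c'_hom[THEN homD(3)]

lemma ob_br [simp]: "ob A"
  using hom_ob(2)[OF c_hom] by simp

lemma c_c'_lay [simp]: "lay xs c ys \<bullet> lay xs c' ys = idn (xs @ A # A # ys)"
  using lay_cong[OF c_c', of xs ys] by simp

lemma c'_c_lay [simp]: "lay xs c' ys \<bullet> lay xs c ys = idn (xs @ A # A # ys)"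
  using lay_cong[OF c'_c, of xs ys] by simp

lemma ybe_lay [simp]: "xs' = xs @ [A] \<Longrightarrow>
  lay xs c (A # ys) \<bullet> lay xs' c ys \<bullet> lay xs c (A # ys)
    = lay xs' c ys \<bullet> lay xs c (A # ys) \<bullet> lay xs' c ys"
  using lay_cong[OF ybe, of xs ys] by simp

lemmas [simp] = c_c'_lay[THEN tail, unfolded comp_assoc] c'_c_lay[THEN tail, unfolded comp_assoc]

lemmas ybe_lay_comp [simp] = ybe_lay[THEN tail3, unfolded comp_assoc]

text \<open>The two sides are a left and a right inverse of the same braid \<open>?x\<close>, hence
  equal.\<close>

lemma ybe_inverse:
  "lay [] c' [A] \<bullet> lay [A] c' [] \<bullet> lay [] c' [A] = lay [A] c' [] \<bullet> lay [] c' [A] \<bullet> lay [A] c' []"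
  (is "?l = ?r")
proof -
  let ?x = "lay [A] c [] \<bullet> lay [] c [A] \<bullet> lay [A] c []"
  have 1: "?l \<bullet> ?x = idn [A, A, A]"
    \<comment> \<open>The braid relation is used against its orientation as a rewrite rule, so that
      rule is switched off here.\<close>
    by (subst ybe[symmetric]) (simp del: ybe_lay ybe_lay_comp)
  have 2: "?x \<bullet> ?r = idn [A, A, A]"
    by simp
  have "?l = ?l \<bullet> (?x \<bullet> ?r)"
    unfolding 2 by simp
  also have "\<dots> = (?l \<bullet> ?x) \<bullet> ?r"
    by (simp only: comp_assoc)
  also have "\<dots> = ?r"
    unfolding 1 by simp
  finally show ?thesis .
qed

end

locale s_bralg = s_alg + s_br +
  assumes c_m_left: "c \<bullet> lay [] m [A] = lay [A] m [] \<bullet> lay [] c [A] \<bullet> lay [A] c []"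
    and c_m_right: "c \<bullet> lay [A] m [] = lay [] m [A] \<bullet> lay [A] c [] \<bullet> lay [] c [A]"
    and c_u_left: "c \<bullet> lay [] u [A] = lay [A] u []"
    and c_u_right: "c \<bullet> lay [A] u [] = lay [] u [A]"
begin

lemma c_m_left_lay [simp]:
  "lay xs c ys \<bullet> lay xs m (A # ys) = lay (xs @ [A]) m ys \<bullet> lay xs c (A # ys) \<bullet> lay (xs @ [A]) c ys"
  using lay_cong[OF c_m_left, of xs ys] by simp

lemma c_m_right_lay [simp]: "xs' = xs @ [A] \<Longrightarrow>
  lay xs c ys \<bullet> lay xs' m ys = lay xs m (A # ys) \<bullet> lay (xs @ [A]) c ys \<bullet> lay xs c (A # ys)"
  using lay_cong[OF c_m_right, of xs ys] by simp

lemma c_u_left_lay [simp]: "lay xs c ys \<bullet> lay xs u (A # ys) = lay (xs @ [A]) u ys"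
  using lay_cong[OF c_u_left, of xs ys] by simp

lemma c_u_right_lay [simp]: "xs' = xs @ [A] \<Longrightarrow> lay xs c ys \<bullet> lay xs' u ys = lay xs u (A # ys)"
  using lay_cong[OF c_u_right, of xs ys] by simp

lemmas [simp] = c_m_left_lay[THEN tail, unfolded comp_assoc] c_m_right_lay[THEN tail, unfolded comp_assoc]
  c_u_left_lay[THEN tail, unfolded comp_assoc] c_u_right_lay[THEN tail, unfolded comp_assoc]

definition m2 where "m2 = lay [A] m [] \<bullet> lay [] m [A, A] \<bullet> lay [A] c [A]"
definition u2 where "u2 = lay [A] u [] \<bullet> lay [] u []"

text \<open>Once multiplications are pushed behind crossings, both bracketings of a triple product
  show the same three crossings, followed by products that agree by associativity of
  \<open>m\<close>.\<close>

lemma alg2: "alg [A, A] m2 u2"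
  by (simp add: alg_def hom_def m2_def u2_def)

end

locale s_coalg = strict_monoidal +
  fixes A and d and e
  assumes d_hom: "hom d [A] [A, A]" and e_hom: "hom e [A] []"
    and d_coassoc: "lay [A] d [] \<bullet> d = lay [] d [A] \<bullet> d"
    and d_counit_left: "lay [] e [A] \<bullet> d = idn [A]"
    and d_counit_right: "lay [A] e [] \<bullet> d = idn [A]"
begin

lemmas [simp] = d_hom[THEN homD(1)] d_hom[THEN homD(2)] d_hom[THEN homD(3)]
  e_hom[THEN homD(1)] e_hom[THEN homD(2)] e_hom[THEN homD(3)]

lemma ob_coalg [simp]: "ob A"
  using hom_ob(1)[OF d_hom] by simp

lemma d_coassoc_lay [simp]: "xs' = xs @ [A] \<Longrightarrow> lay xs' d ys \<bullet> lay xs d ys = lay xs d (A # ys) \<bullet> lay xs d ys"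
  using lay_cong[OF d_coassoc, of xs ys] by simp

lemma d_counit_left_lay [simp]: "lay xs e (A # ys) \<bullet> lay xs d ys = idn (xs @ A # ys)"
  using lay_cong[OF d_counit_left, of xs ys] by simp

lemma d_counit_right_lay [simp]: "xs' = xs @ [A] \<Longrightarrow> lay xs' e ys \<bullet> lay xs d ys = idn (xs @ A # ys)"
  using lay_cong[OF d_counit_right, of xs ys] by simp

lemmas [simp] = d_coassoc_lay[THEN tail, unfolded comp_assoc]
  d_counit_left_lay[THEN tail, unfolded comp_assoc] d_counit_right_lay[THEN tail, unfolded comp_assoc]

end

text \<open>The stage reached by the tensor algebra as soon as \<open>d\<close> and \<open>e\<close>
  are defined as algebra maps. Coassociativity, the counit laws and compatibility with
  \<open>c\<close> are then proved with these rewrite rules already at hand; \<open>s_bialg\<close>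
  adds them.\<close>

locale s_prebialg = s_bralg +
  fixes d and e
  assumes d_hom: "hom d [A] [A, A]" and e_hom: "hom e [A] []"
    and d_m: "d \<bullet> m = m2 \<bullet> lay [A, A] d [] \<bullet> lay [] d [A]"
    and d_u: "d \<bullet> u = u2"
    and e_m: "e \<bullet> m = e \<bullet> lay [] e [A]"
    and e_u: "e \<bullet> u = idn []"
begin

lemmas [simp] = d_hom[THEN homD(1)] d_hom[THEN homD(2)] d_hom[THEN homD(3)]
  e_hom[THEN homD(1)] e_hom[THEN homD(2)] e_hom[THEN homD(3)]

lemma d_m_lay [simp]: "lay xs d ys \<bullet> lay xs m ys = lay (xs @ [A]) m ys \<bullet> lay xs m (A # A # ys)
  \<bullet> lay (xs @ [A]) c (A # ys) \<bullet> lay (xs @ [A, A]) d ys \<bullet> lay xs d (A # ys)"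
  using lay_cong[OF d_m, of xs ys] by (simp add: m2_def)

lemma d_u_lay [simp]: "lay xs d ys \<bullet> lay xs u ys = lay (xs @ [A]) u ys \<bullet> lay xs u ys"
  using lay_cong[OF d_u, of xs ys] by (simp add: u2_def)

lemma e_m_lay [simp]: "lay xs e ys \<bullet> lay xs m ys = lay xs e ys \<bullet> lay xs e (A # ys)"
  using lay_cong[OF e_m, of xs ys] by simp

lemma e_u_lay [simp]: "lay xs e ys \<bullet> lay xs u ys = idn (xs @ ys)"
  using lay_cong[OF e_u, of xs ys] by simp

lemmas [simp] = d_m_lay[THEN tail, unfolded comp_assoc] d_u_lay[THEN tail, unfolded comp_assoc]
  e_m_lay[THEN tail, unfolded comp_assoc] e_u_lay[THEN tail, unfolded comp_assoc]

end

locale s_bialg = s_prebialg + s_coalg +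
  assumes d_c_left: "lay [] d [A] \<bullet> c = lay [A] c [] \<bullet> lay [] c [A] \<bullet> lay [A] d []"
    and d_c_right: "lay [A] d [] \<bullet> c = lay [] c [A] \<bullet> lay [A] c [] \<bullet> lay [] d [A]"
    and e_c_left: "lay [] e [A] \<bullet> c = lay [A] e []"
    and e_c_right: "lay [A] e [] \<bullet> c = lay [] e [A]"
begin

lemma d_c_left_lay [simp]:
  "lay xs d (A # ys) \<bullet> lay xs c ys = lay (xs @ [A]) c ys \<bullet> lay xs c (A # ys) \<bullet> lay (xs @ [A]) d ys"
  using lay_cong[OF d_c_left, of xs ys] by simp

lemma d_c_right_lay [simp]: "xs' = xs @ [A] \<Longrightarrow>
  lay xs' d ys \<bullet> lay xs c ys = lay xs c (A # ys) \<bullet> lay (xs @ [A]) c ys \<bullet> lay xs d (A # ys)"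
  using lay_cong[OF d_c_right, of xs ys] by simp

lemma e_c_left_lay [simp]: "lay xs e (A # ys) \<bullet> lay xs c ys = lay (xs @ [A]) e ys"
  using lay_cong[OF e_c_left, of xs ys] by simp

lemma e_c_right_lay [simp]: "xs' = xs @ [A] \<Longrightarrow> lay xs' e ys \<bullet> lay xs c ys = lay xs e (A # ys)"
  using lay_cong[OF e_c_right, of xs ys] by simp

lemmas [simp] = d_c_left_lay[THEN tail, unfolded comp_assoc] d_c_right_lay[THEN tail, unfolded comp_assoc]
  e_c_left_lay[THEN tail, unfolded comp_assoc] e_c_right_lay[THEN tail, unfolded comp_assoc]

end

section \<open>The braiding of tensor powers\<close>

context s_br begin

abbreviation pw where "pw n \<equiv> replicate n A"

text \<open>\<open>X n\<close> is the component \<open>c_T^{1,n}\<close>, one strand passing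
  \<open>n\<close> strands, and \<open>D m n\<close> below is \<open>c_T^{m,n}\<close>, the strands
  of the first block passing one at a time, the innermost first. Since \<open>pw m @ pw n\<close> is
  already a word of length \<open>m + n\<close>, no joining isomorphism occurs.\<close>

primrec X where
  "X 0 = idn [A]"
| "X (Suc n) = lay [A] (X n) [] \<bullet> lay [] c (pw n)"

primrec D where
  "D 0 n = idn (pw n)"
| "D (Suc m) n = lay [] (X n) (pw m) \<bullet> lay [A] (D m n) []"

lemma pw_ob [simp]: "list_all ob (pw n)"
  by (induction n) simp_all

lemma X_hom: "hom (X n) (A # pw n) (pw n @ [A])"
  by (induction n) (simp_all add: hom_def)

lemmas [simp] = X_hom[THEN homD(1)] X_hom[THEN homD(2)] X_hom[THEN homD(3)]

lemma D_hom: "hom (D m n) (pw m @ pw n) (pw n @ pw m)"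
  by (induction m) (simp_all add: hom_def)

lemmas [simp] = D_hom[THEN homD(1)] D_hom[THEN homD(2)] D_hom[THEN homD(3)]

lemma D_1_1: "D (Suc 0) (Suc 0) = c"
  by (simp add: lay_nil)

lemma D_0_right: "D n 0 = idn (pw n)"
  by (induction n) simp_all

lemma D_add_left: "D (l + m) n = lay [] (D l n) (pw m) \<bullet> lay (pw l) (D m n) []"
proof (induction l)
  case 0
  show ?case by (simp add: lay_nil)
next
  case (Suc l)
  then show ?case by (simp add: replicate_add)
qed

lemma X_add: "X (m + n) = lay (pw m) (X n) [] \<bullet> lay [] (X m) (pw n)"
proof (induction m)
  case 0
  show ?case by (simp add: lay_nil)
next
  case (Suc m)
  then show ?case by (simp add: replicate_add)
qed

lemma D_add_right: "D l (m + n) = lay (pw m) (D l n) [] \<bullet> lay [] (D l m) (pw n)"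
proof (induction l)
  case 0
  show ?case by (simp add: replicate_add)
next
  case (Suc l)
  then show ?case by (simp add: X_add replicate_add)
qed

text \<open>The first of three stages towards the Yang-Baxter equation for blocks. Here the sizes
  are 1, 1 and \<open>n\<close>, and every further strand costs one use of the braid relation;
  \<open>X_D\<close> enlarges the second block and \<open>D_ybe\<close> the first.\<close>

lemma X_c: "lay (pw n) c [] \<bullet> lay [] (X n) [A] \<bullet> lay [A] (X n) []
  = lay [] (X n) [A] \<bullet> lay [A] (X n) [] \<bullet> lay [] c (pw n)"
proof (induction n)
  case 0
  show ?case by simp
next
  case (Suc n)
  have IH: "lay (A # pw n) c ys \<bullet> lay [A] (X n) (A # ys) \<bullet> lay [A, A] (X n) ys
    = lay [A] (X n) (A # ys) \<bullet> lay [A, A] (X n) ys \<bullet> lay [A] c (pw n @ ys)" for ys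
    using lay_cong[OF Suc, of "[A]" ys] by simp
  show ?case
    using IH[of "[]"] IH[of "[]", THEN tail3] by simp
qed

lemma X_D: "lay (pw n) (X m) [] \<bullet> lay [] (X n) (pw m) \<bullet> lay [A] (D m n) []
  = lay [] (D m n) [A] \<bullet> lay (pw m) (X n) [] \<bullet> lay [] (X m) (pw n)"
proof (induction m)
  case 0
  show ?case by (simp add: lay_nil)
next
  case (Suc m)
  have IH: "lay (A # pw n) (X m) [] \<bullet> lay [A] (X n) (pw m) \<bullet> lay [A, A] (D m n) []
    = lay [A] (D m n) [A] \<bullet> lay (A # pw m) (X n) [] \<bullet> lay [A] (X m) (pw n)"
    using lay_cong[OF Suc, of "[A]" "[]"] by simp
  have c: "lay (pw n) c (pw m) \<bullet> lay [] (X n) (A # pw m) \<bullet> lay [A] (X n) (pw m)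
    = lay [] (X n) (A # pw m) \<bullet> lay [A] (X n) (pw m) \<bullet> lay [] c (pw n @ pw m)"
    using lay_cong[OF X_c, of "[]" n "pw m"] by simp
  have "lay (pw n) (X (Suc m)) [] \<bullet> lay [] (X n) (pw (Suc m)) \<bullet> lay [A] (D (Suc m) n) []
    = lay (pw n @ [A]) (X m) [] \<bullet> (lay (pw n) c (pw m) \<bullet> lay [] (X n) (A # pw m) \<bullet> lay [A] (X n) (pw m))
      \<bullet> lay [A, A] (D m n) []"
    by (simp add: replicate_append_same)
  also have "\<dots> = lay [] (X n) (A # pw m) \<bullet> (lay (A # pw n) (X m) [] \<bullet> lay [A] (X n) (pw m)
      \<bullet> lay [A, A] (D m n) []) \<bullet> lay [] c (pw m @ pw n)"
    unfolding c by (simp add: replicate_append_same)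
  also have "\<dots> = lay [] (D (Suc m) n) [A] \<bullet> lay (pw (Suc m)) (X n) [] \<bullet> lay [] (X (Suc m)) (pw n)"
    unfolding IH by (simp add: replicate_append_same)
  finally show ?case .
qed

lemma D_ybe: "lay (pw n) (D l m) [] \<bullet> lay [] (D l n) (pw m) \<bullet> lay (pw l) (D m n) []
  = lay [] (D m n) (pw l) \<bullet> lay (pw m) (D l n) [] \<bullet> lay [] (D l m) (pw n)"
proof (induction l)
  case 0
  show ?case by simp
next
  case (Suc l)
  have IH: "lay (A # pw n) (D l m) [] \<bullet> lay [A] (D l n) (pw m) \<bullet> lay (A # pw l) (D m n) []
    = lay [A] (D m n) (pw l) \<bullet> lay (A # pw m) (D l n) [] \<bullet> lay [A] (D l m) (pw n)"
    using lay_cong[OF Suc, of "[A]" "[]"] by simp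
  have c: "lay (pw n) (X m) (pw l) \<bullet> lay [] (X n) (pw m @ pw l) \<bullet> lay [A] (D m n) (pw l)
  = lay [] (D m n) (A # pw l) \<bullet> lay (pw m) (X n) (pw l) \<bullet> lay [] (X m) (pw n @ pw l)"
    using lay_cong[OF X_D, of "[]" n m "pw l"] by simp
  have "lay (pw n) (D (Suc l) m) [] \<bullet> lay [] (D (Suc l) n) (pw m) \<bullet> lay (pw (Suc l)) (D m n) []
    = lay (pw n) (X m) (pw l) \<bullet> lay [] (X n) (pw m @ pw l) \<bullet>
      (lay (A # pw n) (D l m) [] \<bullet> lay [A] (D l n) (pw m) \<bullet> lay (A # pw l) (D m n) [])"
    by simp
  also have "\<dots> = (lay (pw n) (X m) (pw l) \<bullet> lay [] (X n) (pw m @ pw l) \<bullet> lay [A] (D m n) (pw l))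
      \<bullet> lay (A # pw m) (D l n) [] \<bullet> lay [A] (D l m) (pw n)"
    unfolding IH by simp
  also have "\<dots> = lay [] (D m n) (pw (Suc l)) \<bullet> lay (pw m) (D (Suc l) n) [] \<bullet> lay [] (D (Suc l) m) (pw n)"
    unfolding c by simp
  finally show ?case .
qed

text \<open>Additivity in the second index determines \<open>E 1 n\<close>, then additivity in the
  first determines all \<open>E m n\<close>. Additivity is given only for nonzero summands, as in
  the specification of the family, so the smallest blocks are split off in each induction.\<close>

lemma D_unique:
  assumes hom: "\<And>m n. hom (E m n) (pw m @ pw n) (pw n @ pw m)"
    and left: "\<And>l m n. l \<noteq> 0 \<Longrightarrow> m \<noteq> 0 \<Longrightarrow> E (l + m) n = lay [] (E l n) (pw m) \<bullet> lay (pw l) (E m n) []"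
    and right: "\<And>l m n. m \<noteq> 0 \<Longrightarrow> n \<noteq> 0 \<Longrightarrow> E l (m + n) = lay (pw m) (E l n) [] \<bullet> lay [] (E l m) (pw n)"
    and zero: "\<And>n. E 0 n = idn (pw n)" "\<And>n. E n 0 = idn (pw n)"
    and one: "E 1 1 = c"
  shows "E m n = D m n"
proof -
  have X: "E 1 n = X n" for n
  proof (induction n)
    case 0
    show ?case by (simp add: zero)
  next
    case (Suc n)
    show ?case
    proof (cases "n = 0")
      case True
      with one show ?thesis by (simp add: lay_nil)
    next
      case False
      with right[of 1 n 1] Suc one show ?thesis by simp
    qed
  qed
  show ?thesis
  proof (induction m)
    case 0
    show ?case by (simp add: zero)
  next
    case (Suc m)
    show ?case
    proof (cases "m = 0")
      case True
      with X[of n] show ?thesis by (simp add: lay_nil)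
    next
      case False
      with left[of 1 m n] Suc X[of n] show ?thesis by simp
    qed
  qed
qed

end

section \<open>The braided tensor algebra\<close>

text \<open>The coproduct property is demanded between arbitrary words \<open>xs\<close> and
  \<open>ys\<close>: this is the form taken by preservation of coproducts under all tensor functors.
  The summand of index \<open>n\<close> is the word of length \<open>n\<close> itself.\<close>

locale s_tensor = s_br ob ar dm cd comp idn lay V c c'
  for ob ar dm cd and comp (infixr "\<bullet>" 55) and idn lay V c c' +
  fixes T and i
  assumes i_hom: "hom (i n) (replicate n V) [T]"
    and T_ex: "list_all ob xs \<Longrightarrow> list_all ob ys \<Longrightarrow> (\<And>n. hom (f n) (xs @ replicate n V @ ys) zs) \<Longrightarrow>
      \<exists>k. hom k (xs @ T # ys) zs \<and> (\<forall>n. k \<bullet> lay xs (i n) ys = f n)"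
    and T_uniq: "hom k (xs @ T # ys) zs \<Longrightarrow> hom k' (xs @ T # ys) zs \<Longrightarrow>
      (\<And>n. k \<bullet> lay xs (i n) ys = k' \<bullet> lay xs (i n) ys) \<Longrightarrow> k = k'"
begin

lemmas [simp] = i_hom[THEN homD(1)] i_hom[THEN homD(2)] i_hom[THEN homD(3)]

lemma ob_T [simp]: "ob T"
  using hom_ob(2)[OF i_hom] by simp

text \<open>The products of two and, below, of three injections, written as layers.
  \<open>T_uniq2\<close> and \<open>T_uniq3\<close> show that these families are jointly
  epic.\<close>

definition I2 where
  "I2 m n = lay [T] (i n) [] \<bullet> lay [] (i m) (pw n)"

definition I3 where
  "I3 l m n = lay [T, T] (i n) [] \<bullet> lay [T] (i m) (pw n) \<bullet> lay [] (i l) (pw m @ pw n)"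

lemma I2_hom: "hom (I2 m n) (pw m @ pw n) [T, T]"
  by (simp add: hom_def I2_def)

lemmas [simp] = I2_hom[THEN homD(1)] I2_hom[THEN homD(2)] I2_hom[THEN homD(3)]

lemma T_uniq1:
  assumes "hom k [T] zs" "hom k' [T] zs" and "\<And>n. k \<bullet> i n = k' \<bullet> i n"
  shows "k = k'"
  by (rule T_uniq[of k "[]" "[]" zs]) (use assms in \<open>simp_all add: lay_nil\<close>)

lemma T_uniq2:
  assumes "hom k [T, T] zs" "hom k' [T, T] zs" and "\<And>m n. k \<bullet> I2 m n = k' \<bullet> I2 m n"
  shows "k = k'"
proof (rule T_uniq[of k "[T]" "[]" zs])
  fix n
  show "k \<bullet> lay [T] (i n) [] = k' \<bullet> lay [T] (i n) []"
    by (rule T_uniq[of _ "[]" "pw n" zs]) (use assms in \<open>simp_all add: hom_def I2_def\<close>)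
qed (use assms in simp_all)

lemma T_uniq3:
  assumes "hom k [T, T, T] zs" "hom k' [T, T, T] zs" and "\<And>l m n. k \<bullet> I3 l m n = k' \<bullet> I3 l m n"
  shows "k = k'"
proof (rule T_uniq[of k "[T, T]" "[]" zs])
  fix n
  show "k \<bullet> lay [T, T] (i n) [] = k' \<bullet> lay [T, T] (i n) []"
  proof (rule T_uniq[of _ "[T]" "pw n" zs])
    fix m
    show "(k \<bullet> lay [T, T] (i n) []) \<bullet> lay [T] (i m) (pw n) = (k' \<bullet> lay [T, T] (i n) []) \<bullet> lay [T] (i m) (pw n)"
      by (rule T_uniq[of _ "[]" "pw m @ pw n" zs]) (use assms in \<open>simp_all add: hom_def I3_def\<close>)
  qed (use assms in \<open>simp_all add: hom_def\<close>)
qed (use assms in simp_all)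

lemma T_ex2:
  assumes "\<And>m n. hom (f m n) (pw m @ pw n) zs"
  shows "\<exists>k. hom k [T, T] zs \<and> (\<forall>m n. k \<bullet> I2 m n = f m n)"
proof -
  have "\<exists>g. hom g (T # pw n) zs \<and> (\<forall>m. g \<bullet> lay [] (i m) (pw n) = f m n)" for n
    using T_ex[of "[]" "pw n" "\<lambda>m. f m n" zs] assms by simp
  then obtain g where g: "\<And>n. hom (g n) (T # pw n) zs" "\<And>m n. g n \<bullet> lay [] (i m) (pw n) = f m n"
    by metis
  obtain k where "hom k [T, T] zs" "\<And>n. k \<bullet> lay [T] (i n) [] = g n"
    using T_ex[of "[T]" "[]" g zs] g(1) by auto
  then show ?thesis
    using g(2) by (intro exI[of _ k]) (simp add: I2_def tail)
qed

definition u where "u = i 0"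

definition m where
  "m = (SOME k. hom k [T, T] [T] \<and> (\<forall>m n. k \<bullet> I2 m n = i (m + n)))"

lemma m: "hom m [T, T] [T] \<and> (\<forall>k n. m \<bullet> I2 k n = i (k + n))"
  unfolding m_def by (rule someI_ex, rule T_ex2) (simp add: hom_def replicate_add)

lemmas m_I2 [simp] = m[THEN conjunct2, rule_format]
lemmas m_hom = m[THEN conjunct1]

lemma u_hom: "hom u [] [T]"
  by (simp add: u_def hom_def)

lemma m_lay_I3: "lay [] m [T] \<bullet> I3 k l n = I2 (k + l) n" "lay [T] m [] \<bullet> I3 k l n = I2 k (l + n)"
proof -
  note [simp] = m_hom[THEN homD(1)] m_hom[THEN homD(2)] m_hom[THEN homD(3)]
  have "lay [] m (pw n) \<bullet> lay [T] (i l) (pw n) \<bullet> lay [] (i k) (pw l @ pw n) = lay [] (i (k + l)) (pw n)"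
    using lay_cong[OF m_I2, of "[]" k l "pw n"] by (simp add: I2_def)
  then show "lay [] m [T] \<bullet> I3 k l n = I2 (k + l) n"
    by (simp add: I2_def I3_def)
  have "lay [T] m [] \<bullet> lay [T, T] (i n) [] \<bullet> lay [T] (i l) (pw n) = lay [T] (i (l + n)) []"
    using lay_cong[OF m_I2, of "[T]" l n "[]"] by (simp add: I2_def)
  from this[THEN tail3] show "lay [T] m [] \<bullet> I3 k l n = I2 k (l + n)"
    by (simp add: I2_def I3_def replicate_add)
qed

lemma u_i: "lay [] u [T] \<bullet> lay [] (i n) [] = I2 0 n"
  unfolding I2_def u_def by (rule swap[where ys = "[]"]) simp_all

lemma alg_T: "m \<bullet> lay [T] m [] = m \<bullet> lay [] m [T]" "m \<bullet> lay [] u [T] = idn [T]" "m \<bullet> lay [T] u [] = idn [T]"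
proof -
  note [simp] = m_hom[THEN homD(1)] m_hom[THEN homD(2)] m_hom[THEN homD(3)]
    u_hom[THEN homD(1)] u_hom[THEN homD(2)] u_hom[THEN homD(3)]
  show "m \<bullet> lay [T] m [] = m \<bullet> lay [] m [T]"
    by (rule T_uniq3[where zs = "[T]"]) (simp_all add: hom_def m_lay_I3 add.assoc)
  show "m \<bullet> lay [] u [T] = idn [T]"
  proof (rule T_uniq1)
    fix n
    have "(m \<bullet> lay [] u [T]) \<bullet> i n = m \<bullet> lay [] u [T] \<bullet> lay [] (i n) []"
      by (simp add: lay_nil)
    also have "\<dots> = m \<bullet> I2 0 n"
      by (subst u_i) simp
    finally show "(m \<bullet> lay [] u [T]) \<bullet> i n = idn [T] \<bullet> i n"
      by simp
  qed (simp_all add: hom_def)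
  show "m \<bullet> lay [T] u [] = idn [T]"
  proof (rule T_uniq1)
    fix n
    have "(m \<bullet> lay [T] u []) \<bullet> i n = m \<bullet> I2 n 0"
      by (simp add: I2_def u_def lay_nil)
    then show "(m \<bullet> lay [T] u []) \<bullet> i n = idn [T] \<bullet> i n"
      by simp
  qed (simp_all add: hom_def)
qed

sublocale Ta: s_alg ob ar dm cd comp idn lay T m u
  by unfold_locales (rule m_hom u_hom alg_T)+

text \<open>The tensor algebra is generated in degree one; the uniqueness statements for maps out of
  it are inductions along this equation.\<close>

lemma i_Suc: "i (Suc n) = m \<bullet> lay [T] (i n) [] \<bullet> lay [] (i 1) (pw n)"
  using m_I2[of 1 n] by (simp add: I2_def)

definition alg_map where
  "alg_map F W mW uW \<longleftrightarrow> hom F [T] W \<and> F \<bullet> m = mW \<bullet> lay W F [] \<bullet> lay [] F [T] \<and> F \<bullet> u = uW"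

text \<open>Only the recursion read off from \<open>i_Suc\<close> matters, so \<open>mW\<close> and
  \<open>uW\<close> may be any operations on \<open>W\<close>. This is exploited in
  \<open>T_coassoc\<close> for the threefold tensor power, whose algebra laws are never
  established.\<close>

lemma alg_map_unique:
  assumes "alg_map F W mW uW" "alg_map G W mW uW" "F \<bullet> i 1 = G \<bullet> i 1"
  shows "F = G"
proof (rule T_uniq1[where zs = W])
  have step: "H \<bullet> i (Suc n) = mW \<bullet> lay W (H \<bullet> i n) [] \<bullet> lay [] (H \<bullet> i 1) (pw n)" if H: "alg_map H W mW uW" for H n
  proof -
    have [simp]: "ar H" "dm H = [T]" "cd H = W" "list_all ob W" and Hm: "H \<bullet> m = mW \<bullet> lay W H [] \<bullet> lay [] H [T]"
      using H hom_ob(2) by (auto simp: alg_map_def hom_def)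
    have swap: "lay [] H [T] \<bullet> lay [T] (i n) [] = lay W (i n) [] \<bullet> lay [] H (pw n)"
      by (rule swap[where ys = "[]"]) simp_all
    show ?thesis
      by (subst i_Suc) (simp add: Hm[THEN tail] swap[THEN tail])
  qed
  show "F \<bullet> i n = G \<bullet> i n" for n
  proof (induction n)
    case 0
    show ?case using assms by (simp add: alg_map_def u_def)
  next
    case (Suc n)
    with assms(3) show ?case by (simp only: step[OF assms(1), of n] step[OF assms(2), of n])
  qed
qed (use assms in \<open>simp_all add: alg_map_def\<close>)

lemma alg_map_exists:
  assumes W: "alg W mW uW" and f: "hom f [V] W"
  shows "\<exists>F. alg_map F W mW uW \<and> F \<bullet> i 1 = f"
proof -
  have [simp]: "ar mW" "dm mW = W @ W" "cd mW = W" "ar uW" "dm uW = []" "cd uW = W"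
    "ar f" "dm f = [V]" "cd f = W" "list_all ob W"
    and assoc: "mW \<bullet> lay [] mW W = mW \<bullet> lay W mW []"
    and unit: "mW \<bullet> lay [] uW W = idn W" "mW \<bullet> lay W uW [] = idn W"
    using W f hom_ob(2)[OF f] by (simp_all add: alg_def hom_def)
  \<comment> \<open>\<open>g n\<close> is the \<open>n\<close>-fold product of \<open>f\<close>,
    bracketed to the right and starting from the unit \<open>uW\<close>. Associativity of
    \<open>mW\<close> enters through \<open>g_add\<close>.\<close>
  define g where "g = rec_nat uW (\<lambda>n h. mW \<bullet> lay W h [] \<bullet> lay [] f (pw n))"
  have g0: "g 0 = uW" and gS: "g (Suc n) = mW \<bullet> lay W (g n) [] \<bullet> lay [] f (pw n)" for n
    by (simp_all add: g_def)
  have g_hom: "hom (g n) (pw n) W" for n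
    by (induction n) (simp_all add: g0 gS hom_def)
  note [simp] = g_hom[THEN homD(1)] g_hom[THEN homD(2)] g_hom[THEN homD(3)]
  have g_add: "g (k + n) = mW \<bullet> lay W (g n) [] \<bullet> lay [] (g k) (pw n)" for k n
  proof (induction k)
    case 0
    have "mW \<bullet> lay W (g n) [] \<bullet> lay [] uW (pw n) = mW \<bullet> lay [] uW W \<bullet> lay [] (g n) []"
      by (rule arg_cong[where f = "(\<bullet>) mW"], rule swap[where ys = "[]", symmetric]) simp_all
    also have "\<dots> = g n"
      by (simp add: unit(1)[THEN tail] lay_nil)
    finally show ?case
      by (simp add: g0)
  next
    case (Suc k)
    have swap: "lay [] mW W \<bullet> lay (W @ W) (g n) [] = lay W (g n) [] \<bullet> lay [] mW (pw n)"
      by (rule swap[where ys = "[]"]) simp_all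
    have "g (Suc k + n) = (mW \<bullet> lay W mW []) \<bullet> lay (W @ W) (g n) [] \<bullet> lay W (g k) (pw n) \<bullet> lay [] f (pw k @ pw n)"
      by (simp add: gS Suc replicate_add)
    also have "\<dots> = mW \<bullet> lay W (g n) [] \<bullet> lay [] (g (Suc k)) (pw n)"
      unfolding assoc[symmetric] using swap by (simp add: gS) (metis comp_assoc)
    finally show ?case .
  qed
  obtain F where F: "hom F [T] W" "\<And>n. F \<bullet> i n = g n"
    using T_ex[of "[]" "[]" g W] g_hom by (auto simp: lay_nil)
  note [simp] = F(1)[THEN homD(1)] F(1)[THEN homD(2)] F(1)[THEN homD(3)]
  have "F \<bullet> m = mW \<bullet> lay W F [] \<bullet> lay [] F [T]"
  proof (rule T_uniq2[where zs = W])
    fix k n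
    have swap: "lay [] F [T] \<bullet> lay [T] (i n) [] = lay W (i n) [] \<bullet> lay [] F (pw n)"
      by (rule swap[where ys = "[]"]) simp_all
    have "(mW \<bullet> lay W F [] \<bullet> lay [] F [T]) \<bullet> I2 k n = mW \<bullet> lay W (F \<bullet> i n) [] \<bullet> lay [] (F \<bullet> i k) (pw n)"
      by (simp add: I2_def swap[THEN tail])
    also have "\<dots> = g (k + n)"
      by (simp only: F g_add)
    finally show "(F \<bullet> m) \<bullet> I2 k n = (mW \<bullet> lay W F [] \<bullet> lay [] F [T]) \<bullet> I2 k n"
      by (simp add: F)
  qed (simp_all add: hom_def)
  moreover have "F \<bullet> i 1 = f"
    using gS[of 0] by (simp add: F g0 lay_nil unit(2)[THEN tail])
  ultimately show ?thesis
    using F by (auto simp: alg_map_def u_def g0)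
qed

definition C where
  "C = (SOME k. hom k [T, T] [T, T] \<and> (\<forall>m n. k \<bullet> I2 m n = I2 n m \<bullet> D m n))"

lemma C: "hom C [T, T] [T, T] \<and> (\<forall>m n. C \<bullet> I2 m n = I2 n m \<bullet> D m n)"
  unfolding C_def by (rule someI_ex, rule T_ex2) (simp add: hom_def)

lemmas C_I2 [simp] = C[THEN conjunct2, rule_format]
lemmas C_hom = C[THEN conjunct1]

lemma C_I3: "lay [] C [T] \<bullet> I3 k l n = I3 l k n \<bullet> lay [] (D k l) (pw n)"
    "lay [T] C [] \<bullet> I3 k l n = I3 k n l \<bullet> lay (pw k) (D l n) []"
proof -
  note [simp] = C_hom[THEN homD(1)] C_hom[THEN homD(2)] C_hom[THEN homD(3)]
  have "lay [] C (pw n) \<bullet> lay [T] (i l) (pw n) \<bullet> lay [] (i k) (pw l @ pw n)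
     = lay [T] (i k) (pw n) \<bullet> lay [] (i l) (pw k @ pw n) \<bullet> lay [] (D k l) (pw n)"
    using lay_cong[OF C_I2, of "[]" k l "pw n"] by (simp add: I2_def)
  then show "lay [] C [T] \<bullet> I3 k l n = I3 l k n \<bullet> lay [] (D k l) (pw n)"
    by (simp add: I3_def)
  have "lay [T] C [] \<bullet> lay [T, T] (i n) [] \<bullet> lay [T] (i l) (pw n)
     = lay [T, T] (i l) [] \<bullet> lay [T] (i n) (pw l) \<bullet> lay [T] (D l n) []"
    using lay_cong[OF C_I2, of "[T]" l n "[]"] by (simp add: I2_def)
  from this[THEN tail3] show "lay [T] C [] \<bullet> I3 k l n = I3 k n l \<bullet> lay (pw k) (D l n) []"
    by (simp add: I3_def)
qed

text \<open>On products of injections each law becomes a property of the blocks \<open>D\<close>: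
  additivity in either index for the multiplication, \<open>D_ybe\<close> for the braid relation,
  triviality of empty blocks for the unit.\<close>

lemma C_alg:
  "C \<bullet> lay [] m [T] = lay [T] m [] \<bullet> lay [] C [T] \<bullet> lay [T] C []"
  "C \<bullet> lay [T] m [] = lay [] m [T] \<bullet> lay [T] C [] \<bullet> lay [] C [T]"
  "C \<bullet> lay [] u [T] = lay [T] u []"
  "C \<bullet> lay [T] u [] = lay [] u [T]"
  "lay [] C [T] \<bullet> lay [T] C [] \<bullet> lay [] C [T] = lay [T] C [] \<bullet> lay [] C [T] \<bullet> lay [T] C []"
proof -
  note [simp] = C_hom[THEN homD(1)] C_hom[THEN homD(2)] C_hom[THEN homD(3)]
  note tails = C_I3[THEN tail, unfolded comp_assoc] m_lay_I3[THEN tail, unfolded comp_assoc]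
  show "C \<bullet> lay [] m [T] = lay [T] m [] \<bullet> lay [] C [T] \<bullet> lay [T] C []"
    by (rule T_uniq3[where zs = "[T, T]"]) (simp_all add: hom_def m_lay_I3 C_I3 tails D_add_left)
  show "C \<bullet> lay [T] m [] = lay [] m [T] \<bullet> lay [T] C [] \<bullet> lay [] C [T]"
    by (rule T_uniq3[where zs = "[T, T]"]) (simp_all add: hom_def m_lay_I3 C_I3 tails D_add_right)
  show "lay [] C [T] \<bullet> lay [T] C [] \<bullet> lay [] C [T] = lay [T] C [] \<bullet> lay [] C [T] \<bullet> lay [T] C []"
    by (rule T_uniq3[where zs = "[T, T, T]"]) (simp_all add: hom_def C_I3 tails D_ybe)
  show "C \<bullet> lay [] u [T] = lay [T] u []"
  proof (rule T_uniq1[where zs = "[T, T]"])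
    fix n
    have "(C \<bullet> lay [] u [T]) \<bullet> i n = C \<bullet> lay [] u [T] \<bullet> lay [] (i n) []"
      by (simp add: lay_nil)
    also have "\<dots> = C \<bullet> I2 0 n"
      by (subst u_i) simp
    also have "\<dots> = lay [T] u [] \<bullet> i n"
      by simp (simp add: I2_def u_def lay_nil)
    finally show "(C \<bullet> lay [] u [T]) \<bullet> i n = lay [T] u [] \<bullet> i n" .
  qed (simp_all add: hom_def)
  show "C \<bullet> lay [T] u [] = lay [] u [T]"
  proof (rule T_uniq1[where zs = "[T, T]"])
    fix n
    have "(C \<bullet> lay [T] u []) \<bullet> i n = C \<bullet> I2 n 0"
      by (simp add: I2_def u_def lay_nil)
    also have "\<dots> = lay [] u [T] \<bullet> lay [] (i n) []"
      by (subst u_i) (simp add: D_0_right)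
    finally show "(C \<bullet> lay [T] u []) \<bullet> i n = lay [] u [T] \<bullet> i n"
      by (simp only: comp_assoc lay_nil i_hom[THEN homD(1)])
  qed (simp_all add: hom_def)
qed

end

section \<open>Invertibility of the braiding of tensor powers\<close>

context s_br begin

lemma inverse_br: "s_br ob ar dm cd (\<bullet>) idn lay A c' c"
  by unfold_locales (rule c'_hom c_hom c'_c c_c' ybe_inverse)+

text \<open>Crossed blocks are uncrossed by the same construction applied to \<open>c'\<close> with
  the sizes exchanged. \<open>D (Suc m) n\<close> splits a strand off its first block, which is the
  second block of the inverse; hence the use of \<open>D_add_right\<close> for the latter.\<close>

lemma D_inverse_left: "s_br.D (\<bullet>) idn lay A c' n m \<bullet> D m n = idn (pw m @ pw n)"
proof -
  interpret J: s_br ob ar dm cd "(\<bullet>)" idn lay A c' c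
    by (rule inverse_br)
  have X: "J.D n (Suc 0) \<bullet> X n = idn (A # pw n)" for n
  proof (induction n)
    case 0
    show ?case by simp
  next
    case (Suc n)
    show ?case
      using lay_cong[OF Suc, of "[A]" "[]"] by (simp add: lay_nil[of c'] tail)
  qed
  show ?thesis
  proof (induction m)
    case 0
    show ?case by (simp add: J.D_0_right)
  next
    case (Suc m)
    have 1: "lay [] (J.D n (Suc 0)) (pw m) \<bullet> lay [] (X n) (pw m) = idn (A # pw n @ pw m)"
      using lay_cong[OF X, of "[]" n "pw m"] by simp
    have "J.D n (1 + m) \<bullet> D (Suc m) n = lay [A] (J.D n m) [] \<bullet> lay [A] (D m n) []"
      unfolding J.D_add_right by (simp add: 1[THEN tail])
    also have "\<dots> = idn (A # pw m @ pw n)"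
      using lay_cong[OF Suc, of "[A]" "[]"] by simp
    finally show ?case by simp
  qed
qed

lemma D_inverse: "\<exists>E. \<forall>m n. hom (E m n) (pw m @ pw n) (pw n @ pw m) \<and>
  E n m \<bullet> D m n = idn (pw m @ pw n) \<and> D n m \<bullet> E m n = idn (pw m @ pw n)"
proof -
  interpret J: s_br ob ar dm cd "(\<bullet>)" idn lay A c' c
    by (rule inverse_br)
  show ?thesis
    by (rule exI[of _ J.D]) (use J.D_hom D_inverse_left J.D_inverse_left in blast)
qed

end

context s_tensor begin

definition C' where
  "C' = (SOME k. hom k [T, T] [T, T] \<and> C \<bullet> k = idn [T, T] \<and> k \<bullet> C = idn [T, T])"

lemma C': "hom C' [T, T] [T, T] \<and> C \<bullet> C' = idn [T, T] \<and> C' \<bullet> C = idn [T, T]"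
proof -
  note [simp] = C_hom[THEN homD(1)] C_hom[THEN homD(2)] C_hom[THEN homD(3)]
  obtain E where E: "\<And>m n. hom (E m n) (pw m @ pw n) (pw n @ pw m)"
    "\<And>m n. E n m \<bullet> D m n = idn (pw m @ pw n)" "\<And>m n. D n m \<bullet> E m n = idn (pw m @ pw n)"
    using D_inverse by blast
  obtain k where k: "hom k [T, T] [T, T]" "\<And>m n. k \<bullet> I2 m n = I2 n m \<bullet> E m n"
    using T_ex2[of "\<lambda>m n. I2 n m \<bullet> E m n" "[T, T]"] E(1) by (auto simp: hom_def)
  note [simp] = k(1)[THEN homD(1)] k(1)[THEN homD(2)] k(1)[THEN homD(3)]
  have "(C \<bullet> k) \<bullet> I2 m n = idn [T, T] \<bullet> I2 m n" for m n
    by (simp add: k(2) tail[OF C_I2] E(3))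
  then have "C \<bullet> k = idn [T, T]"
    by (rule T_uniq2[where zs = "[T, T]", rotated 2]) (simp_all add: hom_def del: comp_assoc)
  moreover have "(k \<bullet> C) \<bullet> I2 m n = idn [T, T] \<bullet> I2 m n" for m n
    by (simp add: tail[OF k(2)] E(2))
  then have "k \<bullet> C = idn [T, T]"
    by (rule T_uniq2[where zs = "[T, T]", rotated 2]) (simp_all add: hom_def del: comp_assoc)
  ultimately have "\<exists>k. hom k [T, T] [T, T] \<and> C \<bullet> k = idn [T, T] \<and> k \<bullet> C = idn [T, T]"
    using k(1) by blast
  then show ?thesis
    unfolding C'_def by (rule someI_ex)
qed

sublocale Ta: s_bralg ob ar dm cd comp idn lay T m u C C'
  by unfold_locales (simp_all only: C' C_hom C_alg)

text \<open>\<open>K\<close> should be thought of as a crossing of \<open>xs\<close> with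
  \<open>T\<close> combined with a map from \<open>T\<close> to \<open>W\<close>. The third
  condition takes the place of multiplicativity: it is a hexagon, by which a product crosses factor
  by factor. With \<open>i_Suc\<close> it determines \<open>K\<close> from its value in degree
  one.\<close>

lemma twisted_unique_right:
  assumes K: "hom K (xs @ [T]) (W @ xs)" "K \<bullet> lay xs u [] = lay [] uW xs"
      "K \<bullet> lay xs m [] = lay [] mW xs \<bullet> lay W K [] \<bullet> lay [] K [T]"
    and L: "hom L (xs @ [T]) (W @ xs)" "L \<bullet> lay xs u [] = lay [] uW xs"
      "L \<bullet> lay xs m [] = lay [] mW xs \<bullet> lay W L [] \<bullet> lay [] L [T]"
    and KL: "K \<bullet> lay xs (i 1) [] = L \<bullet> lay xs (i 1) []"
  shows "K = L"
proof -
  have ob [simp]: "list_all ob xs" "list_all ob W"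
    using hom_ob[OF K(1)] by simp_all
  have step: "H \<bullet> lay xs (i (Suc n)) [] =
      lay [] mW xs \<bullet> lay W (H \<bullet> lay xs (i n) []) [] \<bullet> lay [] (H \<bullet> lay xs (i 1) []) (pw n)"
    if H: "hom H (xs @ [T]) (W @ xs)" and Hm: "H \<bullet> lay xs m [] = lay [] mW xs \<bullet> lay W H [] \<bullet> lay [] H [T]" for H n
  proof -
    have [simp]: "ar H" "dm H = xs @ [T]" "cd H = W @ xs"
      using H by (auto simp: hom_def)
    have swap: "lay [] H [T] \<bullet> lay (xs @ [T]) (i n) [] = lay (W @ xs) (i n) [] \<bullet> lay [] H (pw n)"
      by (rule swap[where ys = "[]"]) simp_all
    show ?thesis
      by (subst i_Suc) (simp add: Hm[THEN tail] swap[THEN tail])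
  qed
  show ?thesis
  proof (rule T_uniq[of K xs "[]" "W @ xs"])
    show "K \<bullet> lay xs (i n) [] = L \<bullet> lay xs (i n) []" for n
    proof (induction n)
      case 0
      show ?case using K(2) L(2) by (simp add: u_def)
    next
      case (Suc n)
      with KL show ?case by (simp only: step[OF K(1,3), of n] step[OF L(1,3), of n])
    qed
  qed (use K L in simp_all)
qed

lemma twisted_unique_left:
  assumes K: "hom K (T # xs) (xs @ W)" "K \<bullet> lay [] u xs = lay xs uW []"
      "K \<bullet> lay [] m xs = lay xs mW [] \<bullet> lay [] K W \<bullet> lay [T] K []"
    and L: "hom L (T # xs) (xs @ W)" "L \<bullet> lay [] u xs = lay xs uW []"
      "L \<bullet> lay [] m xs = lay xs mW [] \<bullet> lay [] L W \<bullet> lay [T] L []"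
    and KL: "K \<bullet> lay [] (i 1) xs = L \<bullet> lay [] (i 1) xs"
  shows "K = L"
proof -
  have ob [simp]: "list_all ob xs" "list_all ob W"
    using hom_ob[OF K(1)] by simp_all
  have step: "H \<bullet> lay [] (i (Suc n)) xs =
      lay xs mW [] \<bullet> lay [] (H \<bullet> lay [] (i 1) xs) W \<bullet> lay [V] (H \<bullet> lay [] (i n) xs) []"
    if H: "hom H (T # xs) (xs @ W)" and Hm: "H \<bullet> lay [] m xs = lay xs mW [] \<bullet> lay [] H W \<bullet> lay [T] H []" for H n
  proof -
    have [simp]: "ar H" "dm H = T # xs" "cd H = xs @ W"
      using H by (auto simp: hom_def)
    show ?thesis
      by (subst i_Suc) (simp add: Hm[THEN tail])
  qed
  show ?thesis
  proof (rule T_uniq[of K "[]" xs "xs @ W"])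
    show "K \<bullet> lay [] (i n) xs = L \<bullet> lay [] (i n) xs" for n
    proof (induction n)
      case 0
      show ?case using K(2) L(2) by (simp add: u_def)
    next
      case (Suc n)
      with KL show ?case by (simp only: step[OF K(1,3), of n] step[OF L(1,3), of n])
    qed
  qed (use K L in simp_all)
qed

text \<open>Comultiplication and counit are explicit only in degree one, so a generator has to be
  recognised again after it has crossed \<open>T\<close>. The arrow \<open>Y\<close> is that
  crossing with \<open>V\<close> in place of the second \<open>T\<close>.\<close>

lemma C_i1_right: "\<exists>Y. hom Y [T, V] [V, T] \<and> C \<bullet> lay [T] (i 1) [] = lay [] (i 1) [T] \<bullet> Y"
proof -
  obtain Y where Y: "hom Y [T, V] [V, T]" "\<And>n. Y \<bullet> lay [] (i n) [V] = lay [V] (i n) [] \<bullet> D n 1"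
    using T_ex[of "[]" "[V]" "\<lambda>n. lay [V] (i n) [] \<bullet> D n 1" "[V, T]"] by (auto simp: hom_def)
  note [simp] = Y(1)[THEN homD(1)] Y(1)[THEN homD(2)] Y(1)[THEN homD(3)]
  have "C \<bullet> lay [T] (i 1) [] = lay [] (i 1) [T] \<bullet> Y"
  proof (rule T_uniq[of _ "[]" "[V]" "[T, T]"])
    fix n
    show "(C \<bullet> lay [T] (i 1) []) \<bullet> lay [] (i n) [V] = (lay [] (i 1) [T] \<bullet> Y) \<bullet> lay [] (i n) [V]"
      using C_I2[of n 1] by (simp add: I2_def Y(2))
  qed (simp_all add: hom_def)
  with Y(1) show ?thesis by blast
qed

lemma C_i1_left: "\<exists>Y. hom Y [V, T] [T, V] \<and> C \<bullet> lay [] (i 1) [T] = lay [T] (i 1) [] \<bullet> Y"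
proof -
  obtain Y where Y: "hom Y [V, T] [T, V]" "\<And>n. Y \<bullet> lay [V] (i n) [] = lay [] (i n) [V] \<bullet> D 1 n"
    using T_ex[of "[V]" "[]" "\<lambda>n. lay [] (i n) [V] \<bullet> D 1 n" "[T, V]"] by (auto simp: hom_def)
  note [simp] = Y(1)[THEN homD(1)] Y(1)[THEN homD(2)] Y(1)[THEN homD(3)]
  have "C \<bullet> lay [] (i 1) [T] = lay [T] (i 1) [] \<bullet> Y"
  proof (rule T_uniq[of _ "[V]" "[]" "[T, T]"])
    fix n
    show "(C \<bullet> lay [] (i 1) [T]) \<bullet> lay [V] (i n) [] = (lay [T] (i 1) [] \<bullet> Y) \<bullet> lay [V] (i n) []"
      using C_I2[of 1 n] by (simp add: I2_def Y(2))
  qed (simp_all add: hom_def)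
  with Y(1) show ?thesis by blast
qed

end

section \<open>Extension of a braided map from generators to the tensor algebra\<close>

locale s_lift = s_tensor ob ar dm cd comp idn lay V c c' T i +
    B: s_bralg ob ar dm cd comp idn lay B mB uB cB cB'
  for ob ar dm cd and comp (infixr "\<bullet>" 55) and idn lay V c c' T i B mB uB cB cB' +
  fixes f and F
  assumes f_hom: "hom f [V] [B]"
    and f_br: "cB \<bullet> lay [B] f [] \<bullet> lay [] f [V] = lay [B] f [] \<bullet> lay [] f [V] \<bullet> c"
    and F: "alg_map F [B] mB uB" and F_i1: "F \<bullet> i 1 = f"
begin

lemmas [simp] = f_hom[THEN homD(1)] f_hom[THEN homD(2)] f_hom[THEN homD(3)]

lemma F_hom: "hom F [T] [B]"
  using F by (simp add: alg_map_def)

lemmas [simp] = F_hom[THEN homD(1)] F_hom[THEN homD(2)] F_hom[THEN homD(3)]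

lemma f_br_lay: "xs' = xs @ [B] \<Longrightarrow> lay xs cB ys \<bullet> lay xs' f ys \<bullet> lay xs f (V # ys)
    = lay xs' f ys \<bullet> lay xs f (V # ys) \<bullet> lay xs c ys"
  using lay_cong[OF f_br, of xs ys] by simp

definition fn where "fn n = F \<bullet> i n"

lemma fn_hom: "hom (fn n) (pw n) [B]"
  by (simp add: fn_def hom_def)

lemmas [simp] = fn_hom[THEN homD(1)] fn_hom[THEN homD(2)] fn_hom[THEN homD(3)]

lemma fn_0: "fn 0 = uB"
  using F by (simp add: fn_def alg_map_def u_def)

lemma fn_Suc: "fn (Suc n) = mB \<bullet> lay [B] (fn n) [] \<bullet> lay [] f (pw n)"
proof -
  have Fm: "F \<bullet> m = mB \<bullet> lay [B] F [] \<bullet> lay [] F [T]"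
    using F by (simp add: alg_map_def)
  show ?thesis
    unfolding fn_def F_i1[symmetric] by (subst i_Suc) (simp add: Fm[THEN tail])
qed

text \<open>Compatibility of \<open>F\<close> with the braidings is a statement about pairs of
  degrees, proved by enlarging one block at a time: here \<open>f\<close> is crossed with the
  \<open>n\<close>-fold product \<open>fn n\<close>, in \<open>fn_D\<close> two such products are
  crossed.\<close>

lemma fn_X: "cB \<bullet> lay [B] (fn n) [] \<bullet> lay [] f (pw n) = lay [B] f [] \<bullet> lay [] (fn n) [V] \<bullet> X n"
proof (induction n)
  case 0
  show ?case
    by (simp add: fn_0 layer[where f = cB] swap[where f = f and g = uB and ys = "[]"])
next
  case (Suc n)
  have IH: "lay [B] cB [] \<bullet> lay [B, B] (fn n) [] \<bullet> lay [B] f (pw n)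
    = lay [B, B] f [] \<bullet> lay [B] (fn n) [V] \<bullet> lay [B] (X n) []"
    using lay_cong[OF Suc, of "[B]" "[]"] by simp
  show ?case
    by (simp add: fn_Suc layer[where f = cB] f_br_lay f_br_lay[THEN tail3] IH IH[THEN tail3])
qed

lemma fn_D: "cB \<bullet> lay [B] (fn n) [] \<bullet> lay [] (fn k) (pw n) = lay [B] (fn k) [] \<bullet> lay [] (fn n) (pw k) \<bullet> D k n"
proof (induction k)
  case 0
  have "lay [] uB [B] \<bullet> lay [] (fn n) [] = lay [B] (fn n) [] \<bullet> lay [] uB (pw n)"
    by (rule swap[where ys = "[]"]) simp_all
  then have "cB \<bullet> lay [B] (fn n) [] \<bullet> lay [] (fn 0) (pw n) = cB \<bullet> lay [] uB [B] \<bullet> lay [] (fn n) []"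
    by (simp add: fn_0)
  also have "\<dots> = lay [B] (fn 0) [] \<bullet> lay [] (fn n) []"
    by (simp only: fn_0 B.c_u_left[THEN tail])
  finally show ?case by simp
next
  case (Suc k)
  have IH: "lay [B] cB [] \<bullet> lay [B, B] (fn n) [] \<bullet> lay [B] (fn k) (pw n)
      = lay [B, B] (fn k) [] \<bullet> lay [B] (fn n) (pw k) \<bullet> lay [B] (D k n) []"
    using lay_cong[OF Suc, of "[B]" "[]"] by simp
  have fX: "lay [] cB (pw k) \<bullet> lay [B] (fn n) (pw k) \<bullet> lay [] f (pw n @ pw k)
      = lay [B] f (pw k) \<bullet> lay [] (fn n) (V # pw k) \<bullet> lay [] (X n) (pw k)"
    using lay_cong[OF fn_X, of "[]" n "pw k"] by simp
  have mB_fn: "lay [] mB [B] \<bullet> lay [B, B] (fn n) [] = lay [B] (fn n) [] \<bullet> lay [] mB (pw n)"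
    by (rule swap[where ys = "[]"]) simp_all
  \<comment> \<open>\<open>fn (Suc k)\<close> is split as \<open>f\<close> times
    \<open>fn k\<close>. Its crossing with \<open>fn n\<close> falls apart into one for
    \<open>fn k\<close>, covered by the induction hypothesis, and one for \<open>f\<close>, covered
    by \<open>fn_X\<close>.\<close>
  have "cB \<bullet> lay [B] (fn n) [] \<bullet> lay [] (fn (Suc k)) (pw n)
      = cB \<bullet> (lay [] mB [B] \<bullet> lay [B, B] (fn n) []) \<bullet> lay [B] (fn k) (pw n) \<bullet> lay [] f (pw k @ pw n)"
    unfolding mB_fn by (simp add: fn_Suc)
  also have "\<dots> = lay [B] mB [] \<bullet> lay [] cB [B] \<bullet> (lay [B] cB [] \<bullet> lay [B, B] (fn n) [] \<bullet> lay [B] (fn k) (pw n))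
        \<bullet> lay [] f (pw k @ pw n)"
    by (simp only: comp_assoc B.c_m_left[THEN tail])
  also have "\<dots> = lay [B] mB [] \<bullet> lay [B, B] (fn k) [] \<bullet>
      (lay [] cB (pw k) \<bullet> lay [B] (fn n) (pw k) \<bullet> lay [] f (pw n @ pw k)) \<bullet> lay [V] (D k n) []"
    unfolding IH by simp
  also have "\<dots> = lay [B] (fn (Suc k)) [] \<bullet> lay [] (fn n) (pw (Suc k)) \<bullet> D (Suc k) n"
    unfolding fX by (simp add: fn_Suc)
  finally show ?case .
qed

lemma F_br: "cB \<bullet> lay [B] F [] \<bullet> lay [] F [T] = lay [B] F [] \<bullet> lay [] F [T] \<bullet> C"
proof (rule T_uniq2[where zs = "[B, B]"])
  fix k n
  have "(cB \<bullet> lay [B] F [] \<bullet> lay [] F [T]) \<bullet> I2 k n = cB \<bullet> lay [B] (fn n) [] \<bullet> lay [] (fn k) (pw n)"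
    by (simp add: I2_def fn_def)
  also have "\<dots> = (lay [B] F [] \<bullet> lay [] F [T]) \<bullet> I2 n k \<bullet> D k n"
    unfolding fn_D by (simp add: I2_def fn_def)
  finally show "(cB \<bullet> lay [B] F [] \<bullet> lay [] F [T]) \<bullet> I2 k n = (lay [B] F [] \<bullet> lay [] F [T] \<bullet> C) \<bullet> I2 k n"
    by simp
qed (simp_all add: hom_def)

lemma F_br_lay: "xs' = xs @ [B] \<Longrightarrow> lay xs cB ys \<bullet> lay xs' F ys \<bullet> lay xs F (T # ys)
    = lay xs' F ys \<bullet> lay xs F (T # ys) \<bullet> lay xs C ys"
  using lay_cong[OF F_br, of xs ys] by simp

lemma F_m_lay: "lay xs F ys \<bullet> lay xs m ys = lay xs mB ys \<bullet> lay (xs @ [B]) F ys \<bullet> lay xs F (T # ys)"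
  and F_u_lay: "lay xs F ys \<bullet> lay xs u ys = lay xs uB ys"
proof -
  have F1: "F \<bullet> m = mB \<bullet> lay [B] F [] \<bullet> lay [] F [T]" and F2: "F \<bullet> u = uB"
    using F by (simp_all add: alg_map_def)
  show "lay xs F ys \<bullet> lay xs m ys = lay xs mB ys \<bullet> lay (xs @ [B]) F ys \<bullet> lay xs F (T # ys)"
      "lay xs F ys \<bullet> lay xs u ys = lay xs uB ys"
    using lay_cong[OF F1, of xs ys] lay_cong[OF F2, of xs ys] by simp_all
qed

lemmas F_simps = F_br_lay F_br_lay[THEN tail3, unfolded comp_assoc] F_m_lay F_u_lay
  F_m_lay[THEN tail, unfolded comp_assoc] F_u_lay[THEN tail, unfolded comp_assoc]

end

section \<open>The braided tensor bialgebra\<close>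

text \<open>From here on the words are explicit lists, so that ranks can be computed by simplification.\<close>

context strict_monoidal begin

declare sort [simp del] sort_comp [simp del] rsort [simp] rank_def [simp]

end

locale s_tensor_add = s_tensor + strict_additive
begin

definition d where
  "d = (SOME F. alg_map F [T, T] Ta.m2 Ta.u2 \<and> F \<bullet> i 1 = (lay [] u [T] \<bullet> i 1) \<uplus> (lay [T] u [] \<bullet> i 1))"

definition e where
  "e = (SOME F. alg_map F [] (idn []) (idn []) \<and> F \<bullet> i 1 = zero [V] [])"

lemma d: "alg_map d [T, T] Ta.m2 Ta.u2 \<and> d \<bullet> i 1 = (lay [] u [T] \<bullet> i 1) \<uplus> (lay [T] u [] \<bullet> i 1)"
  unfolding d_def by (rule someI_ex, rule alg_map_exists[OF Ta.alg2]) (simp add: hom_def)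

lemma e: "alg_map e [] (idn []) (idn []) \<and> e \<bullet> i 1 = zero [V] []"
  unfolding e_def by (rule someI_ex, rule alg_map_exists) (simp_all add: alg_def hom_def)

sublocale Ta: s_prebialg ob ar dm cd comp idn lay T m u C C' d e
proof unfold_locales
  show "hom d [T] [T, T]" "hom e [T] []" "d \<bullet> u = Ta.u2" "e \<bullet> u = idn []"
    using d e by (simp_all add: alg_map_def)
  then show "d \<bullet> m = Ta.m2 \<bullet> lay [T, T] d [] \<bullet> lay [] d [T]" "e \<bullet> m = e \<bullet> lay [] e [T]"
    using d e by (simp_all add: alg_map_def hom_def lay_nil)
qed

lemma d_i1_lay [simp]: "lay xs d ys \<bullet> lay xs (i (Suc 0)) ys
    = (lay (xs @ [T]) (i (Suc 0)) ys \<bullet> lay xs u (V # ys)) \<uplus> (lay (xs @ [T]) u ys \<bullet> lay xs (i (Suc 0)) ys)"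
proof -
  have "d \<bullet> i 1 = (lay [T] (i 1) [] \<bullet> lay [] u [V]) \<uplus> (lay [T] u [] \<bullet> lay [] (i 1) [])"
    unfolding d[THEN conjunct2] using sort[of u "i 1" "[]" "[]" "[T]" "[]"] by (simp add: lay_nil)
  from lay_cong[OF this, of xs ys] show ?thesis by simp
qed

lemma e_i1_lay [simp]: "list_all ob xs \<Longrightarrow> list_all ob ys \<Longrightarrow>
  lay xs e ys \<bullet> lay xs (i (Suc 0)) ys = zero (xs @ V # ys) (xs @ ys)"
  using lay_cong[OF e[THEN conjunct2], of xs ys] by simp

lemmas d_i1_lay_comp [simp] = d_i1_lay[THEN tail, unfolded comp_assoc]

lemma e_i1_lay_comp [simp]: "list_all ob xs \<Longrightarrow> list_all ob ys \<Longrightarrow> ar k \<Longrightarrow> cd k = xs @ V # ys \<Longrightarrow>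
  lay xs e ys \<bullet> lay xs (i (Suc 0)) ys \<bullet> k = zero (dm k) (xs @ ys)"
  by (simp add: zero_comp e_i1_lay[THEN tail])

text \<open>Both sides let the second strand cross the first while comultiplying it, with values
  multiplied by \<open>m2\<close>. \<open>twisted_unique_right\<close> reduces the claim to a
  generator in the second strand, which \<open>C_i1_right\<close> carries through \<open>C\<close>
  to the place where \<open>d\<close> is explicit.\<close>

lemma d_C_left: "lay [] d [T] \<bullet> C = lay [T] C [] \<bullet> lay [] C [T] \<bullet> lay [T] d []"
proof -
  obtain Y where Y: "hom Y [T, V] [V, T]" "C \<bullet> lay [T] (i 1) [] = lay [] (i 1) [T] \<bullet> Y"
    using C_i1_right by blast
  note [simp] = Y(1)[THEN homD(1)] Y(1)[THEN homD(2)] Y(1)[THEN homD(3)]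
  have Y_lay: "lay xs C ys \<bullet> lay xs' (i (Suc 0)) ys = lay xs (i (Suc 0)) (T # ys) \<bullet> lay xs Y ys"
    if "xs' = xs @ [T]" for xs xs' ys
    using lay_cong[OF Y(2), of xs ys] that by simp
  show ?thesis
  proof (rule twisted_unique_right[where xs = "[T]" and W = "[T, T]" and mW = Ta.m2 and uW = Ta.u2])
    show "(lay [] d [T] \<bullet> C) \<bullet> lay [T] (i 1) [] = (lay [T] C [] \<bullet> lay [] C [T] \<bullet> lay [T] d []) \<bullet> lay [T] (i 1) []"
      by (simp add: layer[where f = C] layer[where f = Y] Y_lay Y_lay[THEN tail])
  qed (simp_all add: hom_def Ta.m2_def Ta.u2_def layer[where f = C])
qed

lemma d_C_right: "lay [T] d [] \<bullet> C = lay [] C [T] \<bullet> lay [T] C [] \<bullet> lay [] d [T]"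
proof -
  obtain Y where Y: "hom Y [V, T] [T, V]" "C \<bullet> lay [] (i 1) [T] = lay [T] (i 1) [] \<bullet> Y"
    using C_i1_left by blast
  note [simp] = Y(1)[THEN homD(1)] Y(1)[THEN homD(2)] Y(1)[THEN homD(3)]
  have Y_lay: "lay xs C ys \<bullet> lay xs (i (Suc 0)) (T # ys) = lay (xs @ [T]) (i (Suc 0)) ys \<bullet> lay xs Y ys"
    for xs ys
    using lay_cong[OF Y(2), of xs ys] by simp
  show ?thesis
  proof (rule twisted_unique_left[where xs = "[T]" and W = "[T, T]" and mW = Ta.m2 and uW = Ta.u2])
    show "(lay [T] d [] \<bullet> C) \<bullet> lay [] (i 1) [T] = (lay [] C [T] \<bullet> lay [T] C [] \<bullet> lay [] d [T]) \<bullet> lay [] (i 1) [T]"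
      by (simp add: layer[where f = C] layer[where f = Y] Y_lay Y_lay[THEN tail])
  qed (simp_all del: rsort add: lsort hom_def Ta.m2_def Ta.u2_def layer[where f = C])
qed

text \<open>The same comparison with the empty word as target; on a generator both sides
  vanish.\<close>

lemma e_C_left: "lay [] e [T] \<bullet> C = lay [T] e []"
proof -
  obtain Y where Y: "hom Y [T, V] [V, T]" "C \<bullet> lay [T] (i 1) [] = lay [] (i 1) [T] \<bullet> Y"
    using C_i1_right by blast
  note [simp] = Y(1)[THEN homD(1)] Y(1)[THEN homD(2)] Y(1)[THEN homD(3)]
  show ?thesis
  proof (rule twisted_unique_right[where xs = "[T]" and W = "[]" and mW = "idn []" and uW = "idn []"])
    show "(lay [] e [T] \<bullet> C) \<bullet> lay [T] (i 1) [] = lay [T] e [] \<bullet> lay [T] (i 1) []"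
      using Y(2) by simp
  qed (simp_all add: hom_def layer[where f = C])
qed

lemma e_C_right: "lay [T] e [] \<bullet> C = lay [] e [T]"
proof -
  obtain Y where Y: "hom Y [V, T] [T, V]" "C \<bullet> lay [] (i 1) [T] = lay [T] (i 1) [] \<bullet> Y"
    using C_i1_left by blast
  note [simp] = Y(1)[THEN homD(1)] Y(1)[THEN homD(2)] Y(1)[THEN homD(3)]
  show ?thesis
  proof (rule twisted_unique_left[where xs = "[T]" and W = "[]" and mW = "idn []" and uW = "idn []"])
    show "(lay [T] e [] \<bullet> C) \<bullet> lay [] (i 1) [T] = lay [] e [T] \<bullet> lay [] (i 1) [T]"
      using Y(2) by simp
  qed (simp_all del: rsort add: lsort hom_def layer[where f = C])
qed

lemma d_e_C_lay:
  "lay xs d (T # ys) \<bullet> lay xs C ys = lay (xs @ [T]) C ys \<bullet> lay xs C (T # ys) \<bullet> lay (xs @ [T]) d ys"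
  "xs' = xs @ [T] \<Longrightarrow>
    lay xs' d ys \<bullet> lay xs C ys = lay xs C (T # ys) \<bullet> lay (xs @ [T]) C ys \<bullet> lay xs d (T # ys)"
  "lay xs e (T # ys) \<bullet> lay xs C ys = lay (xs @ [T]) e ys"
  "xs' = xs @ [T] \<Longrightarrow> lay xs' e ys \<bullet> lay xs C ys = lay xs e (T # ys)"
  using lay_cong[OF d_C_left, of xs ys] lay_cong[OF d_C_right, of xs ys]
    lay_cong[OF e_C_left, of xs ys] lay_cong[OF e_C_right, of xs ys] by simp_all

lemmas layers = layer[where f = d] layer[where f = m] layer[where f = u] layer[where f = "i (Suc 0)"]

lemmas d_e_C_simps = d_e_C_lay d_e_C_lay[THEN tail, unfolded comp_assoc]

text \<open>Both composites are algebra maps into the braided threefold tensor power. Their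
  multiplicativity needs \<open>d_C_left\<close> and \<open>d_C_right\<close>, which move
  comultiplications past the crossings of \<open>m2\<close>.\<close>

lemma T_coassoc: "lay [T] d [] \<bullet> d = lay [] d [T] \<bullet> d"
proof -
  \<comment> \<open>The three crossings shuffle \<open>a1 a2 a3 b1 b2 b3\<close> into
    \<open>a1 b1 a2 b2 a3 b3\<close>, after which neighbours are multiplied in pairs.\<close>
  define m3 where "m3 = lay [T, T] m [] \<bullet> lay [T] m [T, T] \<bullet> lay [] m [T, T, T, T]
    \<bullet> lay [T, T, T] C [T] \<bullet> lay [T] C [T, T, T] \<bullet> lay [T, T] C [T, T]"
  define u3 where "u3 = lay [T, T] u [] \<bullet> lay [T] u [] \<bullet> lay [] u []"
  show ?thesis
  proof (rule alg_map_unique)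
    show "alg_map (lay [T] d [] \<bullet> d) [T, T, T] m3 u3"
      by (simp add: alg_map_def hom_def m3_def u3_def layers d_e_C_simps)
    show "alg_map (lay [] d [T] \<bullet> d) [T, T, T] m3 u3"
      by (simp add: alg_map_def hom_def m3_def u3_def layers d_e_C_simps)
    show "(lay [T] d [] \<bullet> d) \<bullet> i 1 = (lay [] d [T] \<bullet> d) \<bullet> i 1"
      by (simp add: layers add_assoc)
  qed
qed

text \<open>Both sides are algebra endomorphisms. On a generator the counit kills one of the two
  summands of \<open>d\<close> and cancels the unit in the other.\<close>

lemma T_counit: "lay [] e [T] \<bullet> d = idn [T]" "lay [T] e [] \<bullet> d = idn [T]"
proof -
  have 1: "alg_map (idn [T]) [T] m u"
    by (simp add: alg_map_def hom_def)
  show "lay [] e [T] \<bullet> d = idn [T]"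
    by (rule alg_map_unique[OF _ 1]) (simp_all add: alg_map_def hom_def layers d_e_C_simps, simp_all add: lay_nil comp_zero)
  show "lay [T] e [] \<bullet> d = idn [T]"
    by (rule alg_map_unique[OF _ 1]) (simp_all add: alg_map_def hom_def layers d_e_C_simps, simp_all add: lay_nil comp_zero)
qed

sublocale Ta: s_bialg ob ar dm cd comp idn lay T m u C C' d e
  by unfold_locales
    (rule d_C_left d_C_right e_C_left e_C_right T_coassoc T_counit Ta.d_hom Ta.e_hom)+

end

section \<open>Primitive elements\<close>

locale s_bialg_add = s_bialg + strict_additive
begin

definition p where "p = lay [] u [A] \<uplus> lay [A] u []"

lemma p_hom: "hom p [A] [A, A]"
  by (simp add: p_def hom_def)

text \<open>Applying \<open>e\<close> to the first factor of
  \<open>d \<bullet> f = p \<bullet> f\<close> gives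
  \<open>f = f \<uplus> (u \<bullet> e \<bullet> f)\<close>. Cancellation leaves
  \<open>u \<bullet> e \<bullet> f = 0\<close>, and \<open>e \<bullet> u = idn []\<close> removes
  the unit.\<close>

lemma counit_primitive:
  assumes "hom f ws [A]" and "d \<bullet> f = p \<bullet> f"
  shows "e \<bullet> f = zero ws []"
proof -
  have [simp]: "ar f" "dm f = ws" "cd f = [A]"
    using assms by (simp_all add: hom_def)
  have "f = (lay [] e [A] \<bullet> d) \<bullet> f"
    unfolding d_counit_left by simp
  also have "\<dots> = lay [] e [A] \<bullet> p \<bullet> f"
    using assms(2) by simp
  also have "\<dots> = f \<uplus> (u \<bullet> e \<bullet> f)"
    by (simp add: p_def) (simp add: lay_nil)
  finally have "u \<bullet> e \<bullet> f = zero ws [A]"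
    using add_cancel[of f "u \<bullet> e \<bullet> f"] by simp
  then have "(e \<bullet> u) \<bullet> e \<bullet> f = e \<bullet> zero ws [A]"
    by simp
  then show ?thesis
    using hom_ob(1)[OF assms(1)] unfolding e_u by (simp add: comp_zero)
qed

text \<open>The restriction of the braiding to primitive elements must be invertible, so
  \<open>restrict\<close> is applied to \<open>c'\<close> as well. Composing a law for
  \<open>c\<close> with \<open>c'\<close> exchanges the sides: the first law comes from
  \<open>d_c_right\<close>, the second from \<open>d_c_left\<close>.\<close>

lemma inverse_naturality:
  "lay [] d [A] \<bullet> c' = lay [A] c' [] \<bullet> lay [] c' [A] \<bullet> lay [A] d []"
  "lay [A] d [] \<bullet> c' = lay [] c' [A] \<bullet> lay [A] c' [] \<bullet> lay [] d [A]"
  "c' \<bullet> lay [] u [A] = lay [A] u []"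
  "c' \<bullet> lay [A] u [] = lay [] u [A]"
proof -
  have "lay [] d [A] \<bullet> c' = lay [A] c' [] \<bullet> lay [] c' [A] \<bullet> (lay [] c [A] \<bullet> lay [A] c [] \<bullet> lay [] d [A]) \<bullet> c'"
    by simp
  also have "\<dots> = lay [A] c' [] \<bullet> lay [] c' [A] \<bullet> lay [A] d [] \<bullet> (c \<bullet> c')"
    unfolding d_c_right[symmetric] by (simp only: comp_assoc)
  finally show "lay [] d [A] \<bullet> c' = lay [A] c' [] \<bullet> lay [] c' [A] \<bullet> lay [A] d []"
    unfolding c_c' by simp
  have "lay [A] d [] \<bullet> c' = lay [] c' [A] \<bullet> lay [A] c' [] \<bullet> (lay [A] c [] \<bullet> lay [] c [A] \<bullet> lay [A] d []) \<bullet> c'"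
    by simp
  also have "\<dots> = lay [] c' [A] \<bullet> lay [A] c' [] \<bullet> lay [] d [A] \<bullet> (c \<bullet> c')"
    unfolding d_c_left[symmetric] by (simp only: comp_assoc)
  finally show "lay [A] d [] \<bullet> c' = lay [] c' [A] \<bullet> lay [A] c' [] \<bullet> lay [] d [A]"
    unfolding c_c' by simp
  have "c' \<bullet> lay [] u [A] = (c' \<bullet> c) \<bullet> lay [A] u []"
    by (simp only: comp_assoc c_u_right)
  then show "c' \<bullet> lay [] u [A] = lay [A] u []"
    unfolding c'_c by simp
  have "c' \<bullet> lay [A] u [] = (c' \<bullet> c) \<bullet> lay [] u [A]"
    by (simp only: comp_assoc c_u_left)
  then show "c' \<bullet> lay [A] u [] = lay [] u [A]"
    unfolding c'_c by simp
qed

end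

text \<open>As for coproducts, the universal property of the equalizer is required in every word
  context; in particular all layers of \<open>x\<close> are monic.\<close>

locale s_prim = s_bialg_add +
  fixes P and x
  assumes x_hom: "hom x [P] [A]" and d_x: "d \<bullet> x = p \<bullet> x"
    and P_ex: "hom h ws (xs @ A # ys) \<Longrightarrow> lay xs d ys \<bullet> h = lay xs p ys \<bullet> h \<Longrightarrow>
      \<exists>k. hom k ws (xs @ P # ys) \<and> lay xs x ys \<bullet> k = h"
    and P_mono: "hom k ws (xs @ P # ys) \<Longrightarrow> hom k' ws (xs @ P # ys) \<Longrightarrow>
      lay xs x ys \<bullet> k = lay xs x ys \<bullet> k' \<Longrightarrow> k = k'"
begin

lemmas [simp] = x_hom[THEN homD(1)] x_hom[THEN homD(2)] x_hom[THEN homD(3)]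

lemma ob_P [simp]: "ob P"
  using hom_ob(1)[OF x_hom] by simp

definition x2 where "x2 = lay [A] x [] \<bullet> lay [] x [P]"

lemma x2_hom: "hom x2 [P, P] [A, A]"
  by (simp add: x2_def hom_def)

lemmas [simp] = x2_hom[THEN homD(1)] x2_hom[THEN homD(2)] x2_hom[THEN homD(3)]

lemma x2_mono:
  assumes "hom k ws (xs @ P # P # ys)" "hom k' ws (xs @ P # P # ys)" "lay xs x2 ys \<bullet> k = lay xs x2 ys \<bullet> k'"
  shows "k = k'"
proof -
  have [simp]: "list_all ob xs" "list_all ob ys"
    using hom_ob(2)[OF assms(1)] by simp_all
  have "lay xs x (P # ys) \<bullet> k = lay xs x (P # ys) \<bullet> k'"
    by (rule P_mono[of _ ws "xs @ [A]" ys]) (use assms in \<open>auto simp: hom_def x2_def\<close>)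
  then show ?thesis
    by (rule P_mono[of k ws xs "P # ys" k', rotated 2]) (use assms in simp_all)
qed

lemma d_x_lay: "lay xs d ys \<bullet> lay xs x ys
  = (lay xs u (A # ys) \<bullet> lay xs x ys) \<uplus> (lay (xs @ [A]) u ys \<bullet> lay xs x ys)"
  using lay_cong[OF d_x, of xs ys] by (simp add: p_def)

text \<open>Kept general in \<open>b\<close> to serve for \<open>c\<close> and for
  \<open>c'\<close>. The two output strands are corestricted one after the other: \<open>k\<close>
  has values in \<open>P\<close> on the right strand only, and \<open>k'\<close> then achieves it on
  the left.\<close>

lemma restrict:
  assumes b_hom: "hom b [A, A] [A, A]"
    and b: "lay [] d [A] \<bullet> b = lay [A] b [] \<bullet> lay [] b [A] \<bullet> lay [A] d []"
      "lay [A] d [] \<bullet> b = lay [] b [A] \<bullet> lay [A] b [] \<bullet> lay [] d [A]"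
      "b \<bullet> lay [] u [A] = lay [A] u []" "b \<bullet> lay [A] u [] = lay [] u [A]"
  shows "\<exists>k. hom k [P, P] [P, P] \<and> x2 \<bullet> k = b \<bullet> x2"
proof -
  note [simp] = b_hom[THEN homD(1)] b_hom[THEN homD(2)] b_hom[THEN homD(3)]
  have b_lay: "lay xs d (A # ys) \<bullet> lay xs b ys = lay (xs @ [A]) b ys \<bullet> lay xs b (A # ys) \<bullet> lay (xs @ [A]) d ys"
      "xs' = xs @ [A] \<Longrightarrow> lay xs' d ys \<bullet> lay xs b ys = lay xs b (A # ys) \<bullet> lay (xs @ [A]) b ys \<bullet> lay xs d (A # ys)"
      "lay xs b ys \<bullet> lay xs u (A # ys) = lay (xs @ [A]) u ys"
      "xs' = xs @ [A] \<Longrightarrow> lay xs b ys \<bullet> lay xs' u ys = lay xs u (A # ys)" for xs xs' ys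
    using lay_cong[OF b(1), of xs ys] lay_cong[OF b(2), of xs ys]
      lay_cong[OF b(3), of xs ys] lay_cong[OF b(4), of xs ys] by simp_all
  note b_simps = b_lay b_lay[THEN tail, unfolded comp_assoc] layer[where f = b] d_x_lay
    d_x_lay[THEN tail, unfolded comp_assoc] p_def
  have "\<exists>k. hom k [P, A] ([A] @ P # []) \<and> lay [A] x [] \<bullet> k = b \<bullet> lay [] x [A]"
    by (rule P_ex) (simp_all add: hom_def b_simps)
  then obtain k where k: "hom k [P, A] [A, P]" "lay [A] x [] \<bullet> k = b \<bullet> lay [] x [A]"
    by auto
  note [simp] = k(1)[THEN homD(1)] k(1)[THEN homD(2)] k(1)[THEN homD(3)]
  \<comment> \<open>\<open>k\<close> is known only after \<open>x\<close> has been applied to its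
    right output. An arrow \<open>q\<close> on the left output commutes with that \<open>x\<close>,
    so \<open>q\<close> can be evaluated through \<open>b\<close>.\<close>
  have slide: "lay [A, A] x [] \<bullet> lay [] q [P] \<bullet> k = lay [] q [A] \<bullet> b \<bullet> lay [] x [A]" if "hom q [A] [A, A]" for q
  proof -
    have "lay [A, A] x [] \<bullet> lay [] q [P] = lay [] q [A] \<bullet> lay [A] x []"
      by (rule swap[where ys = "[]", symmetric]) (use that in \<open>simp_all add: hom_def\<close>)
    from tail[OF this, of k] show ?thesis
      using k(2) by simp
  qed
  have "\<exists>k'. hom k' [P, P] ([] @ P # [P]) \<and> lay [] x [P] \<bullet> k' = k \<bullet> lay [P] x []"
  proof (rule P_ex)
    show "lay [] d [P] \<bullet> k \<bullet> lay [P] x [] = lay [] p [P] \<bullet> k \<bullet> lay [P] x []"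
    \<comment> \<open>The equation is checked after \<open>x\<close> on the last strand, which is
      monic; only there can \<open>k\<close> be replaced by \<open>b\<close>.\<close>
    proof (rule P_mono[of _ "[P, P]" "[A, A]" "[]"])
      show "lay [A, A] x [] \<bullet> lay [] d [P] \<bullet> k \<bullet> lay [P] x [] = lay [A, A] x [] \<bullet> lay [] p [P] \<bullet> k \<bullet> lay [P] x []"
        unfolding slide[OF d_hom, THEN tail3] slide[OF p_hom, THEN tail3] by (simp add: b_simps)
    qed (simp_all add: hom_def p_def)
  qed (simp add: hom_def)
  then obtain k' where k': "hom k' [P, P] [P, P]" "lay [] x [P] \<bullet> k' = k \<bullet> lay [P] x []"
    by auto
  have "x2 \<bullet> k' = b \<bullet> x2"
    by (simp add: x2_def k'(2) k(2)[THEN tail])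
  with k'(1) show ?thesis by blast
qed

definition cP where "cP = (SOME k. hom k [P, P] [P, P] \<and> x2 \<bullet> k = c \<bullet> x2)"
definition cP' where "cP' = (SOME k. hom k [P, P] [P, P] \<and> x2 \<bullet> k = c' \<bullet> x2)"

lemma cP: "hom cP [P, P] [P, P] \<and> x2 \<bullet> cP = c \<bullet> x2"
  unfolding cP_def by (rule someI_ex, rule restrict[OF c_hom d_c_left d_c_right c_u_left c_u_right])

lemma cP': "hom cP' [P, P] [P, P] \<and> x2 \<bullet> cP' = c' \<bullet> x2"
  unfolding cP'_def by (rule someI_ex, rule restrict[OF c'_hom inverse_naturality])

lemma cP_unique: "hom k [P, P] [P, P] \<Longrightarrow> x2 \<bullet> k = c \<bullet> x2 \<Longrightarrow> k = cP"
  using x2_mono[of k "[P, P]" "[]" "[]" cP] cP by (simp add: lay_nil)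

lemma cP_lay: "lay xs x2 ys \<bullet> lay xs cP ys = lay xs c ys \<bullet> lay xs x2 ys"
  using lay_cong[OF cP[THEN conjunct2], of xs ys] by simp

sublocale P: s_br ob ar dm cd comp idn lay P cP cP'
proof
  note [simp] = cP[THEN conjunct1, THEN homD(1)] cP[THEN conjunct1, THEN homD(2)] cP[THEN conjunct1, THEN homD(3)]
    cP'[THEN conjunct1, THEN homD(1)] cP'[THEN conjunct1, THEN homD(2)] cP'[THEN conjunct1, THEN homD(3)]
  show "hom cP [P, P] [P, P]" "hom cP' [P, P] [P, P]"
    using cP cP' by auto
  have "x2 \<bullet> cP \<bullet> cP' = x2 \<bullet> idn [P, P]"
    using cP cP' tail[OF cP[THEN conjunct2], of cP'] by (simp add: tail[OF c_c'])
  then show "cP \<bullet> cP' = idn [P, P]"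
    by - (rule x2_mono[of _ "[P, P]" "[]" "[]"], simp_all add: hom_def lay_nil)
  have "x2 \<bullet> cP' \<bullet> cP = x2 \<bullet> idn [P, P]"
    using cP cP' tail[OF cP'[THEN conjunct2], of cP] by (simp add: tail[OF c'_c])
  then show "cP' \<bullet> cP = idn [P, P]"
    by - (rule x2_mono[of _ "[P, P]" "[]" "[]"], simp_all add: hom_def lay_nil)
  \<comment> \<open>The braid relation is compared after \<open>x\<close> on all three strands,
    where it is the one for \<open>c\<close>; then the last \<open>x\<close> and the remaining pair
    \<open>x2\<close> are cancelled.\<close>
  define x3 where "x3 = lay [A, A] x [] \<bullet> lay [A] x [P] \<bullet> lay [] x [P, P]"
  have [simp]: "ar x3" "dm x3 = [P, P, P]" "cd x3 = [A, A, A]"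
    by (simp_all add: x3_def)
  have x_cP: "xs' = xs @ [A] \<Longrightarrow> lay xs' x ys \<bullet> lay xs x (P # ys) \<bullet> lay xs cP ys
     = lay xs c ys \<bullet> lay xs' x ys \<bullet> lay xs x (P # ys)" for xs xs' ys
    using cP_lay[of xs ys] by (simp add: x2_def)
  have 1: "x3 \<bullet> lay [] cP [P] = lay [] c [A] \<bullet> x3"
    by (simp add: x3_def x_cP)
  have 2: "x3 \<bullet> lay [P] cP [] = lay [A] c [] \<bullet> x3"
    by (simp add: x3_def x_cP x_cP[THEN tail3, unfolded comp_assoc])
  have "x3 \<bullet> lay [] cP [P] \<bullet> lay [P] cP [] \<bullet> lay [] cP [P]
      = x3 \<bullet> lay [P] cP [] \<bullet> lay [] cP [P] \<bullet> lay [P] cP []"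
    by (simp add: 1 2 1[THEN tail] 2[THEN tail])
  then have "lay [] x2 [P] \<bullet> lay [] cP [P] \<bullet> lay [P] cP [] \<bullet> lay [] cP [P]
      = lay [] x2 [P] \<bullet> lay [P] cP [] \<bullet> lay [] cP [P] \<bullet> lay [P] cP []"
    by - (rule P_mono[of _ "[P, P, P]" "[A, A]" "[]"], simp_all add: hom_def x2_def x3_def)
  then show "lay [] cP [P] \<bullet> lay [P] cP [] \<bullet> lay [] cP [P] = lay [P] cP [] \<bullet> lay [] cP [P] \<bullet> lay [P] cP []"
    by - (rule x2_mono[of _ "[P, P, P]" "[]" "[P]"], simp_all add: hom_def)
qed

lemma restrict_br:
  assumes k: "hom k [V] [P]" and cV: "hom cV [V, V] [V, V]"
    and br: "c \<bullet> lay [A] (x \<bullet> k) [] \<bullet> lay [] (x \<bullet> k) [V] = lay [A] (x \<bullet> k) [] \<bullet> lay [] (x \<bullet> k) [V] \<bullet> cV"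
  shows "cP \<bullet> lay [P] k [] \<bullet> lay [] k [V] = lay [P] k [] \<bullet> lay [] k [V] \<bullet> cV"
proof -
  have [simp]: "ar k" "dm k = [V]" "cd k = [P]" "ar cV" "dm cV = [V, V]" "cd cV = [V, V]" "ob V"
    using k cV hom_ob(1)[OF k] by (simp_all add: hom_def)
  have "x2 \<bullet> cP \<bullet> lay [P] k [] \<bullet> lay [] k [V] = c \<bullet> lay [A] (x \<bullet> k) [] \<bullet> lay [] (x \<bullet> k) [V]"
    unfolding cP[THEN conjunct2, THEN tail] by (simp add: x2_def)
  also have "\<dots> = x2 \<bullet> lay [P] k [] \<bullet> lay [] k [V] \<bullet> cV"
    unfolding br by (simp add: x2_def)
  finally show ?thesis
    by - (rule x2_mono[of _ "[V, V]" "[]" "[]"], simp_all add: hom_def lay_nil)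
qed

end

section \<open>Extending primitive maps to bialgebra maps\<close>

locale s_bilift = s_tensor_add ob ar dm cd comp idn lay V c c' T i add zero +
    s_lift ob ar dm cd comp idn lay V c c' T i B mB uB cB cB' f F +
    B: s_bialg_add ob ar dm cd comp idn lay B mB uB cB cB' dB eB add zero
  for ob ar dm cd and comp (infixr "\<bullet>" 55) and idn lay V c c' T i
    and add (infixl "\<uplus>" 53) and zero B mB uB cB cB' dB eB f F +
  assumes f_prim: "dB \<bullet> f = B.p \<bullet> f"
begin

text \<open>Both sides are algebra maps into the braided tensor square of \<open>B\<close>; for the
  right-hand side this uses that \<open>F\<close> respects the braidings. On generators the equation
  says that \<open>f\<close> takes primitive values.\<close>

lemma F_d: "dB \<bullet> F = lay [B] F [] \<bullet> lay [] F [T] \<bullet> d"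
proof (rule alg_map_unique)
  have f_prim_lay: "lay xs dB ys \<bullet> lay xs f ys
    = (lay xs uB (B # ys) \<bullet> lay xs f ys) \<uplus> (lay (xs @ [B]) uB ys \<bullet> lay xs f ys)" for xs ys
    using lay_cong[OF f_prim, of xs ys] by (simp add: B.p_def)
  have F_i1_lay: "lay xs F ys \<bullet> lay xs (i (Suc 0)) ys = lay xs f ys" for xs ys
    using lay_cong[OF F_i1, of xs ys] by simp
  note simps = alg_map_def hom_def B.m2_def B.u2_def F_simps layer[where f = F] layer[where f = m] layer[where f = dB]
    layer[where f = u] layer[where f = d] layer[where f = "i (Suc 0)"]
    F_i1_lay F_i1_lay[THEN tail] f_prim_lay
  show "alg_map (dB \<bullet> F) [B, B] B.m2 B.u2"
    by (simp add: simps)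
  show "alg_map (lay [B] F [] \<bullet> lay [] F [T] \<bullet> d) [B, B] B.m2 B.u2"
    by (simp add: simps)
  show "(dB \<bullet> F) \<bullet> i 1 = (lay [B] F [] \<bullet> lay [] F [T] \<bullet> d) \<bullet> i 1"
    by (simp add: simps)
qed

text \<open>On generators the claim is that \<open>eB \<bullet> f\<close> vanishes, which
  \<open>counit_primitive\<close> derives from primitivity of \<open>f\<close>.\<close>

lemma F_e: "eB \<bullet> F = e"
proof (rule alg_map_unique)
  have "eB \<bullet> f = zero [V] []"
    by (rule B.counit_primitive[OF f_hom f_prim])
  then show "(eB \<bullet> F) \<bullet> i 1 = e \<bullet> i 1"
    using F_i1 e by simp
  show "alg_map e [] (idn []) (idn [])"
    using e by simp
  show "alg_map (eB \<bullet> F) [] (idn []) (idn [])"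
    by (simp add: alg_map_def hom_def F_simps layer[where f = F] layer[where f = eB] layer[where f = u] layer[where f = m])
qed

end

section \<open>Strictification of a monoidal category\<close>

context category begin

lemma HomD: "f \<in> Hom C X Y \<Longrightarrow> f \<in> Arr C" "f \<in> Hom C X Y \<Longrightarrow> Dom C f = X" "f \<in> Hom C X Y \<Longrightarrow> Cod C f = Y"
  by (simp_all add: Hom_def)

lemma Hom_Obj: "f \<in> Hom C X Y \<Longrightarrow> X \<in> Obj C" "f \<in> Hom C X Y \<Longrightarrow> Y \<in> Obj C"
  using Dom_Obj Cod_Obj by (auto simp: Hom_def)

lemma Comp_typing [simp]:
  assumes "f \<in> Arr C" "g \<in> Arr C" "Cod C f = Dom C g"
  shows "g \<cdot> f \<in> Arr C" "Dom C (g \<cdot> f) = Dom C f" "Cod C (g \<cdot> f) = Cod C g"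
  using Comp_Hom[of f "Dom C f" "Dom C g" g "Cod C g"] assms by (simp_all add: Hom_def)

lemma Ident_typing [simp]:
  assumes "X \<in> Obj C"
  shows "\<iota> X \<in> Arr C" "Dom C (\<iota> X) = X" "Cod C (\<iota> X) = X"
  using Ident_Hom[OF assms] by (simp_all add: Hom_def)

lemma Obj_typing [simp]: "f \<in> Arr C \<Longrightarrow> Dom C f \<in> Obj C" "f \<in> Arr C \<Longrightarrow> Cod C f \<in> Obj C"
  by (rule Dom_Obj, assumption) (rule Cod_Obj)

lemma Comp_assoc_simp [simp]:
  "f \<in> Arr C \<Longrightarrow> g \<in> Arr C \<Longrightarrow> h \<in> Arr C \<Longrightarrow> Cod C f = Dom C g \<Longrightarrow> Cod C g = Dom C h \<Longrightarrow>
    (h \<cdot> g) \<cdot> f = h \<cdot> (g \<cdot> f)"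
  using Comp_assoc[of f "Dom C f" "Dom C g" g "Dom C h" h "Cod C h"] by (simp add: Hom_def)

lemma Ident_simp [simp]:
  "f \<in> Arr C \<Longrightarrow> Y = Cod C f \<Longrightarrow> \<iota> Y \<cdot> f = f" "f \<in> Arr C \<Longrightarrow> X = Dom C f \<Longrightarrow> f \<cdot> \<iota> X = f"
  using Comp_Ident_left[of f "Dom C f" "Cod C f"] Comp_Ident_right[of f "Dom C f" "Cod C f"]
  by (simp_all add: Hom_def)

lemma inverse_unique: "inverse_arrows C f g \<Longrightarrow> inverse_arrows C f h \<Longrightarrow> g = h"
proof -
  assume *: "inverse_arrows C f g" "inverse_arrows C f h"
  then have [simp]: "f \<in> Arr C" "g \<in> Arr C" "h \<in> Arr C" "Dom C g = Cod C f" "Cod C g = Dom C f"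
      "Dom C h = Cod C f" "Cod C h = Dom C f"
    by (simp_all add: inverse_arrows_def Hom_def)
  have "g = g \<cdot> (f \<cdot> h)"
    using * by (simp add: inverse_arrows_def)
  also have "\<dots> = (g \<cdot> f) \<cdot> h"
    by simp
  also have "\<dots> = h"
    using * by (simp add: inverse_arrows_def del: Comp_assoc_simp)
  finally show ?thesis .
qed

lemma inv_arr: "is_iso C f \<Longrightarrow> inverse_arrows C f (inv_arr C f)"
  unfolding is_iso_def inv_arr_def using inverse_unique by (metis the_equality)

lemma inv_arr_simps [simp]:
  assumes "is_iso C f"
  shows "inv_arr C f \<in> Arr C" "Dom C (inv_arr C f) = Cod C f" "Cod C (inv_arr C f) = Dom C f"
    "inv_arr C f \<cdot> f = \<iota> (Dom C f)" "f \<cdot> inv_arr C f = \<iota> (Cod C f)"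
  using inv_arr[OF assms] by (simp_all add: inverse_arrows_def Hom_def)

lemma iso_Arr: "is_iso C f \<Longrightarrow> f \<in> Arr C"
  by (auto simp: is_iso_def inverse_arrows_def)

lemma iso_epi:
  assumes "is_iso C e" "f \<in> Arr C" "g \<in> Arr C" "Dom C f = Cod C e" "Dom C g = Cod C e" "f \<cdot> e = g \<cdot> e"
  shows "f = g"
proof -
  have [simp]: "e \<in> Arr C"
    using assms(1) by (rule iso_Arr)
  have "(h \<cdot> e) \<cdot> inv_arr C e = h" if "h \<in> Arr C" "Dom C h = Cod C e" for h
    using that assms(1) by simp
  then show ?thesis
    using assms by metis
qed

end

context monoidal_category begin

lemma tensor_typing [simp]:
  assumes "f \<in> Arr M" "g \<in> Arr M"
  shows "f \<otimes> g \<in> Arr M" "Dom M (f \<otimes> g) = Dom M f \<boxtimes> Dom M g" "Cod M (f \<otimes> g) = Cod M f \<boxtimes> Cod M g"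
  using tensor_Hom[of f "Dom M f" "Cod M f" g "Dom M g" "Cod M g"] assms by (simp_all add: Hom_def)

lemma tensor_Comp_simp [simp]:
  "f \<in> Arr M \<Longrightarrow> g \<in> Arr M \<Longrightarrow> f' \<in> Arr M \<Longrightarrow> g' \<in> Arr M \<Longrightarrow> Cod M f = Dom M g \<Longrightarrow> Cod M f' = Dom M g'
    \<Longrightarrow> (g \<otimes> g') \<cdot> (f \<otimes> f') = (g \<cdot> f) \<otimes> (g' \<cdot> f')"
  using tensor_Comp[of f "Dom M f" "Dom M g" g "Cod M g" f' "Dom M f'" "Dom M g'" g' "Cod M g'"]
  by (simp add: Hom_def)

lemma assoc_typing [simp]:
  assumes "X \<in> Obj M" "Y \<in> Obj M" "Z \<in> Obj M"
  shows "\<a> X Y Z \<in> Arr M" "Dom M (\<a> X Y Z) = (X \<boxtimes> Y) \<boxtimes> Z" "Cod M (\<a> X Y Z) = X \<boxtimes> (Y \<boxtimes> Z)"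
  using assoc_Hom[OF assms] by (simp_all add: Hom_def)

lemma unit_typing [simp]:
  assumes "X \<in> Obj M"
  shows "\<l> X \<in> Arr M" "Dom M (\<l> X) = \<I> \<boxtimes> X" "Cod M (\<l> X) = X"
    "\<r> X \<in> Arr M" "Dom M (\<r> X) = X \<boxtimes> \<I>" "Cod M (\<r> X) = X"
  using lunit_Hom[OF assms] runit_Hom[OF assms] by (simp_all add: Hom_def)

lemmas [simp] = unit_Obj tensor_Obj tensor_Ident assoc_iso lunit_iso runit_iso

lemma Arr_Hom: "f \<in> Arr M \<Longrightarrow> f \<in> Hom M (Dom M f) (Cod M f)"
  by (simp add: Hom_def)

lemma iso_tensor:
  assumes "is_iso M f" "is_iso M g"
  shows "is_iso M (f \<otimes> g)"
proof -
  have [simp]: "f \<in> Arr M" "g \<in> Arr M"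
    using assms iso_Arr by auto
  have "inverse_arrows M (f \<otimes> g) (inv_arr M f \<otimes> inv_arr M g)"
    using assms by (simp add: inverse_arrows_def Hom_def)
  then show ?thesis
    by (auto simp: is_iso_def)
qed

lemma iso_Ident: "X \<in> Obj M \<Longrightarrow> is_iso M (\<iota> X)"
  unfolding is_iso_def inverse_arrows_def by (rule exI[of _ "\<iota> X"]) (simp add: Hom_def)

lemma lunit_epi: "f \<in> Arr M \<Longrightarrow> g \<in> Arr M \<Longrightarrow> Dom M f = Dom M g \<Longrightarrow> Cod M f = Cod M g \<Longrightarrow>
    \<iota> \<I> \<otimes> f = \<iota> \<I> \<otimes> g \<Longrightarrow> f = g"
  using lunit_natural[OF Arr_Hom, of f] lunit_natural[OF Arr_Hom, of g]
  by - (rule iso_epi[of "\<l> (Dom M f)"], simp_all)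

lemma runit_epi: "f \<in> Arr M \<Longrightarrow> g \<in> Arr M \<Longrightarrow> Dom M f = Dom M g \<Longrightarrow> Cod M f = Cod M g \<Longrightarrow>
    f \<otimes> \<iota> \<I> = g \<otimes> \<iota> \<I> \<Longrightarrow> f = g"
  using runit_natural[OF Arr_Hom, of f] runit_natural[OF Arr_Hom, of g]
  by - (rule iso_epi[of "\<r> (Dom M f)"], simp_all)

lemma iso_Comp:
  assumes "is_iso M f" "is_iso M g" "Cod M f = Dom M g"
  shows "is_iso M (g \<cdot> f)"
proof -
  have [simp]: "f \<in> Arr M" "g \<in> Arr M"
    using assms iso_Arr by auto
  have 1: "inv_arr M g \<cdot> (g \<cdot> h) = h" if "h \<in> Arr M" "Cod M h = Dom M g" for h
    using that assms Comp_assoc_simp[of h g "inv_arr M g"] by (simp del: Comp_assoc_simp)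
  have 2: "f \<cdot> (inv_arr M f \<cdot> h) = h" if "h \<in> Arr M" "Cod M h = Cod M f" for h
    using that assms Comp_assoc_simp[of h "inv_arr M f" f] by (simp del: Comp_assoc_simp)
  have "inverse_arrows M (g \<cdot> f) (inv_arr M f \<cdot> inv_arr M g)"
    using assms by (simp add: inverse_arrows_def Hom_def 1 2)
  then show ?thesis
    by (auto simp: is_iso_def)
qed

text \<open>Kelly's coherence: tensoring both sides with the unit reduces it to the pentagon and the triangle.\<close>

lemma lunit_assoc:
  assumes [simp]: "X \<in> Obj M" "Y \<in> Obj M"
  shows "\<l> (X \<boxtimes> Y) \<cdot> \<a> \<I> X Y = \<l> X \<otimes> \<iota> Y"
proof (rule lunit_epi)
  let ?e = "\<a> \<I> (\<I> \<boxtimes> X) Y \<cdot> (\<a> \<I> \<I> X \<otimes> \<iota> Y)"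
  have e: "is_iso M ?e"
    by (intro iso_Comp iso_tensor iso_Ident assoc_iso) simp_all
  have "(\<iota> \<I> \<otimes> (\<l> (X \<boxtimes> Y) \<cdot> \<a> \<I> X Y)) \<cdot> ?e
    = (\<iota> \<I> \<otimes> \<l> (X \<boxtimes> Y)) \<cdot> ((\<iota> \<I> \<otimes> \<a> \<I> X Y) \<cdot> ?e)"
    using Comp_assoc_simp[of ?e "\<iota> \<I> \<otimes> \<a> \<I> X Y" "\<iota> \<I> \<otimes> \<l> (X \<boxtimes> Y)"] by (simp del: Comp_assoc_simp)
  also have "\<dots> = (\<iota> \<I> \<otimes> \<l> (X \<boxtimes> Y)) \<cdot> (\<a> \<I> \<I> (X \<boxtimes> Y) \<cdot> \<a> (\<I> \<boxtimes> \<I>) X Y)"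
    by (simp only: pentagon unit_Obj assms)
  also have "\<dots> = (\<r> \<I> \<otimes> \<iota> (X \<boxtimes> Y)) \<cdot> \<a> (\<I> \<boxtimes> \<I>) X Y"
    using triangle[of \<I> "X \<boxtimes> Y"]
      Comp_assoc_simp[of "\<a> (\<I> \<boxtimes> \<I>) X Y" "\<a> \<I> \<I> (X \<boxtimes> Y)" "\<iota> \<I> \<otimes> \<l> (X \<boxtimes> Y)"]
    by (simp del: Comp_assoc_simp)
  also have "\<dots> = \<a> \<I> X Y \<cdot> ((\<r> \<I> \<otimes> \<iota> X) \<otimes> \<iota> Y)"
    using assoc_natural[OF Arr_Hom Arr_Hom Arr_Hom, of "\<r> \<I>" "\<iota> X" "\<iota> Y"] by simp
  also have "\<dots> = \<a> \<I> X Y \<cdot> (((\<iota> \<I> \<otimes> \<l> X) \<otimes> \<iota> Y) \<cdot> (\<a> \<I> \<I> X \<otimes> \<iota> Y))"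
    using triangle[of \<I> X] by simp
  also have "\<dots> = (\<iota> \<I> \<otimes> (\<l> X \<otimes> \<iota> Y)) \<cdot> ?e"
    using assoc_natural[OF Arr_Hom Arr_Hom Arr_Hom, of "\<iota> \<I>" "\<l> X" "\<iota> Y"]
      Comp_assoc_simp[of "\<a> \<I> \<I> X \<otimes> \<iota> Y" "(\<iota> \<I> \<otimes> \<l> X) \<otimes> \<iota> Y" "\<a> \<I> X Y"]
      Comp_assoc_simp[of "\<a> \<I> \<I> X \<otimes> \<iota> Y" "\<a> \<I> (\<I> \<boxtimes> X) Y" "\<iota> \<I> \<otimes> (\<l> X \<otimes> \<iota> Y)"]
    by (simp del: Comp_assoc_simp tensor_Comp_simp)
  finally show "\<iota> \<I> \<otimes> (\<l> (X \<boxtimes> Y) \<cdot> \<a> \<I> X Y) = \<iota> \<I> \<otimes> (\<l> X \<otimes> \<iota> Y)"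
    by - (rule iso_epi[OF e], simp_all)
qed simp_all

section \<open>The action of words on objects\<close>

primrec act :: "'o list \<Rightarrow> 'o \<Rightarrow> 'o" where
  "act [] Z = Z"
| "act (X # xs) Z = X \<boxtimes> act xs Z"

primrec actm :: "'o list \<Rightarrow> 'a \<Rightarrow> 'a" where
  "actm [] f = f"
| "actm (X # xs) f = \<iota> X \<otimes> actm xs f"

text \<open>The isomorphism from \<open>act xs Z \<boxtimes> W\<close> to
  \<open>act xs (Z \<boxtimes> W)\<close> built from associators; it expresses that
  \<open>act xs\<close> commutes with tensoring on the right.\<close>

primrec assw :: "'o list \<Rightarrow> 'o \<Rightarrow> 'o \<Rightarrow> 'a" where
  "assw [] Z W = \<iota> (Z \<boxtimes> W)"
| "assw (X # xs) Z W = (\<iota> X \<otimes> assw xs Z W) \<cdot> \<a> X (act xs Z) W"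

abbreviation ob :: "'o \<Rightarrow> bool" where "ob X \<equiv> X \<in> Obj M"
abbreviation obs :: "'o list \<Rightarrow> bool" where "obs \<equiv> list_all ob"

lemma act_Obj [simp]: "obs xs \<Longrightarrow> ob Z \<Longrightarrow> ob (act xs Z)"
  by (induction xs) simp_all

lemma act_append [simp]: "act (xs @ ys) Z = act xs (act ys Z)"
  by (induction xs) simp_all

lemma actm_typing [simp]:
  "obs xs \<Longrightarrow> f \<in> Arr M \<Longrightarrow> actm xs f \<in> Arr M"
  "obs xs \<Longrightarrow> f \<in> Arr M \<Longrightarrow> Dom M (actm xs f) = act xs (Dom M f)"
  "obs xs \<Longrightarrow> f \<in> Arr M \<Longrightarrow> Cod M (actm xs f) = act xs (Cod M f)"
  by (induction xs) simp_all

lemma actm_append [simp]: "actm (xs @ ys) f = actm xs (actm ys f)"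
  by (induction xs) simp_all

lemma actm_Ident [simp]: "obs xs \<Longrightarrow> ob X \<Longrightarrow> actm xs (\<iota> X) = \<iota> (act xs X)"
  by (induction xs) simp_all

lemma actm_Comp: "obs xs \<Longrightarrow> f \<in> Arr M \<Longrightarrow> g \<in> Arr M \<Longrightarrow> Cod M f = Dom M g \<Longrightarrow>
  actm xs (g \<cdot> f) = actm xs g \<cdot> actm xs f"
  by (induction xs) simp_all

lemma assw_typing [simp]:
  "obs xs \<Longrightarrow> ob Z \<Longrightarrow> ob W \<Longrightarrow> assw xs Z W \<in> Arr M"
  "obs xs \<Longrightarrow> ob Z \<Longrightarrow> ob W \<Longrightarrow> Dom M (assw xs Z W) = act xs Z \<boxtimes> W"
  "obs xs \<Longrightarrow> ob Z \<Longrightarrow> ob W \<Longrightarrow> Cod M (assw xs Z W) = act xs (Z \<boxtimes> W)"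
  by (induction xs) simp_all

lemma assw_append: "obs xs \<Longrightarrow> obs ys \<Longrightarrow> ob Z \<Longrightarrow> ob W \<Longrightarrow>
  assw (xs @ ys) Z W = actm xs (assw ys Z W) \<cdot> assw xs (act ys Z) W"
proof (induction xs)
  case (Cons X xs)
  then show ?case
    using Comp_assoc_simp[of "\<a> X (act xs (act ys Z)) W" "\<iota> X \<otimes> assw xs (act ys Z) W" "\<iota> X \<otimes> actm xs (assw ys Z W)"]
    by (simp del: Comp_assoc_simp)
qed simp

lemma assw_natural: "obs xs \<Longrightarrow> f \<in> Arr M \<Longrightarrow> ob W \<Longrightarrow>
  actm xs (f \<otimes> \<iota> W) \<cdot> assw xs (Dom M f) W = assw xs (Cod M f) W \<cdot> (actm xs f \<otimes> \<iota> W)"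
proof (induction xs)
  case (Cons X xs)
  then have [simp]: "ob X" "obs xs" "f \<in> Arr M" "ob W" by simp_all
  have "actm (X # xs) (f \<otimes> \<iota> W) \<cdot> assw (X # xs) (Dom M f) W
    = (\<iota> X \<otimes> (assw xs (Cod M f) W \<cdot> (actm xs f \<otimes> \<iota> W))) \<cdot> \<a> X (act xs (Dom M f)) W"
    using Cons Comp_assoc_simp[of "\<a> X (act xs (Dom M f)) W" "\<iota> X \<otimes> assw xs (Dom M f) W" "\<iota> X \<otimes> actm xs (f \<otimes> \<iota> W)"]
    by (simp del: Comp_assoc_simp)
  also have "\<dots> = (\<iota> X \<otimes> assw xs (Cod M f) W) \<cdot> ((\<iota> X \<otimes> (actm xs f \<otimes> \<iota> W)) \<cdot> \<a> X (act xs (Dom M f)) W)"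
    using Comp_assoc_simp[of "\<a> X (act xs (Dom M f)) W" "\<iota> X \<otimes> (actm xs f \<otimes> \<iota> W)" "\<iota> X \<otimes> assw xs (Cod M f) W"]
    by (simp del: Comp_assoc_simp)
  also have "(\<iota> X \<otimes> (actm xs f \<otimes> \<iota> W)) \<cdot> \<a> X (act xs (Dom M f)) W
     = \<a> X (act xs (Cod M f)) W \<cdot> ((\<iota> X \<otimes> actm xs f) \<otimes> \<iota> W)"
    using assoc_natural[OF Arr_Hom Arr_Hom Arr_Hom, of "\<iota> X" "actm xs f" "\<iota> W"] by simp
  finally show ?case
    using Comp_assoc_simp[of "(\<iota> X \<otimes> actm xs f) \<otimes> \<iota> W" "\<a> X (act xs (Cod M f)) W" "\<iota> X \<otimes> assw xs (Cod M f) W"]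
    by (simp del: Comp_assoc_simp)
qed simp

text \<open>An arrow between words is a transformation between the functors \<open>act xs\<close> and \<open>act ys\<close> which
  is compatible with tensoring on the right. On these functors whiskering is strictly associative.\<close>

definition warrow :: "'o list \<Rightarrow> ('o \<Rightarrow> 'a) \<Rightarrow> 'o list \<Rightarrow> bool" where
  "warrow xs \<phi> ys \<longleftrightarrow> obs xs \<and> obs ys \<and> (\<forall>Z. \<not> ob Z \<longrightarrow> \<phi> Z = undefined) \<and>
     (\<forall>Z. ob Z \<longrightarrow> \<phi> Z \<in> Arr M \<and> Dom M (\<phi> Z) = act xs Z \<and> Cod M (\<phi> Z) = act ys Z) \<and>
     (\<forall>f. f \<in> Arr M \<longrightarrow> \<phi> (Cod M f) \<cdot> actm xs f = actm ys f \<cdot> \<phi> (Dom M f)) \<and>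
     (\<forall>Z W. ob Z \<longrightarrow> ob W \<longrightarrow> \<phi> (Z \<boxtimes> W) \<cdot> assw xs Z W = assw ys Z W \<cdot> (\<phi> Z \<otimes> \<iota> W))"

text \<open>Values outside the objects are fixed, so that transformations agreeing on all objects
  are equal as functions.\<close>

definition restr :: "('o \<Rightarrow> 'a) \<Rightarrow> 'o \<Rightarrow> 'a" where
  "restr \<phi> = (\<lambda>Z. if ob Z then \<phi> Z else undefined)"

lemma warrowI:
  assumes "obs xs" "obs ys" "\<And>Z. ob Z \<Longrightarrow> \<phi> Z \<in> Arr M" "\<And>Z. ob Z \<Longrightarrow> Dom M (\<phi> Z) = act xs Z"
    "\<And>Z. ob Z \<Longrightarrow> Cod M (\<phi> Z) = act ys Z"
    "\<And>f. f \<in> Arr M \<Longrightarrow> \<phi> (Cod M f) \<cdot> actm xs f = actm ys f \<cdot> \<phi> (Dom M f)"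
    "\<And>Z W. ob Z \<Longrightarrow> ob W \<Longrightarrow> \<phi> (Z \<boxtimes> W) \<cdot> assw xs Z W = assw ys Z W \<cdot> (\<phi> Z \<otimes> \<iota> W)"
  shows "warrow xs (restr \<phi>) ys"
  using assms by (simp add: warrow_def restr_def)

lemma warrow_comp:
  assumes "warrow xs \<phi> ys" "warrow ys \<psi> zs"
  shows "warrow xs (restr (\<lambda>Z. \<psi> Z \<cdot> \<phi> Z)) zs"
proof (rule warrowI)
  note [simp] = assms[unfolded warrow_def]
  fix f assume [simp]: "f \<in> Arr M"
  have "(\<psi> (Cod M f) \<cdot> \<phi> (Cod M f)) \<cdot> actm xs f = \<psi> (Cod M f) \<cdot> (actm ys f \<cdot> \<phi> (Dom M f))"
    by simp
  also have "\<dots> = (\<psi> (Cod M f) \<cdot> actm ys f) \<cdot> \<phi> (Dom M f)"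
    by (subst Comp_assoc_simp) simp_all
  also have "\<dots> = actm zs f \<cdot> (\<psi> (Dom M f) \<cdot> \<phi> (Dom M f))"
    by simp
  finally show "(\<psi> (Cod M f) \<cdot> \<phi> (Cod M f)) \<cdot> actm xs f = actm zs f \<cdot> (\<psi> (Dom M f) \<cdot> \<phi> (Dom M f))" .
next
  note [simp] = assms[unfolded warrow_def]
  fix Z W assume [simp]: "ob Z" "ob W"
  have "(\<psi> (Z \<boxtimes> W) \<cdot> \<phi> (Z \<boxtimes> W)) \<cdot> assw xs Z W = \<psi> (Z \<boxtimes> W) \<cdot> (assw ys Z W \<cdot> (\<phi> Z \<otimes> \<iota> W))"
    by simp
  also have "\<dots> = (\<psi> (Z \<boxtimes> W) \<cdot> assw ys Z W) \<cdot> (\<phi> Z \<otimes> \<iota> W)"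
    by (subst Comp_assoc_simp) simp_all
  also have "\<dots> = assw zs Z W \<cdot> ((\<psi> Z \<cdot> \<phi> Z) \<otimes> \<iota> W)"
    by simp
  finally show "(\<psi> (Z \<boxtimes> W) \<cdot> \<phi> (Z \<boxtimes> W)) \<cdot> assw xs Z W = assw zs Z W \<cdot> ((\<psi> Z \<cdot> \<phi> Z) \<otimes> \<iota> W)" .
qed (use assms[unfolded warrow_def] in simp_all)

lemma warrow_idn: "obs xs \<Longrightarrow> warrow xs (restr (\<lambda>Z. \<iota> (act xs Z))) xs"
  by (rule warrowI) simp_all

lemma warrow_lay:
  assumes "warrow us \<phi> vs" "obs xs" "obs ys"
  shows "warrow (xs @ us @ ys) (restr (\<lambda>Z. actm xs (\<phi> (act ys Z)))) (xs @ vs @ ys)"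
proof (rule warrowI)
  note [simp] = assms(2,3) assms(1)[unfolded warrow_def]
  fix f assume [simp]: "f \<in> Arr M"
  have "\<phi> (act ys (Cod M f)) \<cdot> actm us (actm ys f) = actm vs (actm ys f) \<cdot> \<phi> (act ys (Dom M f))"
    using assms(1)[unfolded warrow_def, THEN conjunct2, THEN conjunct2, THEN conjunct2, THEN conjunct2,
      THEN conjunct1, rule_format, of "actm ys f"] by simp
  then show "actm xs (\<phi> (act ys (Cod M f))) \<cdot> actm (xs @ us @ ys) f
     = actm (xs @ vs @ ys) f \<cdot> actm xs (\<phi> (act ys (Dom M f)))"
    by (simp add: actm_Comp[symmetric])
next
  note [simp] = assms(2,3) assms(1)[unfolded warrow_def]
  fix Z W assume [simp]: "ob Z" "ob W"
  let ?Y = "act ys Z"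
  \<comment> \<open>Whiskering by \<open>ys\<close> on the right changes the argument of
    \<open>\<phi>\<close>, and the associators of \<open>ys\<close> then appear as an arrow at which
    \<open>\<phi>\<close> is natural.\<close>
  have 1: "\<phi> (act ys (Z \<boxtimes> W)) \<cdot> actm us (assw ys Z W) = actm vs (assw ys Z W) \<cdot> \<phi> (?Y \<boxtimes> W)"
    using assms(1)[unfolded warrow_def, THEN conjunct2, THEN conjunct2, THEN conjunct2, THEN conjunct2,
      THEN conjunct1, rule_format, of "assw ys Z W"] by simp
  have 2: "\<phi> (act ys (Z \<boxtimes> W)) \<cdot> assw (us @ ys) Z W = assw (vs @ ys) Z W \<cdot> (\<phi> ?Y \<otimes> \<iota> W)"
  proof -
    have "\<phi> (act ys (Z \<boxtimes> W)) \<cdot> assw (us @ ys) Z W = (\<phi> (act ys (Z \<boxtimes> W)) \<cdot> actm us (assw ys Z W)) \<cdot> assw us ?Y W"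
      by (subst Comp_assoc_simp) (simp_all add: assw_append)
    also have "\<dots> = actm vs (assw ys Z W) \<cdot> (\<phi> (?Y \<boxtimes> W) \<cdot> assw us ?Y W)"
      unfolding 1 by (subst Comp_assoc_simp) simp_all
    also have "\<dots> = assw (vs @ ys) Z W \<cdot> (\<phi> ?Y \<otimes> \<iota> W)"
      by (simp add: assw_append)
    finally show ?thesis .
  qed
  have "actm xs (\<phi> (act ys (Z \<boxtimes> W))) \<cdot> assw (xs @ us @ ys) Z W
    = actm xs (\<phi> (act ys (Z \<boxtimes> W)) \<cdot> assw (us @ ys) Z W) \<cdot> assw xs (act us ?Y) W"
    by (simp add: assw_append[of xs "us @ ys"] actm_Comp)
  also have "\<dots> = actm xs (assw (vs @ ys) Z W) \<cdot> (actm xs (\<phi> ?Y \<otimes> \<iota> W) \<cdot> assw xs (act us ?Y) W)"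
    unfolding 2 by (simp add: actm_Comp)
  also have "actm xs (\<phi> ?Y \<otimes> \<iota> W) \<cdot> assw xs (act us ?Y) W = assw xs (act vs ?Y) W \<cdot> (actm xs (\<phi> ?Y) \<otimes> \<iota> W)"
    using assw_natural[of xs "\<phi> ?Y" W] by simp
  finally show "actm xs (\<phi> (act ys (Z \<boxtimes> W))) \<cdot> assw (xs @ us @ ys) Z W
     = assw (xs @ vs @ ys) Z W \<cdot> (actm xs (\<phi> ?Y) \<otimes> \<iota> W)"
    by (simp add: assw_append[of xs "vs @ ys"])
qed (use assms[unfolded warrow_def] in simp_all)

end

section \<open>The strict monoidal category of words\<close>

type_synonym ('o, 'a) warr = "('o list \<times> ('o \<Rightarrow> 'a) \<times> 'o list) option"

context monoidal_category begin

definition ar :: "('o, 'a) warr \<Rightarrow> bool" where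
  "ar a \<longleftrightarrow> (case a of None \<Rightarrow> False | Some (xs, \<phi>, ys) \<Rightarrow> warrow xs \<phi> ys)"

definition dm :: "('o, 'a) warr \<Rightarrow> 'o list" where "dm a = fst (the a)"
definition cd :: "('o, 'a) warr \<Rightarrow> 'o list" where "cd a = snd (snd (the a))"
definition ev :: "('o, 'a) warr \<Rightarrow> 'o \<Rightarrow> 'a" where "ev a = fst (snd (the a))"

definition wcomp :: "('o, 'a) warr \<Rightarrow> ('o, 'a) warr \<Rightarrow> ('o, 'a) warr" (infixr "\<bullet>" 55) where
  "b \<bullet> a = (if ar b \<and> ar a \<and> dm b = cd a then Some (dm a, restr (\<lambda>Z. ev b Z \<cdot> ev a Z), cd b) else None)"

definition idn :: "'o list \<Rightarrow> ('o, 'a) warr" where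
  "idn xs = (if obs xs then Some (xs, restr (\<lambda>Z. \<iota> (act xs Z)), xs) else None)"

definition lay :: "'o list \<Rightarrow> ('o, 'a) warr \<Rightarrow> 'o list \<Rightarrow> ('o, 'a) warr" where
  "lay xs a ys = (if obs xs \<and> ar a \<and> obs ys
     then Some (xs @ dm a @ ys, restr (\<lambda>Z. actm xs (ev a (act ys Z))), xs @ cd a @ ys) else None)"

lemma ar_Some: "ar (Some (xs, \<phi>, ys)) = warrow xs \<phi> ys" and not_ar_None: "\<not> ar None"
  by (simp_all add: ar_def)

lemma Some_sel: "dm (Some (xs, \<phi>, ys)) = xs" "cd (Some (xs, \<phi>, ys)) = ys" "ev (Some (xs, \<phi>, ys)) = \<phi>"
  by (simp_all add: dm_def cd_def ev_def)

lemma ar_warrow: "ar a \<Longrightarrow> warrow (dm a) (ev a) (cd a)"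
  by (auto simp: ar_def dm_def cd_def ev_def split: option.splits)

lemma ev_typing [simp]:
  assumes "ar a" "ob Z"
  shows "ev a Z \<in> Arr M" "Dom M (ev a Z) = act (dm a) Z" "Cod M (ev a Z) = act (cd a) Z"
  using ar_warrow[OF assms(1)] assms(2) by (simp_all add: warrow_def)

lemma ev_natural: "ar a \<Longrightarrow> f \<in> Arr M \<Longrightarrow> ev a (Cod M f) \<cdot> actm (dm a) f = actm (cd a) f \<cdot> ev a (Dom M f)"
  and ev_module: "ar a \<Longrightarrow> ob Z \<Longrightarrow> ob W \<Longrightarrow>
    ev a (Z \<boxtimes> W) \<cdot> assw (dm a) Z W = assw (cd a) Z W \<cdot> (ev a Z \<otimes> \<iota> W)"
  using ar_warrow by (simp_all add: warrow_def)

lemma warr_eqI: "ar a \<Longrightarrow> ar b \<Longrightarrow> dm a = dm b \<Longrightarrow> cd a = cd b \<Longrightarrow> (\<And>Z. ob Z \<Longrightarrow> ev a Z = ev b Z) \<Longrightarrow> a = b"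
  by (cases a; cases b) (auto simp: not_ar_None ar_Some Some_sel warrow_def fun_eq_iff, metis)

lemma not_ar: "\<not> ar (b \<bullet> a) \<Longrightarrow> b \<bullet> a = None" "\<not> ar (lay xs a ys) \<Longrightarrow> lay xs a ys = None" "\<not> ar (idn xs) \<Longrightarrow> idn xs = None"
proof -
  show "\<not> ar (b \<bullet> a) \<Longrightarrow> b \<bullet> a = None"
    using warrow_comp[OF ar_warrow, of a "ev b" "cd b"] ar_warrow[of b] by (auto simp: wcomp_def ar_Some split: if_splits)
  show "\<not> ar (lay xs a ys) \<Longrightarrow> lay xs a ys = None"
    using warrow_lay[OF ar_warrow, of a xs ys] by (auto simp: lay_def ar_Some split: if_splits)
  show "\<not> ar (idn xs) \<Longrightarrow> idn xs = None"
    using warrow_idn[of xs] by (auto simp: idn_def ar_Some split: if_splits)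
qed

lemma w_ar_comp: "ar (b \<bullet> a) \<longleftrightarrow> ar b \<and> ar a \<and> dm b = cd a"
  using warrow_comp[OF ar_warrow, of a "ev b" "cd b"] ar_warrow[of b] by (auto simp: wcomp_def ar_Some not_ar_None)

lemma w_ar_lay: "ar (lay xs a ys) \<longleftrightarrow> obs xs \<and> ar a \<and> obs ys"
  using warrow_lay[OF ar_warrow, of a xs ys] by (auto simp: lay_def ar_Some not_ar_None)

lemma w_ar_idn: "ar (idn xs) \<longleftrightarrow> obs xs"
  using warrow_idn[of xs] by (auto simp: idn_def ar_Some not_ar_None)

lemma w_sel:
  "ar b \<Longrightarrow> ar a \<Longrightarrow> dm b = cd a \<Longrightarrow> dm (b \<bullet> a) = dm a \<and> cd (b \<bullet> a) = cd b"
  "obs xs \<Longrightarrow> ar a \<Longrightarrow> obs ys \<Longrightarrow> dm (lay xs a ys) = xs @ dm a @ ys \<and> cd (lay xs a ys) = xs @ cd a @ ys"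
  "obs xs \<Longrightarrow> dm (idn xs) = xs \<and> cd (idn xs) = xs"
  by (simp_all add: wcomp_def lay_def idn_def Some_sel)

lemma w_ev:
  "ar b \<Longrightarrow> ar a \<Longrightarrow> dm b = cd a \<Longrightarrow> ob Z \<Longrightarrow> ev (b \<bullet> a) Z = ev b Z \<cdot> ev a Z"
  "obs xs \<Longrightarrow> ar a \<Longrightarrow> obs ys \<Longrightarrow> ob Z \<Longrightarrow> ev (lay xs a ys) Z = actm xs (ev a (act ys Z))"
  "obs xs \<Longrightarrow> ob Z \<Longrightarrow> ev (idn xs) Z = \<iota> (act xs Z)"
  by (simp_all add: wcomp_def lay_def idn_def Some_sel restr_def)

text \<open>Equality also for ill-typed expressions, where both sides are the junk value
  \<open>None\<close>. This gives the laws of the strict category that carry no typing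
  hypotheses.\<close>

lemma warr_eqI': "(ar a \<longleftrightarrow> ar b) \<Longrightarrow> (\<not> ar a \<Longrightarrow> a = None) \<Longrightarrow> (\<not> ar b \<Longrightarrow> b = None) \<Longrightarrow>
  (ar a \<Longrightarrow> ar b \<Longrightarrow> dm a = dm b \<and> cd a = cd b \<and> (\<forall>Z. ob Z \<longrightarrow> ev a Z = ev b Z)) \<Longrightarrow> a = b"
  using warr_eqI by metis

lemma w_ob: "ar a \<Longrightarrow> obs (dm a)" "ar a \<Longrightarrow> obs (cd a)"
  using ar_warrow by (auto simp: warrow_def)

end

context monoidal_category begin

sublocale W: strict_monoidal ob ar dm cd wcomp idn lay
proof
  note [simp] = w_ar_comp w_ar_lay w_ar_idn w_sel w_ev w_ob
  fix f g h :: "('o, 'a) warr" and xs ys us vs ws zs :: "'o list"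
  show "(h \<bullet> g) \<bullet> f = h \<bullet> (g \<bullet> f)"
    by (rule warr_eqI', (simp cong: conj_cong; blast?), erule not_ar, erule not_ar, simp cong: conj_cong)
  show "ar (g \<bullet> f) \<longleftrightarrow> ar g \<and> ar f \<and> dm g = cd f" "ar (idn xs) \<longleftrightarrow> list_all ob xs"
    "ar (lay xs f ys) \<longleftrightarrow> list_all ob xs \<and> ar f \<and> list_all ob ys"
    by simp_all
  show "ar f \<Longrightarrow> list_all ob (dm f)" "ar f \<Longrightarrow> list_all ob (cd f)"
    by simp_all
  show "lay xs (lay us f vs) ys = lay (xs @ us) f (vs @ ys)"
    by (rule warr_eqI', (simp cong: conj_cong; blast?), erule not_ar, erule not_ar, simp cong: conj_cong)
  show "lay xs (g \<bullet> f) ys = lay xs g ys \<bullet> lay xs f ys"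
    by (rule warr_eqI', (simp cong: conj_cong; blast?), erule not_ar, erule not_ar, simp add: actm_Comp cong: conj_cong)
  show "ar f \<Longrightarrow> lay [] f [] = f"
    by (rule warr_eqI) simp_all
  show "lay xs (idn ws) ys = idn (xs @ ws @ ys)"
    by (rule warr_eqI', (simp cong: conj_cong; blast?), erule not_ar, erule not_ar, simp cong: conj_cong)
  show "ar f \<Longrightarrow> ws = xs @ dm f @ ys \<Longrightarrow> lay xs f ys \<bullet> idn ws = lay xs f ys"
    "ar f \<Longrightarrow> ws = xs @ cd f @ ys \<Longrightarrow> idn ws \<bullet> lay xs f ys = lay xs f ys"
    by (rule warr_eqI', (simp cong: conj_cong; blast?), erule not_ar, erule not_ar, simp cong: conj_cong)+
  show "lay xs f (ys @ cd g @ zs) \<bullet> lay (xs @ dm f @ ys) g zs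
        = lay (xs @ cd f @ ys) g zs \<bullet> lay xs f (ys @ dm g @ zs)" if "ar f" "ar g"
  proof (rule warr_eqI', goal_cases)
    case 2
    then show ?case by (rule not_ar)
  next
    case 3
    then show ?case by (rule not_ar)
  next
    case 4
    \<comment> \<open>Interchange is naturality of \<open>ev f\<close> at the arrow by which
      \<open>g\<close>, whiskered by \<open>ys\<close>, acts on objects.\<close>
    have "ev f (act (ys @ cd g) (act zs Z)) \<cdot> actm (dm f) (actm ys (ev g (act zs Z)))
      = actm (cd f) (actm ys (ev g (act zs Z))) \<cdot> ev f (act (ys @ dm g) (act zs Z))" if "ob Z" for Z
      using 4 that ev_natural[of f "actm ys (ev g (act zs Z))"] by simp
    with 4 show ?case by (simp add: actm_Comp[symmetric])
  qed (use that in auto)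
qed (simp_all add: w_sel)

lemmas [simp] = w_ev

lemma warrow_inverse:
  assumes a: "ar a" and iso: "\<And>Z. ob Z \<Longrightarrow> is_iso M (ev a Z)"
  shows "warrow (cd a) (restr (\<lambda>Z. inv_arr M (ev a Z))) (dm a)"
proof (rule warrowI)
  note [simp] = a iso w_ob
  fix f assume [simp]: "f \<in> Arr M"
  let ?X = "Dom M f" and ?Y = "Cod M f"
  have "(inv_arr M (ev a ?Y) \<cdot> actm (cd a) f) \<cdot> ev a ?X = inv_arr M (ev a ?Y) \<cdot> (ev a ?Y \<cdot> actm (dm a) f)"
    using ev_natural[OF a, of f] by simp
  also have "\<dots> = (inv_arr M (ev a ?Y) \<cdot> ev a ?Y) \<cdot> actm (dm a) f"
    by (subst Comp_assoc_simp) simp_all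
  also have "\<dots> = (actm (dm a) f \<cdot> inv_arr M (ev a ?X)) \<cdot> ev a ?X"
    by simp
  finally show "inv_arr M (ev a ?Y) \<cdot> actm (cd a) f = actm (dm a) f \<cdot> inv_arr M (ev a ?X)"
    by - (rule iso_epi[of "ev a ?X"], simp_all)
next
  note [simp] = a iso w_ob
  fix Z W assume [simp]: "ob Z" "ob W"
  have "(inv_arr M (ev a (Z \<boxtimes> W)) \<cdot> assw (cd a) Z W) \<cdot> (ev a Z \<otimes> \<iota> W)
    = inv_arr M (ev a (Z \<boxtimes> W)) \<cdot> (ev a (Z \<boxtimes> W) \<cdot> assw (dm a) Z W)"
    using ev_module[OF a, of Z W] by simp
  also have "\<dots> = (inv_arr M (ev a (Z \<boxtimes> W)) \<cdot> ev a (Z \<boxtimes> W)) \<cdot> assw (dm a) Z W"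
    by (subst Comp_assoc_simp) simp_all
  also have "\<dots> = (assw (dm a) Z W \<cdot> (inv_arr M (ev a Z) \<otimes> \<iota> W)) \<cdot> (ev a Z \<otimes> \<iota> W)"
    by simp
  finally show "inv_arr M (ev a (Z \<boxtimes> W)) \<cdot> assw (cd a) Z W = assw (dm a) Z W \<cdot> (inv_arr M (ev a Z) \<otimes> \<iota> W)"
    by - (rule iso_epi[of "ev a Z \<otimes> \<iota> W"], simp_all add: iso_tensor iso_Ident)
qed (use a iso in \<open>simp_all add: w_ob\<close>)

section \<open>The full and faithful embedding into words\<close>

definition up :: "'a \<Rightarrow> ('o, 'a) warr" where
  "up f = (if f \<in> Arr M then Some ([Dom M f], restr (\<lambda>Z. f \<otimes> \<iota> Z), [Cod M f]) else None)"

text \<open>The letter \<open>X \<boxtimes> Y\<close> tensors with the product, the word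
  \<open>[X, Y]\<close> tensors twice, so the component is an associator; its compatibility with
  tensoring on the right is the pentagon. \<open>merge\<close> is the inverse.\<close>

definition split :: "'o \<Rightarrow> 'o \<Rightarrow> ('o, 'a) warr" where
  "split X Y = Some ([X \<boxtimes> Y], restr (\<lambda>Z. \<a> X Y Z), [X, Y])"

definition merge :: "'o \<Rightarrow> 'o \<Rightarrow> ('o, 'a) warr" where
  "merge X Y = Some ([X, Y], restr (\<lambda>Z. inv_arr M (\<a> X Y Z)), [X \<boxtimes> Y])"

text \<open>The left unitor identifies the letter \<open>\<I>\<close> with the empty word. Its
  compatibility with tensoring on the right is the coherence law \<open>lunit_assoc\<close>.\<close>

definition delI :: "('o, 'a) warr" where "delI = Some ([\<I>], restr (\<lambda>Z. \<l> Z), [])"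
definition insI :: "('o, 'a) warr" where "insI = Some ([], restr (\<lambda>Z. inv_arr M (\<l> Z)), [\<I>])"

lemma up_ar: "ar (up f) \<longleftrightarrow> f \<in> Arr M"
proof -
  have "warrow [Dom M f] (restr (\<lambda>Z. f \<otimes> \<iota> Z)) [Cod M f]" if [simp]: "f \<in> Arr M"
  proof (rule warrowI)
    fix g assume [simp]: "g \<in> Arr M"
    show "f \<otimes> \<iota> (Cod M g) \<cdot> actm [Dom M f] g = actm [Cod M f] g \<cdot> f \<otimes> \<iota> (Dom M g)"
      by simp
  next
    fix Z W assume [simp]: "ob Z" "ob W"
    show "f \<otimes> \<iota> (Z \<boxtimes> W) \<cdot> assw [Dom M f] Z W = assw [Cod M f] Z W \<cdot> (f \<otimes> \<iota> Z) \<otimes> \<iota> W"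
      using assoc_natural[OF Arr_Hom Arr_Hom Arr_Hom, of f "\<iota> Z" "\<iota> W"] by simp
  qed simp_all
  then show ?thesis
    by (auto simp: up_def ar_Some not_ar_None)
qed

lemma up [simp]:
  "f \<in> Arr M \<Longrightarrow> ar (up f)" "f \<in> Arr M \<Longrightarrow> dm (up f) = [Dom M f]" "f \<in> Arr M \<Longrightarrow> cd (up f) = [Cod M f]"
  "f \<in> Arr M \<Longrightarrow> ob Z \<Longrightarrow> ev (up f) Z = f \<otimes> \<iota> Z"
  by (simp_all add: up_ar) (simp_all add: up_def Some_sel restr_def)

lemma split [simp]:
  assumes "ob X" "ob Y"
  shows "ar (split X Y)" "dm (split X Y) = [X \<boxtimes> Y]" "cd (split X Y) = [X, Y]"
    "ob Z \<Longrightarrow> ev (split X Y) Z = \<a> X Y Z"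
proof -
  have "warrow [X \<boxtimes> Y] (restr (\<lambda>Z. \<a> X Y Z)) [X, Y]"
  proof (rule warrowI)
    note [simp] = assms
    fix f assume [simp]: "f \<in> Arr M"
    show "\<a> X Y (Cod M f) \<cdot> actm [X \<boxtimes> Y] f = actm [X, Y] f \<cdot> \<a> X Y (Dom M f)"
      using assoc_natural[OF Arr_Hom Arr_Hom Arr_Hom, of "\<iota> X" "\<iota> Y" f] by simp
  next
    note [simp] = assms
    fix Z W assume [simp]: "ob Z" "ob W"
    show "\<a> X Y (Z \<boxtimes> W) \<cdot> assw [X \<boxtimes> Y] Z W = assw [X, Y] Z W \<cdot> \<a> X Y Z \<otimes> \<iota> W"
      using pentagon[of X Y Z W] by simp
  qed (use assms in simp_all)
  then show "ar (split X Y)" "dm (split X Y) = [X \<boxtimes> Y]" "cd (split X Y) = [X, Y]"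
    "ob Z \<Longrightarrow> ev (split X Y) Z = \<a> X Y Z"
    by (simp_all add: split_def ar_Some Some_sel restr_def)
qed

lemma delI [simp]: "ar delI" "dm delI = [\<I>]" "cd delI = []" "ob Z \<Longrightarrow> ev delI Z = \<l> Z"
proof -
  have "warrow [\<I>] (restr (\<lambda>Z. \<l> Z)) []"
  proof (rule warrowI)
    fix f assume [simp]: "f \<in> Arr M"
    show "\<l> (Cod M f) \<cdot> actm [\<I>] f = actm [] f \<cdot> \<l> (Dom M f)"
      using lunit_natural[OF Arr_Hom, of f] by simp
  qed (simp_all add: lunit_assoc)
  then show "ar delI" "dm delI = [\<I>]" "cd delI = []" "ob Z \<Longrightarrow> ev delI Z = \<l> Z"
    by (simp_all add: delI_def ar_Some Some_sel restr_def)
qed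

lemma merge [simp]:
  assumes "ob X" "ob Y"
  shows "ar (merge X Y)" "dm (merge X Y) = [X, Y]" "cd (merge X Y) = [X \<boxtimes> Y]"
    "ob Z \<Longrightarrow> ev (merge X Y) Z = inv_arr M (\<a> X Y Z)"
proof -
  have *: "merge X Y = Some (cd (split X Y), restr (\<lambda>Z. inv_arr M (ev (split X Y) Z)), dm (split X Y))"
    using assms by (simp add: merge_def restr_def fun_eq_iff)
  show "ar (merge X Y)"
    unfolding * using warrow_inverse[of "split X Y"] assms by (simp add: ar_Some)
  show "dm (merge X Y) = [X, Y]" "cd (merge X Y) = [X \<boxtimes> Y]"
    "ob Z \<Longrightarrow> ev (merge X Y) Z = inv_arr M (\<a> X Y Z)"
    by (simp_all add: merge_def Some_sel restr_def)
qed

lemma insI [simp]: "ar insI" "dm insI = []" "cd insI = [\<I>]" "ob Z \<Longrightarrow> ev insI Z = inv_arr M (\<l> Z)"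
proof -
  have *: "insI = Some (cd delI, restr (\<lambda>Z. inv_arr M (ev delI Z)), dm delI)"
    by (simp add: insI_def restr_def fun_eq_iff)
  show "ar insI"
    unfolding * using warrow_inverse[of delI] by (simp add: ar_Some)
  show "dm insI = []" "cd insI = [\<I>]" "ob Z \<Longrightarrow> ev insI Z = inv_arr M (\<l> Z)"
    by (simp_all add: insI_def Some_sel restr_def)
qed

lemma merge_split: "ob X \<Longrightarrow> ob Y \<Longrightarrow> merge X Y \<bullet> split X Y = idn [X \<boxtimes> Y]"
  and split_merge: "ob X \<Longrightarrow> ob Y \<Longrightarrow> split X Y \<bullet> merge X Y = idn [X, Y]"
  and delI_insI: "delI \<bullet> insI = idn []" and insI_delI: "insI \<bullet> delI = idn [\<I>]"
  by (rule warr_eqI; simp)+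

lemma cancel_lay [simp]:
  "ob X \<Longrightarrow> ob Y \<Longrightarrow> lay xs (merge X Y) ys \<bullet> lay xs (split X Y) ys = idn (xs @ (X \<boxtimes> Y) # ys)"
  "ob X \<Longrightarrow> ob Y \<Longrightarrow> lay xs (split X Y) ys \<bullet> lay xs (merge X Y) ys = idn (xs @ X # Y # ys)"
  "lay xs delI ys \<bullet> lay xs insI ys = idn (xs @ ys)"
  "lay xs insI ys \<bullet> lay xs delI ys = idn (xs @ \<I> # ys)"
  using W.lay_cong[OF merge_split, of X Y xs ys] W.lay_cong[OF split_merge, of X Y xs ys]
    W.lay_cong[OF delI_insI, of xs ys] W.lay_cong[OF insI_delI, of xs ys] by simp_all

lemmas cancel_lay_comp [simp] = cancel_lay[THEN W.tail, unfolded W.comp_assoc]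

lemma up_Comp: "f \<in> Arr M \<Longrightarrow> g \<in> Arr M \<Longrightarrow> Cod M f = Dom M g \<Longrightarrow>
    up (g \<cdot> f) = lay [] (up g) [] \<bullet> lay [] (up f) []"
  by (rule warr_eqI) simp_all

lemma up_Ident: "ob X \<Longrightarrow> up (\<iota> X) = idn [X]"
  by (rule warr_eqI) simp_all

lemma up_tensor:
  assumes [simp]: "f \<in> Arr M" "g \<in> Arr M"
  shows "up (f \<otimes> g) = lay [] (merge (Cod M f) (Cod M g)) [] \<bullet> lay [] (up f) [Cod M g]
    \<bullet> lay [Dom M f] (up g) [] \<bullet> lay [] (split (Dom M f) (Dom M g)) []"
proof -
  have "split (Cod M f) (Cod M g) \<bullet> up (f \<otimes> g)
    = lay [] (up f) [Cod M g] \<bullet> lay [Dom M f] (up g) [] \<bullet> split (Dom M f) (Dom M g)"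
  proof (rule warr_eqI)
    fix Z assume [simp]: "ob Z"
    show "ev (split (Cod M f) (Cod M g) \<bullet> up (f \<otimes> g)) Z
      = ev (lay [] (up f) [Cod M g] \<bullet> lay [Dom M f] (up g) [] \<bullet> split (Dom M f) (Dom M g)) Z"
      using assoc_natural[OF Arr_Hom Arr_Hom Arr_Hom, of f g "\<iota> Z"]
        Comp_assoc_simp[of "\<a> (Dom M f) (Dom M g) Z" "f \<otimes> \<iota> (Dom M g \<boxtimes> Z)" "\<iota> (Cod M f) \<otimes> (g \<otimes> \<iota> Z)"]
      by (simp del: Comp_assoc_simp)
  qed simp_all
  then have "(merge (Cod M f) (Cod M g) \<bullet> split (Cod M f) (Cod M g)) \<bullet> up (f \<otimes> g)
    = merge (Cod M f) (Cod M g) \<bullet> lay [] (up f) [Cod M g] \<bullet> lay [Dom M f] (up g) [] \<bullet> split (Dom M f) (Dom M g)"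
    by simp
  then show ?thesis
    unfolding merge_split[OF Obj_typing(2) Obj_typing(2), OF assms] by (simp add: W.lay_nil)
qed

lemma up_lunit: "ob X \<Longrightarrow> up (\<l> X) = lay [] delI [X] \<bullet> lay [] (split \<I> X) []"
  by (rule warr_eqI) (simp_all add: lunit_assoc)

lemma up_runit: "ob X \<Longrightarrow> up (\<r> X) = lay [X] delI [] \<bullet> lay [] (split X \<I>) []"
  by (rule warr_eqI) (simp_all add: triangle)

text \<open>After both products of the target have been split, the equation reads at each object as
  the pentagon; merging again gives the stated form.\<close>

lemma up_assoc:
  assumes [simp]: "ob X" "ob Y" "ob Z"
  shows "up (\<a> X Y Z) = lay [] (merge X (Y \<boxtimes> Z)) [] \<bullet> lay [X] (merge Y Z) [] \<bullet> lay [] (split X Y) [Z]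
    \<bullet> lay [] (split (X \<boxtimes> Y) Z) []"
proof -
  have "lay [X] (split Y Z) [] \<bullet> lay [] (split X (Y \<boxtimes> Z)) [] \<bullet> up (\<a> X Y Z)
     = lay [] (split X Y) [Z] \<bullet> lay [] (split (X \<boxtimes> Y) Z) []"
    by (rule warr_eqI) (use pentagon[of X Y Z] in simp_all)
  then have "lay [] (merge X (Y \<boxtimes> Z)) [] \<bullet> lay [X] (merge Y Z) [] \<bullet> lay [X] (split Y Z) []
      \<bullet> lay [] (split X (Y \<boxtimes> Z)) [] \<bullet> lay [] (up (\<a> X Y Z)) []
     = lay [] (merge X (Y \<boxtimes> Z)) [] \<bullet> lay [X] (merge Y Z) [] \<bullet> lay [] (split X Y) [Z] \<bullet> lay [] (split (X \<boxtimes> Y) Z) []"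
    by (simp add: W.lay_nil)
  then show ?thesis
    by (simp add: W.lay_nil[of "up (\<a> X Y Z)"])
qed

lemma inv_typing [simp]:
  "ob X \<Longrightarrow> \<l>' X \<in> Arr M" "ob X \<Longrightarrow> Dom M (\<l>' X) = X" "ob X \<Longrightarrow> Cod M (\<l>' X) = \<I> \<boxtimes> X"
  "ob X \<Longrightarrow> \<r>' X \<in> Arr M" "ob X \<Longrightarrow> Dom M (\<r>' X) = X" "ob X \<Longrightarrow> Cod M (\<r>' X) = X \<boxtimes> \<I>"
  "ob X \<Longrightarrow> ob Y \<Longrightarrow> ob Z \<Longrightarrow> \<a>' X Y Z \<in> Arr M"
  "ob X \<Longrightarrow> ob Y \<Longrightarrow> ob Z \<Longrightarrow> Dom M (\<a>' X Y Z) = X \<boxtimes> (Y \<boxtimes> Z)"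
  "ob X \<Longrightarrow> ob Y \<Longrightarrow> ob Z \<Longrightarrow> Cod M (\<a>' X Y Z) = (X \<boxtimes> Y) \<boxtimes> Z"
  by (simp_all add: lunit_inv_def runit_inv_def assoc_inv_def)

text \<open>The component at the unit object already decides, since tensoring with
  \<open>\<I>\<close> on the right is faithful.\<close>

lemma up_inj: "f \<in> Arr M \<Longrightarrow> up f = up g \<Longrightarrow> f = g"
proof -
  assume f: "f \<in> Arr M" and eq: "up f = up g"
  then have g: "g \<in> Arr M"
    by (metis up_ar)
  have "Dom M f = Dom M g" "Cod M f = Cod M g"
    using arg_cong[OF eq, of dm] arg_cong[OF eq, of cd] f g by simp_all
  moreover have "f \<otimes> \<iota> \<I> = g \<otimes> \<iota> \<I>"
    using arg_cong[OF eq, of "\<lambda>a. ev a \<I>"] f g by simp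
  ultimately show ?thesis
    using f g by - (rule runit_epi)
qed

text \<open>A transformation compatible with tensoring on the right is determined by its component
  at \<open>\<I>\<close>, because \<open>Z\<close> is \<open>\<I> \<boxtimes> Z\<close> up to the
  left unitor and the triangle turns that unitor into a right one. Conjugating this component with
  right unitors produces \<open>f\<close>.\<close>

lemma up_full:
  assumes a: "W.hom a [X] [Y]"
  shows "\<exists>f \<in> Hom M X Y. up f = a"
proof -
  have [simp]: "ar a" "dm a = [X]" "cd a = [Y]" "ob X" "ob Y"
    using a W.hom_ob[OF a] by (simp_all add: W.hom_def)
  define f where "f = \<r> Y \<cdot> (ev a \<I> \<cdot> \<r>' X)"
  have [simp]: "f \<in> Arr M" "Dom M f = X" "Cod M f = Y"
    by (simp_all add: f_def)
  have f: "f \<cdot> \<r> X = \<r> Y \<cdot> ev a \<I>"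
    by (simp add: f_def runit_inv_def)
  have "up f = a"
  proof (rule warr_eqI)
    fix Z assume [simp]: "ob Z"
    have "ev a Z \<cdot> (\<r> X \<otimes> \<iota> Z) = (ev a Z \<cdot> (\<iota> X \<otimes> \<l> Z)) \<cdot> \<a> X \<I> Z"
      using triangle[of X Z] by simp
    also have "\<dots> = ((\<iota> Y \<otimes> \<l> Z) \<cdot> ev a (\<I> \<boxtimes> Z)) \<cdot> \<a> X \<I> Z"
      using ev_natural[of a "\<l> Z"] by simp
    also have "\<dots> = ((\<iota> Y \<otimes> \<l> Z) \<cdot> \<a> Y \<I> Z) \<cdot> (ev a \<I> \<otimes> \<iota> Z)"
      using ev_module[of a \<I> Z] by simp
    also have "\<dots> = (\<r> Y \<cdot> ev a \<I>) \<otimes> \<iota> Z"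
      using triangle[of Y Z] by (simp del: Comp_assoc_simp)
    also have "\<dots> = (f \<otimes> \<iota> Z) \<cdot> (\<r> X \<otimes> \<iota> Z)"
      unfolding f[symmetric] by simp
    finally have "ev a Z = f \<otimes> \<iota> Z"
      by - (rule iso_epi[of "\<r> X \<otimes> \<iota> Z"], simp_all add: iso_tensor iso_Ident)
    then show "ev (up f) Z = ev a Z"
      by simp
  qed simp_all
  then show ?thesis
    by (intro bexI[of _ f]) (simp_all add: Hom_def)
qed

end

section \<open>Translation between a monoidal category and its strictification\<close>

context monoidal_category begin

text \<open>A flattening is an isomorphism from a letter to a word. An arrow \<open>f\<close> is represented by the
  arrow \<open>S\<close> between words obtained by flattening its source and target. The constraints are
  represented by identities, so a composite in \<open>M\<close> is represented by the evident strict composite.\<close>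

definition flat :: "('o, 'a) warr \<Rightarrow> 'o \<Rightarrow> 'o list \<Rightarrow> bool" where
  "flat p X xs \<longleftrightarrow> W.hom p [X] xs \<and> (\<exists>p'. W.hom p' xs [X] \<and> p' \<bullet> p = idn [X] \<and> p \<bullet> p' = idn xs)"

definition finv :: "('o, 'a) warr \<Rightarrow> ('o, 'a) warr" where
  "finv p = (SOME p'. W.hom p' (cd p) (dm p) \<and> p' \<bullet> p = idn (dm p) \<and> p \<bullet> p' = idn (cd p))"

lemma finv: "flat p X xs \<Longrightarrow> W.hom (finv p) xs [X] \<and> finv p \<bullet> p = idn [X] \<and> p \<bullet> finv p = idn xs"
proof -
  assume *: "flat p X xs"
  then have "dm p = [X]" "cd p = xs"
    by (auto simp: flat_def W.hom_def)
  then have "\<exists>p'. W.hom p' (cd p) (dm p) \<and> p' \<bullet> p = idn (dm p) \<and> p \<bullet> p' = idn (cd p)"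
    using * by (simp add: flat_def)
  from someI_ex[OF this, folded finv_def] show ?thesis
    using \<open>dm p = [X]\<close> \<open>cd p = xs\<close> by simp
qed

lemma flatI: "W.hom p [X] xs \<Longrightarrow> W.hom p' xs [X] \<Longrightarrow> p' \<bullet> p = idn [X] \<Longrightarrow> p \<bullet> p' = idn xs \<Longrightarrow> flat p X xs"
  by (auto simp: flat_def)

lemma flat_hom: "flat p X xs \<Longrightarrow> W.hom p [X] xs"
  by (simp add: flat_def)

lemma flat_ob: "flat p X xs \<Longrightarrow> ob X"
  using W.hom_ob[OF flat_hom, of p X xs] by simp

definition represents :: "'a \<Rightarrow> ('o, 'a) warr \<Rightarrow> ('o, 'a) warr \<Rightarrow> ('o, 'a) warr \<Rightarrow> bool" where
  "represents f p q S \<longleftrightarrow> f \<in> Arr M \<and> flat p (Dom M f) (cd p) \<and> flat q (Cod M f) (cd q) \<and>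
     W.hom S (cd p) (cd q) \<and> q \<bullet> up f = S \<bullet> p"

lemma representsD:
  assumes "represents f p q S"
  shows "f \<in> Arr M" "W.hom S (cd p) (cd q)" "flat p (Dom M f) (cd p)" "flat q (Cod M f) (cd q)"
    "q \<bullet> up f = S \<bullet> p"
  using assms by (simp_all add: represents_def)

lemma represents_flat: "represents f p q S \<Longrightarrow> flat p X xs \<Longrightarrow> flat q Y ys \<Longrightarrow> f \<in> Hom M X Y \<and> W.hom S xs ys"
  by (auto simp: represents_def flat_def W.hom_def Hom_def)

text \<open>Flattenings are invertible and \<open>up\<close> is faithful, so an equation in
  \<open>M\<close> is equivalent to its word form and not only implied by it. The equivalence allows
  axioms to be transferred both ways and definite descriptions to be evaluated on words.\<close>

lemma represents_eq:
  assumes "represents f p q S" "represents g p q S'"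
  shows "f = g \<longleftrightarrow> S = S'"
proof
  note * = assms[unfolded represents_def flat_def W.hom_def]
  note [simp] = finv[OF representsD(3)[OF assms(1)]] finv[OF representsD(4)[OF assms(1)]]
  show "S = S'" if "f = g"
  proof -
    have "(S \<bullet> p) \<bullet> finv p = (S' \<bullet> p) \<bullet> finv p"
      using that * by metis
    then show ?thesis
      using * by simp
  qed
  show "f = g" if "S = S'"
  proof -
    have "(finv q \<bullet> q) \<bullet> up f = (finv q \<bullet> q) \<bullet> up g"
      unfolding W.comp_assoc using that * by metis
    then have "up f = up g"
      using * by (simp del: W.comp_assoc)
    then show ?thesis
      using * up_inj by blast
  qed
qed

lemma represents_exists:
  assumes "f \<in> Hom M X Y" "flat p X xs" "flat q Y ys"
  shows "represents f p q (q \<bullet> up f \<bullet> finv p)"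
  using assms finv[OF assms(2)] by (simp add: represents_def flat_def W.hom_def Hom_def)

lemma represents_full:
  assumes "W.hom S xs ys" "flat p X xs" "flat q Y ys"
  shows "\<exists>f. represents f p q S \<and> f \<in> Hom M X Y"
proof -
  note * = assms[unfolded flat_def W.hom_def] finv[OF assms(2), unfolded W.hom_def] finv[OF assms(3), unfolded W.hom_def]
  have "W.hom (finv q \<bullet> S \<bullet> p) [X] [Y]"
    using * by (simp add: W.hom_def)
  from up_full[OF this] obtain f where f: "f \<in> Hom M X Y" "up f = finv q \<bullet> S \<bullet> p"
    by blast
  have "q \<bullet> up f = (q \<bullet> finv q) \<bullet> S \<bullet> p"
    unfolding f(2) by simp
  also have "\<dots> = S \<bullet> p"
    using * by (simp del: W.comp_assoc)
  finally have "q \<bullet> up f = S \<bullet> p" .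
  then show ?thesis
    using assms f(1) by (auto simp: represents_def flat_def W.hom_def Hom_def intro!: exI[of _ f])
qed

lemma represents_Comp:
  assumes "represents f p q S" "represents g q r S'"
  shows "represents (g \<cdot> f) p r (S' \<bullet> S)"
proof -
  note * = assms[unfolded represents_def flat_def W.hom_def]
  have [simp]: "Cod M f = Dom M g" "f \<in> Arr M" "g \<in> Arr M"
    using * by auto
  have "r \<bullet> up (g \<cdot> f) = (r \<bullet> up g) \<bullet> up f"
    by (subst up_Comp) (simp_all add: W.lay_nil)
  also have "\<dots> = S' \<bullet> q \<bullet> up f"
    using * by simp
  also have "\<dots> = (S' \<bullet> S) \<bullet> p"
    using * by simp
  finally have 1: "r \<bullet> up (g \<cdot> f) = (S' \<bullet> S) \<bullet> p" .
  show ?thesis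
    unfolding represents_def 1 using assms by (auto simp: represents_def W.hom_def)
qed

text \<open>Splits the product and flattens both factors. \<open>hd (dm p)\<close> recovers the
  object that \<open>p\<close> flattens, so objects need not be passed along.\<close>

definition fl :: "('o, 'a) warr \<Rightarrow> ('o, 'a) warr \<Rightarrow> ('o, 'a) warr" where
  "fl p q = lay (cd p) q [] \<bullet> lay [] p (dm q) \<bullet> lay [] (split (hd (dm p)) (hd (dm q))) []"

definition F1 :: "'o \<Rightarrow> ('o, 'a) warr" where "F1 X = idn [X]"

lemma flat_fl:
  assumes "flat p X xs" "flat q Y ys"
  shows "flat (fl p q) (X \<boxtimes> Y) (xs @ ys)"
proof (rule flatI)
  note [simp] = assms[THEN flat_hom, unfolded W.hom_def] finv[OF assms(1), unfolded W.hom_def]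
    finv[OF assms(2), unfolded W.hom_def] flat_ob[OF assms(1)] flat_ob[OF assms(2)]
  have [simp]: "obs xs" "obs ys"
    using W.hom_ob(2)[OF flat_hom] assms by auto
  have eq: "lay us (finv p) vs \<bullet> lay us p vs = idn (us @ X # vs)" "lay us p vs \<bullet> lay us (finv p) vs = idn (us @ xs @ vs)"
    "lay us (finv q) vs \<bullet> lay us q vs = idn (us @ Y # vs)" "lay us q vs \<bullet> lay us (finv q) vs = idn (us @ ys @ vs)" for us vs
    using W.lay_cong[OF finv[OF assms(1), THEN conjunct2, THEN conjunct1], of us vs]
      W.lay_cong[OF finv[OF assms(1), THEN conjunct2, THEN conjunct2], of us vs]
      W.lay_cong[OF finv[OF assms(2), THEN conjunct2, THEN conjunct1], of us vs]
      W.lay_cong[OF finv[OF assms(2), THEN conjunct2, THEN conjunct2], of us vs]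
    by (simp_all only: W.lay_comp W.lay_idn append.simps)
  let ?r = "lay [] (merge X Y) [] \<bullet> lay [] (finv p) [Y] \<bullet> lay xs (finv q) []"
  show "W.hom (fl p q) [X \<boxtimes> Y] (xs @ ys)" "W.hom ?r (xs @ ys) [X \<boxtimes> Y]"
    by (simp_all add: W.hom_def fl_def)
  show "?r \<bullet> fl p q = idn [X \<boxtimes> Y]"
    by (simp add: fl_def eq[THEN W.tail] del: W.rsort)
  show "fl p q \<bullet> ?r = idn (xs @ ys)"
    by (simp add: fl_def eq eq[THEN W.tail] del: W.rsort)
qed

lemma flat_F1: "ob X \<Longrightarrow> flat (F1 X) X [X]"
  by (rule flatI[where p' = "idn [X]"]) (simp_all add: F1_def W.hom_def)

lemma flat_delI: "flat delI \<I> []"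
  by (rule flatI[where p' = insI]) (simp_all add: delI_insI insI_delI W.hom_def)

lemma cd_F [simp]: "ob X \<Longrightarrow> cd (F1 X) = [X]"
  by (simp add: F1_def)

lemma cd_fl [simp]:
  assumes "flat p X xs" "flat q Y ys"
  shows "cd (fl p q) = xs @ ys"
  using flat_hom[OF flat_fl[OF assms]] by (simp add: W.hom_def)

lemma flat_cd: "flat p X xs \<Longrightarrow> cd p = xs" "flat p X xs \<Longrightarrow> dm p = [X]" "flat p X xs \<Longrightarrow> ar p"
  by (simp_all add: flat_def W.hom_def)

lemma represents_tensor:
  assumes "represents f p q S" "represents g p' q' S'"
  shows "represents (f \<otimes> g) (fl p p') (fl q q') (lay [] S (cd q') \<bullet> lay (cd p) S' [])"
proof -
  note fg = representsD[OF assms(1)] representsD[OF assms(2)]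
  note [simp] = fg(1,6) fg(2,7)[unfolded W.hom_def]
    flat_cd(2,3)[OF fg(3)] flat_cd(2,3)[OF fg(4)] flat_cd(2,3)[OF fg(8)] flat_cd(2,3)[OF fg(9)]
  have [simp]: "obs (cd p)" "obs (cd q)" "obs (cd p')" "obs (cd q')"
    using W.hom_ob(2)[OF flat_hom] fg by blast+
  have 1: "lay us q vs \<bullet> lay us (up f) vs = lay us S vs \<bullet> lay us p vs"
      "lay us q' vs \<bullet> lay us (up g) vs = lay us S' vs \<bullet> lay us p' vs" for us vs
    using W.lay_cong[OF fg(5), of us vs] W.lay_cong[OF fg(10), of us vs] by simp_all
  have sw: "lay (cd q) q' [] \<bullet> lay [] S [Cod M g] = lay [] S (cd q') \<bullet> lay (cd p) q' []"
    by (rule W.swap[where ys = "[]", symmetric]) simp_all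
  have sw2: "lay [] p [Cod M g] \<bullet> lay [Dom M f] (up g) [] = lay (cd p) (up g) [] \<bullet> lay [] p [Dom M g]"
    by (rule W.swap[where ys = "[]"]) simp_all
  have "fl q q' \<bullet> up (f \<otimes> g) = lay (cd q) q' [] \<bullet> (lay [] q [Cod M g] \<bullet> lay [] (up f) [Cod M g])
    \<bullet> lay [Dom M f] (up g) [] \<bullet> lay [] (split (Dom M f) (Dom M g)) []"
    by (simp add: fl_def up_tensor del: W.rsort)
  also have "\<dots> = (lay (cd q) q' [] \<bullet> lay [] S [Cod M g]) \<bullet> (lay [] p [Cod M g]
    \<bullet> lay [Dom M f] (up g) []) \<bullet> lay [] (split (Dom M f) (Dom M g)) []"
    unfolding 1 by (simp del: W.rsort)
  also have "\<dots> = lay [] S (cd q') \<bullet> (lay (cd p) q' [] \<bullet> lay (cd p) (up g) []) \<bullet> lay [] p [Dom M g]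
     \<bullet> lay [] (split (Dom M f) (Dom M g)) []"
    unfolding sw sw2 by (simp del: W.rsort)
  also have "\<dots> = (lay [] S (cd q') \<bullet> lay (cd p) S' []) \<bullet> fl p p'"
    unfolding 1 by (simp add: fl_def del: W.rsort)
  finally have 2: "fl q q' \<bullet> up (f \<otimes> g) = (lay [] S (cd q') \<bullet> lay (cd p) S' []) \<bullet> fl p p'" .
  show ?thesis
    using flat_fl[OF fg(3) fg(8)] flat_fl[OF fg(4) fg(9)]
    by (simp add: represents_def 2 cd_fl[OF fg(3) fg(8)] cd_fl[OF fg(4) fg(9)] W.hom_def)
qed

lemma represents_Ident:
  assumes "flat p X xs"
  shows "represents (\<iota> X) p p (idn xs)"
  using assms flat_ob[OF assms] W.hom_ob(2)[OF flat_hom[OF assms]] flat_cd[OF assms]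
  by (simp add: represents_def up_Ident W.hom_def)

text \<open>Both bracketings flatten to the same word, and by \<open>up_assoc\<close> the associator
  only splits one way and merges the other; after flattening nothing of it remains.\<close>

lemma represents_assoc:
  assumes "flat p X xs" "flat q Y ys" "flat r Z zs"
  shows "represents (\<a> X Y Z) (fl (fl p q) r) (fl p (fl q r)) (idn (xs @ ys @ zs))"
proof -
  note [simp] = flat_cd[OF assms(1)] flat_cd[OF assms(2)] flat_cd[OF assms(3)]
    flat_ob[OF assms(1)] flat_ob[OF assms(2)] flat_ob[OF assms(3)]
    cd_fl[OF assms(1,2)] cd_fl[OF assms(2,3)] flat_cd(2,3)[OF flat_fl[OF assms(1,2)]] flat_cd(2,3)[OF flat_fl[OF assms(2,3)]]
    cd_fl[OF flat_fl[OF assms(1,2)] assms(3)] cd_fl[OF assms(1) flat_fl[OF assms(2,3)]]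
  have [simp]: "obs xs" "obs ys" "obs zs"
    using W.hom_ob(2)[OF flat_hom] assms by blast+
  have "fl p (fl q r) \<bullet> up (\<a> X Y Z) = lay (xs @ ys) r [] \<bullet> lay xs q [Z] \<bullet> (lay xs (split Y Z) [] \<bullet> lay [] p [Y \<boxtimes> Z])
      \<bullet> lay [X] (merge Y Z) [] \<bullet> lay [] (split X Y) [Z] \<bullet> lay [] (split (X \<boxtimes> Y) Z) []"
    by (simp add: fl_def[of p] fl_def[of q r] up_assoc del: W.rsort)
  also have "lay xs (split Y Z) [] \<bullet> lay [] p [Y \<boxtimes> Z] = lay [] p [Y, Z] \<bullet> lay [X] (split Y Z) []"
    by (rule W.swap[where ys = "[]", symmetric]) simp_all
  finally have "fl p (fl q r) \<bullet> up (\<a> X Y Z) = fl (fl p q) r"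
    by (simp add: fl_def[of _ r] fl_def[of p q] del: W.rsort)
  then show ?thesis
    using flat_fl[OF assms(1) flat_fl[OF assms(2,3)]] flat_fl[OF flat_fl[OF assms(1,2)] assms(3)]
      flat_cd(2,3)[OF flat_fl[OF assms(1) flat_fl[OF assms(2,3)]]]
      flat_cd(2,3)[OF flat_fl[OF flat_fl[OF assms(1,2)] assms(3)]]
    by (simp add: represents_def W.hom_def)
qed

lemma represents_lunit:
  assumes "flat p X xs"
  shows "represents (\<l> X) (fl delI p) p (idn xs)"
proof -
  note [simp] = flat_cd[OF assms] flat_ob[OF assms] cd_fl[OF flat_delI assms]
  have [simp]: "obs xs"
    using W.hom_ob(2)[OF flat_hom] assms by blast
  have "p \<bullet> up (\<l> X) = fl delI p"
    by (simp add: fl_def up_lunit W.layer[where f = p] del: W.rsort)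
  then show ?thesis
    using assms flat_fl[OF flat_delI assms] flat_cd(2,3)[OF flat_fl[OF flat_delI assms]] by (simp add: represents_def W.hom_def)
qed

lemma represents_runit:
  assumes "flat p X xs"
  shows "represents (\<r> X) (fl p delI) p (idn xs)"
proof -
  note [simp] = flat_cd[OF assms] flat_ob[OF assms] cd_fl[OF assms flat_delI]
  have [simp]: "obs xs"
    using W.hom_ob(2)[OF flat_hom] assms by blast
  have sw: "lay [] p [] \<bullet> lay [X] delI [] = lay xs delI [] \<bullet> lay [] p [\<I>]"
    by (rule W.swap[where ys = "[]"]) simp_all
  have "p \<bullet> up (\<r> X) = fl p delI"
    by (simp add: fl_def up_runit W.layer[where f = p] sw[THEN W.tail] del: W.rsort)
  then show ?thesis
    using assms flat_fl[OF assms flat_delI] flat_cd(2,3)[OF flat_fl[OF assms flat_delI]] by (simp add: represents_def W.hom_def)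
qed

lemma represents_inverse:
  assumes f: "represents f p q S" "is_iso M f" and S': "W.hom S' (cd q) (cd p)" "S' \<bullet> S = idn (cd p)"
  shows "represents (inv_arr M f) q p S'"
proof -
  note [simp] = f(2) iso_Arr[OF f(2)] flat_cd(2,3)[OF representsD(3)[OF f(1)]] flat_cd(2,3)[OF representsD(4)[OF f(1)]]
    S'[unfolded W.hom_def] representsD(2)[OF f(1), unfolded W.hom_def]
  have 1: "p = S' \<bullet> q \<bullet> up f"
    unfolding representsD(5)[OF f(1)] by (simp add: S'(2)[THEN W.tail])
  have 2: "up f \<bullet> up (inv_arr M f) = idn [Cod M f]"
    using up_Comp[of "inv_arr M f" f] by (simp add: up_Ident W.lay_nil)
  have "p \<bullet> up (inv_arr M f) = S' \<bullet> q"
    by (subst 1) (simp add: 2)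
  then show ?thesis
    using representsD[OF f(1)] S' by (simp add: represents_def)
qed

lemma represents_inverse_exists:
  assumes f: "represents f p q S" "is_iso M f"
  shows "\<exists>S'. represents (inv_arr M f) q p S' \<and> S' \<bullet> S = idn (cd p) \<and> S \<bullet> S' = idn (cd q)"
proof -
  note [simp] = f(2) iso_Arr[OF f(2)]
  obtain S' where S': "represents (inv_arr M f) q p S'"
    using represents_exists[OF _ representsD(4)[OF f(1)] representsD(3)[OF f(1)], of "inv_arr M f"]
    by (auto simp: Hom_def)
  have "represents (\<iota> (Dom M f)) p p (S' \<bullet> S)" "represents (\<iota> (Cod M f)) q q (S \<bullet> S')"
    using represents_Comp[OF f(1) S'] represents_Comp[OF S' f(1)] by simp_all
  then show ?thesis
    using S' represents_eq represents_Ident[OF representsD(3)[OF f(1)]] represents_Ident[OF representsD(4)[OF f(1)]]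
    by blast
qed

lemma represents_is_iso:
  assumes f: "represents f p q S" and S': "W.hom S' (cd q) (cd p)" "S' \<bullet> S = idn (cd p)" "S \<bullet> S' = idn (cd q)"
  shows "is_iso M f"
proof -
  obtain g where g: "represents g q p S'" "g \<in> Hom M (Cod M f) (Dom M f)"
    using represents_full[OF S'(1) representsD(4)[OF f] representsD(3)[OF f]] by blast
  have "g \<cdot> f = \<iota> (Dom M f)"
    using represents_eq[OF represents_Comp[OF f g(1)] represents_Ident[OF representsD(3)[OF f]]] S' by simp
  moreover have "f \<cdot> g = \<iota> (Cod M f)"
    using represents_eq[OF represents_Comp[OF g(1) f] represents_Ident[OF representsD(4)[OF f]]] S' by simp
  ultimately show ?thesis
    using g(2) representsD(1)[OF f] by (auto simp: is_iso_def inverse_arrows_def)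
qed

lemma idn_inverse: "flat p X xs \<Longrightarrow> W.hom (idn xs) xs xs \<and> idn xs \<bullet> idn xs = idn xs"
  using W.hom_ob(2)[OF flat_hom, of p X xs] by (simp add: W.hom_def)

lemma represents_assoc_inv:
  assumes "flat p X xs" "flat q Y ys" "flat r Z zs"
  shows "represents (\<a>' X Y Z) (fl p (fl q r)) (fl (fl p q) r) (idn (xs @ ys @ zs))"
  unfolding assoc_inv_def
  using assms idn_inverse[OF flat_fl[OF assms(1) flat_fl[OF assms(2,3)]]] flat_ob
  by (intro represents_inverse[OF represents_assoc[OF assms]])
    (auto simp: flat_cd[OF flat_fl[OF assms(1) flat_fl[OF assms(2,3)]]] flat_cd[OF flat_fl[OF flat_fl[OF assms(1,2)] assms(3)]])

lemma represents_lunit_inv: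
  assumes "flat p X xs"
  shows "represents (\<l>' X) p (fl delI p) (idn xs)"
  unfolding lunit_inv_def using assms idn_inverse[OF assms] flat_ob[OF assms]
  by (intro represents_inverse[OF represents_lunit[OF assms]])
    (auto simp: flat_cd[OF flat_fl[OF flat_delI assms]] flat_cd[OF assms])

lemma represents_runit_inv:
  assumes "flat p X xs"
  shows "represents (\<r>' X) p (fl p delI) (idn xs)"
  unfolding runit_inv_def using assms idn_inverse[OF assms] flat_ob[OF assms]
  by (intro represents_inverse[OF represents_runit[OF assms]])
    (auto simp: flat_cd[OF flat_fl[OF assms flat_delI]] flat_cd[OF assms])

lemmas represents_rules = represents_Comp represents_tensor represents_Ident represents_assoc
  represents_assoc_inv represents_lunit represents_lunit_inv represents_runit represents_runit_inv

end

section \<open>The axioms of braided structures in word form\<close>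

context monoidal_category begin

definition isflat :: "('o, 'a) warr \<Rightarrow> bool" where
  "isflat p \<longleftrightarrow> (\<exists>X xs. flat p X xs)"

lemma isflat [simp]: "ob X \<Longrightarrow> isflat (F1 X)" "isflat delI" "isflat p \<Longrightarrow> isflat q \<Longrightarrow> isflat (fl p q)"
  unfolding isflat_def using flat_F1 flat_delI flat_fl by blast+

lemma cd_fl' [simp]: "isflat p \<Longrightarrow> isflat q \<Longrightarrow> cd (fl p q) = cd p @ cd q"
  unfolding isflat_def using cd_fl flat_cd(1) by metis

lemmas flat_rules = flat_F1 flat_delI flat_fl

lemma represents_typing:
  assumes "represents f p q S"
  shows "ar S" "dm S = cd p" "cd S = cd q" "isflat p" "isflat q" "f \<in> Arr M"
  using representsD[OF assms] by (auto simp: W.hom_def isflat_def)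

lemma algebra_eqs:
  assumes A: "ob A" and m: "represents m (fl (F1 A) (F1 A)) (F1 A) mh" and u: "represents u delI (F1 A) uh"
  shows
    "m \<cdot> (m \<otimes> \<iota> A) = m \<cdot> (\<iota> A \<otimes> m) \<cdot> \<a> A A A \<longleftrightarrow>
      mh \<bullet> lay [] mh [A] = mh \<bullet> lay [A] mh []"
    "m \<cdot> (u \<otimes> \<iota> A) = \<l> A \<longleftrightarrow>
      mh \<bullet> lay [] uh [A] = idn [A]"
    "m \<cdot> (\<iota> A \<otimes> u) = \<r> A \<longleftrightarrow>
      mh \<bullet> lay [A] uh [] = idn [A]"
  supply [simp] = A represents_typing[OF m] represents_typing[OF u]
  \<comment> \<open>\<open>represents_rules\<close> follow the syntax of both sides and synthesise
    their word forms; simplification then erases the identities that represent constraints. The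
    other transfer lemmas use the same scheme.\<close>
  by (rule trans[OF represents_eq], (rule represents_rules flat_rules assms unit_Obj)+, simp add: W.layer[where f = mh] W.layer[where f = uh])+

lemma braid_eq:
  assumes A: "ob A" and c: "represents c (fl (F1 A) (F1 A)) (fl (F1 A) (F1 A)) ch"
  shows
    "(c \<otimes> \<iota> A) \<cdot> \<a>' A A A \<cdot> (\<iota> A \<otimes> c) \<cdot> \<a> A A A \<cdot> (c \<otimes> \<iota> A) = \<a>' A A A \<cdot> (\<iota> A \<otimes> c) \<cdot> \<a> A A A \<cdot> (c \<otimes> \<iota> A) \<cdot> \<a>' A A A \<cdot> (\<iota> A \<otimes> c) \<cdot> \<a> A A A \<longleftrightarrow>
      lay [] ch [A] \<bullet> lay [A] ch [] \<bullet> lay [] ch [A] = lay [A] ch [] \<bullet> lay [] ch [A] \<bullet> lay [A] ch []"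
  supply [simp] = A represents_typing[OF c]
  by (rule trans[OF represents_eq], (rule represents_rules flat_rules assms unit_Obj)+, simp add: W.layer[where f = ch])+

lemma braided_algebra_eqs:
  assumes A: "ob A" and m: "represents m (fl (F1 A) (F1 A)) (F1 A) mh" and u: "represents u delI (F1 A) uh" and c: "represents c (fl (F1 A) (F1 A)) (fl (F1 A) (F1 A)) ch"
  shows
    "c \<cdot> (m \<otimes> \<iota> A) = (\<iota> A \<otimes> m) \<cdot> \<a> A A A \<cdot> (c \<otimes> \<iota> A) \<cdot> \<a>' A A A \<cdot> (\<iota> A \<otimes> c) \<cdot> \<a> A A A \<longleftrightarrow>
      ch \<bullet> lay [] mh [A] = lay [A] mh [] \<bullet> lay [] ch [A] \<bullet> lay [A] ch []"
    "c \<cdot> (\<iota> A \<otimes> m) = (m \<otimes> \<iota> A) \<cdot> \<a>' A A A \<cdot> (\<iota> A \<otimes> c) \<cdot> \<a> A A A \<cdot> (c \<otimes> \<iota> A) \<cdot> \<a>' A A A \<longleftrightarrow>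
      ch \<bullet> lay [A] mh [] = lay [] mh [A] \<bullet> lay [A] ch [] \<bullet> lay [] ch [A]"
    "c \<cdot> (u \<otimes> \<iota> A) \<cdot> \<l>' A = (\<iota> A \<otimes> u) \<cdot> \<r>' A \<longleftrightarrow>
      ch \<bullet> lay [] uh [A] = lay [A] uh []"
    "c \<cdot> (\<iota> A \<otimes> u) \<cdot> \<r>' A = (u \<otimes> \<iota> A) \<cdot> \<l>' A \<longleftrightarrow>
      ch \<bullet> lay [A] uh [] = lay [] uh [A]"
  supply [simp] = A represents_typing[OF m] represents_typing[OF u] represents_typing[OF c]
  by (rule trans[OF represents_eq], (rule represents_rules flat_rules assms unit_Obj)+, simp add: W.layer[where f = mh] W.layer[where f = uh] W.layer[where f = ch])+

lemma coalgebra_eqs: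
  assumes A: "ob A" and d: "represents d (F1 A) (fl (F1 A) (F1 A)) dh" and e: "represents e (F1 A) delI eh"
  shows
    "\<a> A A A \<cdot> (d \<otimes> \<iota> A) \<cdot> d = (\<iota> A \<otimes> d) \<cdot> d \<longleftrightarrow>
      lay [] dh [A] \<bullet> dh = lay [A] dh [] \<bullet> dh"
    "\<l> A \<cdot> (e \<otimes> \<iota> A) \<cdot> d = \<iota> A \<longleftrightarrow>
      lay [] eh [A] \<bullet> dh = idn [A]"
    "\<r> A \<cdot> (\<iota> A \<otimes> e) \<cdot> d = \<iota> A \<longleftrightarrow>
      lay [A] eh [] \<bullet> dh = idn [A]"
  supply [simp] = A represents_typing[OF d] represents_typing[OF e]
  by (rule trans[OF represents_eq], (rule represents_rules flat_rules assms unit_Obj)+, simp add: W.layer[where f = dh] W.layer[where f = eh])+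

lemma braided_coalgebra_eqs:
  assumes A: "ob A" and d: "represents d (F1 A) (fl (F1 A) (F1 A)) dh" and e: "represents e (F1 A) delI eh" and c: "represents c (fl (F1 A) (F1 A)) (fl (F1 A) (F1 A)) ch"
  shows
    "(d \<otimes> \<iota> A) \<cdot> c = \<a>' A A A \<cdot> (\<iota> A \<otimes> c) \<cdot> \<a> A A A \<cdot> (c \<otimes> \<iota> A) \<cdot> \<a>' A A A \<cdot> (\<iota> A \<otimes> d) \<longleftrightarrow>
      lay [] dh [A] \<bullet> ch = lay [A] ch [] \<bullet> lay [] ch [A] \<bullet> lay [A] dh []"
    "(\<iota> A \<otimes> d) \<cdot> c = \<a> A A A \<cdot> (c \<otimes> \<iota> A) \<cdot> \<a>' A A A \<cdot> (\<iota> A \<otimes> c) \<cdot> \<a> A A A \<cdot> (d \<otimes> \<iota> A) \<longleftrightarrow>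
      lay [A] dh [] \<bullet> ch = lay [] ch [A] \<bullet> lay [A] ch [] \<bullet> lay [] dh [A]"
    "\<l> A \<cdot> (e \<otimes> \<iota> A) \<cdot> c = \<r> A \<cdot> (\<iota> A \<otimes> e) \<longleftrightarrow>
      lay [] eh [A] \<bullet> ch = lay [A] eh []"
    "\<r> A \<cdot> (\<iota> A \<otimes> e) \<cdot> c = \<l> A \<cdot> (e \<otimes> \<iota> A) \<longleftrightarrow>
      lay [A] eh [] \<bullet> ch = lay [] eh [A]"
  supply [simp] = A represents_typing[OF d] represents_typing[OF e] represents_typing[OF c]
  by (rule trans[OF represents_eq], (rule represents_rules flat_rules assms unit_Obj)+, simp add: W.layer[where f = dh] W.layer[where f = eh] W.layer[where f = ch])+

lemma bialgebra_eqs: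
  assumes A: "ob A" and m: "represents m (fl (F1 A) (F1 A)) (F1 A) mh" and u: "represents u delI (F1 A) uh" and c: "represents c (fl (F1 A) (F1 A)) (fl (F1 A) (F1 A)) ch" and d: "represents d (F1 A) (fl (F1 A) (F1 A)) dh" and e: "represents e (F1 A) delI eh"
  shows
    "d \<cdot> m = (m \<otimes> m) \<cdot> middle M A c \<cdot> (d \<otimes> d) \<longleftrightarrow>
      dh \<bullet> mh = lay [A] mh [] \<bullet> lay [] mh [A, A] \<bullet> lay [A] ch [A] \<bullet> lay [A, A] dh [] \<bullet> lay [] dh [A]"
    "d \<cdot> u = (u \<otimes> u) \<cdot> \<l>' \<I> \<longleftrightarrow>
      dh \<bullet> uh = lay [A] uh [] \<bullet> lay [] uh []"
    "e \<cdot> m = \<l> \<I> \<cdot> (e \<otimes> e) \<longleftrightarrow>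
      eh \<bullet> mh = eh \<bullet> lay [] eh [A]"
    "e \<cdot> u = \<iota> \<I> \<longleftrightarrow>
      eh \<bullet> uh = idn []"
  supply [simp] = A represents_typing[OF m] represents_typing[OF u] represents_typing[OF c] represents_typing[OF d] represents_typing[OF e]
  unfolding middle_def
  by (rule trans[OF represents_eq], (rule represents_rules flat_rules assms unit_Obj)+, simp add: W.layer[where f = mh] W.layer[where f = uh] W.layer[where f = ch] W.layer[where f = dh] W.layer[where f = eh])+

abbreviation "rep2 A \<equiv> fl (F1 A) (F1 A)"

lemma cd_rep [simp]: "ob A \<Longrightarrow> cd (rep2 A) = [A, A]"
  by simp

lemma flat_rep2: "ob A \<Longrightarrow> flat (rep2 A) (A \<boxtimes> A) [A, A]"
  using flat_fl[OF flat_F1 flat_F1, of A A] by simp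

lemma hom_represents:
  assumes "represents f p q S" "flat p X xs" "flat q Y ys"
  shows "f \<in> Hom M X Y" "W.hom S xs ys"
  using represents_flat[OF assms] by simp_all

lemma braided_objectD:
  assumes V: "is_braided_object M A c" and c: "represents c (rep2 A) (rep2 A) ch"
  shows "\<exists>ch'. s_br ob ar dm cd (\<bullet>) idn lay A ch ch' \<and> represents (inv_arr M c) (rep2 A) (rep2 A) ch'"
proof -
  have A: "ob A" and iso: "is_iso M c"
    using V by (simp_all add: is_braided_object_def)
  obtain ch' where ch': "represents (inv_arr M c) (rep2 A) (rep2 A) ch'" "ch' \<bullet> ch = idn [A, A]" "ch \<bullet> ch' = idn [A, A]"
    using represents_inverse_exists[OF c iso] A by auto
  have "s_br ob ar dm cd (\<bullet>) idn lay A ch ch'"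
    using hom_represents[OF c flat_rep2 flat_rep2] hom_represents[OF ch'(1) flat_rep2 flat_rep2] A ch' V braid_eq[OF A c]
    by unfold_locales (simp_all add: is_braided_object_def)
  with ch'(1) show ?thesis by blast
qed

lemma braided_objectI:
  assumes A: "s_br ob ar dm cd (\<bullet>) idn lay A ch ch'" and c: "represents c (rep2 A) (rep2 A) ch"
  shows "is_braided_object M A c"
proof -
  interpret s_br ob ar dm cd wcomp idn lay A ch ch'
    by (rule A)
  have "is_iso M c"
    using c'_hom c'_c c_c' represents_is_iso[OF c] by simp
  then show ?thesis
    using hom_represents(1)[OF c flat_rep2 flat_rep2] ybe braid_eq[OF ob_br c] by (simp add: is_braided_object_def)
qed

lemma algebraD:
  assumes A: "is_algebra M A m u"
    and reps: "represents m (rep2 A) (F1 A) mh" "represents u delI (F1 A) uh"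
  shows "s_alg ob ar dm cd (\<bullet>) idn lay A mh uh"
proof -
  have ob: "ob A"
    using A by (simp add: is_algebra_def)
  show ?thesis
    using A algebra_eqs[OF ob reps] hom_represents[OF reps(1) flat_rep2[OF ob] flat_F1[OF ob]]
      hom_represents[OF reps(2) flat_delI flat_F1[OF ob]]
    by unfold_locales (simp_all add: is_algebra_def)
qed

lemma braided_algebraD:
  assumes A: "is_braided_algebra M A m u c"
    and reps: "represents m (rep2 A) (F1 A) mh" "represents u delI (F1 A) uh"
      "represents c (rep2 A) (rep2 A) ch"
  shows "\<exists>ch'. s_bralg ob ar dm cd (\<bullet>) idn lay A mh uh ch ch'"
proof -
  have br: "is_braided_object M A c" and alg: "is_algebra M A m u"
    using A by (simp_all add: is_braided_algebra_def)
  obtain ch' where "s_br ob ar dm cd (\<bullet>) idn lay A ch ch'"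
    using braided_objectD[OF br reps(3)] by blast
  moreover have "ob A"
    using br by (simp add: is_braided_object_def)
  ultimately have "s_bralg ob ar dm cd (\<bullet>) idn lay A mh uh ch ch'"
    using algebraD[OF alg reps(1,2)] A braided_algebra_eqs[OF _ reps]
    by (simp add: s_bralg_def s_bralg_axioms_def is_braided_algebra_def)
  then show ?thesis by blast
qed

lemma braided_bialgebraD:
  assumes A: "is_braided_bialgebra M A m u d e c"
    and reps: "represents m (rep2 A) (F1 A) mh" "represents u delI (F1 A) uh"
      "represents c (rep2 A) (rep2 A) ch" "represents d (F1 A) (rep2 A) dh" "represents e (F1 A) delI eh"
  shows "\<exists>ch'. s_bialg ob ar dm cd (\<bullet>) idn lay A mh uh ch ch' dh eh"
proof -
  have alg: "is_braided_algebra M A m u c" and co: "is_coalgebra M A d e"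
    using A by (simp_all add: is_braided_bialgebra_def is_braided_coalgebra_def)
  obtain ch' where "s_bralg ob ar dm cd (\<bullet>) idn lay A mh uh ch ch'"
    using braided_algebraD[OF alg reps(1-3)] by blast
  then interpret s_bralg ob ar dm cd wcomp idn lay A mh uh ch ch' .
  have "s_bialg ob ar dm cd (\<bullet>) idn lay A mh uh ch ch' dh eh"
    using A hom_represents[OF reps(4) flat_F1 flat_rep2] hom_represents[OF reps(5) flat_F1 flat_delI]
      coalgebra_eqs[OF ob_A reps(4,5)] braided_coalgebra_eqs[OF ob_A reps(4,5,3)] bialgebra_eqs[OF ob_A reps]
    by unfold_locales (simp_all add: is_braided_bialgebra_def is_braided_coalgebra_def is_coalgebra_def m2_def u2_def
      W.lay_nil)
  then show ?thesis by blast
qed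

lemma braided_bialgebraI:
  assumes A: "s_bialg ob ar dm cd (\<bullet>) idn lay A mh uh ch ch' dh eh"
    and reps: "represents m (rep2 A) (F1 A) mh" "represents u delI (F1 A) uh"
      "represents c (rep2 A) (rep2 A) ch" "represents d (F1 A) (rep2 A) dh" "represents e (F1 A) delI eh"
  shows "is_braided_bialgebra M A m u d e c"
proof -
  interpret s_bialg ob ar dm cd wcomp idn lay A mh uh ch ch' dh eh
    by (rule A)
  have "is_algebra M A m u"
    using algebra_eqs[OF ob_A reps(1,2)] m_assoc m_unit_left m_unit_right
      hom_represents[OF reps(1) flat_rep2 flat_F1] hom_represents[OF reps(2) flat_delI flat_F1]
    by (simp add: is_algebra_def)
  moreover have "is_braided_object M A c"
    using braided_objectI[OF _ reps(3)] s_br_axioms .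
  ultimately have "is_braided_algebra M A m u c"
    using braided_algebra_eqs[OF ob_A reps(1-3)] c_m_left c_m_right c_u_left c_u_right
    by (simp add: is_braided_algebra_def)
  moreover have "is_coalgebra M A d e"
    using coalgebra_eqs[OF ob_A reps(4,5)] d_coassoc d_counit_left d_counit_right
      hom_represents[OF reps(4) flat_F1 flat_rep2] hom_represents[OF reps(5) flat_F1 flat_delI]
    by (simp add: is_coalgebra_def)
  then have "is_braided_coalgebra M A d e c"
    using braided_coalgebra_eqs[OF ob_A reps(4,5,3)] d_c_left d_c_right e_c_left e_c_right
      \<open>is_braided_object M A c\<close>
    by (simp add: is_braided_coalgebra_def)
  ultimately show ?thesis
    using bialgebra_eqs[OF ob_A reps] d_m d_u e_m e_u
    by (simp add: is_braided_bialgebra_def m2_def u2_def W.lay_nil)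
qed

lemma morphism_eqs:
  assumes f: "represents f (F1 A) (F1 B) fh" and AB: "ob A" "ob B"
  shows
    "represents m (rep2 A) (F1 A) mh \<Longrightarrow> represents m' (rep2 B) (F1 B) mh' \<Longrightarrow>
      f \<cdot> m = m' \<cdot> (f \<otimes> f) \<longleftrightarrow> fh \<bullet> mh = mh' \<bullet> lay [B] fh [] \<bullet> lay [] fh [A]"
    "represents u delI (F1 A) uh \<Longrightarrow> represents u' delI (F1 B) uh' \<Longrightarrow> f \<cdot> u = u' \<longleftrightarrow> fh \<bullet> uh = uh'"
    "represents d (F1 A) (rep2 A) dh \<Longrightarrow> represents d' (F1 B) (rep2 B) dh' \<Longrightarrow>
      d' \<cdot> f = (f \<otimes> f) \<cdot> d \<longleftrightarrow> dh' \<bullet> fh = lay [B] fh [] \<bullet> lay [] fh [A] \<bullet> dh"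
    "represents e (F1 A) delI eh \<Longrightarrow> represents e' (F1 B) delI eh' \<Longrightarrow> e' \<cdot> f = e \<longleftrightarrow> eh' \<bullet> fh = eh"
    "represents c (rep2 A) (rep2 A) ch \<Longrightarrow> represents c' (rep2 B) (rep2 B) ch' \<Longrightarrow>
      c' \<cdot> (f \<otimes> f) = (f \<otimes> f) \<cdot> c \<longleftrightarrow> ch' \<bullet> lay [B] fh [] \<bullet> lay [] fh [A] = lay [B] fh [] \<bullet> lay [] fh [A] \<bullet> ch"
  supply [simp] = AB represents_typing[OF f]
  by (rule trans[OF represents_eq], (assumption | rule represents_rules flat_rules assms)+, simp)+

end

section \<open>Additive structure, coproducts and equalizers of words\<close>

locale additive_monoidal = preadditive_monoidal_category M
  for M :: "('o, 'a, 'm) preadditive_monoidal_category_scheme" (structure) +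
  assumes tensor_add_left: "ob X \<Longrightarrow> f \<in> Hom M Y Z \<Longrightarrow> g \<in> Hom M Y Z \<Longrightarrow> \<iota> X \<otimes> (f \<oplus> g) = (\<iota> X \<otimes> f) \<oplus> (\<iota> X \<otimes> g)"
    and tensor_add_right: "ob X \<Longrightarrow> f \<in> Hom M Y Z \<Longrightarrow> g \<in> Hom M Y Z \<Longrightarrow> (f \<oplus> g) \<otimes> \<iota> X = (f \<otimes> \<iota> X) \<oplus> (g \<otimes> \<iota> X)"
begin

abbreviation par :: "'a \<Rightarrow> 'a \<Rightarrow> bool" where
  "par f g \<equiv> f \<in> Arr M \<and> g \<in> Arr M \<and> Dom M f = Dom M g \<and> Cod M f = Cod M g"

lemma add_typing [simp]:
  assumes "f \<in> Arr M" "g \<in> Arr M" "Dom M f = Dom M g" "Cod M f = Cod M g"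
  shows "f \<oplus> g \<in> Arr M" "Dom M (f \<oplus> g) = Dom M g" "Cod M (f \<oplus> g) = Cod M g"
proof -
  interpret G: comm_group "\<lparr>carrier = Hom M (Dom M g) (Cod M g), mult = (\<lambda>f g. f \<oplus> g), one = \<zero> (Dom M g) (Cod M g)\<rparr>"
    using assms by (intro Hom_comm_group) simp_all
  show "f \<oplus> g \<in> Arr M" "Dom M (f \<oplus> g) = Dom M g" "Cod M (f \<oplus> g) = Cod M g"
    using G.m_closed[of f g] assms by (simp_all add: Hom_def)
qed

lemma zero_typing [simp]:
  assumes "ob X" "ob Y"
  shows "\<zero> X Y \<in> Arr M" "Dom M (\<zero> X Y) = X" "Cod M (\<zero> X Y) = Y"
proof -
  interpret G: comm_group "\<lparr>carrier = Hom M X Y, mult = (\<lambda>f g. f \<oplus> g), one = \<zero> X Y\<rparr>"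
    using assms by (rule Hom_comm_group)
  show "\<zero> X Y \<in> Arr M" "Dom M (\<zero> X Y) = X" "Cod M (\<zero> X Y) = Y"
    using G.one_closed by (simp_all add: Hom_def)
qed

lemma add_laws:
  assumes "par f g"
  shows "par g h \<Longrightarrow> (f \<oplus> g) \<oplus> h = f \<oplus> (g \<oplus> h)" "f \<oplus> g = g \<oplus> f" "f \<oplus> \<zero> (Dom M f) (Cod M f) = f"
    "f \<oplus> g = f \<Longrightarrow> g = \<zero> (Dom M f) (Cod M f)"
proof -
  interpret G: comm_group "\<lparr>carrier = Hom M (Dom M f) (Cod M f), mult = (\<lambda>f g. f \<oplus> g), one = \<zero> (Dom M f) (Cod M f)\<rparr>"
    using assms by (intro Hom_comm_group) simp_all
  show "par g h \<Longrightarrow> (f \<oplus> g) \<oplus> h = f \<oplus> (g \<oplus> h)" "f \<oplus> g = g \<oplus> f" "f \<oplus> \<zero> (Dom M f) (Cod M f) = f"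
    using G.m_assoc[of f g h] G.m_comm[of f g] G.r_one[of f] assms by (simp_all add: Hom_def)
  show "f \<oplus> g = f \<Longrightarrow> g = \<zero> (Dom M f) (Cod M f)"
    using G.r_cancel_one[of f g] G.m_comm[of f g] assms by (simp add: Hom_def)
qed

lemma Comp_add:
  assumes "par f g"
  shows "h \<in> Arr M \<Longrightarrow> Cod M g = Dom M h \<Longrightarrow> h \<cdot> (f \<oplus> g) = (h \<cdot> f) \<oplus> (h \<cdot> g)"
    "h \<in> Arr M \<Longrightarrow> Cod M h = Dom M g \<Longrightarrow> (f \<oplus> g) \<cdot> h = (f \<cdot> h) \<oplus> (g \<cdot> h)"
  using Comp_add_right[of f "Dom M g" "Cod M g" g h "Cod M h"]
    Comp_add_left[of h "Dom M h" "Dom M g" f "Cod M g" g] assms by (simp_all add: Hom_def)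

lemma actm_add: "obs xs \<Longrightarrow> par f g \<Longrightarrow> actm xs (f \<oplus> g) = actm xs f \<oplus> actm xs g"
proof (induction xs)
  case (Cons X xs)
  then show ?case
    using tensor_add_left[of X "actm xs f" "Dom M (actm xs g)" "Cod M (actm xs g)" "actm xs g"] by (simp add: Hom_def)
qed simp

text \<open>In a group only zero is idempotent, so additive operations preserve zero; composites and
  tensor products with zero arrows are computed in this way.\<close>

lemma zero_unique:
  assumes "h \<in> Arr M" "h \<oplus> h = h"
  shows "h = \<zero> (Dom M h) (Cod M h)"
  using add_laws(4)[of h h] assms by simp

lemma zero_zero: "ob X \<Longrightarrow> ob Y \<Longrightarrow> \<zero> X Y \<oplus> \<zero> X Y = \<zero> X Y"
  using add_laws(3)[of "\<zero> X Y" "\<zero> X Y"] by simp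

lemma Comp_zero:
  assumes "h \<in> Arr M"
  shows "ob X \<Longrightarrow> h \<cdot> \<zero> X (Dom M h) = \<zero> X (Cod M h)" "ob Y \<Longrightarrow> \<zero> (Cod M h) Y \<cdot> h = \<zero> (Dom M h) Y"
proof -
  show "h \<cdot> \<zero> X (Dom M h) = \<zero> X (Cod M h)" if "ob X"
    using zero_unique[of "h \<cdot> \<zero> X (Dom M h)"] assms that
    by (simp add: Comp_add(1)[symmetric] zero_zero)
  show "\<zero> (Cod M h) Y \<cdot> h = \<zero> (Dom M h) Y" if "ob Y"
    using zero_unique[of "\<zero> (Cod M h) Y \<cdot> h"] assms that
    by (simp add: Comp_add(2)[symmetric] zero_zero)
qed

lemma actm_zero:
  assumes "obs xs" "ob X" "ob Y"
  shows "actm xs (\<zero> X Y) = \<zero> (act xs X) (act xs Y)"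
  using zero_unique[of "actm xs (\<zero> X Y)"] assms by (simp add: actm_add[symmetric] zero_zero)

lemma zero_tensor:
  assumes "ob W" "ob X" "ob Y"
  shows "\<zero> X Y \<otimes> \<iota> W = \<zero> (X \<boxtimes> W) (Y \<boxtimes> W)"
  using zero_unique[of "\<zero> X Y \<otimes> \<iota> W"] assms tensor_add_right[of W "\<zero> X Y" X Y "\<zero> X Y"]
  by (simp add: Hom_def zero_zero)

definition wadd :: "('o, 'a) warr \<Rightarrow> ('o, 'a) warr \<Rightarrow> ('o, 'a) warr" (infixl "\<uplus>" 53) where
  "a \<uplus> b = (if ar a \<and> ar b \<and> dm a = dm b \<and> cd a = cd b
     then Some (dm b, restr (\<lambda>Z. ev a Z \<oplus> ev b Z), cd b) else None)"

definition wzero :: "'o list \<Rightarrow> 'o list \<Rightarrow> ('o, 'a) warr" where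
  "wzero xs ys = (if obs xs \<and> obs ys then Some (xs, restr (\<lambda>Z. \<zero> (act xs Z) (act ys Z)), ys) else None)"

lemma warrow_add:
  assumes [simp]: "ar a" "ar b" "dm a = dm b" "cd a = cd b"
  shows "warrow (dm b) (restr (\<lambda>Z. ev a Z \<oplus> ev b Z)) (cd b)"
proof (rule warrowI)
  note [simp] = w_ob[OF assms(1)] w_ob[OF assms(2)]
  fix f assume [simp]: "f \<in> Arr M"
  show "(ev a (Cod M f) \<oplus> ev b (Cod M f)) \<cdot> actm (dm b) f = actm (cd b) f \<cdot> (ev a (Dom M f) \<oplus> ev b (Dom M f))"
    using ev_natural[of a f] ev_natural[of b f] by (simp add: Comp_add)
next
  note [simp] = w_ob[OF assms(1)] w_ob[OF assms(2)]
  fix Z W assume [simp]: "ob Z" "ob W"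
  have "(ev a Z \<oplus> ev b Z) \<otimes> \<iota> W = (ev a Z \<otimes> \<iota> W) \<oplus> (ev b Z \<otimes> \<iota> W)"
    by (rule tensor_add_right) (simp_all add: Hom_def)
  then show "(ev a (Z \<boxtimes> W) \<oplus> ev b (Z \<boxtimes> W)) \<cdot> assw (dm b) Z W = assw (cd b) Z W \<cdot> ((ev a Z \<oplus> ev b Z) \<otimes> \<iota> W)"
    using ev_module[of a Z W] ev_module[of b Z W] by (simp add: Comp_add)
qed (use w_ob[OF assms(2)] in simp_all)

lemma warrow_zero:
  assumes [simp]: "obs xs" "obs ys"
  shows "warrow xs (restr (\<lambda>Z. \<zero> (act xs Z) (act ys Z))) ys"
proof (rule warrowI)
  fix f assume [simp]: "f \<in> Arr M"
  show "\<zero> (act xs (Cod M f)) (act ys (Cod M f)) \<cdot> actm xs f = actm ys f \<cdot> \<zero> (act xs (Dom M f)) (act ys (Dom M f))"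
    using Comp_zero(1)[of "actm ys f" "act xs (Dom M f)"] Comp_zero(2)[of "actm xs f" "act ys (Cod M f)"] by simp
next
  fix Z W assume [simp]: "ob Z" "ob W"
  show "\<zero> (act xs (Z \<boxtimes> W)) (act ys (Z \<boxtimes> W)) \<cdot> assw xs Z W = assw ys Z W \<cdot> (\<zero> (act xs Z) (act ys Z) \<otimes> \<iota> W)"
    using Comp_zero(1)[of "assw ys Z W" "act xs Z \<boxtimes> W"] Comp_zero(2)[of "assw xs Z W" "act ys (Z \<boxtimes> W)"]
    by (simp add: zero_tensor)
qed simp_all

lemma w_ar_add: "ar (a \<uplus> b) \<longleftrightarrow> ar a \<and> ar b \<and> dm a = dm b \<and> cd a = cd b"
  using warrow_add[of a b] by (auto simp: wadd_def ar_Some not_ar_None)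

lemma w_ar_zero: "ar (wzero xs ys) \<longleftrightarrow> obs xs \<and> obs ys"
  using warrow_zero[of xs ys] by (auto simp: wzero_def ar_Some not_ar_None)

lemma w_add_sel:
  "ar a \<Longrightarrow> ar b \<Longrightarrow> dm a = dm b \<Longrightarrow> cd a = cd b \<Longrightarrow> dm (a \<uplus> b) = dm b \<and> cd (a \<uplus> b) = cd b"
  "obs xs \<Longrightarrow> obs ys \<Longrightarrow> dm (wzero xs ys) = xs \<and> cd (wzero xs ys) = ys"
  "ar a \<Longrightarrow> ar b \<Longrightarrow> dm a = dm b \<Longrightarrow> cd a = cd b \<Longrightarrow> ob Z \<Longrightarrow> ev (a \<uplus> b) Z = ev a Z \<oplus> ev b Z"
  "obs xs \<Longrightarrow> obs ys \<Longrightarrow> ob Z \<Longrightarrow> ev (wzero xs ys) Z = \<zero> (act xs Z) (act ys Z)"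
  by (simp_all add: wadd_def wzero_def Some_sel restr_def)

lemma not_ar_add: "\<not> ar (a \<uplus> b) \<Longrightarrow> a \<uplus> b = None"
  unfolding w_ar_add by (auto simp: wadd_def)

sublocale W: strict_additive ob ar dm cd wcomp idn lay wadd wzero
proof
  note [simp] = w_ar_add w_ar_zero w_add_sel w_ob
  fix f g h :: "('o, 'a) warr" and xs ys us vs ws zs :: "'o list"
  show "ar (f \<uplus> g) \<longleftrightarrow> ar f \<and> ar g \<and> dm f = dm g \<and> cd f = cd g" "ar (wzero xs ys) \<longleftrightarrow> list_all ob xs \<and> list_all ob ys"
    by simp_all
  show "h \<bullet> (f \<uplus> g) = (h \<bullet> f) \<uplus> (h \<bullet> g)" if "ar f" "ar g" "dm f = dm g" "cd f = cd g"
    using that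
    by - (rule warr_eqI', simp cong: conj_cong, erule not_ar, erule not_ar_add, simp add: Comp_add cong: conj_cong)
  show "(f \<uplus> g) \<bullet> h = (f \<bullet> h) \<uplus> (g \<bullet> h)" if "ar f" "ar g" "dm f = dm g" "cd f = cd g"
    using that
    by - (rule warr_eqI', simp cong: conj_cong, erule not_ar, erule not_ar_add, simp add: Comp_add cong: conj_cong)
  show "lay xs (f \<uplus> g) ys = lay xs f ys \<uplus> lay xs g ys"
    by (rule warr_eqI', (simp cong: conj_cong; blast?), erule not_ar, erule not_ar_add, simp add: actm_add cong: conj_cong)
  show "(f \<uplus> g) \<uplus> h = f \<uplus> (g \<uplus> h)"
    by (rule warr_eqI', (simp cong: conj_cong; metis), erule not_ar_add, erule not_ar_add, simp add: add_laws(1) cong: conj_cong)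
  show "f \<uplus> g = g \<uplus> f"
    by (rule warr_eqI', fastforce, erule not_ar_add, erule not_ar_add, simp add: add_laws(2) cong: conj_cong)
  show "f \<uplus> wzero xs ys = f" if f: "ar f" "dm f = xs" "cd f = ys"
  proof (rule warr_eqI)
    have [simp]: "obs xs" "obs ys"
      using f w_ob by auto
    show "ev (f \<uplus> wzero xs ys) Z = ev f Z" if "ob Z" for Z
      using add_laws(3)[of "ev f Z" "ev f Z"] that f by simp
  qed (use f w_ob in auto)
  show "f \<bullet> wzero xs ys = wzero xs (cd f)" if f: "ar f" "dm f = ys" "list_all ob xs"
  proof (rule warr_eqI)
    show "ev (f \<bullet> wzero xs ys) Z = ev (wzero xs (cd f)) Z" if "ob Z" for Z
      using Comp_zero(1)[of "ev f Z" "act xs Z"] that f by auto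
  qed (use f in auto)
  show "wzero xs ys \<bullet> f = wzero (dm f) ys" if f: "ar f" "cd f = xs" "list_all ob ys"
  proof (rule warr_eqI)
    show "ev (wzero xs ys \<bullet> f) Z = ev (wzero (dm f) ys) Z" if "ob Z" for Z
      using Comp_zero(2)[of "ev f Z" "act ys Z"] that f by auto
  qed (use f in auto)
  show "list_all ob us \<Longrightarrow> list_all ob vs \<Longrightarrow> list_all ob xs \<Longrightarrow> list_all ob ys \<Longrightarrow>
      lay xs (wzero us vs) ys = wzero (xs @ us @ ys) (xs @ vs @ ys)"
    by (rule warr_eqI) (simp_all add: actm_zero)
  show "g = wzero (dm f) (cd f)" if f: "ar f" "f \<uplus> g = f"
  proof (rule warr_eqI)
    have g: "ar g" "dm f = dm g" "cd f = cd g"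
      using f w_ar_add by metis+
    then show "ar g" "ar (wzero (dm f) (cd f))" "dm g = dm (wzero (dm f) (cd f))" "cd g = cd (wzero (dm f) (cd f))"
      by simp_all
    fix Z assume "ob Z"
    moreover have "ev f Z \<oplus> ev g Z = ev f Z"
      using w_add_sel(3)[OF f(1) g \<open>ob Z\<close>] f(2) by simp
    ultimately show "ev g Z = ev (wzero (dm f) (cd f)) Z"
      using add_laws(4)[of "ev f Z" "ev g Z"] f g by simp
  qed
qed (simp_all add: w_add_sel)

lemma represents_add:
  assumes "represents f p q S" "represents g p q S'"
  shows "represents (f \<oplus> g) p q (S \<uplus> S')"
proof -
  note f = representsD[OF assms(1)] and g = representsD[OF assms(2)]
  have "Dom M f = Dom M g" "Cod M f = Cod M g"
    using flat_cd(2)[OF f(3)] flat_cd(2)[OF f(4)] flat_cd(2)[OF g(3)] flat_cd(2)[OF g(4)] by simp_all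
  note [simp] = this f(1) g(1) f(2)[unfolded W.hom_def] g(2)[unfolded W.hom_def]
    flat_cd(2,3)[OF g(3)] flat_cd(2,3)[OF g(4)]
  have "up (f \<oplus> g) = up f \<uplus> up g"
  proof (rule warr_eqI)
    show "ev (up (f \<oplus> g)) Z = ev (up f \<uplus> up g) Z" if "ob Z" for Z
      using that tensor_add_right[of Z f "Dom M g" "Cod M g" g] by (simp add: w_add_sel(3) Hom_def)
  qed simp_all
  then have "q \<bullet> up (f \<oplus> g) = (S \<uplus> S') \<bullet> p"
    using f(5) g(5) by simp
  then show ?thesis
    using f g by (simp add: represents_def W.hom_def)
qed

lemma represents_zero:
  assumes "flat p X xs" "flat q Y ys"
  shows "represents (\<zero> X Y) p q (wzero xs ys)"
proof -
  note [simp] = flat_ob[OF assms(1)] flat_ob[OF assms(2)] flat_cd[OF assms(1)] flat_cd[OF assms(2)]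
  have [simp]: "obs xs" "obs ys"
    using assms W.hom_ob(2)[OF flat_hom] by blast+
  have "up (\<zero> X Y) = wzero [X] [Y]"
    by (rule warr_eqI) (simp_all add: w_add_sel zero_tensor)
  then show ?thesis
    using assms by (simp add: represents_def W.hom_def W.comp_zero W.zero_comp)
qed

end

section \<open>Universal properties inside words\<close>

context monoidal_category begin

text \<open>Universal properties of words can be checked pointwise: compatibility with morphisms and with
  tensoring on the right follows from uniqueness.\<close>

lemma pointwise_colimit:
  fixes a f :: "nat \<Rightarrow> ('o, 'a) warr"
  assumes a: "\<And>n. W.hom (a n) (xs n) ws" and f: "\<And>n. W.hom (f n) (xs n) zs"
    and ex: "\<And>Z. ob Z \<Longrightarrow> \<exists>k \<in> Hom M (act ws Z) (act zs Z). \<forall>n. k \<cdot> ev (a n) Z = ev (f n) Z"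
    and epi: "\<And>Z Y h h'. ob Z \<Longrightarrow> h \<in> Hom M (act ws Z) Y \<Longrightarrow> h' \<in> Hom M (act ws Z) Y \<Longrightarrow>
      (\<And>n. h \<cdot> ev (a n) Z = h' \<cdot> ev (a n) Z) \<Longrightarrow> h = h'"
    and epi2: "\<And>Z W Y h h'. ob Z \<Longrightarrow> ob W \<Longrightarrow> h \<in> Hom M (act ws Z \<boxtimes> W) Y \<Longrightarrow> h' \<in> Hom M (act ws Z \<boxtimes> W) Y \<Longrightarrow>
      (\<And>n. h \<cdot> (ev (a n) Z \<otimes> \<iota> W) = h' \<cdot> (ev (a n) Z \<otimes> \<iota> W)) \<Longrightarrow> h = h'"
  shows "\<exists>k. W.hom k ws zs \<and> (\<forall>n. k \<bullet> a n = f n)"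
proof -
  obtain \<phi> where \<phi>: "\<And>Z. ob Z \<Longrightarrow> \<phi> Z \<in> Hom M (act ws Z) (act zs Z)"
      "\<And>Z n. ob Z \<Longrightarrow> \<phi> Z \<cdot> ev (a n) Z = ev (f n) Z"
    using ex by metis
  note [simp] = \<phi>(1)[THEN HomD(1)] \<phi>(1)[THEN HomD(2)] \<phi>(1)[THEN HomD(3)]
    a[THEN W.homD(1)] a[THEN W.homD(2)] a[THEN W.homD(3)] f[THEN W.homD(1)] f[THEN W.homD(2)] f[THEN W.homD(3)]
  have [simp]: "obs (xs n)" "obs ws" "obs zs" for n
    using W.hom_ob[OF a] W.hom_ob[OF f] by auto
  have w: "warrow ws (restr \<phi>) zs"
  proof (rule warrowI)
    fix g assume [simp]: "g \<in> Arr M"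
    show "\<phi> (Cod M g) \<cdot> actm ws g = actm zs g \<cdot> \<phi> (Dom M g)"
    proof (rule epi)
      fix n
      have "(\<phi> (Cod M g) \<cdot> actm ws g) \<cdot> ev (a n) (Dom M g) = \<phi> (Cod M g) \<cdot> (ev (a n) (Cod M g) \<cdot> actm (xs n) g)"
        using ev_natural[of "a n" g] by simp
      also have "\<dots> = (\<phi> (Cod M g) \<cdot> ev (a n) (Cod M g)) \<cdot> actm (xs n) g"
        by (rule Comp_assoc_simp[symmetric]) simp_all
      also have "\<dots> = actm zs g \<cdot> ev (f n) (Dom M g)"
        using ev_natural[of "f n" g] by (simp add: \<phi>(2) del: Comp_assoc_simp)
      also have "\<dots> = (actm zs g \<cdot> \<phi> (Dom M g)) \<cdot> ev (a n) (Dom M g)"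
        by (simp add: \<phi>(2))
      finally show "(\<phi> (Cod M g) \<cdot> actm ws g) \<cdot> ev (a n) (Dom M g) = (actm zs g \<cdot> \<phi> (Dom M g)) \<cdot> ev (a n) (Dom M g)" .
    qed (simp_all add: Hom_def)
  next
    fix Z W assume [simp]: "ob Z" "ob W"
    show "\<phi> (Z \<boxtimes> W) \<cdot> assw ws Z W = assw zs Z W \<cdot> (\<phi> Z \<otimes> \<iota> W)"
    \<comment> \<open>The arrows compared here start at \<open>act ws Z \<boxtimes> W\<close>, so
      the family must be jointly epic also after tensoring with \<open>W\<close> on the
      right.\<close>
    proof (rule epi2)
      fix n
      have "(\<phi> (Z \<boxtimes> W) \<cdot> assw ws Z W) \<cdot> (ev (a n) Z \<otimes> \<iota> W) = \<phi> (Z \<boxtimes> W) \<cdot> (ev (a n) (Z \<boxtimes> W) \<cdot> assw (xs n) Z W)"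
        using ev_module[of "a n" Z W] by simp
      also have "\<dots> = (\<phi> (Z \<boxtimes> W) \<cdot> ev (a n) (Z \<boxtimes> W)) \<cdot> assw (xs n) Z W"
        by (rule Comp_assoc_simp[symmetric]) simp_all
      also have "\<dots> = assw zs Z W \<cdot> (ev (f n) Z \<otimes> \<iota> W)"
        using ev_module[of "f n" Z W] by (simp add: \<phi>(2) del: Comp_assoc_simp)
      also have "\<dots> = (assw zs Z W \<cdot> (\<phi> Z \<otimes> \<iota> W)) \<cdot> (ev (a n) Z \<otimes> \<iota> W)"
        by (simp add: \<phi>(2))
      finally show "(\<phi> (Z \<boxtimes> W) \<cdot> assw ws Z W) \<cdot> (ev (a n) Z \<otimes> \<iota> W) = (assw zs Z W \<cdot> (\<phi> Z \<otimes> \<iota> W)) \<cdot> (ev (a n) Z \<otimes> \<iota> W)" .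
    qed (simp_all add: Hom_def)
  qed simp_all
  let ?k = "Some (ws, restr \<phi>, zs) :: ('o, 'a) warr"
  have [simp]: "ar ?k" "dm ?k = ws" "cd ?k = zs" "\<And>Z. ob Z \<Longrightarrow> ev ?k Z = \<phi> Z"
    using w by (simp_all add: ar_Some Some_sel restr_def)
  have "?k \<bullet> a n = f n" for n
    by (rule warr_eqI) (simp_all add: \<phi>(2))
  then show ?thesis
    by (intro exI[of _ ?k]) (simp add: W.hom_def)
qed

lemma pointwise_limit:
  assumes a: "W.hom a ws xs" and f: "W.hom f zs xs"
    and ex: "\<And>Z. ob Z \<Longrightarrow> \<exists>k \<in> Hom M (act zs Z) (act ws Z). ev a Z \<cdot> k = ev f Z"
    and mono: "\<And>Z Y h h'. ob Z \<Longrightarrow> h \<in> Hom M Y (act ws Z) \<Longrightarrow> h' \<in> Hom M Y (act ws Z) \<Longrightarrow>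
      ev a Z \<cdot> h = ev a Z \<cdot> h' \<Longrightarrow> h = h'"
  shows "\<exists>k. W.hom k zs ws \<and> a \<bullet> k = f"
proof -
  obtain \<phi> where \<phi>: "\<And>Z. ob Z \<Longrightarrow> \<phi> Z \<in> Hom M (act zs Z) (act ws Z)"
      "\<And>Z. ob Z \<Longrightarrow> ev a Z \<cdot> \<phi> Z = ev f Z"
    using ex by metis
  note [simp] = \<phi>(1)[THEN HomD(1)] \<phi>(1)[THEN HomD(2)] \<phi>(1)[THEN HomD(3)]
    a[THEN W.homD(1)] a[THEN W.homD(2)] a[THEN W.homD(3)] f[THEN W.homD(1)] f[THEN W.homD(2)] f[THEN W.homD(3)]
  have [simp]: "obs xs" "obs ws" "obs zs"
    using W.hom_ob[OF a] W.hom_ob[OF f] by auto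
  have assoc: "ev a Z \<cdot> (\<phi> Z \<cdot> g) = ev f Z \<cdot> g" if "ob Z" "g \<in> Arr M" "Cod M g = act zs Z" for Z g
    using Comp_assoc_simp[of g "\<phi> Z" "ev a Z"] that by (simp add: \<phi>(2) del: Comp_assoc_simp)
  have w: "warrow zs (restr \<phi>) ws"
  proof (rule warrowI)
    fix g assume [simp]: "g \<in> Arr M"
    show "\<phi> (Cod M g) \<cdot> actm zs g = actm ws g \<cdot> \<phi> (Dom M g)"
    proof (rule mono[of "Cod M g"])
      have "ev a (Cod M g) \<cdot> (\<phi> (Cod M g) \<cdot> actm zs g) = actm xs g \<cdot> ev f (Dom M g)"
        using ev_natural[of f g] by (simp add: assoc)
      also have "\<dots> = (actm xs g \<cdot> ev a (Dom M g)) \<cdot> \<phi> (Dom M g)"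
        by (simp add: \<phi>(2))
      also have "\<dots> = ev a (Cod M g) \<cdot> (actm ws g \<cdot> \<phi> (Dom M g))"
        using ev_natural[of a g] by (simp add: Comp_assoc_simp[symmetric] del: Comp_assoc_simp)
      finally show "ev a (Cod M g) \<cdot> (\<phi> (Cod M g) \<cdot> actm zs g) = ev a (Cod M g) \<cdot> (actm ws g \<cdot> \<phi> (Dom M g))" .
    qed (simp_all add: Hom_def)
  next
    fix Z W assume [simp]: "ob Z" "ob W"
    show "\<phi> (Z \<boxtimes> W) \<cdot> assw zs Z W = assw ws Z W \<cdot> (\<phi> Z \<otimes> \<iota> W)"
    \<comment> \<open>In contrast to the colimit case, cancellation takes place at the target
      \<open>act ws (Z \<boxtimes> W)\<close>, an instance of \<open>mono\<close> itself.\<close>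
    proof (rule mono[of "Z \<boxtimes> W"])
      have "ev a (Z \<boxtimes> W) \<cdot> (\<phi> (Z \<boxtimes> W) \<cdot> assw zs Z W) = assw xs Z W \<cdot> (ev f Z \<otimes> \<iota> W)"
        using ev_module[of f Z W] by (simp add: assoc)
      also have "\<dots> = (assw xs Z W \<cdot> (ev a Z \<otimes> \<iota> W)) \<cdot> (\<phi> Z \<otimes> \<iota> W)"
        by (simp add: \<phi>(2))
      also have "\<dots> = ev a (Z \<boxtimes> W) \<cdot> (assw ws Z W \<cdot> (\<phi> Z \<otimes> \<iota> W))"
        using ev_module[of a Z W] by (simp add: Comp_assoc_simp[symmetric] del: Comp_assoc_simp)
      finally show "ev a (Z \<boxtimes> W) \<cdot> (\<phi> (Z \<boxtimes> W) \<cdot> assw zs Z W) = ev a (Z \<boxtimes> W) \<cdot> (assw ws Z W \<cdot> (\<phi> Z \<otimes> \<iota> W))" .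
    qed (simp_all add: Hom_def)
  qed simp_all
  let ?k = "Some (zs, restr \<phi>, ws) :: ('o, 'a) warr"
  have [simp]: "ar ?k" "dm ?k = zs" "cd ?k = ws" "\<And>Z. ob Z \<Longrightarrow> ev ?k Z = \<phi> Z"
    using w by (simp_all add: ar_Some Some_sel restr_def)
  have "a \<bullet> ?k = f"
    by (rule warr_eqI) (simp_all add: \<phi>(2))
  then show ?thesis
    by (intro exI[of _ ?k]) (simp add: W.hom_def)
qed

end

locale coproduct_monoidal = monoidal_category M for M :: "('o, 'a, 'm) monoidal_category_scheme" (structure) +
  assumes preserves_coproducts: "ob X \<Longrightarrow>
    preserves_denumerable_coproducts M M (tensor_left M X) \<and> preserves_denumerable_coproducts M M (tensor_right M X)"
begin

lemma act_coproduct: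
  fixes X :: "nat \<Rightarrow> 'o"
  assumes "is_coproduct M X S \<kappa>"
  shows "obs xs \<Longrightarrow> is_coproduct M (\<lambda>n. act xs (X n)) (act xs S) (\<lambda>n. actm xs (\<kappa> n))"
proof (induction xs)
  case (Cons Y xs)
  then show ?case
    using preserves_coproducts[of Y]
    by (auto simp: preserves_denumerable_coproducts_def tensor_left_def)
qed (simp add: assms)

lemma coproduct_tensor:
  fixes X :: "nat \<Rightarrow> 'o"
  assumes "is_coproduct M X S \<kappa>" "ob W"
  shows "is_coproduct M (\<lambda>n. X n \<boxtimes> W) (S \<boxtimes> W) (\<lambda>n. \<kappa> n \<otimes> \<iota> W)"
  using assms preserves_coproducts[of W]
  by (auto simp: preserves_denumerable_coproducts_def tensor_right_def)

lemma coproduct_epi: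
  fixes X :: "nat \<Rightarrow> 'o"
  assumes S: "is_coproduct M X S \<kappa>" and h: "h \<in> Hom M S Y" "h' \<in> Hom M S Y" "\<And>n. h \<cdot> \<kappa> n = h' \<cdot> \<kappa> n"
  shows "h = h'"
proof -
  have "\<And>n. \<kappa> n \<in> Hom M (X n) S"
    using S by (simp add: is_coproduct_def)
  then have "\<exists>!k. k \<in> Hom M S Y \<and> (\<forall>n. k \<cdot> \<kappa> n = h \<cdot> \<kappa> n)"
    using S[unfolded is_coproduct_def, THEN conjunct2, THEN conjunct2, rule_format, of Y "\<lambda>n. h \<cdot> \<kappa> n"]
      h Hom_Obj Comp_Hom by blast
  then show ?thesis
    using h by auto
qed

lemma coproduct_exists:
  fixes X :: "nat \<Rightarrow> 'o"
  assumes S: "is_coproduct M X S \<kappa>" and f: "ob Y" "\<And>n. f n \<in> Hom M (X n) Y"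
  shows "\<exists>k \<in> Hom M S Y. \<forall>n. k \<cdot> \<kappa> n = f n"
  using S f unfolding is_coproduct_def by blast

text \<open>At an object \<open>Z\<close> the layered injections arise from \<open>\<kappa>\<close>
  by tensoring with \<open>act ys Z\<close> on the right and then with the letters of
  \<open>xs\<close> on the left, so they form a coproduct at every \<open>Z\<close>;
  \<open>pointwise_colimit\<close> assembles the induced arrows.\<close>

lemma word_coproduct:
  fixes X :: "nat \<Rightarrow> 'o"
  assumes S: "is_coproduct M X S \<kappa>" and [simp]: "obs xs" "obs ys"
  shows "(\<And>n. W.hom (f n) (xs @ X n # ys) zs) \<Longrightarrow>
      \<exists>k. W.hom k (xs @ S # ys) zs \<and> (\<forall>n. k \<bullet> lay xs (up (\<kappa> n)) ys = f n)"
    and "W.hom k (xs @ S # ys) zs \<Longrightarrow> W.hom k' (xs @ S # ys) zs \<Longrightarrow>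
      (\<And>n. k \<bullet> lay xs (up (\<kappa> n)) ys = k' \<bullet> lay xs (up (\<kappa> n)) ys) \<Longrightarrow> k = k'"
proof -
  have \<kappa>: "\<kappa> n \<in> Hom M (X n) S" for n
    using S by (simp add: is_coproduct_def)
  note [simp] = HomD[OF \<kappa>] Hom_Obj(1)[OF \<kappa>] Hom_Obj(2)[OF \<kappa>[of 0]]
  have a: "W.hom (lay xs (up (\<kappa> n)) ys) (xs @ X n # ys) (xs @ S # ys)" for n
    by (simp add: W.hom_def)
  have cop: "is_coproduct M (\<lambda>n. act (xs @ X n # ys) Z) (act (xs @ S # ys) Z) (\<lambda>n. ev (lay xs (up (\<kappa> n)) ys) Z)"
    if "ob Z" for Z
    using act_coproduct[OF coproduct_tensor[OF S, of "act ys Z"], of xs] that by simp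
  show "\<exists>k. W.hom k (xs @ S # ys) zs \<and> (\<forall>n. k \<bullet> lay xs (up (\<kappa> n)) ys = f n)"
    if f: "\<And>n. W.hom (f n) (xs @ X n # ys) zs"
  proof (rule pointwise_colimit[OF a f])
    have [simp]: "obs zs"
      using W.hom_ob(2)[OF f] .
    fix Z assume [simp]: "ob Z"
    show "\<exists>k \<in> Hom M (act (xs @ S # ys) Z) (act zs Z). \<forall>n. k \<cdot> ev (lay xs (up (\<kappa> n)) ys) Z = ev (f n) Z"
      using f[unfolded W.hom_def] by (intro coproduct_exists[OF cop]) (simp_all add: Hom_def)
    fix Y h h'
    show "h \<in> Hom M (act (xs @ S # ys) Z) Y \<Longrightarrow> h' \<in> Hom M (act (xs @ S # ys) Z) Y \<Longrightarrow>
      (\<And>n. h \<cdot> ev (lay xs (up (\<kappa> n)) ys) Z = h' \<cdot> ev (lay xs (up (\<kappa> n)) ys) Z) \<Longrightarrow> h = h'"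
      by (rule coproduct_epi[OF cop[OF \<open>ob Z\<close>]], assumption, assumption, blast)
    fix W assume W: "ob W"
    show "h \<in> Hom M (act (xs @ S # ys) Z \<boxtimes> W) Y \<Longrightarrow> h' \<in> Hom M (act (xs @ S # ys) Z \<boxtimes> W) Y \<Longrightarrow>
      (\<And>n. h \<cdot> (ev (lay xs (up (\<kappa> n)) ys) Z \<otimes> \<iota> W) = h' \<cdot> (ev (lay xs (up (\<kappa> n)) ys) Z \<otimes> \<iota> W)) \<Longrightarrow> h = h'"
      by (rule coproduct_epi[OF coproduct_tensor[OF cop[OF \<open>ob Z\<close>] W]], assumption, assumption, blast)
  qed
  assume k: "W.hom k (xs @ S # ys) zs" "W.hom k' (xs @ S # ys) zs"
    and eq: "\<And>n. k \<bullet> lay xs (up (\<kappa> n)) ys = k' \<bullet> lay xs (up (\<kappa> n)) ys"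
  note [simp] = k[unfolded W.hom_def]
  show "k = k'"
  proof (rule warr_eqI)
    fix Z assume [simp]: "ob Z"
    have "ev k Z \<cdot> ev (lay xs (up (\<kappa> n)) ys) Z = ev k' Z \<cdot> ev (lay xs (up (\<kappa> n)) ys) Z" for n
      using arg_cong[OF eq[of n], of "\<lambda>a. ev a Z"] by simp
    then show "ev k Z = ev k' Z"
      by (intro coproduct_epi[OF cop, of Z "ev k Z" "act zs Z" "ev k' Z"]) (simp_all add: Hom_def)
  qed simp_all
qed

end

locale equalizer_monoidal = monoidal_category M for M :: "('o, 'a, 'm) monoidal_category_scheme" (structure) +
  assumes preserves_equalizers: "ob X \<Longrightarrow>
    preserves_equalizers M M (tensor_left M X) \<and> preserves_equalizers M M (tensor_right M X)"
begin

lemma act_equalizer: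
  assumes "is_equalizer M X Y f g E e"
  shows "obs xs \<Longrightarrow> is_equalizer M (act xs X) (act xs Y) (actm xs f) (actm xs g) (act xs E) (actm xs e)"
proof (induction xs)
  case (Cons Z xs)
  then show ?case
    using preserves_equalizers[of Z] by (auto simp: preserves_equalizers_def tensor_left_def)
qed (simp add: assms)

lemma word_equalizer:
  assumes E: "is_equalizer M X Y f g E e" and [simp]: "obs xs" "obs ys"
  shows "W.hom h ws (xs @ X # ys) \<Longrightarrow> lay xs (up f) ys \<bullet> h = lay xs (up g) ys \<bullet> h \<Longrightarrow>
      \<exists>k. W.hom k ws (xs @ E # ys) \<and> lay xs (up e) ys \<bullet> k = h"
    and "W.hom k ws (xs @ E # ys) \<Longrightarrow> W.hom k' ws (xs @ E # ys) \<Longrightarrow>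
      lay xs (up e) ys \<bullet> k = lay xs (up e) ys \<bullet> k' \<Longrightarrow> k = k'"
proof -
  have fge: "f \<in> Hom M X Y" "g \<in> Hom M X Y" "e \<in> Hom M E X"
    using E by (simp_all add: is_equalizer_def)
  note [simp] = HomD[OF fge(1)] HomD[OF fge(2)] HomD[OF fge(3)] Hom_Obj[OF fge(1)] Hom_Obj[OF fge(3)]
  have a: "W.hom (lay xs (up e) ys) (xs @ E # ys) (xs @ X # ys)"
    by (simp add: W.hom_def)
  have eq: "is_equalizer M (act (xs @ X # ys) Z) (act (xs @ Y # ys) Z) (ev (lay xs (up f) ys) Z) (ev (lay xs (up g) ys) Z)
      (act (xs @ E # ys) Z) (ev (lay xs (up e) ys) Z)" if "ob Z" for Z
  proof -
    have "is_equalizer M (X \<boxtimes> act ys Z) (Y \<boxtimes> act ys Z) (f \<otimes> \<iota> (act ys Z)) (g \<otimes> \<iota> (act ys Z))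
        (E \<boxtimes> act ys Z) (e \<otimes> \<iota> (act ys Z))"
      using preserves_equalizers[of "act ys Z"] E that by (auto simp: preserves_equalizers_def tensor_right_def)
    from act_equalizer[OF this, of xs] that show ?thesis by simp
  qed
  have mono: "k = k'" if "ob Z" "k \<in> Hom M V (act (xs @ E # ys) Z)" "k' \<in> Hom M V (act (xs @ E # ys) Z)"
    "ev (lay xs (up e) ys) Z \<cdot> k = ev (lay xs (up e) ys) Z \<cdot> k'" for Z V k k'
  proof -
    let ?a = "\<lambda>h. ev (lay xs (up h) ys) Z"
    have "?a e \<cdot> k \<in> Hom M V (act (xs @ X # ys) Z)"
      using that(1,2) by (simp add: Hom_def)
    moreover have "?a f \<cdot> (?a e \<cdot> k) = ?a g \<cdot> (?a e \<cdot> k)"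
    proof -
      have "?a f \<cdot> ?a e = ?a g \<cdot> ?a e"
        using eq[OF that(1)] by (simp add: is_equalizer_def)
      then have "(?a f \<cdot> ?a e) \<cdot> k = (?a g \<cdot> ?a e) \<cdot> k"
        by simp
      then show ?thesis
        using that(1,2) by (simp add: Hom_def del: tensor_Comp_simp)
    qed
    ultimately have "\<exists>!j. j \<in> Hom M V (act (xs @ E # ys) Z) \<and> ?a e \<cdot> j = ?a e \<cdot> k"
      using eq[OF that(1)] unfolding is_equalizer_def by blast
    then show ?thesis
      using that by auto
  qed
  show "\<exists>k. W.hom k ws (xs @ E # ys) \<and> lay xs (up e) ys \<bullet> k = h"
    if h: "W.hom h ws (xs @ X # ys)" "lay xs (up f) ys \<bullet> h = lay xs (up g) ys \<bullet> h"
  proof (rule pointwise_limit[OF a h(1)])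
    note [simp] = h(1)[unfolded W.hom_def]
    fix Z assume [simp]: "ob Z"
    have "ev h Z \<in> Hom M (act ws Z) (act (xs @ X # ys) Z)"
      by (simp add: Hom_def)
    moreover have "ev (lay xs (up f) ys) Z \<cdot> ev h Z = ev (lay xs (up g) ys) Z \<cdot> ev h Z"
      using arg_cong[OF h(2), of "\<lambda>a. ev a Z"] by simp
    ultimately show "\<exists>k \<in> Hom M (act ws Z) (act (xs @ E # ys) Z). ev (lay xs (up e) ys) Z \<cdot> k = ev h Z"
      using eq[OF \<open>ob Z\<close>] unfolding is_equalizer_def by blast
  qed (rule mono)
  assume k: "W.hom k ws (xs @ E # ys)" "W.hom k' ws (xs @ E # ys)"
    and ek: "lay xs (up e) ys \<bullet> k = lay xs (up e) ys \<bullet> k'"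
  note [simp] = k[unfolded W.hom_def]
  show "k = k'"
  proof (rule warr_eqI)
    fix Z assume [simp]: "ob Z"
    have "ev (lay xs (up e) ys) Z \<cdot> ev k Z = ev (lay xs (up e) ys) Z \<cdot> ev k' Z"
      using arg_cong[OF ek, of "\<lambda>a. ev a Z"] by simp
    then show "ev k Z = ev k' Z"
      by - (rule mono[of Z "ev k Z" "act ws Z"], simp_all add: Hom_def)
  qed simp_all
qed

end

section \<open>Representing the braided tensor bialgebra\<close>

context monoidal_category begin

text \<open>Runs parallel to \<open>tpow\<close> and flattens the \<open>n\<close>-th power to a
  word of length \<open>n\<close>; the zeroth power is \<open>\<I>\<close>, hence
  \<open>delI\<close>.\<close>

fun K :: "'o \<Rightarrow> nat \<Rightarrow> ('o, 'a) warr" where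
  "K V 0 = delI"
| "K V (Suc 0) = F1 V"
| "K V (Suc (Suc n)) = fl (K V (Suc n)) (F1 V)"

lemma flat_K: "ob V \<Longrightarrow> flat (K V n) (tpow M V n) (replicate n V)"
proof (induction V n rule: K.induct)
  case (3 V n)
  then show ?case
    using flat_fl[OF 3(1) flat_F1[of V]] by (simp add: replicate_append_same)
qed (simp_all add: flat_delI flat_F1)

lemma cd_K [simp]: "ob V \<Longrightarrow> cd (K V n) = replicate n V"
  and isflat_K [simp]: "ob V \<Longrightarrow> isflat (K V n)"
  using flat_cd[OF flat_K] flat_K isflat_def by blast+

lemma represents_cong: "represents f p q S \<Longrightarrow> S = S' \<Longrightarrow> represents f p q S'"
  by simp

lemma obs_replicate [simp]: "ob V \<Longrightarrow> obs (replicate n V)"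
  by (induction n) simp_all

text \<open>\<open>tjoin\<close> is composed of constraints only. This removes it from the
  conditions that describe the multiplication and the braiding family.\<close>

lemma represents_tjoin:
  "ob V \<Longrightarrow> represents (tjoin M V m n) (fl (K V m) (K V n)) (K V (m + n)) (idn (replicate (m + n) V))"
proof (induction V m n rule: tjoin.induct)
  case (1 V m)
  then show ?case
    using represents_runit[OF flat_K] by simp
next
  case (2 V)
  then show ?case
    using represents_lunit[OF flat_F1] by simp
next
  case (3 V m)
  then show ?case
    using represents_Ident[OF flat_K, of V "Suc (Suc m)"] by simp
next
  case (4 V m n)
  note [simp] = 4(2)
  have a: "represents (\<a>' (tpow M V m) (tpow M V (Suc n)) V) (fl (K V m) (fl (K V (Suc n)) (F1 V)))
      (fl (fl (K V m) (K V (Suc n))) (F1 V)) (idn (replicate m V @ replicate (Suc n) V @ [V]))"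
    by (intro represents_assoc_inv flat_K flat_F1) simp_all
  have e: "(lay [] (idn (replicate (m + Suc n) V)) (cd (F1 V)) \<bullet> lay (cd (fl (K V m) (K V (Suc n)))) (idn [V]) [])
      \<bullet> idn (replicate m V @ replicate (Suc n) V @ [V]) = idn (replicate (m + Suc (Suc n)) V)"
    by (simp add: replicate_add replicate_append_same replicate_app_Cons_same)
  have "represents (tjoin M V m (Suc (Suc n))) (fl (K V m) (K V (Suc (Suc n)))) (fl (K V (m + Suc n)) (F1 V))
    (idn (replicate (m + Suc (Suc n)) V))"
    using represents_Comp[OF a represents_tensor[OF 4(1) represents_Ident[OF flat_F1]]]
    unfolding e[symmetric] by simp
  then show ?case
    by (simp only: K.simps add_Suc_right)
qed

text \<open>The tool for evaluating definite descriptions. If the describing predicate, read on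
  words, says \<open>S' = S\<close>, then fullness gives existence, faithfulness gives uniqueness,
  and the described arrow is represented by \<open>S\<close>.\<close>

lemma THE_represents:
  assumes flat: "flat p X xs" "flat q Y ys" and S: "W.hom S xs ys"
    and iff: "\<And>f S'. represents f p q S' \<Longrightarrow> f \<in> Hom M X Y \<Longrightarrow> P f \<longleftrightarrow> S' = S"
    and PH: "\<And>f. P f \<Longrightarrow> f \<in> Hom M X Y"
  shows "represents (The P) p q S \<and> P (The P)"
proof -
  obtain f where f: "represents f p q S" "f \<in> Hom M X Y"
    using represents_full[OF S flat] by blast
  have Pf: "P f"
    using iff f by blast
  have "g = f" if "P g" for g
  proof -
    have "represents g p q (q \<bullet> up g \<bullet> finv p)"
      using represents_exists[OF PH[OF that] flat] .
    with iff that PH have "represents g p q S"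
      by metis
    then show ?thesis
      using represents_eq f(1) by blast
  qed
  with Pf have "The P = f"
    by (rule the_equality)
  with f(1) Pf show ?thesis
    by simp
qed

end

locale tensor_setting = additive_monoidal M + coproduct_monoidal M + equalizer_monoidal M
  for M :: "('o, 'a, 'm) preadditive_monoidal_category_scheme" (structure) +
  fixes T :: "'o \<Rightarrow> 'o" and \<alpha> :: "'o \<Rightarrow> nat \<Rightarrow> 'a"
  assumes T_coproduct: "ob V \<Longrightarrow> is_coproduct M (tpow M V) (T V) (\<alpha> V)"
begin

lemma \<alpha>_Hom: "ob V \<Longrightarrow> \<alpha> V n \<in> Hom M (tpow M V n) (T V)"
  using T_coproduct by (simp add: is_coproduct_def)

lemma ob_T [simp]: "ob V \<Longrightarrow> ob (T V)"
  using Hom_Obj(2)[OF \<alpha>_Hom] .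

definition inj_word :: "'o \<Rightarrow> nat \<Rightarrow> ('o, 'a) warr" where
  "inj_word V n = F1 (T V) \<bullet> up (\<alpha> V n) \<bullet> finv (K V n)"

lemma represents_\<alpha>: "ob V \<Longrightarrow> represents (\<alpha> V n) (K V n) (F1 (T V)) (inj_word V n)"
  unfolding inj_word_def by (rule represents_exists[OF \<alpha>_Hom flat_K flat_F1]) simp_all

text \<open>The injections of the coproduct in \<open>M\<close> start at the letter
  \<open>tpow M V n\<close>, those of the strict locale at a word of \<open>n\<close> letters; the
  universal properties correspond because \<open>K V n\<close> is invertible.\<close>

lemma inj_word_tensor:
  assumes V: "s_br ob ar dm cd (\<bullet>) idn lay V c c'"
  shows "s_tensor_add ob ar dm cd (\<bullet>) idn lay V c c' (T V) (inj_word V) wadd wzero"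
proof -
  interpret s_br ob ar dm cd wcomp idn lay V c c'
    by (rule V)
  note [simp] = HomD[OF \<alpha>_Hom[OF ob_br]]
  have hom: "W.hom (inj_word V n) (replicate n V) [T V]" for n
    using hom_represents(2)[OF represents_\<alpha> flat_K flat_F1] by simp
  note [simp] = hom[THEN W.homD(1)] hom[THEN W.homD(2)] hom[THEN W.homD(3)]
    flat_cd(2,3)[OF flat_K[OF ob_br]] flat_cd(1)[OF flat_K[OF ob_br]]
  have K_lay: "lay xs (K V n) ys \<bullet> lay xs (finv (K V n)) ys = idn (xs @ replicate n V @ ys)" for n xs ys
    using W.lay_cong[OF finv[OF flat_K[OF ob_br, of n], THEN conjunct2, THEN conjunct2], of xs ys] by simp
  have fK [simp]: "ar (finv (K V n))" "dm (finv (K V n)) = replicate n V" "cd (finv (K V n)) = [tpow M V n]" for n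
    using finv[OF flat_K[OF ob_br, of n]] by (simp_all add: W.hom_def)
  have up_lay: "lay xs (up (\<alpha> V n)) ys = lay xs (inj_word V n) ys \<bullet> lay xs (K V n) ys" for xs ys n
  proof -
    have "F1 (T V) \<bullet> up (\<alpha> V n) = inj_word V n \<bullet> K V n"
      using representsD(5)[OF represents_\<alpha>[OF ob_br]] .
    from W.lay_cong[OF this, of xs ys] show ?thesis
      by (simp add: F1_def)
  qed
  have inj_lay: "lay xs (inj_word V n) ys = lay xs (up (\<alpha> V n)) ys \<bullet> lay xs (finv (K V n)) ys" for xs ys n
    by (simp add: inj_word_def F1_def)
  show ?thesis
  proof unfold_locales
    show "W.hom (inj_word V n) (replicate n V) [T V]" for n
      by (rule hom)
    show "\<exists>k. W.hom k (xs @ T V # ys) zs \<and> (\<forall>n. k \<bullet> lay xs (inj_word V n) ys = f n)"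
      if xy [simp]: "list_all ob xs" "list_all ob ys" and f: "\<And>n. W.hom (f n) (xs @ replicate n V @ ys) zs" for xs ys zs f
    proof -
      have "W.hom (f n \<bullet> lay xs (K V n) ys) (xs @ tpow M V n # ys) zs" for n
        using f[of n] by (simp add: W.hom_def)
      then obtain k where k: "W.hom k (xs @ T V # ys) zs" "\<And>n. k \<bullet> lay xs (up (\<alpha> V n)) ys = f n \<bullet> lay xs (K V n) ys"
        using word_coproduct(1)[OF T_coproduct[OF ob_br] xy, of "\<lambda>n. f n \<bullet> lay xs (K V n) ys" zs] by auto
      have "k \<bullet> lay xs (inj_word V n) ys = f n" for n
        using k(2)[THEN W.tail, of n "lay xs (finv (K V n)) ys"] f[of n]
        by (simp add: inj_lay K_lay W.hom_def)
      with k(1) show ?thesis by blast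
    qed
    show "k = k'" if k: "W.hom k (xs @ T V # ys) zs" "W.hom k' (xs @ T V # ys) zs"
      and eq: "\<And>n. k \<bullet> lay xs (inj_word V n) ys = k' \<bullet> lay xs (inj_word V n) ys" for k k' xs ys zs
    proof (rule word_coproduct(2)[OF T_coproduct[OF ob_br] _ _ k])
      show "obs xs" "obs ys"
        using W.hom_ob(1)[OF k(1)] by simp_all
      show "k \<bullet> lay xs (up (\<alpha> V n)) ys = k' \<bullet> lay xs (up (\<alpha> V n)) ys" for n
        using eq[THEN W.tail, of n "lay xs (K V n) ys"] by (simp add: up_lay)
    qed
  qed
qed

end

locale tensor_object = tensor_setting M T \<alpha>
  for M :: "('o, 'a, 'm) preadditive_monoidal_category_scheme" (structure)
    and T :: "'o \<Rightarrow> 'o" and \<alpha> :: "'o \<Rightarrow> nat \<Rightarrow> 'a" +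
  fixes V :: 'o and c :: 'a
  assumes braided: "is_braided_object M V c"
begin

lemma ob_V: "ob V" and c_Hom: "c \<in> Hom M (V \<boxtimes> V) (V \<boxtimes> V)"
  using braided by (simp_all add: is_braided_object_def)

definition cw :: "('o, 'a) warr" where "cw = rep2 V \<bullet> up c \<bullet> finv (rep2 V)"

lemma represents_c: "represents c (rep2 V) (rep2 V) cw"
  unfolding cw_def by (rule represents_exists[OF c_Hom flat_rep2 flat_rep2]) (rule ob_V)+

definition cw' :: "('o, 'a) warr" where "cw' = (SOME c'. s_br ob ar dm cd (\<bullet>) idn lay V cw c')"

sublocale S: s_tensor_add ob ar dm cd wcomp idn lay V cw cw' "T V" "inj_word V" wadd wzero
proof -
  have "\<exists>c'. s_br ob ar dm cd (\<bullet>) idn lay V cw c'"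
    using braided_objectD[OF braided represents_c] by blast
  then have "s_br ob ar dm cd (\<bullet>) idn lay V cw cw'"
    unfolding cw'_def by (rule someI_ex)
  then show "s_tensor_add ob ar dm cd (\<bullet>) idn lay V cw cw' (T V) (inj_word V) wadd wzero"
    by (rule inj_word_tensor)
qed

abbreviation pw :: "nat \<Rightarrow> 'o list" where "pw n \<equiv> replicate n V"

lemma flat_K2: "flat (fl (K V m) (K V n)) (tpow M V m \<boxtimes> tpow M V n) (pw m @ pw n)"
  using flat_fl[OF flat_K flat_K] ob_V by blast

text \<open>With constraints and \<open>tjoin\<close> gone, the specification becomes the list of
  properties proved for the strict blocks and required by \<open>D_unique\<close>.\<close>

lemma braiding_family_iff:
  assumes d: "\<And>m n. represents (d m n) (fl (K V m) (K V n)) (fl (K V n) (K V m)) (D m n)"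
  shows "is_braiding_family M V c d \<longleftrightarrow>
     (\<forall>l m n. lay (pw n) (D l m) [] \<bullet> lay [] (D l n) (pw m) \<bullet> lay (pw l) (D m n) []
        = lay [] (D m n) (pw l) \<bullet> lay (pw m) (D l n) [] \<bullet> lay [] (D l m) (pw n)) \<and>
     (\<forall>l m n. l \<noteq> 0 \<and> m \<noteq> 0 \<longrightarrow> lay [] (D l n) (pw m) \<bullet> lay (pw l) (D m n) [] = D (l + m) n) \<and>
     (\<forall>l m n. m \<noteq> 0 \<and> n \<noteq> 0 \<longrightarrow> lay (pw m) (D l n) [] \<bullet> lay [] (D l m) (pw n) = D l (m + n)) \<and>
     (\<forall>n. D 0 n = idn (pw n)) \<and> (\<forall>n. D n 0 = idn (pw n)) \<and> D 1 1 = cw"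
proof -
  let ?W = "tpow M V"
  note [simp] = ob_V represents_typing[OF d]
  have hom: "d m n \<in> Hom M (?W m \<boxtimes> ?W n) (?W n \<boxtimes> ?W m)" for m n
    using hom_represents(1)[OF d flat_K2 flat_K2] .
  note rules = represents_rules represents_tjoin flat_K flat_rules d ob_V unit_Obj
  have 1: "\<a>' (?W n) (?W m) (?W l) \<cdot> (\<iota> (?W n) \<otimes> d l m) \<cdot> \<a> (?W n) (?W l) (?W m) \<cdot> (d l n \<otimes> \<iota> (?W m)) \<cdot>
          \<a>' (?W l) (?W n) (?W m) \<cdot> (\<iota> (?W l) \<otimes> d m n) \<cdot> \<a> (?W l) (?W m) (?W n)
        = (d m n \<otimes> \<iota> (?W l)) \<cdot> \<a>' (?W m) (?W n) (?W l) \<cdot> (\<iota> (?W m) \<otimes> d l n) \<cdot> \<a> (?W m) (?W l) (?W n) \<cdot>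
          (d l m \<otimes> \<iota> (?W n)) \<longleftrightarrow>
      lay (pw n) (D l m) [] \<bullet> lay [] (D l n) (pw m) \<bullet> lay (pw l) (D m n) []
        = lay [] (D m n) (pw l) \<bullet> lay (pw m) (D l n) [] \<bullet> lay [] (D l m) (pw n)" for l m n
    by (rule trans[OF represents_eq[where p = "fl (fl (K V l) (K V m)) (K V n)"]], (rule rules)+, simp)
  have 2: "(\<iota> (?W n) \<otimes> tjoin M V l m) \<cdot> \<a> (?W n) (?W l) (?W m) \<cdot> (d l n \<otimes> \<iota> (?W m)) \<cdot>
          \<a>' (?W l) (?W n) (?W m) \<cdot> (\<iota> (?W l) \<otimes> d m n) \<cdot> \<a> (?W l) (?W m) (?W n)
        = d (l + m) n \<cdot> (tjoin M V l m \<otimes> \<iota> (?W n)) \<longleftrightarrow>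
      lay [] (D l n) (pw m) \<bullet> lay (pw l) (D m n) [] = D (l + m) n" for l m n
    by (rule trans[OF represents_eq[where p = "fl (fl (K V l) (K V m)) (K V n)"]], (rule rules)+, simp add: replicate_add)
  have 3: "(tjoin M V m n \<otimes> \<iota> (?W l)) \<cdot> \<a>' (?W m) (?W n) (?W l) \<cdot> (\<iota> (?W m) \<otimes> d l n) \<cdot>
          \<a> (?W m) (?W l) (?W n) \<cdot> (d l m \<otimes> \<iota> (?W n)) \<cdot> \<a>' (?W l) (?W m) (?W n)
        = d l (m + n) \<cdot> (\<iota> (?W l) \<otimes> tjoin M V m n) \<longleftrightarrow>
      lay (pw m) (D l n) [] \<bullet> lay [] (D l m) (pw n) = D l (m + n)" for l m n
    by (rule trans[OF represents_eq[where p = "fl (K V l) (fl (K V m) (K V n))"]], (rule rules)+, simp add: replicate_add)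
  \<comment> \<open>\<open>K V 0\<close> is unfolded to \<open>delI\<close>, since the rules for
    unitors are stated with \<open>delI\<close>.\<close>
  have d': "represents (d 0 n) (fl delI (K V n)) (fl (K V n) delI) (D 0 n)"
     "represents (d n 0) (fl (K V n) delI) (fl delI (K V n)) (D n 0)" for n
    using d[of 0 n] d[of n 0] by simp_all
  have 4: "d 0 n \<cdot> \<l>' (?W n) = \<r>' (?W n) \<longleftrightarrow> D 0 n = idn (pw n)" for n
    by (rule trans[OF represents_eq[where p = "K V n"]], (rule represents_rules d' flat_K ob_V)+, simp)
  have 5: "d n 0 \<cdot> \<r>' (?W n) = \<l>' (?W n) \<longleftrightarrow> D n 0 = idn (pw n)" for n
    by (rule trans[OF represents_eq[where p = "K V n"]], (rule represents_rules d' flat_K ob_V)+, simp)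
  have 6: "d 1 1 = c \<longleftrightarrow> D 1 1 = cw"
    using represents_eq[OF _ represents_c, of "d 1 1" "D 1 1"] d[of 1 1] by simp
  show ?thesis
    unfolding is_braiding_family_def Let_def using hom by (simp only: 1 2 3 4 5 6 simp_thms)
qed

text \<open>The description ranges over whole families, which \<open>THE_represents\<close> does not
  cover. A competing family is translated entry by entry, and \<open>D_unique\<close> compares the
  word forms.\<close>

lemma represents_braiding_family:
  "represents (braiding_family M V c m n) (fl (K V m) (K V n)) (fl (K V n) (K V m)) (S.D m n)"
proof -
  have "\<exists>f. represents f (fl (K V m) (K V n)) (fl (K V n) (K V m)) (S.D m n)" for m n
    using represents_full[OF S.D_hom flat_K2 flat_K2] by blast
  then obtain d where d: "\<And>m n. represents (d m n) (fl (K V m) (K V n)) (fl (K V n) (K V m)) (S.D m n)"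
    by metis
  have "is_braiding_family M V c d"
    using S.D_ybe S.D_add_left S.D_add_right S.D_0_right S.D_1_1 by (simp add: braiding_family_iff[OF d])
  moreover have "d' = d" if d': "is_braiding_family M V c d'" for d'
  proof -
    have "d' m n \<in> Hom M (tpow M V m \<boxtimes> tpow M V n) (tpow M V n \<boxtimes> tpow M V m)" for m n
      using d' by (simp add: is_braiding_family_def Let_def)
    from represents_exists[OF this flat_K2 flat_K2]
    have "\<exists>D. represents (d' m n) (fl (K V m) (K V n)) (fl (K V n) (K V m)) D" for m n
      by blast
    then obtain D where D: "\<And>m n. represents (d' m n) (fl (K V m) (K V n)) (fl (K V n) (K V m)) (D m n)"
      by metis
    have "D m n = S.D m n" for m n
      using d' hom_represents(2)[OF D flat_K2 flat_K2]
      by (intro S.D_unique) (simp_all add: braiding_family_iff[OF D])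
    then show ?thesis
      using represents_eq[OF D d] by (intro ext) simp
  qed
  ultimately have "braiding_family M V c = d"
    unfolding braiding_family_def by (intro the_equality)
  with d show ?thesis by simp
qed

lemma T_mult_rule: "represents (T_mult M T \<alpha> V) (rep2 (T V)) (F1 (T V)) S.m \<and>
  T_mult M T \<alpha> V \<in> Hom M (T V \<boxtimes> T V) (T V) \<and>
  (\<forall>m n. T_mult M T \<alpha> V \<cdot> (\<alpha> V m \<otimes> \<alpha> V n) = \<alpha> V (m + n) \<cdot> tjoin M V m n)"
  unfolding T_mult_def
proof (rule THE_represents[OF flat_rep2 flat_F1 S.m_hom])
  note [simp] = ob_V
  fix f m' assume f: "represents f (rep2 (T V)) (F1 (T V)) m'" and fh: "f \<in> Hom M (T V \<boxtimes> T V) (T V)"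
  note [simp] = represents_typing[OF f]
  have m': "W.hom m' [T V, T V] [T V]"
    using hom_represents(2)[OF f flat_rep2 flat_F1] by simp
  \<comment> \<open>The words \<open>pw n\<close> are not explicit lists, so ranks cannot be
    computed; layers are sorted by position instead.\<close>
  have "f \<cdot> (\<alpha> V m \<otimes> \<alpha> V n) = \<alpha> V (m + n) \<cdot> tjoin M V m n \<longleftrightarrow> m' \<bullet> S.I2 m n = inj_word V (m + n)" for m n
    by (rule trans[OF represents_eq[where p = "fl (K V m) (K V n)"]],
      (rule represents_rules represents_tjoin represents_\<alpha> flat_K f ob_V)+, simp add: S.I2_def del: W.rsort add: W.sort)
  then show "f \<in> Hom M (T V \<boxtimes> T V) (T V) \<and> (\<forall>m n. f \<cdot> (\<alpha> V m \<otimes> \<alpha> V n) = \<alpha> V (m + n) \<cdot> tjoin M V m n) \<longleftrightarrow> m' = S.m"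
    using fh S.T_uniq2[OF m' S.m_hom] by auto
qed (use ob_V in simp_all)

lemmas T_mult = T_mult_rule[THEN conjunct1]

lemma T_unit: "represents (T_unit \<alpha> V) delI (F1 (T V)) S.u"
  using represents_\<alpha>[OF ob_V, of 0] by (simp add: T_unit_def S.u_def)

lemma T_braiding: "represents (T_braiding M T \<alpha> V c) (rep2 (T V)) (rep2 (T V)) S.C"
  unfolding T_braiding_def
proof (rule THE_represents[OF flat_rep2 flat_rep2 S.C_hom, THEN conjunct1])
  note [simp] = ob_V
  fix f C' assume f: "represents f (rep2 (T V)) (rep2 (T V)) C'" and fh: "f \<in> Hom M (T V \<boxtimes> T V) (T V \<boxtimes> T V)"
  note [simp] = represents_typing[OF f]
  have C': "W.hom C' [T V, T V] [T V, T V]"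
    using hom_represents(2)[OF f flat_rep2 flat_rep2] by simp
  have "f \<cdot> (\<alpha> V m \<otimes> \<alpha> V n) = (\<alpha> V n \<otimes> \<alpha> V m) \<cdot> braiding_family M V c m n \<longleftrightarrow> C' \<bullet> S.I2 m n = S.I2 n m \<bullet> S.D m n" for m n
    by (rule trans[OF represents_eq[where p = "fl (K V m) (K V n)"]],
      (rule represents_rules represents_braiding_family represents_\<alpha> flat_K f ob_V)+,
      simp add: S.I2_def del: W.rsort add: W.sort W.sort_comp)
  then show "f \<in> Hom M (T V \<boxtimes> T V) (T V \<boxtimes> T V) \<and>
      (\<forall>m n. f \<cdot> (\<alpha> V m \<otimes> \<alpha> V n) = (\<alpha> V n \<otimes> \<alpha> V m) \<cdot> braiding_family M V c m n) \<longleftrightarrow> C' = S.C"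
    using fh S.T_uniq2[OF C' S.C_hom] by auto
qed (use ob_V in simp_all)

lemma represents_\<alpha>1: "represents (\<alpha> V 1) (F1 V) (F1 (T V)) (inj_word V 1)"
  using represents_\<alpha>[OF ob_V, of 1] by simp

text \<open>On words the describing conditions say that \<open>d'\<close> is an algebra map into the
  braided tensor square with the prescribed value in degree one; by \<open>alg_map_unique\<close>
  only \<open>S.d\<close> satisfies them.\<close>

lemma T_comult_rule: "represents (T_comult M T \<alpha> V c) (F1 (T V)) (rep2 (T V)) S.d \<and>
  is_algebra_mor M (T V) (T_mult M T \<alpha> V) (T_unit \<alpha> V) (T_comult M T \<alpha> V c) (T V \<boxtimes> T V)
    ((T_mult M T \<alpha> V \<otimes> T_mult M T \<alpha> V) \<cdot> middle M (T V) (T_braiding M T \<alpha> V c))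
    ((T_unit \<alpha> V \<otimes> T_unit \<alpha> V) \<cdot> \<l>' \<I>) \<and>
  T_comult M T \<alpha> V c \<cdot> \<alpha> V 1 = ((T_unit \<alpha> V \<otimes> \<alpha> V 1) \<cdot> \<l>' V) \<oplus> ((\<alpha> V 1 \<otimes> T_unit \<alpha> V) \<cdot> \<r>' V)"
  unfolding T_comult_def Let_def
proof (rule THE_represents[OF flat_F1 flat_rep2 S.Ta.d_hom])
  note [simp] = ob_V
  let ?m = "T_mult M T \<alpha> V" and ?u = "T_unit \<alpha> V" and ?c = "T_braiding M T \<alpha> V c"
  fix f d' assume f: "represents f (F1 (T V)) (rep2 (T V)) d'" and fh: "f \<in> Hom M (T V) (T V \<boxtimes> T V)"
  note [simp] = represents_typing[OF f]
  have d': "W.hom d' [T V] [T V, T V]"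
    using hom_represents(2)[OF f flat_F1 flat_rep2] by simp
  note rules = represents_rules represents_add represents_\<alpha>1 flat_rules f ob_V ob_T T_mult T_unit T_braiding unit_Obj
  have 1: "f \<cdot> ?m = ((?m \<otimes> ?m) \<cdot> middle M (T V) ?c) \<cdot> (f \<otimes> f) \<longleftrightarrow>
      d' \<bullet> S.m = S.Ta.m2 \<bullet> lay [T V, T V] d' [] \<bullet> lay [] d' [T V]"
    unfolding middle_def
    by (rule trans[OF represents_eq[where p = "rep2 (T V)"]], (rule rules)+, simp add: S.Ta.m2_def W.layer[where f = d'] W.layer[where f = S.m])
  have 2: "f \<cdot> ?u = (?u \<otimes> ?u) \<cdot> \<l>' \<I> \<longleftrightarrow> d' \<bullet> S.u = S.Ta.u2"
    by (rule trans[OF represents_eq[where p = delI]], (rule rules)+, simp add: S.Ta.u2_def W.layer[where f = S.u])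
  have 3: "f \<cdot> \<alpha> V 1 = ((?u \<otimes> \<alpha> V 1) \<cdot> \<l>' V) \<oplus> ((\<alpha> V 1 \<otimes> ?u) \<cdot> \<r>' V) \<longleftrightarrow>
      d' \<bullet> inj_word V 1 = (lay [] S.u [T V] \<bullet> inj_word V 1) \<uplus> (lay [T V] S.u [] \<bullet> inj_word V 1)"
    by (rule trans[OF represents_eq[where p = "F1 V"]], (rule rules)+, simp add: W.layer[where f = "inj_word V (Suc 0)"])
  show "is_algebra_mor M (T V) ?m ?u f (T V \<boxtimes> T V) ((?m \<otimes> ?m) \<cdot> middle M (T V) ?c) ((?u \<otimes> ?u) \<cdot> \<l>' \<I>) \<and>
      f \<cdot> \<alpha> V 1 = ((?u \<otimes> \<alpha> V 1) \<cdot> \<l>' V) \<oplus> ((\<alpha> V 1 \<otimes> ?u) \<cdot> \<r>' V) \<longleftrightarrow> d' = S.d"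
    unfolding is_algebra_mor_def 1 2 3 using fh d' S.d S.alg_map_unique[of d' "[T V, T V]" S.Ta.m2 S.Ta.u2 S.d]
    by (auto simp: S.alg_map_def)
qed (use ob_V in \<open>simp_all add: is_algebra_mor_def\<close>)

lemmas T_comult = T_comult_rule[THEN conjunct1]

lemma T_counit: "represents (T_counit M T \<alpha> V) (F1 (T V)) delI S.e"
  unfolding T_counit_def
proof (rule THE_represents[OF flat_F1 flat_delI S.Ta.e_hom, THEN conjunct1])
  note [simp] = ob_V
  let ?m = "T_mult M T \<alpha> V" and ?u = "T_unit \<alpha> V"
  fix f e' assume f: "represents f (F1 (T V)) delI e'" and fh: "f \<in> Hom M (T V) \<I>"
  note [simp] = represents_typing[OF f]
  have e': "W.hom e' [T V] []"
    using hom_represents(2)[OF f flat_F1 flat_delI] by simp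
  note rules = represents_rules represents_\<alpha>1 flat_rules f ob_V ob_T T_mult T_unit unit_Obj represents_zero[OF flat_F1 flat_delI]
  have 1: "f \<cdot> ?m = \<l> \<I> \<cdot> (f \<otimes> f) \<longleftrightarrow> e' \<bullet> S.m = idn [] \<bullet> lay [] e' [] \<bullet> lay [] e' [T V]"
    by (rule trans[OF represents_eq[where p = "rep2 (T V)"]], (rule rules)+, simp)
  have 2: "f \<cdot> ?u = \<iota> \<I> \<longleftrightarrow> e' \<bullet> S.u = idn []"
    by (rule trans[OF represents_eq[where p = delI]], (rule rules)+, simp)
  have 3: "f \<cdot> \<alpha> V 1 = \<zero> V \<I> \<longleftrightarrow> e' \<bullet> inj_word V 1 = wzero [V] []"
    by (rule trans[OF represents_eq[where p = "F1 V"]], (rule rules)+, simp)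
  show "is_algebra_mor M (T V) ?m ?u f \<I> (\<l> \<I>) (\<iota> \<I>) \<and> f \<cdot> \<alpha> V 1 = \<zero> V \<I> \<longleftrightarrow> e' = S.e"
    unfolding is_algebra_mor_def 1 2 3 using fh e' S.e S.alg_map_unique[of e' "[]" "idn []" "idn []" S.e]
    by (auto simp: S.alg_map_def)
qed (use ob_V in \<open>simp_all add: is_algebra_mor_def\<close>)

lemma T_bialgebra: "is_braided_bialgebra M (T V) (T_mult M T \<alpha> V) (T_unit \<alpha> V) (T_comult M T \<alpha> V c)
    (T_counit M T \<alpha> V) (T_braiding M T \<alpha> V c)"
  using braided_bialgebraI[OF _ T_mult T_unit T_braiding T_comult T_counit] S.Ta.s_bialg_axioms by blast

end

section \<open>Universal properties of the tensor bialgebra and of the primitive elements\<close>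

context tensor_object begin

lemma T_typing:
  "T_mult M T \<alpha> V \<in> Arr M" "Dom M (T_mult M T \<alpha> V) = T V \<boxtimes> T V" "Cod M (T_mult M T \<alpha> V) = T V"
  "\<alpha> V n \<in> Arr M" "Dom M (\<alpha> V n) = tpow M V n" "Cod M (\<alpha> V n) = T V"
  using HomD[OF T_mult_rule[THEN conjunct2, THEN conjunct1]] HomD[OF \<alpha>_Hom[OF ob_V]] by simp_all

lemma ob_tpow [simp]: "ob (tpow M V n)"
  using Hom_Obj(1)[OF \<alpha>_Hom[OF ob_V]] .

text \<open>Unlike \<open>i_Suc\<close> this splits off the last factor, following the recursions of
  \<open>tpow\<close>, \<open>tpow_arr\<close> and \<open>iter_mult\<close>; there
  \<open>tjoin\<close> is an identity.\<close>

lemma \<alpha>_Suc: "\<alpha> V (Suc (Suc n)) = T_mult M T \<alpha> V \<cdot> (\<alpha> V (Suc n) \<otimes> \<alpha> V 1)"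
proof -
  have "T_mult M T \<alpha> V \<cdot> (\<alpha> V (Suc n) \<otimes> \<alpha> V 1) = \<alpha> V (Suc n + 1) \<cdot> tjoin M V (Suc n) 1"
    using T_mult_rule by blast
  then show ?thesis
    using ob_V T_typing(4)[of "Suc (Suc n)"] by (simp add: T_typing)
qed

lemma alg_mor_Suc:
  assumes "is_algebra_mor M (T V) (T_mult M T \<alpha> V) (T_unit \<alpha> V) h B mB uB" "mB \<in> Hom M (B \<boxtimes> B) B"
  shows "h \<cdot> \<alpha> V (Suc (Suc n)) = mB \<cdot> ((h \<cdot> \<alpha> V (Suc n)) \<otimes> (h \<cdot> \<alpha> V 1))"
proof -
  have h: "h \<in> Hom M (T V) B" "h \<cdot> T_mult M T \<alpha> V = mB \<cdot> (h \<otimes> h)"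
    using assms by (simp_all add: is_algebra_mor_def)
  note [simp] = HomD[OF h(1)] HomD[OF assms(2)] T_typing
  have "h \<cdot> \<alpha> V (Suc (Suc n)) = (h \<cdot> T_mult M T \<alpha> V) \<cdot> (\<alpha> V (Suc n) \<otimes> \<alpha> V 1)"
    unfolding \<alpha>_Suc by simp
  also have "\<dots> = mB \<cdot> ((h \<otimes> h) \<cdot> (\<alpha> V (Suc n) \<otimes> \<alpha> V 1))"
    unfolding h(2) by (rule Comp_assoc_simp) simp_all
  finally show ?thesis
    by simp
qed

lemma alg_mor_unique:
  assumes h: "is_algebra_mor M (T V) (T_mult M T \<alpha> V) (T_unit \<alpha> V) h B mB uB"
    and h': "is_algebra_mor M (T V) (T_mult M T \<alpha> V) (T_unit \<alpha> V) h' B mB uB"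
    and mB: "mB \<in> Hom M (B \<boxtimes> B) B" and eq: "h \<cdot> \<alpha> V 1 = h' \<cdot> \<alpha> V 1"
  shows "h = h'"
proof (rule coproduct_epi[OF T_coproduct[OF ob_V]])
  show "h \<in> Hom M (T V) B" "h' \<in> Hom M (T V) B"
    using h h' by (simp_all add: is_algebra_mor_def)
  show "h \<cdot> \<alpha> V n = h' \<cdot> \<alpha> V n" for n
  proof (induction n rule: induct_nat_012)
    case 0
    show ?case using h h' by (simp add: is_algebra_mor_def T_unit_def)
  next
    case 1
    show ?case using eq by simp
  next
    case (ge2 n)
    then show ?case
      by (simp only: alg_mor_Suc[OF h mB] alg_mor_Suc[OF h' mB] eq)
  qed
qed

text \<open>The strict data are returned together with \<open>h\<close>, so that comultiplication
  and counit can later be treated on the same arrow of words.\<close>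

lemma lift_strict:
  assumes f: "represents f (F1 V) (F1 B) fw" "is_braided_mor M V c f B cB"
    and B: "s_bralg ob ar dm cd (\<bullet>) idn lay B mw uw bw bw'"
    and reps: "represents mB (rep2 B) (F1 B) mw" "represents uB delI (F1 B) uw" "represents cB (rep2 B) (rep2 B) bw"
  shows "\<exists>h hw. represents h (F1 (T V)) (F1 B) hw \<and>
    s_lift ob ar dm cd (\<bullet>) idn lay V cw cw' (T V) (inj_word V) B mw uw bw bw' fw hw \<and>
    is_algebra_mor M (T V) (T_mult M T \<alpha> V) (T_unit \<alpha> V) h B mB uB \<and> h \<cdot> \<alpha> V 1 = f \<and>
    is_braided_mor M (T V) (T_braiding M T \<alpha> V c) h B cB"
proof -
  interpret B: s_bralg ob ar dm cd wcomp idn lay B mw uw bw bw'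
    by (rule B)
  have fh: "W.hom fw [V] [B]"
    using hom_represents(2)[OF f(1) flat_F1 flat_F1] ob_V by simp
  obtain hw where hw: "S.alg_map hw [B] mw uw" "hw \<bullet> inj_word V 1 = fw"
    using S.alg_map_exists[OF B.alg_letter fh] by blast
  then have "W.hom hw [T V] [B]"
    by (simp add: S.alg_map_def)
  then obtain h where h: "represents h (F1 (T V)) (F1 B) hw" "h \<in> Hom M (T V) B"
    using represents_full[OF _ flat_F1 flat_F1] ob_V by fastforce
  have lift: "s_lift ob ar dm cd (\<bullet>) idn lay V cw cw' (T V) (inj_word V) B mw uw bw bw' fw hw"
    using fh hw f(2) morphism_eqs(5)[OF f(1) ob_V B.ob_A represents_c reps(3)]
    by unfold_locales (simp_all add: is_braided_mor_def)
  then interpret L: s_lift ob ar dm cd wcomp idn lay V cw cw' "T V" "inj_word V" B mw uw bw bw' fw hw .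
  note eqs = morphism_eqs[OF h(1) ob_T[OF ob_V] B.ob_A]
  have 1: "is_algebra_mor M (T V) (T_mult M T \<alpha> V) (T_unit \<alpha> V) h B mB uB"
    unfolding is_algebra_mor_def eqs(1)[OF T_mult reps(1)] eqs(2)[OF T_unit reps(2)]
    using hw(1) h(2) by (simp add: S.alg_map_def)
  have 2: "is_braided_mor M (T V) (T_braiding M T \<alpha> V c) h B cB"
    unfolding is_braided_mor_def eqs(5)[OF T_braiding reps(3)] using L.F_br h(2) by simp
  have "h \<cdot> \<alpha> V 1 = f"
    using represents_eq[OF represents_Comp[OF represents_\<alpha>1 h(1)] f(1)] hw(2) by simp
  with h(1) lift 1 2 show ?thesis by blast
qed

end

context monoidal_category begin

lemma structure_represents:
  assumes "ob B"
  shows "m \<in> Hom M (B \<boxtimes> B) B \<Longrightarrow> \<exists>w. represents m (rep2 B) (F1 B) w" "u \<in> Hom M \<I> B \<Longrightarrow> \<exists>w. represents u delI (F1 B) w"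
    "c \<in> Hom M (B \<boxtimes> B) (B \<boxtimes> B) \<Longrightarrow> \<exists>w. represents c (rep2 B) (rep2 B) w"
    "d \<in> Hom M B (B \<boxtimes> B) \<Longrightarrow> \<exists>w. represents d (F1 B) (rep2 B) w" "e \<in> Hom M B \<I> \<Longrightarrow> \<exists>w. represents e (F1 B) delI w"
  using represents_exists[OF _ flat_rep2[OF assms] flat_F1[OF assms]] represents_exists[OF _ flat_delI flat_F1[OF assms]]
    represents_exists[OF _ flat_rep2[OF assms] flat_rep2[OF assms]] represents_exists[OF _ flat_F1[OF assms] flat_rep2[OF assms]]
    represents_exists[OF _ flat_F1[OF assms] flat_delI] by blast+

lemma braided_algebra_represents:
  assumes "is_braided_algebra M A m u c"
  shows "\<exists>mw uw cw cw'. represents m (rep2 A) (F1 A) mw \<and> represents u delI (F1 A) uw \<and>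
    represents c (rep2 A) (rep2 A) cw \<and> s_bralg ob ar dm cd (\<bullet>) idn lay A mw uw cw cw'"
proof -
  have "ob A" "m \<in> Hom M (A \<boxtimes> A) A" "u \<in> Hom M \<I> A" "c \<in> Hom M (A \<boxtimes> A) (A \<boxtimes> A)"
    using assms by (simp_all add: is_braided_algebra_def is_algebra_def is_braided_object_def)
  then obtain mw uw cw where "represents m (rep2 A) (F1 A) mw" "represents u delI (F1 A) uw" "represents c (rep2 A) (rep2 A) cw"
    using structure_represents by blast
  with braided_algebraD[OF assms] show ?thesis by blast
qed

end

context additive_monoidal begin

lemma braided_bialgebra_represents:
  assumes "is_braided_bialgebra M A m u d e c"
  shows "\<exists>mw uw cw cw' dw ew. represents m (rep2 A) (F1 A) mw \<and> represents u delI (F1 A) uw \<and>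
    represents c (rep2 A) (rep2 A) cw \<and> represents d (F1 A) (rep2 A) dw \<and> represents e (F1 A) delI ew \<and>
    s_bialg_add ob ar dm cd (\<bullet>) idn lay A mw uw cw cw' dw ew wadd wzero"
proof -
  have "ob A" "m \<in> Hom M (A \<boxtimes> A) A" "u \<in> Hom M \<I> A" "c \<in> Hom M (A \<boxtimes> A) (A \<boxtimes> A)" "d \<in> Hom M A (A \<boxtimes> A)" "e \<in> Hom M A \<I>"
    using assms by (simp_all add: is_braided_bialgebra_def is_braided_algebra_def is_braided_coalgebra_def
      is_algebra_def is_coalgebra_def is_braided_object_def)
  then obtain mw uw cw dw ew where reps: "represents m (rep2 A) (F1 A) mw" "represents u delI (F1 A) uw"
      "represents c (rep2 A) (rep2 A) cw" "represents d (F1 A) (rep2 A) dw" "represents e (F1 A) delI ew"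
    using structure_represents by meson
  obtain cw' where "s_bialg ob ar dm cd (\<bullet>) idn lay A mw uw cw cw' dw ew"
    using braided_bialgebraD[OF assms reps] by blast
  then have "s_bialg_add ob ar dm cd (\<bullet>) idn lay A mw uw cw cw' dw ew wadd wzero"
    using W.strict_additive_axioms by (rule s_bialg_add.intro)
  with reps show ?thesis by blast
qed

lemma represents_prim:
  assumes "ob B" "represents u delI (F1 B) uw"
  shows "represents (prim_arr M (BrBialgObj B m u d e c)) (F1 B) (rep2 B) (lay [] uw [B] \<uplus> lay [B] uw [])"
proof -
  note [simp] = assms(1) represents_typing[OF assms(2)]
  have "represents (prim_arr M (BrBialgObj B m u d e c)) (F1 B) (rep2 B)
     (((lay [] (idn [B]) (cd (F1 B)) \<bullet> lay (cd (F1 B)) uw []) \<bullet> idn [B]) \<uplus>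
      ((lay [] uw (cd (F1 B)) \<bullet> lay (cd delI) (idn [B]) []) \<bullet> idn [B]))"
    unfolding prim_arr_def br_bialg.sel by (rule represents_add represents_rules flat_rules assms)+
  then show ?thesis
    \<comment> \<open>\<open>prim_arr\<close> lists its two summands in the opposite order.\<close>
    by (rule represents_cong) (simp add: W.add_commute[of "lay [B] uw []"])
qed

end

context tensor_object begin

text \<open>The version for braided algebras. It supplies the arrows with which \<open>T_arr\<close>
  and the underlying arrow of \<open>\<epsilon>_Br\<close> are identified.\<close>

lemma lift_algebra:
  assumes B: "is_braided_algebra M B mB uB cB" and f: "is_braided_mor M V c f B cB"
  shows "\<exists>h. is_algebra_mor M (T V) (T_mult M T \<alpha> V) (T_unit \<alpha> V) h B mB uB \<and> h \<cdot> \<alpha> V 1 = f \<and>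
    is_braided_mor M (T V) (T_braiding M T \<alpha> V c) h B cB"
proof -
  obtain mw uw bw bw' where reps: "represents mB (rep2 B) (F1 B) mw" "represents uB delI (F1 B) uw"
    "represents cB (rep2 B) (rep2 B) bw" and sB: "s_bralg ob ar dm cd (\<bullet>) idn lay B mw uw bw bw'"
    using braided_algebra_represents[OF B] by blast
  have "ob B" "f \<in> Hom M V B"
    using B f by (simp_all add: is_braided_algebra_def is_algebra_def is_braided_mor_def)
  then have "represents f (F1 V) (F1 B) (F1 B \<bullet> up f \<bullet> finv (F1 V))"
    using represents_exists flat_F1 ob_V by blast
  from lift_strict[OF this f sB reps] show ?thesis by blast
qed

lemma lift_bialgebra:
  assumes B: "is_braided_bialgebra M B mB uB dB eB cB" and f: "is_braided_mor M V c f B cB"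
    and prim: "dB \<cdot> f = prim_arr M (BrBialgObj B mB uB dB eB cB) \<cdot> f"
  shows "\<exists>h. is_algebra_mor M (T V) (T_mult M T \<alpha> V) (T_unit \<alpha> V) h B mB uB \<and> h \<cdot> \<alpha> V 1 = f \<and>
    is_braided_mor M (T V) (T_braiding M T \<alpha> V c) h B cB \<and>
    is_coalgebra_mor M (T V) (T_comult M T \<alpha> V c) (T_counit M T \<alpha> V) h B dB eB"
proof -
  obtain mw uw bw bw' dw ew where reps: "represents mB (rep2 B) (F1 B) mw" "represents uB delI (F1 B) uw"
    "represents cB (rep2 B) (rep2 B) bw" "represents dB (F1 B) (rep2 B) dw" "represents eB (F1 B) delI ew"
    and sB: "s_bialg_add ob ar dm cd (\<bullet>) idn lay B mw uw bw bw' dw ew wadd wzero"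
    using braided_bialgebra_represents[OF B] by blast
  interpret B: s_bialg_add ob ar dm cd wcomp idn lay B mw uw bw bw' dw ew wadd wzero
    by (rule sB)
  have "f \<in> Hom M V B"
    using f by (simp add: is_braided_mor_def)
  then obtain fw where fw: "represents f (F1 V) (F1 B) fw"
    using represents_exists[OF _ flat_F1 flat_F1, of f V B] ob_V by auto
  obtain h hw where h: "represents h (F1 (T V)) (F1 B) hw"
    and L: "s_lift ob ar dm cd (\<bullet>) idn lay V cw cw' (T V) (inj_word V) B mw uw bw bw' fw hw"
    and M: "is_algebra_mor M (T V) (T_mult M T \<alpha> V) (T_unit \<alpha> V) h B mB uB" "h \<cdot> \<alpha> V 1 = f"
      "is_braided_mor M (T V) (T_braiding M T \<alpha> V c) h B cB"
    using lift_strict[OF fw f B.s_bralg_axioms reps(1-3)] by blast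
  interpret L: s_lift ob ar dm cd wcomp idn lay V cw cw' "T V" "inj_word V" B mw uw bw bw' fw hw
    by (rule L)
  have "dw \<bullet> fw = B.p \<bullet> fw"
    using represents_eq[OF represents_Comp[OF fw reps(4)] represents_Comp[OF fw represents_prim[OF B.ob_A reps(2), of mB dB eB cB]]] prim
    by (simp only: B.p_def simp_thms)
  then interpret L: s_bilift ob ar dm cd wcomp idn lay V cw cw' "T V" "inj_word V" wadd wzero B mw uw bw bw' dw ew fw hw
    by unfold_locales
  note eqs = morphism_eqs[OF h ob_T[OF ob_V] B.ob_A]
  have "is_coalgebra_mor M (T V) (T_comult M T \<alpha> V c) (T_counit M T \<alpha> V) h B dB eB"
    unfolding is_coalgebra_mor_def eqs(3)[OF T_comult reps(4)] eqs(4)[OF T_counit reps(5)]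
    using L.F_d L.F_e M(1) by (simp add: is_algebra_mor_def)
  with M show ?thesis by blast
qed

lemma \<alpha>1_braided: "is_braided_mor M V c (\<alpha> V 1) (T V) (T_braiding M T \<alpha> V c)"
proof -
  have "S.C \<bullet> lay [T V] (inj_word V 1) [] \<bullet> lay [] (inj_word V 1) [V]
      = lay [T V] (inj_word V 1) [] \<bullet> lay [] (inj_word V 1) [V] \<bullet> cw"
    using S.C_I2[of 1 1] by (simp add: S.I2_def S.D_1_1 del: S.C_I2 S.D.simps)
  then show ?thesis
    unfolding is_braided_mor_def morphism_eqs(5)[OF represents_\<alpha>1 ob_V ob_T[OF ob_V] represents_c T_braiding]
    using \<alpha>_Hom[OF ob_V, of 1] by simp
qed

lemma \<alpha>1_primitive:
  "T_comult M T \<alpha> V c \<cdot> \<alpha> V 1 = prim_arr M (Tbar_Br_obj M T \<alpha> (BrObj V c)) \<cdot> \<alpha> V 1"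
proof -
  have "S.d \<bullet> inj_word V 1 = (lay [] S.u [T V] \<uplus> lay [T V] S.u []) \<bullet> inj_word V 1"
    using S.d by simp
  then show ?thesis
    using represents_eq[OF represents_Comp[OF represents_\<alpha>1 T_comult]
      represents_Comp[OF represents_\<alpha>1 represents_prim[OF ob_T[OF ob_V] T_unit]]]
    by (simp add: Tbar_Br_obj_def)
qed

end

section \<open>Primitive elements of a braided bialgebra\<close>

locale primitive_object = additive_monoidal M + equalizer_monoidal M
  for M :: "('o, 'a, 'm) preadditive_monoidal_category_scheme" (structure) +
  fixes B :: 'o and m u d e c :: 'a and P :: 'o and x :: 'a
  assumes bialg: "is_braided_bialgebra M B m u d e c"
    and eq: "is_equalizer M B (B \<boxtimes> B) d (prim_arr M (BrBialgObj B m u d e c)) P x"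
begin

lemma x_Hom: "x \<in> Hom M P B"
  using eq by (simp add: is_equalizer_def)

lemma ob_P: "ob P" and ob_B: "ob B"
  using Hom_Obj[OF x_Hom] by simp_all

lemma represents_letter: "represents f (F1 X) (F1 Y) w \<Longrightarrow> ob X \<Longrightarrow> ob Y \<Longrightarrow> w = up f"
  using representsD[of f "F1 X" "F1 Y" w] flat_cd(2)[of "F1 X" "Dom M f" "cd (F1 X)"]
    flat_cd(2)[of "F1 Y" "Cod M f" "cd (F1 Y)"]
  by (simp add: F1_def W.hom_def)

lemma represents_x: "represents x (F1 P) (F1 B) (up x)"
  using represents_exists[OF x_Hom flat_F1[OF ob_P] flat_F1[OF ob_B]] represents_letter ob_P ob_B by metis

lemma strict_primitives:
  "\<exists>mw uw cw cw' dw ew. represents m (rep2 B) (F1 B) mw \<and> represents u delI (F1 B) uw \<and>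
    represents c (rep2 B) (rep2 B) cw \<and> represents d (F1 B) (rep2 B) dw \<and>
    s_prim ob ar dm cd (\<bullet>) idn lay B mw uw cw cw' dw ew wadd wzero P (up x)"
proof -
  obtain mw uw cw cw' dw ew where reps: "represents m (rep2 B) (F1 B) mw" "represents u delI (F1 B) uw"
    "represents c (rep2 B) (rep2 B) cw" "represents d (F1 B) (rep2 B) dw" "represents e (F1 B) delI ew"
    and sB: "s_bialg_add ob ar dm cd (\<bullet>) idn lay B mw uw cw cw' dw ew wadd wzero"
    using braided_bialgebra_represents[OF bialg] by blast
  interpret B: s_bialg_add ob ar dm cd wcomp idn lay B mw uw cw cw' dw ew wadd wzero
    by (rule sB)
  let ?p = "prim_arr M (BrBialgObj B m u d e c)"
  note [simp] = ob_P ob_B HomD[OF x_Hom]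
  have p: "represents ?p (F1 B) (rep2 B) B.p"
    using represents_prim[OF ob_B reps(2)] by (simp add: B.p_def)
  have dp: "d \<in> Arr M" "Dom M d = B" "?p \<in> Arr M" "Dom M ?p = B"
    using eq by (simp_all add: is_equalizer_def Hom_def)
  \<comment> \<open>The equalizer in \<open>M\<close> concerns arrows into the letter
    \<open>B \<boxtimes> B\<close>, the strict one arrows into the word \<open>[B, B]\<close>; they
    differ by the invertible flattening \<open>rep2 B\<close>.\<close>
  have up: "up f = finv (rep2 B) \<bullet> w" if "represents f (F1 B) (rep2 B) w" "f \<in> Arr M" "Dom M f = B" "Cod M f = B \<boxtimes> B" for f w
  proof -
    have fh: "ar (finv (rep2 B))" "finv (rep2 B) \<bullet> rep2 B = idn [B \<boxtimes> B]"
      using finv[OF flat_rep2[OF ob_B]] by (simp_all add: W.hom_def)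
    have "(finv (rep2 B) \<bullet> rep2 B) \<bullet> up f = finv (rep2 B) \<bullet> w"
      using representsD(5)[OF that(1)] representsD(2)[OF that(1)] by (simp add: F1_def W.hom_def)
    then show ?thesis
      unfolding fh(2) using that by simp
  qed
  have "s_prim ob ar dm cd (\<bullet>) idn lay B mw uw cw cw' dw ew wadd wzero P (up x)"
  proof unfold_locales
    show "W.hom (up x) [P] [B]"
      by (simp add: W.hom_def)
    have "d \<cdot> x = ?p \<cdot> x"
      using eq by (simp add: is_equalizer_def)
    then show "dw \<bullet> up x = B.p \<bullet> up x"
      using represents_eq[OF represents_Comp[OF represents_x reps(4)] represents_Comp[OF represents_x p]] by simp
    have cods: "Cod M d = B \<boxtimes> B" "Cod M ?p = B \<boxtimes> B"
      using eq by (simp_all add: is_equalizer_def Hom_def)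
    show "\<exists>k. W.hom k ws (xs @ P # ys) \<and> lay xs (up x) ys \<bullet> k = h"
      if h: "W.hom h ws (xs @ B # ys)" and dh: "lay xs dw ys \<bullet> h = lay xs B.p ys \<bullet> h" for h ws xs ys
    proof (rule word_equalizer(1)[OF eq _ _ h])
      show "obs xs" "obs ys"
        using W.hom_ob(2)[OF h] by simp_all
      show "lay xs (up d) ys \<bullet> h = lay xs (up ?p) ys \<bullet> h"
        unfolding up[OF reps(4) dp(1,2) cods(1)] up[OF p dp(3,4) cods(2)] using dh by simp
    qed
    show "k = k'" if k: "W.hom k ws (xs @ P # ys)" "W.hom k' ws (xs @ P # ys)"
      and xk: "lay xs (up x) ys \<bullet> k = lay xs (up x) ys \<bullet> k'" for k k' ws xs ys
      by (rule word_equalizer(2)[OF eq _ _ k xk]) (use W.hom_ob(2)[OF k(1)] in simp_all)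
  qed
  with reps show ?thesis by blast
qed

text \<open>Repeats the description inside \<open>P_Br_obj\<close>, so that both unfold to the same
  term.\<close>

definition cP :: 'a where
  "cP = (THE cP. cP \<in> Hom M (P \<boxtimes> P) (P \<boxtimes> P) \<and> (x \<otimes> x) \<cdot> cP = c \<cdot> (x \<otimes> x))"

lemma cP_rule:
  assumes c: "represents c (rep2 B) (rep2 B) cw"
    and S: "s_prim ob ar dm cd (\<bullet>) idn lay B mw uw cw cw' dw ew wadd wzero P (up x)"
  shows "represents cP (rep2 P) (rep2 P) (s_prim.cP ar dm cd (\<bullet>) lay B cw P (up x)) \<and>
    cP \<in> Hom M (P \<boxtimes> P) (P \<boxtimes> P) \<and> (x \<otimes> x) \<cdot> cP = c \<cdot> (x \<otimes> x)"
  unfolding cP_def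
proof (rule THE_represents[OF flat_rep2 flat_rep2])
  interpret S: s_prim ob ar dm cd wcomp idn lay B mw uw cw cw' dw ew wadd wzero P "up x"
    by (rule S)
  show "W.hom S.cP [P, P] [P, P]"
    using S.cP by blast
  fix f w assume f: "represents f (rep2 P) (rep2 P) w" and fh: "f \<in> Hom M (P \<boxtimes> P) (P \<boxtimes> P)"
  note [simp] = represents_typing[OF f] ob_P ob_B
  have "W.hom w [P, P] [P, P]"
    using hom_represents(2)[OF f flat_rep2 flat_rep2] by simp
  moreover have "(x \<otimes> x) \<cdot> f = c \<cdot> (x \<otimes> x) \<longleftrightarrow> S.x2 \<bullet> w = cw \<bullet> S.x2"
    by (rule trans[OF represents_eq[where p = "rep2 P"]], (rule represents_rules represents_x flat_rules f c)+, simp add: S.x2_def)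
  ultimately show "f \<in> Hom M (P \<boxtimes> P) (P \<boxtimes> P) \<and> (x \<otimes> x) \<cdot> f = c \<cdot> (x \<otimes> x) \<longleftrightarrow> w = S.cP"
    using fh S.cP S.cP_unique by blast
qed (use ob_P in simp_all)

lemma P_braided: "is_braided_object M P cP"
  and x_braided: "is_braided_mor M P cP x B c"
  and restrict: "g \<in> Hom M V B \<Longrightarrow> d \<cdot> g = prim_arr M (BrBialgObj B m u d e c) \<cdot> g \<Longrightarrow>
    \<exists>!k. k \<in> Hom M V P \<and> x \<cdot> k = g"
  and restrict_braided: "k \<in> Hom M V P \<Longrightarrow> is_braided_object M V cV \<Longrightarrow> is_braided_mor M V cV (x \<cdot> k) B c \<Longrightarrow>
    is_braided_mor M V cV k P cP"
proof -
  obtain mw uw cw cw' dw ew where c: "represents c (rep2 B) (rep2 B) cw"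
    and S: "s_prim ob ar dm cd (\<bullet>) idn lay B mw uw cw cw' dw ew wadd wzero P (up x)"
    using strict_primitives by blast
  interpret S: s_prim ob ar dm cd wcomp idn lay B mw uw cw cw' dw ew wadd wzero P "up x"
    by (rule S)
  note cP = cP_rule[OF c S]
  show "is_braided_object M P cP"
    using braided_objectI[OF S.P.s_br_axioms] cP by blast
  show "is_braided_mor M P cP x B c"
    using cP x_Hom by (simp add: is_braided_mor_def)
  show "g \<in> Hom M V B \<Longrightarrow> d \<cdot> g = prim_arr M (BrBialgObj B m u d e c) \<cdot> g \<Longrightarrow>
    \<exists>!k. k \<in> Hom M V P \<and> x \<cdot> k = g"
    using eq by (simp add: is_equalizer_def)
  assume k: "k \<in> Hom M V P" and V: "is_braided_object M V cV" and br: "is_braided_mor M V cV (x \<cdot> k) B c"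
  have V': "ob V" "cV \<in> Hom M (V \<boxtimes> V) (V \<boxtimes> V)"
    using V by (simp_all add: is_braided_object_def)
  obtain kw bw where kw: "represents k (F1 V) (F1 P) kw" and bw: "represents cV (rep2 V) (rep2 V) bw"
    using represents_exists[OF k flat_F1[OF V'(1)] flat_F1[OF ob_P]] represents_exists[OF V'(2) flat_rep2 flat_rep2] V' by blast
  have "cw \<bullet> lay [B] (up x \<bullet> kw) [] \<bullet> lay [] (up x \<bullet> kw) [V] = lay [B] (up x \<bullet> kw) [] \<bullet> lay [] (up x \<bullet> kw) [V] \<bullet> bw"
    using br morphism_eqs(5)[OF represents_Comp[OF kw represents_x] V'(1) ob_B bw c] by (simp only: is_braided_mor_def)
  then have "S.cP \<bullet> lay [P] kw [] \<bullet> lay [] kw [V] = lay [P] kw [] \<bullet> lay [] kw [V] \<bullet> bw"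
    using hom_represents(2)[OF kw flat_F1 flat_F1] hom_represents(2)[OF bw flat_rep2 flat_rep2] V'(1) ob_P
    by (intro S.restrict_br) simp_all
  then show "is_braided_mor M V cV k P cP"
    using morphism_eqs(5)[OF kw V'(1) ob_P bw cP[THEN conjunct1]] k by (simp add: is_braided_mor_def)
qed

end

section \<open>The adjunction\<close>

context monoidal_category begin

lemma braided_mor_comp: "is_braided_mor M X c f Y c' \<Longrightarrow> is_braided_mor M Y c' g Z c'' \<Longrightarrow>
  c \<in> Hom M (X \<boxtimes> X) (X \<boxtimes> X) \<Longrightarrow> c' \<in> Hom M (Y \<boxtimes> Y) (Y \<boxtimes> Y) \<Longrightarrow> c'' \<in> Hom M (Z \<boxtimes> Z) (Z \<boxtimes> Z) \<Longrightarrow>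
  is_braided_mor M X c (g \<cdot> f) Z c''"
proof -
  assume f: "is_braided_mor M X c f Y c'" and g: "is_braided_mor M Y c' g Z c''"
    and c: "c \<in> Hom M (X \<boxtimes> X) (X \<boxtimes> X)" "c' \<in> Hom M (Y \<boxtimes> Y) (Y \<boxtimes> Y)" "c'' \<in> Hom M (Z \<boxtimes> Z) (Z \<boxtimes> Z)"
  have fg: "f \<in> Hom M X Y" "g \<in> Hom M Y Z"
    using f g by (simp_all add: is_braided_mor_def)
  note [simp] = HomD[OF fg(1)] HomD[OF fg(2)] HomD[OF c(1)] HomD[OF c(2)] HomD[OF c(3)]
  have "c'' \<cdot> ((g \<cdot> f) \<otimes> (g \<cdot> f)) = (c'' \<cdot> (g \<otimes> g)) \<cdot> (f \<otimes> f)"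
    by simp
  also have "\<dots> = (g \<otimes> g) \<cdot> (c' \<cdot> (f \<otimes> f))"
    using g by (simp add: is_braided_mor_def)
  also have "\<dots> = ((g \<otimes> g) \<cdot> (f \<otimes> f)) \<cdot> c"
    using f by (simp add: is_braided_mor_def del: tensor_Comp_simp)
  finally show ?thesis
    by (simp add: is_braided_mor_def Hom_def)
qed

lemma algebra_mor_comp: "is_algebra_mor M X m u f Y m' u' \<Longrightarrow> is_algebra_mor M Y m' u' g Z m'' u'' \<Longrightarrow>
  m \<in> Hom M (X \<boxtimes> X) X \<Longrightarrow> m' \<in> Hom M (Y \<boxtimes> Y) Y \<Longrightarrow> m'' \<in> Hom M (Z \<boxtimes> Z) Z \<Longrightarrow> u \<in> Hom M \<I> X \<Longrightarrow>
  is_algebra_mor M X m u (g \<cdot> f) Z m'' u''"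
proof -
  assume f: "is_algebra_mor M X m u f Y m' u'" and g: "is_algebra_mor M Y m' u' g Z m'' u''"
    and m: "m \<in> Hom M (X \<boxtimes> X) X" "m' \<in> Hom M (Y \<boxtimes> Y) Y" "m'' \<in> Hom M (Z \<boxtimes> Z) Z" "u \<in> Hom M \<I> X"
  have fg: "f \<in> Hom M X Y" "g \<in> Hom M Y Z"
    using f g by (simp_all add: is_algebra_mor_def)
  note [simp] = HomD[OF fg(1)] HomD[OF fg(2)] HomD[OF m(1)] HomD[OF m(2)] HomD[OF m(3)] HomD[OF m(4)]
  have "(g \<cdot> f) \<cdot> m = (g \<cdot> m') \<cdot> (f \<otimes> f)"
    using f by (simp add: is_algebra_mor_def)
  also have "\<dots> = m'' \<cdot> ((g \<cdot> f) \<otimes> (g \<cdot> f))"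
    using g by (simp add: is_algebra_mor_def)
  finally show ?thesis
    using f g by (simp add: is_algebra_mor_def Hom_def)
qed

lemma coalgebra_mor_comp: "is_coalgebra_mor M X d e f Y d' e' \<Longrightarrow> is_coalgebra_mor M Y d' e' g Z d'' e'' \<Longrightarrow>
  d \<in> Hom M X (X \<boxtimes> X) \<Longrightarrow> d' \<in> Hom M Y (Y \<boxtimes> Y) \<Longrightarrow> d'' \<in> Hom M Z (Z \<boxtimes> Z) \<Longrightarrow> e'' \<in> Hom M Z \<I> \<Longrightarrow>
  is_coalgebra_mor M X d e (g \<cdot> f) Z d'' e''"
proof -
  assume f: "is_coalgebra_mor M X d e f Y d' e'" and g: "is_coalgebra_mor M Y d' e' g Z d'' e''"
    and d: "d \<in> Hom M X (X \<boxtimes> X)" "d' \<in> Hom M Y (Y \<boxtimes> Y)" "d'' \<in> Hom M Z (Z \<boxtimes> Z)" "e'' \<in> Hom M Z \<I>"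
  have fg: "f \<in> Hom M X Y" "g \<in> Hom M Y Z"
    using f g by (simp_all add: is_coalgebra_mor_def)
  note [simp] = HomD[OF fg(1)] HomD[OF fg(2)] HomD[OF d(1)] HomD[OF d(2)] HomD[OF d(3)] HomD[OF d(4)]
  have "d'' \<cdot> (g \<cdot> f) = (d'' \<cdot> g) \<cdot> f"
    by simp
  also have "\<dots> = (g \<otimes> g) \<cdot> (d' \<cdot> f)"
    using g by (simp add: is_coalgebra_mor_def)
  also have "\<dots> = ((g \<otimes> g) \<cdot> (f \<otimes> f)) \<cdot> d"
    using f by (simp add: is_coalgebra_mor_def del: tensor_Comp_simp)
  finally have "d'' \<cdot> (g \<cdot> f) = ((g \<cdot> f) \<otimes> (g \<cdot> f)) \<cdot> d"
    by simp
  moreover have "e'' \<cdot> (g \<cdot> f) = e"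
    using f g Comp_assoc_simp[of f g e''] by (simp add: is_coalgebra_mor_def del: Comp_assoc_simp)
  ultimately show ?thesis
    by (simp add: is_coalgebra_mor_def Hom_def)
qed

lemma structured_Hom:
  "F \<in> Hom (structured_category M S U mor) X Y \<longleftrightarrow> F = StrArr X (und F) Y \<and> X \<in> S \<and> Y \<in> S \<and> mor X (und F) Y"
  by (cases F) (auto simp: structured_category_def Hom_def)

lemma structured_sel [simp]:
  "Obj (structured_category M S U mor) = S" "Dom (structured_category M S U mor) = src"
  "Cod (structured_category M S U mor) = trg"
  "Comp (structured_category M S U mor) G F = StrArr (src F) (und G \<cdot> und F) (trg G)"
  "Ident (structured_category M S U mor) X = StrArr X (\<iota> (U X)) X"
  by (simp_all add: structured_category_def)

lemma structured_category:
  assumes U: "\<And>X. X \<in> S \<Longrightarrow> ob (U X)" and mor: "\<And>X f Y. X \<in> S \<Longrightarrow> Y \<in> S \<Longrightarrow> mor X f Y \<Longrightarrow> f \<in> Hom M (U X) (U Y)"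
    and ident: "\<And>X. X \<in> S \<Longrightarrow> mor X (\<iota> (U X)) X"
    and comp: "\<And>X Y Z f g. X \<in> S \<Longrightarrow> Y \<in> S \<Longrightarrow> Z \<in> S \<Longrightarrow> mor X f Y \<Longrightarrow> mor Y g Z \<Longrightarrow> mor X (g \<cdot> f) Z"
  shows "category (structured_category M S U mor)"
proof
  let ?C = "structured_category M S U mor"
  show "Dom ?C F \<in> Obj ?C" "Cod ?C F \<in> Obj ?C" if "F \<in> Arr ?C" for F
    using that by (auto simp: structured_category_def)
  show "Ident ?C X \<in> Hom ?C X X" if "X \<in> Obj ?C" for X
    using that ident by (simp add: structured_Hom)
  show "Comp ?C G F \<in> Hom ?C X Z" if "F \<in> Hom ?C X Y" "G \<in> Hom ?C Y Z" for F G X Y Z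
    using that comp unfolding structured_Hom by (cases F; cases G) auto
  show "Comp ?C (Comp ?C H G) F = Comp ?C H (Comp ?C G F)"
    if "F \<in> Hom ?C W X" "G \<in> Hom ?C X Y" "H \<in> Hom ?C Y Z" for F G H W X Y Z
    using that mor Comp_assoc unfolding structured_Hom by (cases F; cases G; cases H) (simp; metis)
  show "Comp ?C (Ident ?C Y) F = F" "Comp ?C F (Ident ?C X) = F" if "F \<in> Hom ?C X Y" for F X Y
    using that mor Comp_Ident_left Comp_Ident_right unfolding structured_Hom by (cases F; simp; metis)+
qed

lemma Br_Obj: "X \<in> Obj (Br M) \<longleftrightarrow> is_braided_object M (obj_of X) (br_of X)"
  by (simp add: Br_def)

lemma BrBialg_Obj: "B \<in> Obj (BrBialg M) \<longleftrightarrow>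
    is_braided_bialgebra M (bi_obj B) (bi_mult B) (bi_unit B) (bi_comult B) (bi_counit B) (bi_br B)"
  by (simp add: BrBialg_def)

abbreviation br_mor :: "('o, 'a) br_obj \<Rightarrow> 'a \<Rightarrow> ('o, 'a) br_obj \<Rightarrow> bool" where
  "br_mor X f Y \<equiv> is_braided_mor M (obj_of X) (br_of X) f (obj_of Y) (br_of Y)"

abbreviation alg_mor :: "('o, 'a) br_bialg \<Rightarrow> 'a \<Rightarrow> ('o, 'a) br_bialg \<Rightarrow> bool" where
  "alg_mor X f Y \<equiv> is_algebra_mor M (bi_obj X) (bi_mult X) (bi_unit X) f (bi_obj Y) (bi_mult Y) (bi_unit Y)"

abbreviation bi_mor :: "('o, 'a) br_bialg \<Rightarrow> 'a \<Rightarrow> ('o, 'a) br_bialg \<Rightarrow> bool" where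
  "bi_mor X f Y \<equiv> alg_mor X f Y \<and>
     is_coalgebra_mor M (bi_obj X) (bi_comult X) (bi_counit X) f (bi_obj Y) (bi_comult Y) (bi_counit Y) \<and>
     is_braided_mor M (bi_obj X) (bi_br X) f (bi_obj Y) (bi_br Y)"

lemma Br_Hom: "F \<in> Hom (Br M) X Y \<longleftrightarrow> F = StrArr X (und F) Y \<and> X \<in> Obj (Br M) \<and> Y \<in> Obj (Br M) \<and> br_mor X (und F) Y"
  unfolding Br_def structured_Hom by simp

lemma BrBialg_Hom: "F \<in> Hom (BrBialg M) X Y \<longleftrightarrow>
    F = StrArr X (und F) Y \<and> X \<in> Obj (BrBialg M) \<and> Y \<in> Obj (BrBialg M) \<and> bi_mor X (und F) Y"
  unfolding BrBialg_def structured_Hom by simp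

lemma Br_sel [simp]: "Comp (Br M) G F = StrArr (src F) (und G \<cdot> und F) (trg G)" "Ident (Br M) X = StrArr X (\<iota> (obj_of X)) X"
  "Comp (BrAlg M) G' F' = StrArr (src F') (und G' \<cdot> und F') (trg G')"
  "Comp (BrBialg M) G'' F'' = StrArr (src F'') (und G'' \<cdot> und F'') (trg G'')" "Ident (BrBialg M) B = StrArr B (\<iota> (bi_obj B)) B"
  by (simp_all add: Br_def BrAlg_def BrBialg_def)

lemma Br_typing:
  assumes "X \<in> Obj (Br M)"
  shows "ob (obj_of X)" "br_of X \<in> Hom M (obj_of X \<boxtimes> obj_of X) (obj_of X \<boxtimes> obj_of X)"
  using assms by (simp_all add: Br_Obj is_braided_object_def)

lemma BrBialg_typing:
  assumes "B \<in> Obj (BrBialg M)"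
  shows "ob (bi_obj B)" "bi_br B \<in> Hom M (bi_obj B \<boxtimes> bi_obj B) (bi_obj B \<boxtimes> bi_obj B)"
    "bi_mult B \<in> Hom M (bi_obj B \<boxtimes> bi_obj B) (bi_obj B)" "bi_unit B \<in> Hom M \<I> (bi_obj B)"
    "bi_comult B \<in> Hom M (bi_obj B) (bi_obj B \<boxtimes> bi_obj B)" "bi_counit B \<in> Hom M (bi_obj B) \<I>"
  using assms by (simp_all add: BrBialg_Obj is_braided_bialgebra_def is_braided_algebra_def is_braided_coalgebra_def
      is_algebra_def is_coalgebra_def is_braided_object_def)

lemma br_mor_Ident: "X \<in> Obj (Br M) \<Longrightarrow> br_mor X (\<iota> (obj_of X)) X"
  using Br_typing[of X] HomD[OF Br_typing(2), of X] by (simp add: is_braided_mor_def Hom_def)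

lemma bi_mor_Ident: "B \<in> Obj (BrBialg M) \<Longrightarrow> bi_mor B (\<iota> (bi_obj B)) B"
  using BrBialg_typing[of B] by (simp add: is_braided_mor_def is_algebra_mor_def is_coalgebra_mor_def Hom_def)

lemma br_mor_comp: "X \<in> Obj (Br M) \<Longrightarrow> Y \<in> Obj (Br M) \<Longrightarrow> Z \<in> Obj (Br M) \<Longrightarrow> br_mor X f Y \<Longrightarrow> br_mor Y g Z \<Longrightarrow>
    br_mor X (g \<cdot> f) Z"
  using braided_mor_comp Br_typing(2) by blast

lemma alg_mor_comp: "A \<in> Obj (BrBialg M) \<Longrightarrow> B \<in> Obj (BrBialg M) \<Longrightarrow> C \<in> Obj (BrBialg M) \<Longrightarrow>
    alg_mor A f B \<Longrightarrow> alg_mor B g C \<Longrightarrow> alg_mor A (g \<cdot> f) C"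
  using algebra_mor_comp BrBialg_typing(3,4) by blast

lemma bi_mor_comp: "A \<in> Obj (BrBialg M) \<Longrightarrow> B \<in> Obj (BrBialg M) \<Longrightarrow> C \<in> Obj (BrBialg M) \<Longrightarrow>
    bi_mor A f B \<Longrightarrow> bi_mor B g C \<Longrightarrow> bi_mor A (g \<cdot> f) C"
  using alg_mor_comp coalgebra_mor_comp braided_mor_comp BrBialg_typing by meson

lemma category_Br: "category (Br M)"
  unfolding Br_def
  by (rule structured_category)
    (use br_mor_Ident br_mor_comp in \<open>auto simp: Br_Obj is_braided_object_def is_braided_mor_def[of M]\<close>)

lemma category_BrBialg: "category (BrBialg M)"
  unfolding BrBialg_def
proof (rule structured_category; unfold mem_Collect_eq BrBialg_Obj[symmetric])
  show "B \<in> Obj (BrBialg M) \<Longrightarrow> ob (bi_obj B)" for B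
    by (rule BrBialg_typing)
  show "f \<in> Hom M (bi_obj A) (bi_obj B)" if "bi_mor A f B" for A f B
    using that by (simp add: is_braided_mor_def)
qed (rule bi_mor_Ident bi_mor_comp; assumption)+

lemma mor_Hom: "br_mor X f Y \<Longrightarrow> f \<in> Hom M (obj_of X) (obj_of Y)" "alg_mor A g B \<Longrightarrow> g \<in> Hom M (bi_obj A) (bi_obj B)"
  by (simp_all add: is_braided_mor_def is_algebra_mor_def)

end

context additive_monoidal begin

text \<open>Inserting a unit on either side commutes with an arrow that preserves units, and this
  applies to each summand.\<close>

lemma prim_natural:
  assumes "f \<in> Hom M B B'" "u \<in> Hom M \<I> B" "f \<cdot> u = u'"
  shows "prim_arr M (BrBialgObj B' m' u' d' e' c') \<cdot> f = (f \<otimes> f) \<cdot> prim_arr M (BrBialgObj B m u d e c)"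
proof -
  note [simp] = Hom_Obj[OF assms(1)]
  obtain fw uw where fw: "represents f (F1 B) (F1 B') fw" and uw: "represents u delI (F1 B) uw"
    using represents_exists[OF assms(1) flat_F1 flat_F1] represents_exists[OF assms(2) flat_delI flat_F1] by auto
  note [simp] = represents_typing[OF fw] represents_typing[OF uw]
  have u': "represents u' delI (F1 B') (fw \<bullet> uw)"
    using represents_Comp[OF uw fw] assms(3) by simp
  note prims = represents_prim[OF _ uw, of m d e c] represents_prim[OF _ u', of m' d' e' c']
  show ?thesis
    by (rule iffD2[OF represents_eq[where p = "F1 B"]], (rule represents_rules flat_rules fw prims Hom_Obj[OF assms(1)])+,
      simp del: W.rsort add: W.sort W.sort_comp W.layer[where f = fw])
qed

end

section \<open>The functors, their unit and counit\<close>

locale adjunction_setting = tensor_setting M T \<alpha>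
  for M :: "('o, 'a, 'm) preadditive_monoidal_category_scheme" (structure)
    and T :: "'o \<Rightarrow> 'o" and \<alpha> :: "'o \<Rightarrow> nat \<Rightarrow> 'a" +
  fixes P :: "('o, 'a) br_bialg \<Rightarrow> 'o" and \<xi> :: "('o, 'a) br_bialg \<Rightarrow> 'a"
  assumes P_equalizer: "B \<in> Obj (BrBialg M) \<Longrightarrow>
    is_equalizer M (bi_obj B) (bi_obj B \<boxtimes> bi_obj B) (bi_comult B) (prim_arr M B) (P B) (\<xi> B)"
begin

abbreviation Tb :: "('o, 'a) br_obj \<Rightarrow> ('o, 'a) br_bialg" where "Tb \<equiv> Tbar_Br_obj M T \<alpha>"
abbreviation Pb :: "('o, 'a) br_bialg \<Rightarrow> ('o, 'a) br_obj" where "Pb \<equiv> P_Br_obj M P \<xi>"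
abbreviation Ub :: "('o, 'a) br_bialg \<Rightarrow> ('o, 'a) br_obj" where "Ub B \<equiv> BrObj (bi_obj B) (bi_br B)"
abbreviation \<alpha>1 :: "('o, 'a) br_obj \<Rightarrow> 'a" where "\<alpha>1 X \<equiv> \<alpha> (obj_of X) 1"
abbreviation Ta :: "('o, 'a) br_obj \<Rightarrow> 'a \<Rightarrow> ('o, 'a) br_obj \<Rightarrow> 'a" where
  "Ta X f Y \<equiv> T_arr M T \<alpha> (obj_of X) f (obj_of Y)"

lemma tensor_object: "X \<in> Obj (Br M) \<Longrightarrow> tensor_object M T \<alpha> (obj_of X) (br_of X)"
  by unfold_locales (simp add: Br_Obj)

lemma primitive_object: "B \<in> Obj (BrBialg M) \<Longrightarrow> primitive_object M (bi_obj B) (bi_mult B) (bi_unit B)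
    (bi_comult B) (bi_counit B) (bi_br B) (P B) (\<xi> B)"
  by unfold_locales (use P_equalizer in \<open>simp_all add: BrBialg_Obj\<close>)

lemma Tb_Obj: "X \<in> Obj (Br M) \<Longrightarrow> Tb X \<in> Obj (BrBialg M)"
  using tensor_object.T_bialgebra[OF tensor_object] by (simp add: BrBialg_Obj Tbar_Br_obj_def)

lemma Ub_Obj: "B \<in> Obj (BrBialg M) \<Longrightarrow> Ub B \<in> Obj (Br M)"
  by (simp add: BrBialg_Obj Br_Obj is_braided_bialgebra_def is_braided_algebra_def)

lemma Pb_sel: "B \<in> Obj (BrBialg M) \<Longrightarrow> Pb B = BrObj (P B) (primitive_object.cP M (bi_br B) (P B) (\<xi> B))"
  unfolding P_Br_obj_def primitive_object.cP_def[OF primitive_object] ..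

lemma obj_of_Pb [simp]: "obj_of (Pb B) = P B"
  by (simp add: P_Br_obj_def)

lemma Pb_Obj: "B \<in> Obj (BrBialg M) \<Longrightarrow> Pb B \<in> Obj (Br M)"
  using primitive_object.P_braided[OF primitive_object] by (simp add: Br_Obj Pb_sel)

lemma \<xi>_mor: "B \<in> Obj (BrBialg M) \<Longrightarrow> br_mor (Pb B) (\<xi> B) (Ub B)"
  using primitive_object.x_braided[OF primitive_object] by (simp add: Pb_sel)

lemma \<xi>_primitive: "B \<in> Obj (BrBialg M) \<Longrightarrow> bi_comult B \<cdot> \<xi> B = prim_arr M B \<cdot> \<xi> B"
  using P_equalizer by (simp add: is_equalizer_def)

lemma \<alpha>1_mor: "X \<in> Obj (Br M) \<Longrightarrow> br_mor X (\<alpha>1 X) (Ub (Tb X))"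
  using tensor_object.\<alpha>1_braided[OF tensor_object] by (simp add: Tbar_Br_obj_def)

lemma \<alpha>1_prim: "X \<in> Obj (Br M) \<Longrightarrow> bi_comult (Tb X) \<cdot> \<alpha>1 X = prim_arr M (Tb X) \<cdot> \<alpha>1 X"
  using tensor_object.\<alpha>1_primitive[OF tensor_object, of X] by (simp add: Tbar_Br_obj_def)

lemma Tb_unique:
  assumes "X \<in> Obj (Br M)" "B \<in> Obj (BrBialg M)" "alg_mor (Tb X) h B" "alg_mor (Tb X) h' B" "h \<cdot> \<alpha>1 X = h' \<cdot> \<alpha>1 X"
  shows "h = h'"
  using tensor_object.alg_mor_unique[OF tensor_object[OF assms(1)]] assms(3-5) BrBialg_typing(3)[OF assms(2)]
  by (simp add: Tbar_Br_obj_def)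

text \<open>\<open>h\<close> is given only as an algebra map. Uniqueness of algebra maps identifies
  it with the lift of \<open>f\<close>, which is a bialgebra map; in this way \<open>T_arr\<close>
  and the counit acquire compatibility with the coalgebra structure.\<close>

lemma Tb_lift:
  assumes X: "X \<in> Obj (Br M)" and B: "B \<in> Obj (BrBialg M)" and f: "br_mor X f (Ub B)"
    and prim: "bi_comult B \<cdot> f = prim_arr M B \<cdot> f" and h: "alg_mor (Tb X) h B" "h \<cdot> \<alpha>1 X = f"
  shows "bi_mor (Tb X) h B"
proof -
  obtain h' where h': "bi_mor (Tb X) h' B" "h' \<cdot> \<alpha>1 X = f"
    using tensor_object.lift_bialgebra[OF tensor_object[OF X] B[unfolded BrBialg_Obj]] f prim
    by (auto simp: Tbar_Br_obj_def)
  moreover have "h' = h"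
    using Tb_unique[OF X B] h h' by simp
  ultimately show ?thesis by simp
qed

lemma P_restrict:
  assumes B: "B \<in> Obj (BrBialg M)" and g: "g \<in> Hom M Z (bi_obj B)" "bi_comult B \<cdot> g = prim_arr M B \<cdot> g"
  shows "\<exists>!k. k \<in> Hom M Z (P B) \<and> \<xi> B \<cdot> k = g"
  using primitive_object.restrict[OF primitive_object[OF B], of g Z] g by simp

lemma P_restrict_mor:
  assumes B: "B \<in> Obj (BrBialg M)" and X: "X \<in> Obj (Br M)" and k: "k \<in> Hom M (obj_of X) (P B)" "br_mor X (\<xi> B \<cdot> k) (Ub B)"
  shows "br_mor X k (Pb B)"
  using primitive_object.restrict_braided[OF primitive_object[OF B] k(1)] X k(2) B by (simp add: Br_Obj Pb_sel)

lemma P_mono: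
  assumes B: "B \<in> Obj (BrBialg M)" and k: "k \<in> Hom M Z (P B)" "k' \<in> Hom M Z (P B)" "\<xi> B \<cdot> k = \<xi> B \<cdot> k'"
  shows "k = k'"
proof -
  have x: "\<xi> B \<in> Hom M (P B) (bi_obj B)"
    using mor_Hom(1)[OF \<xi>_mor[OF B]] by simp
  have dp: "bi_comult B \<in> Hom M (bi_obj B) (bi_obj B \<boxtimes> bi_obj B)" "prim_arr M B \<in> Hom M (bi_obj B) (bi_obj B \<boxtimes> bi_obj B)"
    using P_equalizer[OF B] by (simp_all add: is_equalizer_def)
  have "\<xi> B \<cdot> k \<in> Hom M Z (bi_obj B)"
    using x k(1) by (rule Comp_Hom[rotated])
  moreover have "bi_comult B \<cdot> (\<xi> B \<cdot> k) = prim_arr M B \<cdot> (\<xi> B \<cdot> k)"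
    using Comp_assoc[OF k(1) x dp(1)] Comp_assoc[OF k(1) x dp(2)] \<xi>_primitive[OF B] by simp
  ultimately show ?thesis
    using P_restrict[OF B] k by metis
qed

text \<open>Bialgebra maps carry primitive arrows to primitive arrows, which makes the factorization
  defining \<open>Pa\<close> possible.\<close>

lemma prim_comp:
  assumes "A \<in> Obj (BrBialg M)" "B \<in> Obj (BrBialg M)" "bi_mor A f B" "g \<in> Hom M Z (bi_obj A)"
    "bi_comult A \<cdot> g = prim_arr M A \<cdot> g"
  shows "bi_comult B \<cdot> (f \<cdot> g) = prim_arr M B \<cdot> (f \<cdot> g)"
proof -
  have f: "f \<in> Hom M (bi_obj A) (bi_obj B)"
    using assms(3) by (simp add: is_algebra_mor_def)
  have dp: "prim_arr M A \<in> Hom M (bi_obj A) (bi_obj A \<boxtimes> bi_obj A)" "prim_arr M B \<in> Hom M (bi_obj B) (bi_obj B \<boxtimes> bi_obj B)"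
    using P_equalizer assms(1,2) by (simp_all add: is_equalizer_def)
  note [simp] = HomD[OF f] HomD[OF assms(4)] HomD[OF dp(1)] HomD[OF dp(2)]
    HomD[OF BrBialg_typing(5)[OF assms(1)]] HomD[OF BrBialg_typing(5)[OF assms(2)]]
  have nat: "prim_arr M B \<cdot> f = (f \<otimes> f) \<cdot> prim_arr M A"
    using prim_natural[OF f BrBialg_typing(4)[OF assms(1)], of "bi_unit B" "bi_mult B" "bi_comult B" "bi_counit B" "bi_br B"
      "bi_mult A" "bi_comult A" "bi_counit A" "bi_br A"] assms(3) by (simp add: is_algebra_mor_def)
  have "bi_comult B \<cdot> (f \<cdot> g) = (bi_comult B \<cdot> f) \<cdot> g"
    by simp
  also have "\<dots> = (f \<otimes> f) \<cdot> (bi_comult A \<cdot> g)"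
    using assms(3) by (simp add: is_coalgebra_mor_def)
  also have "\<dots> = ((f \<otimes> f) \<cdot> prim_arr M A) \<cdot> g"
    unfolding assms(5) by simp
  also have "\<dots> = prim_arr M B \<cdot> (f \<cdot> g)"
    unfolding nat[symmetric] by simp
  finally show ?thesis .
qed

lemma tpow_arr_typing:
  assumes "f \<in> Hom M V W"
  shows "tpow_arr M f n \<in> Hom M (tpow M V n) (tpow M W n)"
proof (induction n rule: induct_nat_012)
  case (ge2 n)
  then show ?case
    using assms by (simp add: tensor_Hom)
qed (use assms in \<open>simp_all add: Ident_Hom\<close>)

text \<open>\<open>T_arr\<close> is described by its values on all tensor powers. The lift of
  \<open>\<alpha>1 Y \<cdot> f\<close> is prescribed in degree one only; induction on the degree
  shows that it has the described values everywhere, and the coproduct property makes it the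
  described arrow.\<close>

lemma Ta_rule:
  assumes X: "X \<in> Obj (Br M)" and Y: "Y \<in> Obj (Br M)" and f: "br_mor X f Y"
  shows "bi_mor (Tb X) (Ta X f Y) (Tb Y) \<and> Ta X f Y \<cdot> \<alpha>1 X = \<alpha>1 Y \<cdot> f"
proof -
  interpret X: tensor_object M T \<alpha> "obj_of X" "br_of X"
    by (rule tensor_object[OF X])
  interpret Y: tensor_object M T \<alpha> "obj_of Y" "br_of Y"
    by (rule tensor_object[OF Y])
  note fh = mor_Hom(1)[OF f]
  note TY = Tb_Obj[OF Y]
  have \<alpha>Y: "\<alpha>1 Y \<in> Hom M (obj_of Y) (bi_obj (Tb Y))"
    using mor_Hom(1)[OF \<alpha>1_mor[OF Y]] by simp
  have "br_mor X (\<alpha>1 Y \<cdot> f) (Ub (Tb Y))"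
    using br_mor_comp[OF X Y Ub_Obj[OF TY] f \<alpha>1_mor[OF Y]] .
  then obtain h where h: "alg_mor (Tb X) h (Tb Y)" "h \<cdot> \<alpha>1 X = \<alpha>1 Y \<cdot> f"
    using X.lift_algebra[of "bi_obj (Tb Y)" "bi_mult (Tb Y)" "bi_unit (Tb Y)" "bi_br (Tb Y)" "\<alpha>1 Y \<cdot> f"] TY
    by (auto simp: BrBialg_Obj is_braided_bialgebra_def Tbar_Br_obj_def)
  have "bi_comult (Tb Y) \<cdot> (\<alpha>1 Y \<cdot> f) = prim_arr M (Tb Y) \<cdot> (\<alpha>1 Y \<cdot> f)"
  proof -
    have dp: "prim_arr M (Tb Y) \<in> Hom M (bi_obj (Tb Y)) (bi_obj (Tb Y) \<boxtimes> bi_obj (Tb Y))"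
      using P_equalizer[OF TY] by (simp add: is_equalizer_def)
    show ?thesis
      using Comp_assoc[OF fh \<alpha>Y BrBialg_typing(5)[OF TY]] Comp_assoc[OF fh \<alpha>Y dp] \<alpha>1_prim[OF Y] by simp
  qed
  then have bi: "bi_mor (Tb X) h (Tb Y)"
    using Tb_lift[OF X TY \<open>br_mor X (\<alpha>1 Y \<cdot> f) (Ub (Tb Y))\<close> _ h] by blast
  have hT: "h \<in> Hom M (T (obj_of X)) (T (obj_of Y))"
    using mor_Hom(2)[OF h(1)] by (simp add: Tbar_Br_obj_def)
  have tp: "tpow_arr M f n \<in> Hom M (tpow M (obj_of X) n) (tpow M (obj_of Y) n)" for n
    by (rule tpow_arr_typing[OF fh])
  note [simp] = HomD[OF hT] HomD[OF tp] HomD[OF fh] X.T_typing Y.T_typing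
  have eq: "h \<cdot> \<alpha> (obj_of X) n = \<alpha> (obj_of Y) n \<cdot> tpow_arr M f n" for n
  proof (induction n rule: induct_nat_012)
    case 0
    show ?case
      using h(1) Y.T_typing(5)[of 0] by (simp add: is_algebra_mor_def T_unit_def Tbar_Br_obj_def)
  next
    case 1
    show ?case
      using h(2) by simp
  next
    case (ge2 n)
    let ?m = "T_mult M T \<alpha> (obj_of Y)"
    have "h \<cdot> \<alpha> (obj_of X) (Suc (Suc n))
      = ?m \<cdot> ((\<alpha> (obj_of Y) (Suc n) \<cdot> tpow_arr M f (Suc n)) \<otimes> (\<alpha>1 Y \<cdot> f))"
      using X.alg_mor_Suc[of h "bi_obj (Tb Y)" "bi_mult (Tb Y)" "bi_unit (Tb Y)" n] h BrBialg_typing(3)[OF TY] ge2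
      by (simp add: Tbar_Br_obj_def)
    also have "\<dots> = ?m \<cdot> ((\<alpha> (obj_of Y) (Suc n) \<otimes> \<alpha>1 Y) \<cdot> (tpow_arr M f (Suc n) \<otimes> f))"
      by simp
    also have "\<dots> = (?m \<cdot> (\<alpha> (obj_of Y) (Suc n) \<otimes> \<alpha>1 Y)) \<cdot> (tpow_arr M f (Suc n) \<otimes> f)"
      by (rule Comp_assoc_simp[symmetric]) simp_all
    finally show ?case
      unfolding Y.\<alpha>_Suc by simp
  qed
  have "Ta X f Y = h"
    unfolding T_arr_def
  proof (rule the_equality)
    show "h \<in> Hom M (T (obj_of X)) (T (obj_of Y)) \<and> (\<forall>n. h \<cdot> \<alpha> (obj_of X) n = \<alpha> (obj_of Y) n \<cdot> tpow_arr M f n)"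
      using hT eq by simp
  next
    fix g assume "g \<in> Hom M (T (obj_of X)) (T (obj_of Y)) \<and> (\<forall>n. g \<cdot> \<alpha> (obj_of X) n = \<alpha> (obj_of Y) n \<cdot> tpow_arr M f n)"
    then show "g = h"
      by (intro coproduct_epi[OF T_coproduct[OF X.ob_V], of g _ h]) (use hT eq in simp_all)
  qed
  with bi h(2) show ?thesis by simp
qed

definition counit_alg :: "('o, 'a) br_bialg \<Rightarrow> 'a" where
  "counit_alg B = und (\<epsilon>_Br M T \<alpha> (mho_obj B))"

text \<open>The lift of the identity of \<open>B\<close> has the iterated products as values. It is
  claimed to be an algebra map only: identities are not primitive in general, so
  \<open>lift_bialgebra\<close> does not apply.\<close>

lemma counit_alg:
  assumes B: "B \<in> Obj (BrBialg M)"
  shows "alg_mor (Tb (Ub B)) (counit_alg B) B \<and> counit_alg B \<cdot> \<alpha>1 (Ub B) = \<iota> (bi_obj B)"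
proof -
  interpret X: tensor_object M T \<alpha> "bi_obj B" "bi_br B"
    using tensor_object[OF Ub_Obj[OF B]] by simp
  note ty = BrBialg_typing[OF B]
  have "is_braided_algebra M (bi_obj B) (bi_mult B) (bi_unit B) (bi_br B)"
    using B by (simp add: BrBialg_Obj is_braided_bialgebra_def)
  from X.lift_algebra[OF this] obtain h where h: "alg_mor (Tb (Ub B)) h B" "h \<cdot> \<alpha> (bi_obj B) 1 = \<iota> (bi_obj B)"
    using br_mor_Ident[OF Ub_Obj[OF B]] by (auto simp: Tbar_Br_obj_def)
  have hT: "h \<in> Hom M (T (bi_obj B)) (bi_obj B)"
    using mor_Hom(2)[OF h(1)] by (simp add: Tbar_Br_obj_def)
  have eq: "h \<cdot> \<alpha> (bi_obj B) n = iter_mult M (bi_obj B) (bi_mult B) (bi_unit B) n" for n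
  proof (induction n rule: induct_nat_012)
    case 0
    show ?case using h(1) by (simp add: is_algebra_mor_def T_unit_def Tbar_Br_obj_def)
  next
    case 1
    show ?case using h(2) by simp
  next
    case (ge2 n)
    then show ?case
      using X.alg_mor_Suc[of h "bi_obj B" "bi_mult B" "bi_unit B" n] h ty(3)
      by (simp add: Tbar_Br_obj_def)
  qed
  have "counit_alg B = h"
    unfolding counit_alg_def \<epsilon>_Br_def mho_obj_def str_arr.sel br_alg.sel
  proof (rule the_equality)
    show "h \<in> Hom M (T (bi_obj B)) (bi_obj B) \<and> (\<forall>n. h \<cdot> \<alpha> (bi_obj B) n = iter_mult M (bi_obj B) (bi_mult B) (bi_unit B) n)"
      using hT eq by simp
  next
    fix g assume "g \<in> Hom M (T (bi_obj B)) (bi_obj B) \<and> (\<forall>n. g \<cdot> \<alpha> (bi_obj B) n = iter_mult M (bi_obj B) (bi_mult B) (bi_unit B) n)"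
    then show "g = h"
      by (intro coproduct_epi[OF T_coproduct[OF X.ob_V], of g _ h]) (use hT eq in simp_all)
  qed
  with h show ?thesis by simp
qed

text \<open>The equation that is to determine the counit, taken as its definition on underlying
  arrows.\<close>

definition \<epsilon>u :: "('o, 'a) br_bialg \<Rightarrow> 'a" where
  "\<epsilon>u B = counit_alg B \<cdot> Ta (Pb B) (\<xi> B) (Ub B)"

text \<open>On generators the composite is \<open>\<xi> B\<close>, which is braided and primitive,
  so \<open>Tb_lift\<close> makes it a bialgebra map although \<open>counit_alg B\<close> need not
  be one.\<close>

lemma \<epsilon>u:
  assumes B: "B \<in> Obj (BrBialg M)"
  shows "bi_mor (Tb (Pb B)) (\<epsilon>u B) B \<and> \<epsilon>u B \<cdot> \<alpha>1 (Pb B) = \<xi> B"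
proof -
  note PB = Pb_Obj[OF B] and UB = Ub_Obj[OF B] and x = \<xi>_mor[OF B]
  note Ta = Ta_rule[OF PB UB x] and co = counit_alg[OF B]
  have alg: "alg_mor (Tb (Pb B)) (\<epsilon>u B) B"
    unfolding \<epsilon>u_def using alg_mor_comp[OF Tb_Obj[OF PB] Tb_Obj[OF UB] B] Ta co by blast
  have homs: "\<alpha>1 (Pb B) \<in> Hom M (P B) (T (P B))" "Ta (Pb B) (\<xi> B) (Ub B) \<in> Hom M (T (P B)) (T (bi_obj B))"
      "counit_alg B \<in> Hom M (T (bi_obj B)) (bi_obj B)" "\<xi> B \<in> Hom M (P B) (bi_obj B)"
      "\<alpha>1 (Ub B) \<in> Hom M (bi_obj B) (T (bi_obj B))"
    using mor_Hom(1)[OF \<alpha>1_mor[OF PB]] mor_Hom(2)[OF Ta[THEN conjunct1, THEN conjunct1]] mor_Hom(2)[OF co[THEN conjunct1]]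
      mor_Hom(1)[OF x] mor_Hom(1)[OF \<alpha>1_mor[OF UB]] by (simp_all add: Tbar_Br_obj_def)
  have "\<epsilon>u B \<cdot> \<alpha>1 (Pb B) = counit_alg B \<cdot> (\<alpha>1 (Ub B) \<cdot> \<xi> B)"
    unfolding \<epsilon>u_def Comp_assoc[OF homs(1-3)] Ta[THEN conjunct2] ..
  also have "\<dots> = (counit_alg B \<cdot> \<alpha>1 (Ub B)) \<cdot> \<xi> B"
    by (rule Comp_assoc[symmetric, OF homs(4,5,3)])
  also have "\<dots> = \<xi> B"
    unfolding co[THEN conjunct2] using homs(4) by (rule Comp_Ident_left)
  finally have e: "\<epsilon>u B \<cdot> \<alpha>1 (Pb B) = \<xi> B" .
  with Tb_lift[OF PB B x \<xi>_primitive[OF B] alg] show ?thesis by blast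
qed

text \<open>The corestriction of the generators to the equalizer, as prescribed by the equation for
  the unit; it exists because \<open>\<alpha>1 X\<close> is primitive.\<close>

definition \<eta>u :: "('o, 'a) br_obj \<Rightarrow> 'a" where
  "\<eta>u X = (THE k. k \<in> Hom M (obj_of X) (P (Tb X)) \<and> \<xi> (Tb X) \<cdot> k = \<alpha>1 X)"

lemma \<eta>u:
  assumes X: "X \<in> Obj (Br M)"
  shows "br_mor X (\<eta>u X) (Pb (Tb X)) \<and> \<xi> (Tb X) \<cdot> \<eta>u X = \<alpha>1 X"
proof -
  have "\<alpha>1 X \<in> Hom M (obj_of X) (bi_obj (Tb X))"
    using mor_Hom(1)[OF \<alpha>1_mor[OF X]] by simp
  from theI'[OF P_restrict[OF Tb_Obj[OF X] this \<alpha>1_prim[OF X]]]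
  have "\<eta>u X \<in> Hom M (obj_of X) (P (Tb X)) \<and> \<xi> (Tb X) \<cdot> \<eta>u X = \<alpha>1 X"
    unfolding \<eta>u_def .
  then show ?thesis
    using P_restrict_mor[OF Tb_Obj[OF X] X] \<alpha>1_mor[OF X] by simp
qed

definition Pa :: "('o, 'a) br_bialg \<Rightarrow> 'a \<Rightarrow> ('o, 'a) br_bialg \<Rightarrow> 'a" where
  "Pa A f B = (THE h. h \<in> Hom M (P A) (P B) \<and> \<xi> B \<cdot> h = f \<cdot> \<xi> A)"

lemma \<xi>_Hom: "B \<in> Obj (BrBialg M) \<Longrightarrow> \<xi> B \<in> Hom M (P B) (bi_obj B)"
  using mor_Hom(1)[OF \<xi>_mor] by simp

lemma Pa_rule:
  assumes A: "A \<in> Obj (BrBialg M)" and B: "B \<in> Obj (BrBialg M)" and f: "bi_mor A f B"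
  shows "br_mor (Pb A) (Pa A f B) (Pb B) \<and> \<xi> B \<cdot> Pa A f B = f \<cdot> \<xi> A"
proof -
  note fh = mor_Hom(2)[OF f[THEN conjunct1]]
  have "f \<cdot> \<xi> A \<in> Hom M (P A) (bi_obj B)"
    using Comp_Hom[OF \<xi>_Hom[OF A] fh] .
  from theI'[OF P_restrict[OF B this prim_comp[OF A B f \<xi>_Hom[OF A] \<xi>_primitive[OF A]]]]
  have k: "Pa A f B \<in> Hom M (P A) (P B) \<and> \<xi> B \<cdot> Pa A f B = f \<cdot> \<xi> A"
    unfolding Pa_def .
  have "br_mor (Pb A) (f \<cdot> \<xi> A) (Ub B)"
    using br_mor_comp[OF Pb_Obj[OF A] Ub_Obj[OF A] Ub_Obj[OF B] \<xi>_mor[OF A]] f by simp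
  with k show ?thesis
    using P_restrict_mor[OF B Pb_Obj[OF A]] by simp
qed

lemma comp_\<alpha>1:
  assumes "X \<in> Obj (Br M)" "alg_mor (Tb X) h B" "g \<in> Hom M (bi_obj B) Z"
  shows "(g \<cdot> h) \<cdot> \<alpha>1 X = g \<cdot> (h \<cdot> \<alpha>1 X)"
  using Comp_assoc[OF mor_Hom(1)[OF \<alpha>1_mor[OF assms(1)]] _ assms(3), of h] mor_Hom(2)[OF assms(2)] by simp

lemma comp_\<xi>:
  assumes "B \<in> Obj (BrBialg M)" "h \<in> Hom M Z (P B)" "g \<in> Hom M Y Z"
  shows "\<xi> B \<cdot> (h \<cdot> g) = (\<xi> B \<cdot> h) \<cdot> g"
  using Comp_assoc[OF assms(3,2) \<xi>_Hom[OF assms(1)]] by simp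

lemma Tbar_functor: "is_functor (Br M) (BrBialg M) (Tbar_Br M T \<alpha>)"
  unfolding is_functor_def
proof (intro conjI ballI allI)
  fix X assume X: "X \<in> Obj (Br M)"
  show "map_obj (Tbar_Br M T \<alpha>) X \<in> Obj (BrBialg M)"
    using Tb_Obj[OF X] by (simp add: Tbar_Br_def)
  note id = br_mor_Ident[OF X]
  have "Ta X (\<iota> (obj_of X)) X = \<iota> (bi_obj (Tb X))"
  proof (rule Tb_unique[OF X Tb_Obj[OF X]])
    show "Ta X (\<iota> (obj_of X)) X \<cdot> \<alpha>1 X = \<iota> (bi_obj (Tb X)) \<cdot> \<alpha>1 X"
      using Ta_rule[OF X X id] mor_Hom(1)[OF \<alpha>1_mor[OF X]] Comp_Ident_left Comp_Ident_right by simp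
  qed (use Ta_rule[OF X X id] bi_mor_Ident[OF Tb_Obj[OF X]] in simp_all)
  then show "map_arr (Tbar_Br M T \<alpha>) (Ident (Br M) X) = Ident (BrBialg M) (map_obj (Tbar_Br M T \<alpha>) X)"
    by (simp add: Tbar_Br_def)
next
  fix X Y F assume "F \<in> Hom (Br M) X Y"
  then show "map_arr (Tbar_Br M T \<alpha>) F \<in> Hom (BrBialg M) (map_obj (Tbar_Br M T \<alpha>) X) (map_obj (Tbar_Br M T \<alpha>) Y)"
    using Ta_rule[of X Y "und F"] Tb_Obj unfolding Br_Hom BrBialg_Hom by (cases F) (simp add: Tbar_Br_def)
next
  fix X Y Z F G assume F: "F \<in> Hom (Br M) X Y" and G: "G \<in> Hom (Br M) Y Z"
  then have X: "X \<in> Obj (Br M)" and Y: "Y \<in> Obj (Br M)" and Z: "Z \<in> Obj (Br M)"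
    and f: "br_mor X (und F) Y" and g: "br_mor Y (und G) Z" and src: "src F = X" "trg F = Y" "src G = Y" "trg G = Z"
    unfolding Br_Hom by (cases F; cases G; simp)+
  let ?f = "und F" and ?g = "und G"
  have gf: "br_mor X (?g \<cdot> ?f) Z"
    using br_mor_comp[OF X Y Z f g] .
  note Tf = Ta_rule[OF X Y f] and Tg = Ta_rule[OF Y Z g] and Tgf = Ta_rule[OF X Z gf]
  have "Ta X (?g \<cdot> ?f) Z = Ta Y ?g Z \<cdot> Ta X ?f Y"
  proof (rule Tb_unique[OF X Tb_Obj[OF Z]])
    show "alg_mor (Tb X) (Ta X (?g \<cdot> ?f) Z) (Tb Z)" "alg_mor (Tb X) (Ta Y ?g Z \<cdot> Ta X ?f Y) (Tb Z)"
      using Tf Tg Tgf alg_mor_comp[OF Tb_Obj[OF X] Tb_Obj[OF Y] Tb_Obj[OF Z]] by blast+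
    have gh: "Ta Y ?g Z \<in> Hom M (bi_obj (Tb Y)) (bi_obj (Tb Z))"
      using Tg mor_Hom(2) by blast
    have \<alpha>: "\<alpha>1 Y \<in> Hom M (obj_of Y) (bi_obj (Tb Y))" "\<alpha>1 Z \<in> Hom M (obj_of Z) (bi_obj (Tb Z))"
      using mor_Hom(1)[OF \<alpha>1_mor[OF Y]] mor_Hom(1)[OF \<alpha>1_mor[OF Z]] by simp_all
    have "(Ta Y ?g Z \<cdot> Ta X ?f Y) \<cdot> \<alpha>1 X = Ta Y ?g Z \<cdot> (\<alpha>1 Y \<cdot> ?f)"
      using comp_\<alpha>1[OF X _ gh] Tf by simp
    also have "\<dots> = (\<alpha>1 Z \<cdot> ?g) \<cdot> ?f"
      using Comp_assoc[OF mor_Hom(1)[OF f] \<alpha>(1) gh] Tg by simp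
    also have "\<dots> = Ta X (?g \<cdot> ?f) Z \<cdot> \<alpha>1 X"
      using Comp_assoc[OF mor_Hom(1)[OF f] mor_Hom(1)[OF g] \<alpha>(2)] Tgf by simp
    finally show "Ta X (?g \<cdot> ?f) Z \<cdot> \<alpha>1 X = (Ta Y ?g Z \<cdot> Ta X ?f Y) \<cdot> \<alpha>1 X" ..
  qed
  then show "map_arr (Tbar_Br M T \<alpha>) (Comp (Br M) G F) = Comp (BrBialg M) (map_arr (Tbar_Br M T \<alpha>) G) (map_arr (Tbar_Br M T \<alpha>) F)"
    by (simp add: Tbar_Br_def src)
qed (rule category_Br category_BrBialg)+

lemma P_Br_arr: "map_arr (P_Br M P \<xi>) F = StrArr (Pb (src F)) (Pa (src F) (und F) (trg F)) (Pb (trg F))"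
  and P_Br_map_obj: "map_obj (P_Br M P \<xi>) B = Pb B"
  by (simp_all add: P_Br_def Pa_def)

lemma P_functor: "is_functor (BrBialg M) (Br M) (P_Br M P \<xi>)"
  unfolding is_functor_def P_Br_map_obj P_Br_arr
proof (intro conjI ballI allI)
  fix A assume A: "A \<in> Obj (BrBialg M)"
  show "Pb A \<in> Obj (Br M)"
    using Pb_Obj[OF A] .
  note rule = Pa_rule[OF A A bi_mor_Ident[OF A]]
  have "Pa A (\<iota> (bi_obj A)) A = \<iota> (P A)"
  proof (rule P_mono[OF A])
    show "Pa A (\<iota> (bi_obj A)) A \<in> Hom M (P A) (P A)" "\<iota> (P A) \<in> Hom M (P A) (P A)"
      using mor_Hom(1)[OF rule[THEN conjunct1]] Ident_Hom Hom_Obj(1)[OF \<xi>_Hom[OF A]] by simp_all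
    show "\<xi> A \<cdot> Pa A (\<iota> (bi_obj A)) A = \<xi> A \<cdot> \<iota> (P A)"
      using rule Comp_Ident_left[OF \<xi>_Hom[OF A]] Comp_Ident_right[OF \<xi>_Hom[OF A]] by simp
  qed
  then show "StrArr (Pb (src (Ident (BrBialg M) A))) (Pa (src (Ident (BrBialg M) A)) (und (Ident (BrBialg M) A)) (trg (Ident (BrBialg M) A)))
      (Pb (trg (Ident (BrBialg M) A))) = Ident (Br M) (Pb A)"
    by simp
next
  fix A B F assume "F \<in> Hom (BrBialg M) A B"
  then show "StrArr (Pb (src F)) (Pa (src F) (und F) (trg F)) (Pb (trg F)) \<in> Hom (Br M) (Pb A) (Pb B)"
    using Pa_rule[of A B "und F"] Pb_Obj unfolding Br_Hom BrBialg_Hom by (cases F) simp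
next
  fix A B C F G assume F: "F \<in> Hom (BrBialg M) A B" and G: "G \<in> Hom (BrBialg M) B C"
  then have A: "A \<in> Obj (BrBialg M)" and B: "B \<in> Obj (BrBialg M)" and C: "C \<in> Obj (BrBialg M)"
    and f: "bi_mor A (und F) B" and g: "bi_mor B (und G) C" and src: "src F = A" "trg F = B" "src G = B" "trg G = C"
    unfolding BrBialg_Hom by (cases F; cases G; simp)+
  let ?f = "und F" and ?g = "und G"
  have gf: "bi_mor A (?g \<cdot> ?f) C"
    using bi_mor_comp[OF A B C f g] .
  note Pf = Pa_rule[OF A B f] and Pg = Pa_rule[OF B C g] and Pgf = Pa_rule[OF A C gf]
  have homs: "Pa A ?f B \<in> Hom M (P A) (P B)" "Pa B ?g C \<in> Hom M (P B) (P C)" "Pa A (?g \<cdot> ?f) C \<in> Hom M (P A) (P C)"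
    using mor_Hom(1)[OF Pf[THEN conjunct1]] mor_Hom(1)[OF Pg[THEN conjunct1]] mor_Hom(1)[OF Pgf[THEN conjunct1]] by simp_all
  have fgh: "?f \<in> Hom M (bi_obj A) (bi_obj B)" "?g \<in> Hom M (bi_obj B) (bi_obj C)"
    using f g mor_Hom(2) by blast+
  have "Pa A (?g \<cdot> ?f) C = Pa B ?g C \<cdot> Pa A ?f B"
  proof (rule P_mono[OF C homs(3) Comp_Hom[OF homs(1,2)]])
    have "\<xi> C \<cdot> (Pa B ?g C \<cdot> Pa A ?f B) = (?g \<cdot> \<xi> B) \<cdot> Pa A ?f B"
      using comp_\<xi>[OF C homs(2,1)] Pg by simp
    also have "\<dots> = ?g \<cdot> (?f \<cdot> \<xi> A)"
      using Comp_assoc[OF homs(1) \<xi>_Hom[OF B] fgh(2)] Pf by simp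
    also have "\<dots> = \<xi> C \<cdot> Pa A (?g \<cdot> ?f) C"
      using Comp_assoc[OF \<xi>_Hom[OF A] fgh] Pgf by simp
    finally show "\<xi> C \<cdot> Pa A (?g \<cdot> ?f) C = \<xi> C \<cdot> (Pa B ?g C \<cdot> Pa A ?f B)" ..
  qed
  then show "StrArr (Pb (src (Comp (BrBialg M) G F))) (Pa (src (Comp (BrBialg M) G F)) (und (Comp (BrBialg M) G F)) (trg (Comp (BrBialg M) G F)))
      (Pb (trg (Comp (BrBialg M) G F))) =
    Comp (Br M) (StrArr (Pb (src G)) (Pa (src G) (und G) (trg G)) (Pb (trg G))) (StrArr (Pb (src F)) (Pa (src F) (und F) (trg F)) (Pb (trg F)))"
    by (simp add: src)
qed (rule category_Br category_BrBialg)+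

definition \<eta>_bar :: "('o, 'a) br_obj \<Rightarrow> (('o, 'a) br_obj, 'a) str_arr" where
  "\<eta>_bar X = StrArr X (\<eta>u X) (Pb (Tb X))"

definition \<epsilon>_bar :: "('o, 'a) br_bialg \<Rightarrow> (('o, 'a) br_bialg, 'a) str_arr" where
  "\<epsilon>_bar B = StrArr (Tb (Pb B)) (\<epsilon>u B) B"

lemma \<eta>_natural:
  assumes X: "X \<in> Obj (Br M)" and Y: "Y \<in> Obj (Br M)" and f: "br_mor X f Y"
  shows "\<eta>u Y \<cdot> f = Pa (Tb X) (Ta X f Y) (Tb Y) \<cdot> \<eta>u X"
proof -
  note Tf = Ta_rule[OF X Y f] and TX = Tb_Obj[OF X] and TY = Tb_Obj[OF Y]
  note Pf = Pa_rule[OF TX TY Tf[THEN conjunct1]]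
  have homs: "\<eta>u X \<in> Hom M (obj_of X) (P (Tb X))" "\<eta>u Y \<in> Hom M (obj_of Y) (P (Tb Y))"
      "Pa (Tb X) (Ta X f Y) (Tb Y) \<in> Hom M (P (Tb X)) (P (Tb Y))" "f \<in> Hom M (obj_of X) (obj_of Y)"
      "Ta X f Y \<in> Hom M (bi_obj (Tb X)) (bi_obj (Tb Y))"
    using mor_Hom(1)[OF \<eta>u[OF X, THEN conjunct1]] mor_Hom(1)[OF \<eta>u[OF Y, THEN conjunct1]] mor_Hom(1)[OF Pf[THEN conjunct1]]
      mor_Hom(1)[OF f] Tf mor_Hom(2) by simp_all
  show ?thesis
  proof (rule P_mono[OF TY Comp_Hom[OF homs(4,2)] Comp_Hom[OF homs(1,3)]])
    have "\<xi> (Tb Y) \<cdot> (\<eta>u Y \<cdot> f) = \<alpha>1 Y \<cdot> f"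
      using comp_\<xi>[OF TY homs(2,4)] \<eta>u[OF Y] by simp
    also have "\<dots> = Ta X f Y \<cdot> (\<xi> (Tb X) \<cdot> \<eta>u X)"
      using Tf \<eta>u[OF X] by simp
    also have "\<dots> = (\<xi> (Tb Y) \<cdot> Pa (Tb X) (Ta X f Y) (Tb Y)) \<cdot> \<eta>u X"
      using Comp_assoc[OF homs(1) \<xi>_Hom[OF TX] homs(5)] Pf by simp
    also have "\<dots> = \<xi> (Tb Y) \<cdot> (Pa (Tb X) (Ta X f Y) (Tb Y) \<cdot> \<eta>u X)"
      using comp_\<xi>[OF TY homs(3,1)] by simp
    finally show "\<xi> (Tb Y) \<cdot> (\<eta>u Y \<cdot> f) = \<xi> (Tb Y) \<cdot> (Pa (Tb X) (Ta X f Y) (Tb Y) \<cdot> \<eta>u X)" .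
  qed
qed

lemma \<epsilon>_natural:
  assumes A: "A \<in> Obj (BrBialg M)" and B: "B \<in> Obj (BrBialg M)" and f: "bi_mor A f B"
  shows "\<epsilon>u B \<cdot> Ta (Pb A) (Pa A f B) (Pb B) = f \<cdot> \<epsilon>u A"
proof -
  note Pf = Pa_rule[OF A B f] and PA = Pb_Obj[OF A] and PB = Pb_Obj[OF B]
  note Tf = Ta_rule[OF PA PB Pf[THEN conjunct1]] and eA = \<epsilon>u[OF A] and eB = \<epsilon>u[OF B]
  have homs: "f \<in> Hom M (bi_obj A) (bi_obj B)" "\<epsilon>u B \<in> Hom M (bi_obj (Tb (Pb B))) (bi_obj B)"
      "Pa A f B \<in> Hom M (P A) (P B)" "\<alpha>1 (Pb B) \<in> Hom M (P B) (bi_obj (Tb (Pb B)))"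
    using f eB mor_Hom(2) mor_Hom(1)[OF Pf[THEN conjunct1]] mor_Hom(1)[OF \<alpha>1_mor[OF PB]] by simp_all
  show ?thesis
  proof (rule Tb_unique[OF PA B])
    show "alg_mor (Tb (Pb A)) (\<epsilon>u B \<cdot> Ta (Pb A) (Pa A f B) (Pb B)) B"
      using Tf eB alg_mor_comp[OF Tb_Obj[OF PA] Tb_Obj[OF PB] B] by blast
    show "alg_mor (Tb (Pb A)) (f \<cdot> \<epsilon>u A) B"
      using f eA alg_mor_comp[OF Tb_Obj[OF PA] A B] by blast
    have "(\<epsilon>u B \<cdot> Ta (Pb A) (Pa A f B) (Pb B)) \<cdot> \<alpha>1 (Pb A) = \<epsilon>u B \<cdot> (\<alpha>1 (Pb B) \<cdot> Pa A f B)"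
      using comp_\<alpha>1[OF PA _ homs(2)] Tf by simp
    also have "\<dots> = f \<cdot> \<xi> A"
      using Comp_assoc[OF homs(3,4,2)] eB Pf by simp
    also have "\<dots> = (f \<cdot> \<epsilon>u A) \<cdot> \<alpha>1 (Pb A)"
      using comp_\<alpha>1[OF PA _ homs(1)] eA by simp
    finally show "(\<epsilon>u B \<cdot> Ta (Pb A) (Pa A f B) (Pb B)) \<cdot> \<alpha>1 (Pb A) = (f \<cdot> \<epsilon>u A) \<cdot> \<alpha>1 (Pb A)" .
  qed
qed

lemma triangle_T:
  assumes X: "X \<in> Obj (Br M)"
  shows "\<epsilon>u (Tb X) \<cdot> Ta X (\<eta>u X) (Pb (Tb X)) = \<iota> (bi_obj (Tb X))"
proof -
  note TX = Tb_Obj[OF X] and PTX = Pb_Obj[OF Tb_Obj[OF X]] and h = \<eta>u[OF X] and e = \<epsilon>u[OF Tb_Obj[OF X]]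
  note Th = Ta_rule[OF X PTX h[THEN conjunct1]]
  have homs: "\<epsilon>u (Tb X) \<in> Hom M (bi_obj (Tb (Pb (Tb X)))) (bi_obj (Tb X))" "\<eta>u X \<in> Hom M (obj_of X) (P (Tb X))"
      "\<alpha>1 (Pb (Tb X)) \<in> Hom M (P (Tb X)) (bi_obj (Tb (Pb (Tb X))))" "\<alpha>1 X \<in> Hom M (obj_of X) (bi_obj (Tb X))"
    using e mor_Hom(2) mor_Hom(1)[OF h[THEN conjunct1]] mor_Hom(1)[OF \<alpha>1_mor[OF PTX]] mor_Hom(1)[OF \<alpha>1_mor[OF X]] by simp_all
  show ?thesis
  proof (rule Tb_unique[OF X TX])
    show "alg_mor (Tb X) (\<epsilon>u (Tb X) \<cdot> Ta X (\<eta>u X) (Pb (Tb X))) (Tb X)"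
      using Th e alg_mor_comp[OF TX Tb_Obj[OF PTX] TX] by blast
    show "alg_mor (Tb X) (\<iota> (bi_obj (Tb X))) (Tb X)"
      using bi_mor_Ident[OF TX] by blast
    have "(\<epsilon>u (Tb X) \<cdot> Ta X (\<eta>u X) (Pb (Tb X))) \<cdot> \<alpha>1 X = \<epsilon>u (Tb X) \<cdot> (\<alpha>1 (Pb (Tb X)) \<cdot> \<eta>u X)"
      using comp_\<alpha>1[OF X _ homs(1)] Th by simp
    also have "\<dots> = \<alpha>1 X"
      using Comp_assoc[OF homs(2,3,1)] e h by simp
    also have "\<dots> = \<iota> (bi_obj (Tb X)) \<cdot> \<alpha>1 X"
      using Comp_Ident_left[OF homs(4)] by simp
    finally show "(\<epsilon>u (Tb X) \<cdot> Ta X (\<eta>u X) (Pb (Tb X))) \<cdot> \<alpha>1 X = \<iota> (bi_obj (Tb X)) \<cdot> \<alpha>1 X" .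
  qed
qed

lemma triangle_P:
  assumes B: "B \<in> Obj (BrBialg M)"
  shows "Pa (Tb (Pb B)) (\<epsilon>u B) B \<cdot> \<eta>u (Pb B) = \<iota> (P B)"
proof -
  note PB = Pb_Obj[OF B] and e = \<epsilon>u[OF B] and TPB = Tb_Obj[OF Pb_Obj[OF B]]
  note h = \<eta>u[OF PB] and Pe = Pa_rule[OF TPB B e[THEN conjunct1]]
  have homs: "\<eta>u (Pb B) \<in> Hom M (P B) (P (Tb (Pb B)))" "Pa (Tb (Pb B)) (\<epsilon>u B) B \<in> Hom M (P (Tb (Pb B))) (P B)"
      "\<epsilon>u B \<in> Hom M (bi_obj (Tb (Pb B))) (bi_obj B)"
    using mor_Hom(1)[OF h[THEN conjunct1]] mor_Hom(1)[OF Pe[THEN conjunct1]] e mor_Hom(2) by simp_all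
  show ?thesis
  proof (rule P_mono[OF B Comp_Hom[OF homs(1,2)] Ident_Hom[OF Hom_Obj(1)[OF \<xi>_Hom[OF B]]]])
    have "\<xi> B \<cdot> (Pa (Tb (Pb B)) (\<epsilon>u B) B \<cdot> \<eta>u (Pb B)) = (\<epsilon>u B \<cdot> \<xi> (Tb (Pb B))) \<cdot> \<eta>u (Pb B)"
      using comp_\<xi>[OF B homs(2,1)] Pe by simp
    also have "\<dots> = \<epsilon>u B \<cdot> \<alpha>1 (Pb B)"
      using Comp_assoc[OF homs(1) \<xi>_Hom[OF TPB] homs(3)] h by simp
    also have "\<dots> = \<xi> B \<cdot> \<iota> (P B)"
      using e Comp_Ident_right[OF \<xi>_Hom[OF B]] by simp
    finally show "\<xi> B \<cdot> (Pa (Tb (Pb B)) (\<epsilon>u B) B \<cdot> \<eta>u (Pb B)) = \<xi> B \<cdot> \<iota> (P B)" .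
  qed
qed

lemma Tbar_map: "map_obj (Tbar_Br M T \<alpha>) X = Tb X"
    "map_arr (Tbar_Br M T \<alpha>) F = StrArr (Tb (src F)) (Ta (src F) (und F) (trg F)) (Tb (trg F))"
  by (simp_all add: Tbar_Br_def)

lemma id_functor: "category C \<Longrightarrow> is_functor C C id_func"
  by (simp add: is_functor_def id_func_def category.Comp_Hom)

lemma comp_functor: "is_functor C D F \<Longrightarrow> is_functor D E G \<Longrightarrow> is_functor C E (comp_func G F)"
  unfolding is_functor_def comp_func_def by simp metis

lemma adjunction: "is_adjunction (Br M) (BrBialg M) (Tbar_Br M T \<alpha>) (P_Br M P \<xi>) \<eta>_bar \<epsilon>_bar"
  unfolding is_adjunction_def
proof (intro conjI ballI)
  show "is_functor (Br M) (BrBialg M) (Tbar_Br M T \<alpha>)" "is_functor (BrBialg M) (Br M) (P_Br M P \<xi>)"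
    by (rule Tbar_functor P_functor)+
  show "is_nat_trans (Br M) (Br M) id_func (comp_func (P_Br M P \<xi>) (Tbar_Br M T \<alpha>)) \<eta>_bar"
    unfolding is_nat_trans_def
  proof (intro conjI ballI allI)
    fix X assume X: "X \<in> Obj (Br M)"
    show "\<eta>_bar X \<in> Hom (Br M) (map_obj id_func X) (map_obj (comp_func (P_Br M P \<xi>) (Tbar_Br M T \<alpha>)) X)"
      using \<eta>u[OF X] X Pb_Obj[OF Tb_Obj[OF X]] unfolding Br_Hom
      by (simp add: \<eta>_bar_def id_func_def comp_func_def P_Br_map_obj Tbar_map)
  next
    fix X Y F assume "F \<in> Hom (Br M) X Y"
    then show "Comp (Br M) (\<eta>_bar Y) (map_arr id_func F) = Comp (Br M) (map_arr (comp_func (P_Br M P \<xi>) (Tbar_Br M T \<alpha>)) F) (\<eta>_bar X)"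
      using \<eta>_natural[of X Y "und F"] unfolding Br_Hom
      by (cases F) (simp add: \<eta>_bar_def id_func_def comp_func_def P_Br_arr Tbar_map)
  qed (rule id_functor category_Br comp_functor Tbar_functor P_functor)+
  show "is_nat_trans (BrBialg M) (BrBialg M) (comp_func (Tbar_Br M T \<alpha>) (P_Br M P \<xi>)) id_func \<epsilon>_bar"
    unfolding is_nat_trans_def
  proof (intro conjI ballI allI)
    fix B assume B: "B \<in> Obj (BrBialg M)"
    show "\<epsilon>_bar B \<in> Hom (BrBialg M) (map_obj (comp_func (Tbar_Br M T \<alpha>) (P_Br M P \<xi>)) B) (map_obj id_func B)"
      using \<epsilon>u[OF B] B Tb_Obj[OF Pb_Obj[OF B]] unfolding BrBialg_Hom
      by (simp add: \<epsilon>_bar_def id_func_def comp_func_def P_Br_map_obj Tbar_map)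
  next
    fix A B F assume "F \<in> Hom (BrBialg M) A B"
    then show "Comp (BrBialg M) (\<epsilon>_bar B) (map_arr (comp_func (Tbar_Br M T \<alpha>) (P_Br M P \<xi>)) F) = Comp (BrBialg M) (map_arr id_func F) (\<epsilon>_bar A)"
      using \<epsilon>_natural[of A B "und F"] unfolding BrBialg_Hom
      by (cases F) (simp add: \<epsilon>_bar_def id_func_def comp_func_def P_Br_arr Tbar_map)
  qed (rule id_functor category_BrBialg comp_functor Tbar_functor P_functor)+
next
  fix X assume "X \<in> Obj (Br M)"
  then show "Comp (BrBialg M) (\<epsilon>_bar (map_obj (Tbar_Br M T \<alpha>) X)) (map_arr (Tbar_Br M T \<alpha>) (\<eta>_bar X)) = Ident (BrBialg M) (map_obj (Tbar_Br M T \<alpha>) X)"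
    using triangle_T[of X] by (simp add: \<eta>_bar_def \<epsilon>_bar_def Tbar_map)
next
  fix B assume "B \<in> Obj (BrBialg M)"
  then show "Comp (Br M) (map_arr (P_Br M P \<xi>) (\<epsilon>_bar B)) (\<eta>_bar (map_obj (P_Br M P \<xi>) B)) = Ident (Br M) (map_obj (P_Br M P \<xi>) B)"
    using triangle_P[of B] by (simp add: \<eta>_bar_def \<epsilon>_bar_def P_Br_arr P_Br_map_obj)
qed

text \<open>Both parts rest on the equalizer: the factorization gives the equation, and cancelling
  \<open>\<xi>\<close> by \<open>P_mono\<close> gives uniqueness.\<close>

lemma unit_equation:
  assumes X: "X \<in> Obj (Br M)"
  shows "Comp (Br M) (\<xi>_Br M P \<xi> (map_obj (Tbar_Br M T \<alpha>) X)) (\<eta>_bar X) = \<eta>_Br M T \<alpha> X"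
    and "h \<in> Hom (Br M) X (map_obj (P_Br M P \<xi>) (map_obj (Tbar_Br M T \<alpha>) X)) \<Longrightarrow>
      Comp (Br M) (\<xi>_Br M P \<xi> (map_obj (Tbar_Br M T \<alpha>) X)) h = \<eta>_Br M T \<alpha> X \<Longrightarrow> h = \<eta>_bar X"
proof -
  show "Comp (Br M) (\<xi>_Br M P \<xi> (map_obj (Tbar_Br M T \<alpha>) X)) (\<eta>_bar X) = \<eta>_Br M T \<alpha> X"
    using \<eta>u[OF X] by (simp add: \<xi>_Br_def \<eta>_bar_def \<eta>_Br_def Tbar_map mho_Br_def T_Br_def mho_obj_def T_Br_obj_def Tbar_Br_obj_def)
  assume h: "h \<in> Hom (Br M) X (map_obj (P_Br M P \<xi>) (map_obj (Tbar_Br M T \<alpha>) X))"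
    "Comp (Br M) (\<xi>_Br M P \<xi> (map_obj (Tbar_Br M T \<alpha>) X)) h = \<eta>_Br M T \<alpha> X"
  have "\<xi> (Tb X) \<cdot> und h = \<xi> (Tb X) \<cdot> \<eta>u X"
    using h(2) \<eta>u[OF X] by (simp add: \<xi>_Br_def \<eta>_Br_def Tbar_map)
  moreover have "und h \<in> Hom M (obj_of X) (P (Tb X))" "\<eta>u X \<in> Hom M (obj_of X) (P (Tb X))"
    using h(1) mor_Hom(1)[OF \<eta>u[OF X, THEN conjunct1]] mor_Hom(1)[of X "und h" "Pb (Tb X)"] unfolding Br_Hom
    by (simp_all add: Tbar_map P_Br_map_obj)
  ultimately have "und h = \<eta>u X"
    using P_mono[OF Tb_Obj[OF X]] by blast
  with h(1) show "h = \<eta>_bar X"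
    unfolding Br_Hom by (simp add: \<eta>_bar_def Tbar_map P_Br_map_obj)
qed

text \<open>The equation holds by the choice of \<open>\<epsilon>u\<close>. Conversely
  \<open>mho_Br\<close> keeps the underlying arrow, so the equation prescribes it, and source and
  target are those recorded in the hom-set.\<close>

lemma counit_equation:
  assumes B: "B \<in> Obj (BrBialg M)"
  shows "Comp (BrAlg M) (\<epsilon>_Br M T \<alpha> (map_obj mho_Br B)) (map_arr (T_Br M T \<alpha>) (\<xi>_Br M P \<xi> B)) = map_arr mho_Br (\<epsilon>_bar B)"
    and "h \<in> Hom (BrBialg M) (map_obj (Tbar_Br M T \<alpha>) (map_obj (P_Br M P \<xi>) B)) B \<Longrightarrow>
      Comp (BrAlg M) (\<epsilon>_Br M T \<alpha> (map_obj mho_Br B)) (map_arr (T_Br M T \<alpha>) (\<xi>_Br M P \<xi> B)) = map_arr mho_Br h \<Longrightarrow> h = \<epsilon>_bar B"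
proof -
  have "und (\<epsilon>_Br M T \<alpha> (mho_obj B)) \<cdot> Ta (Pb B) (\<xi> B) (Ub B) = \<epsilon>u B"
    by (simp add: \<epsilon>u_def counit_alg_def)
  then show eq: "Comp (BrAlg M) (\<epsilon>_Br M T \<alpha> (map_obj mho_Br B)) (map_arr (T_Br M T \<alpha>) (\<xi>_Br M P \<xi> B)) = map_arr mho_Br (\<epsilon>_bar B)"
    by (simp add: \<xi>_Br_def \<epsilon>_bar_def mho_Br_def T_Br_def P_Br_map_obj \<Omega>_Br_def \<Omega>_obj_def)
      (simp add: \<epsilon>_Br_def mho_obj_def T_Br_obj_def Tbar_Br_obj_def)
  assume h: "h \<in> Hom (BrBialg M) (map_obj (Tbar_Br M T \<alpha>) (map_obj (P_Br M P \<xi>) B)) B"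
    "Comp (BrAlg M) (\<epsilon>_Br M T \<alpha> (map_obj mho_Br B)) (map_arr (T_Br M T \<alpha>) (\<xi>_Br M P \<xi> B)) = map_arr mho_Br h"
  have "und h = \<epsilon>u B"
    using h(2) unfolding eq by (simp add: mho_Br_def \<epsilon>_bar_def)
  with h(1) show "h = \<epsilon>_bar B"
    unfolding BrBialg_Hom by (simp add: \<epsilon>_bar_def Tbar_map P_Br_map_obj)
qed

end

theorem theorem3p5:
  fixes M :: "('o, 'a) preadditive_monoidal_category"
    and T :: "'o \<Rightarrow> 'o" and \<alpha> :: "'o \<Rightarrow> nat \<Rightarrow> 'a"
    and P :: "('o, 'a) br_bialg \<Rightarrow> 'o" and \<xi> :: "('o, 'a) br_bialg \<Rightarrow> 'a"
  assumes "preadditive_monoidal_category M"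
    and "has_equalizers M"
    and "\<And>X. X \<in> Obj M \<Longrightarrow> is_additive M M (tensor_left M X) \<and> is_additive M M (tensor_right M X)"
    and "\<And>X. X \<in> Obj M \<Longrightarrow>
           preserves_equalizers M M (tensor_left M X) \<and> preserves_equalizers M M (tensor_right M X)"
    and "has_denumerable_coproducts M"
    and "\<And>X. X \<in> Obj M \<Longrightarrow> preserves_denumerable_coproducts M M (tensor_left M X) \<and>
           preserves_denumerable_coproducts M M (tensor_right M X)"
    and "\<And>V. V \<in> Obj M \<Longrightarrow> is_coproduct M (tpow M V) (T V) (\<alpha> V)"
    and "\<And>B. B \<in> Obj (BrBialg M) \<Longrightarrow>
           is_equalizer M (bi_obj B) (bi_obj B \<boxtimes>\<^bsub>M\<^esub> bi_obj B) (bi_comult B) (prim_arr M B) (P B) (\<xi> B)"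
  shows "\<exists>\<eta> \<epsilon>.
    is_adjunction (Br M) (BrBialg M) (Tbar_Br M T \<alpha>) (P_Br M P \<xi>) \<eta> \<epsilon> \<and>
    (\<forall>X \<in> Obj (Br M).
       \<xi>_Br M P \<xi> (map_obj (Tbar_Br M T \<alpha>) X) \<cdot>\<^bsub>Br M\<^esub> \<eta> X = \<eta>_Br M T \<alpha> X) \<and>
    (\<forall>B \<in> Obj (BrBialg M).
       \<epsilon>_Br M T \<alpha> (map_obj mho_Br B) \<cdot>\<^bsub>BrAlg M\<^esub> map_arr (T_Br M T \<alpha>) (\<xi>_Br M P \<xi> B)
         = map_arr mho_Br (\<epsilon> B)) \<and>
    (\<forall>X \<in> Obj (Br M).
       \<forall>h \<in> Hom (Br M) X (map_obj (P_Br M P \<xi>) (map_obj (Tbar_Br M T \<alpha>) X)).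
         \<xi>_Br M P \<xi> (map_obj (Tbar_Br M T \<alpha>) X) \<cdot>\<^bsub>Br M\<^esub> h = \<eta>_Br M T \<alpha> X \<longrightarrow> h = \<eta> X) \<and>
    (\<forall>B \<in> Obj (BrBialg M).
       \<forall>h \<in> Hom (BrBialg M) (map_obj (Tbar_Br M T \<alpha>) (map_obj (P_Br M P \<xi>) B)) B.
         \<epsilon>_Br M T \<alpha> (map_obj mho_Br B) \<cdot>\<^bsub>BrAlg M\<^esub> map_arr (T_Br M T \<alpha>) (\<xi>_Br M P \<xi> B)
           = map_arr mho_Br h \<longrightarrow> h = \<epsilon> B)"
proof -
  have additive: "additive_monoidal M"
    using assms(1,3) unfolding additive_monoidal_def additive_monoidal_axioms_def
    by (simp add: is_additive_def tensor_left_def tensor_right_def)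
  have "coproduct_monoidal M" "equalizer_monoidal M"
    using assms(1,4,6) preadditive_monoidal_category.axioms(1)[OF assms(1)]
    by (simp_all add: coproduct_monoidal_def coproduct_monoidal_axioms_def equalizer_monoidal_def equalizer_monoidal_axioms_def)
  with additive have "tensor_setting M T \<alpha>"
    using assms(7) by (simp add: tensor_setting_def tensor_setting_axioms_def)
  then interpret adjunction_setting M T \<alpha> P \<xi>
    using assms(8) by (simp add: adjunction_setting_def adjunction_setting_axioms_def)
  show ?thesis
    using adjunction unit_equation counit_equation by (intro exI[of _ \<eta>_bar] exI[of _ \<epsilon>_bar]) blast
qed

end
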